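(* Suppose $N\ge2$ and $\frac4N\le\alpha\le4$, and fix a radially symmetric initial value $u_0\in H^1(\mathbb{R}^N)\cap C_0(\mathbb{R}^N)$. Given any $\theta\in(-\frac\pi2,\frac\pi2)$, let $u^\theta\in C([0,T_{\max}^\theta),C_0(\mathbb{R}^N)\cap H^1(\mathbb{R}^N))$ denote the corresponding maximal solution of $$e^{-i\theta}u_t=\Delta u+|u|^\alpha u,\qquad u(0)=u_0,$$ in $\mathbb{R}^N$. If $E(u_0)<0$, then there exists $\overline{T}<\infty$ such that $T_{\max}^\theta\le\overline{T}$ for all $-\frac\pi2<\theta<\frac\pi2$.
   Context: All functions are complex-valued. $C_0(\mathbb{R}^N)$ is the space of continuous functions on $\mathbb{R}^N$ vanishing at infinity, with the sup norm. The energy is $$E(w)=\frac12\int_{\mathbb{R}^N}|\nabla w|^2-\frac{1}{\alpha+2}\int_{\mathbb{R}^N}|w|^{\alpha+2},\qquad w\in C_0(\mathbb{R}^N)\cap H^1(\mathbb{R}^N).$$ Maximal solution: for $-\pi/2<\theta<\pi/2$ and $u_0\in C_0(\mathbb{R}^N)\cap H^1(\mathbb{R}^N)$, the Cauchy problem is locally well posed: there exist $T>0$ and a unique $u\in C([0,T],C_0(\mathbb{R}^N)\cap H^1(\mathbb{R}^N))\cap C((0,T),H^2(\mathbb{R}^N))\cap C^1((0,T),L^2(\mathbb{R}^N))$ satisfying the equation for all $t\in(0,T)$ and $u(0)=u_0$. This $u$ extends to a maximal existence interval $[0,T_{\max})$ with $0<T_{\max}\le\infty$, and if $T_{\max}<\infty$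 then $\|u(t)\|_{L^\infty}\to\infty$ as $t\uparrow T_{\max}$. The superscript $\theta$ on $u^\theta$, $T_{\max}^\theta$ indicates dependence on $\theta$. *)

theory Defs
  imports "HOL-Analysis.Analysis"
begin

text \<open>Space \<open>\<real>\<^sup>N\<close> is a type \<open>'a::euclidean_space\<close> with \<open>N = DIM('a)\<close>. Elements of \<open>L\<^sup>2\<close>, \<open>H\<^sup>1\<close>, \<open>H\<^sup>2\<close>
  are Borel measurable representatives, not classes; everything below that refers to them is invariant
  under changes on null sets.\<close>

definition C0 :: "('a::euclidean_space \<Rightarrow> complex) set" where
  "C0 = {f. continuous_on UNIV f \<and> (f \<longlongrightarrow> 0) at_infinity}"

definition sup_norm :: "('a::euclidean_space \<Rightarrow> complex) \<Rightarrow> real" where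
  "sup_norm f = (SUP x. cmod (f x))"

definition L2 :: "('a::euclidean_space \<Rightarrow> complex) set" where
  "L2 = {f \<in> borel_measurable lborel. integrable lborel (\<lambda>x. (cmod (f x))\<^sup>2)}"

definition L2_norm :: "('a::euclidean_space \<Rightarrow> complex) \<Rightarrow> real" where
  "L2_norm f = sqrt (LINT x|lborel. (cmod (f x))\<^sup>2)"

primrec Ck :: "nat \<Rightarrow> ('a::euclidean_space \<Rightarrow> real) \<Rightarrow> bool" where
  "Ck 0 f \<longleftrightarrow> continuous_on UNIV f"
| "Ck (Suc k) f \<longleftrightarrow> (\<forall>x. f differentiable (at x)) \<and>
     (\<forall>b\<in>Basis. Ck k (\<lambda>x. frechet_derivative f (at x) b))"

definition test_fun :: "('a::euclidean_space \<Rightarrow> real) \<Rightarrow> bool" where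
  "test_fun \<phi> \<longleftrightarrow> (\<forall>k. Ck k \<phi>) \<and> compact (closure {x. \<phi> x \<noteq> 0})"

text \<open>\<open>g \<in> L\<^sup>2\<close> is the distributional derivative of \<open>f \<in> L\<^sup>2\<close> in the coordinate direction \<open>b\<close>.\<close>

definition has_weak_deriv ::
    "('a::euclidean_space \<Rightarrow> complex) \<Rightarrow> 'a \<Rightarrow> ('a \<Rightarrow> complex) \<Rightarrow> bool" where
  "has_weak_deriv f b g \<longleftrightarrow> f \<in> L2 \<and> g \<in> L2 \<and>
     (\<forall>\<phi>. test_fun \<phi> \<longrightarrow>
        (LINT x|lborel. frechet_derivative \<phi> (at x) b *\<^sub>R f x) = - (LINT x|lborel. \<phi> x *\<^sub>R g x))"

definition weak_deriv ::
    "'a \<Rightarrow> ('a::euclidean_space \<Rightarrow> complex) \<Rightarrow> 'a \<Rightarrow> complex" where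
  "weak_deriv b f = (SOME g. has_weak_deriv f b g)"

definition H1 :: "('a::euclidean_space \<Rightarrow> complex) set" where
  "H1 = {f \<in> L2. \<forall>b\<in>Basis. \<exists>g. has_weak_deriv f b g}"

definition H1_norm :: "('a::euclidean_space \<Rightarrow> complex) \<Rightarrow> real" where
  "H1_norm f = sqrt ((L2_norm f)\<^sup>2 + (\<Sum>b\<in>Basis. (L2_norm (weak_deriv b f))\<^sup>2))"

definition H2 :: "('a::euclidean_space \<Rightarrow> complex) set" where
  "H2 = {f \<in> H1. \<forall>b\<in>Basis. weak_deriv b f \<in> H1}"

definition H2_norm :: "('a::euclidean_space \<Rightarrow> complex) \<Rightarrow> real" where
  "H2_norm f = sqrt ((L2_norm f)\<^sup>2 + (\<Sum>b\<in>Basis. (H1_norm (weak_deriv b f))\<^sup>2))"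

definition laplacian :: "('a::euclidean_space \<Rightarrow> complex) \<Rightarrow> 'a \<Rightarrow> complex" where
  "laplacian f x = (\<Sum>b\<in>Basis. weak_deriv b (weak_deriv b f) x)"

definition energy :: "real \<Rightarrow> ('a::euclidean_space \<Rightarrow> complex) \<Rightarrow> real" where
  "energy \<alpha> w =
     1 / 2 * (LINT x|lborel. (\<Sum>b\<in>Basis. (cmod (weak_deriv b w x))\<^sup>2))
     - 1 / (\<alpha> + 2) * (LINT x|lborel. cmod (w x) powr (\<alpha> + 2))"

definition radially_symmetric :: "('a::euclidean_space \<Rightarrow> complex) \<Rightarrow> bool" where
  "radially_symmetric f \<longleftrightarrow> (\<forall>x y. norm x = norm y \<longrightarrow> f x = f y)"

text \<open>\<open>u \<in> C(I, X)\<close>, where the space \<open>X\<close> of functions is given by its carrier and its norm.\<close>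

definition continuous_curve ::
    "('a::euclidean_space \<Rightarrow> complex) set \<Rightarrow> (('a \<Rightarrow> complex) \<Rightarrow> real) \<Rightarrow>
     real set \<Rightarrow> (real \<Rightarrow> 'a \<Rightarrow> complex) \<Rightarrow> bool" where
  "continuous_curve X nrm I u \<longleftrightarrow> (\<forall>t\<in>I. u t \<in> X \<and>
     ((\<lambda>s. nrm (\<lambda>x. u s x - u t x)) \<longlongrightarrow> 0) (at t within I))"

definition has_L2_derivative ::
    "(real \<Rightarrow> 'a::euclidean_space \<Rightarrow> complex) \<Rightarrow> ('a \<Rightarrow> complex) \<Rightarrow> real \<Rightarrow> bool" where
  "has_L2_derivative u v t \<longleftrightarrow>
     ((\<lambda>s. L2_norm (\<lambda>x. (u s x - u t x) /\<^sub>R (s - t) - v x)) \<longlongrightarrow> 0) (at t)"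

text \<open>Solutions on the closed interval \<open>[0, T]\<close>; values of \<open>u\<close> outside \<open>[0, T]\<close> are irrelevant.
  The witness \<open>v\<close> is \<open>u\<^sub>t\<close>, and the equation is an equality in \<open>L\<^sup>2\<close>, i.e. almost everywhere.\<close>

definition solution_on ::
    "real \<Rightarrow> real \<Rightarrow> ('a::euclidean_space \<Rightarrow> complex) \<Rightarrow> real \<Rightarrow> (real \<Rightarrow> 'a \<Rightarrow> complex) \<Rightarrow> bool" where
  "solution_on \<alpha> \<theta> u0 T u \<longleftrightarrow>
     0 < T \<and> u 0 = u0 \<and>
     continuous_curve (C0 \<inter> H1) (\<lambda>f. sup_norm f + H1_norm f) {0..T} u \<and>
     continuous_curve H2 H2_norm {0<..<T} u \<and>
     (\<exists>v. continuous_curve L2 L2_norm {0<..<T} v \<and>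
        (\<forall>t\<in>{0<..<T}. has_L2_derivative u (v t) t \<and>
           (AE x in lborel. exp (- \<i> * of_real \<theta>) * v t x =
              laplacian (u t) x + of_real (cmod (u t x) powr \<alpha>) * u t x)))"

text \<open>A solution on \<open>[0, T\<^sub>m\<^sub>a\<^sub>x)\<close> that does not extend to any \<open>[0, T]\<close> strictly containing \<open>[0, T\<^sub>m\<^sub>a\<^sub>x)\<close>.\<close>

definition maximal_solution ::
    "real \<Rightarrow> real \<Rightarrow> ('a::euclidean_space \<Rightarrow> complex) \<Rightarrow> ereal \<Rightarrow> (real \<Rightarrow> 'a \<Rightarrow> complex) \<Rightarrow> bool" where
  "maximal_solution \<alpha> \<theta> u0 Tmax u \<longleftrightarrow>
     0 < Tmax \<and>
     (\<forall>T. 0 < T \<and> ereal T < Tmax \<longrightarrow> solution_on \<alpha> \<theta> u0 T u) \<and>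
     \<not> (\<exists>T w. Tmax \<le> ereal T \<and> solution_on \<alpha> \<theta> u0 T w \<and>
           (\<forall>t. 0 \<le> t \<and> ereal t < Tmax \<longrightarrow> w t = u t))"

end

theory Submission
  imports Defs
begin

text \<open>Along a solution the mass \<open>\<parallel>u\<parallel>\<^sup>2\<close> has derivative \<open>2 cos \<theta> (\<integral>|u|\<^sup>\<alpha>\<^sup>+\<^sup>2 - \<integral>|\<nabla>u|\<^sup>2)\<close>, which is nonnegative because
  \<open>-E\<close> is positive and increases at rate \<open>cos \<theta> \<parallel>u\<^sub>t\<parallel>\<^sup>2\<close>. These rates degenerate as \<open>\<theta> \<rightarrow> \<plusminus>\<pi>/2\<close>, so two mechanisms are combined.
  As soon as the mass at some time \<open>\<tau>\<close> exceeds a fixed multiple of the initial mass, Levine's concavity argument for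
  \<open>F(t) = \<integral>\<^sub>0\<^sup>t \<parallel>u\<parallel>\<^sup>2\<close> gives the bound \<open>(1 + 4/\<alpha>) \<tau>\<close> for the existence time, whatever \<open>\<theta>\<close> is. While the mass stays
  below that multiple, a virial argument applies: for a truncation \<open>\<psi>\<close> of \<open>|x|\<^sup>2\<close> at a large radius \<open>R\<close>, the equation turns
  \<open>sin \<theta> \<langle>i u\<^sub>t, W\<rangle>\<close> with \<open>W = 2 \<nabla>\<psi> \<cdot> \<nabla>u + (\<Delta>\<psi>) u\<close> into \<open>cos \<theta> \<langle>u\<^sub>t, W\<rangle> - \<langle>\<Delta>u + |u|\<^sup>\<alpha> u, W\<rangle>\<close>. The last term is estimated by
  the virial identity and \<open>N \<alpha> \<ge> 4\<close>; its truncation error is absorbed, uniformly in \<open>\<theta>\<close>, by Strauss' inequality for radial functions, where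
  \<open>\<alpha> \<le> 4\<close> enters. The dissipative term is absorbed by the growth of \<open>-E\<close> after weighting with powers of \<open>\<tau> - t\<close>.
  This bounds \<open>\<tau>\<close> independently of \<open>\<theta>\<close>.

  Radial symmetry of \<open>u(t)\<close> follows from invariance under reflections \<open>S\<close> in hyperplanes through the origin: Gronwall's inequality applies to
  \<open>\<parallel>u \<circ> S - u\<parallel>\<^sup>2\<close>. Any two points of equal norm are exchanged by such a reflection.\<close>

section \<open>The space of square integrable functions\<close>

text \<open>The only control of u_t is that cos \<theta> times its squared norm is the rate of -E,
  and -E has no a priori upper bound. Hence the virial inequality is integrated against (\<tau> -
  t)^3: after Young's inequality and an integration by parts, the rate of -E becomes (\<tau> - t)^3
  (-E), which the main virial term supplies with the good sign. The other factor in Young's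
  inequality contains the gradient; cos \<theta> times its square is bounded by the rate of the
  mass, and this is where the bound on the mass is spent. Low regularity shapes the calculus. As u_t
  is merely in L2, its gradient is never formed: time derivatives come from exact polarisations of
  quadratic functionals. Space derivatives come from difference quotients, for which the product
  rule and translation invariance are exact before the limit. The truncation is tuned so that the
  radial loss of the Hessian of \<psi> against that of |x|^2 is comparable to the square of one
  profile \<open>veta\<close>. The same profile weights the radial derivative in Strauss'
  inequality, so all errors beyond radius R are absorbed by one favourable square.\<close>

definition ip :: "('a::euclidean_space \<Rightarrow> complex) \<Rightarrow> ('a \<Rightarrow> complex) \<Rightarrow> real" where
  "ip f g = (LINT x|lborel. f x \<bullet> g x)"

lemma L2_measurable [measurable_dest]: "f \<in> L2 \<Longrightarrow> f \<in> borel_measurable borel"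
  by (simp add: L2_def)

lemma L2_integrable: "f \<in> L2 \<Longrightarrow> integrable lborel (\<lambda>x. (cmod (f x))\<^sup>2)"
  by (simp add: L2_def)

lemma L2I:
  "f \<in> borel_measurable borel \<Longrightarrow> integrable lborel (\<lambda>x. (cmod (f x))\<^sup>2) \<Longrightarrow> f \<in> L2"
  by (simp add: L2_def)

lemma L2_bound:
  assumes "g \<in> L2" "f \<in> borel_measurable borel" "AE x in lborel. cmod (f x) \<le> C * cmod (g x)"
  shows "f \<in> L2"
proof (rule L2I)
  show "integrable lborel (\<lambda>x. (cmod (f x))\<^sup>2)"
  proof (rule Bochner_Integration.integrable_bound)
    show "integrable lborel (\<lambda>x. C\<^sup>2 * (cmod (g x))\<^sup>2)" using L2_integrable[OF assms(1)] by simp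
    show "(\<lambda>x. (cmod (f x))\<^sup>2) \<in> borel_measurable lborel" using assms(2) by measurable
    show "AE x in lborel. norm ((cmod (f x))\<^sup>2) \<le> norm (C\<^sup>2 * (cmod (g x))\<^sup>2)"
      using assms(3) by eventually_elim (simp add: power_mult_distrib[symmetric] power_mono)
  qed
qed (fact assms)

lemma L2_add [intro]:
  assumes "f \<in> L2" "g \<in> L2" shows "(\<lambda>x. f x + g x) \<in> L2"
proof (rule L2I)
  note [measurable] = L2_measurable[OF assms(1)] L2_measurable[OF assms(2)]
  show "(\<lambda>x. f x + g x) \<in> borel_measurable borel" by measurable
  show "integrable lborel (\<lambda>x. (cmod (f x + g x))\<^sup>2)"
  proof (rule Bochner_Integration.integrable_bound)
    show "integrable lborel (\<lambda>x. 2 * (cmod (f x))\<^sup>2 + 2 * (cmod (g x))\<^sup>2)"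
      using assms[THEN L2_integrable] by simp
    show "AE x in lborel. norm ((cmod (f x + g x))\<^sup>2) \<le> norm (2 * (cmod (f x))\<^sup>2 + 2 * (cmod (g x))\<^sup>2)"
    proof (rule AE_I2)
      fix x
      have "(cmod (f x + g x))\<^sup>2 \<le> (cmod (f x) + cmod (g x))\<^sup>2"
        by (intro power_mono norm_triangle_ineq) auto
      also have "\<dots> \<le> 2 * (cmod (f x))\<^sup>2 + 2 * (cmod (g x))\<^sup>2"
        using sum_squares_bound[of "cmod (f x)" "cmod (g x)"] by (simp add: power2_sum)
      finally show "norm ((cmod (f x + g x))\<^sup>2) \<le> norm (2 * (cmod (f x))\<^sup>2 + 2 * (cmod (g x))\<^sup>2)"
        by simp
    qed
  qed measurable
qed

lemma L2_zero [simp, intro]: "(\<lambda>x. 0) \<in> L2"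
  by (simp add: L2_def)

lemma L2_mult_bounded:
  fixes p :: "'a::euclidean_space \<Rightarrow> complex"
  assumes "f \<in> L2" "p \<in> borel_measurable borel" "\<And>x. cmod (p x) \<le> C"
  shows "(\<lambda>x. p x * f x) \<in> L2"
proof (rule L2_bound[OF assms(1)])
  note [measurable] = L2_measurable[OF assms(1)] assms(2)
  show "(\<lambda>x. p x * f x) \<in> borel_measurable borel" by measurable
  show "AE x in lborel. cmod (p x * f x) \<le> C * cmod (f x)"
    using assms(3) by (auto simp: norm_mult intro!: mult_right_mono)
qed

lemma L2_scaleR_bounded:
  assumes "f \<in> L2" "p \<in> borel_measurable borel" "\<And>x. \<bar>p x\<bar> \<le> C"
  shows "(\<lambda>x. p x *\<^sub>R f x) \<in> L2"
  using L2_mult_bounded[of f "\<lambda>x. of_real (p x)" C] assms by (simp add: scaleR_conv_of_real)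

lemma L2_cmult [intro]: "f \<in> L2 \<Longrightarrow> (\<lambda>x. c * f x) \<in> L2"
  by (rule L2_mult_bounded[where C="cmod c"]) auto

lemma L2_scaleR [intro]: "f \<in> L2 \<Longrightarrow> (\<lambda>x. c *\<^sub>R f x) \<in> L2"
  by (rule L2_scaleR_bounded[where C="\<bar>c\<bar>"]) auto

lemma L2_uminus [intro]: "f \<in> L2 \<Longrightarrow> (\<lambda>x. - f x) \<in> L2"
  using L2_cmult[of f "-1"] by simp

lemma L2_diff [intro]: "f \<in> L2 \<Longrightarrow> g \<in> L2 \<Longrightarrow> (\<lambda>x. f x - g x) \<in> L2"
  using L2_add[of f "\<lambda>x. - g x"] by auto

lemma L2_sum [intro]: "(\<And>i. i \<in> A \<Longrightarrow> f i \<in> L2) \<Longrightarrow> (\<lambda>x. \<Sum>i\<in>A. f i x) \<in> L2"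
  by (induction A rule: infinite_finite_induct) auto

lemma integrable_ip:
  assumes "f \<in> L2" "g \<in> L2"
  shows "integrable lborel (\<lambda>x. f x \<bullet> g x)" "integrable lborel (\<lambda>x. cmod (f x) * cmod (g x))"
proof -
  note [measurable] = L2_measurable[OF assms(1)] L2_measurable[OF assms(2)]
  have I: "integrable lborel (\<lambda>x. (cmod (f x))\<^sup>2 + (cmod (g x))\<^sup>2)"
    using assms[THEN L2_integrable] by simp
  have le: "cmod (f x) * cmod (g x) \<le> (cmod (f x))\<^sup>2 + (cmod (g x))\<^sup>2" for x
    using sum_squares_bound[of "cmod (f x)" "cmod (g x)"]
      mult_nonneg_nonneg[OF norm_ge_zero[of "f x"] norm_ge_zero[of "g x"]] by linarith
  show "integrable lborel (\<lambda>x. cmod (f x) * cmod (g x))"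
    by (rule Bochner_Integration.integrable_bound[OF I]) (use le in \<open>auto intro: order_trans[OF _ abs_ge_self]\<close>)
  then show "integrable lborel (\<lambda>x. f x \<bullet> g x)"
    by (rule Bochner_Integration.integrable_bound) (auto simp: Cauchy_Schwarz_ineq2)
qed

lemma L2_norm_nonneg [simp]: "0 \<le> L2_norm f"
  by (simp add: L2_norm_def)

lemma L2_norm_sq: "(L2_norm f)\<^sup>2 = ip f f"
  by (simp add: L2_norm_def ip_def power2_norm_eq_inner)

lemma ip_nonneg [simp]: "0 \<le> ip f f"
  by (simp add: L2_norm_sq[symmetric])

lemma ip_commute: "ip f g = ip g f"
  by (simp add: ip_def inner_commute)

lemma ip_add_left: "f \<in> L2 \<Longrightarrow> g \<in> L2 \<Longrightarrow> h \<in> L2 \<Longrightarrow> ip (\<lambda>x. f x + g x) h = ip f h + ip g h"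
  by (simp add: ip_def inner_add_left integrable_ip)

lemma ip_add_right: "f \<in> L2 \<Longrightarrow> g \<in> L2 \<Longrightarrow> h \<in> L2 \<Longrightarrow> ip f (\<lambda>x. g x + h x) = ip f g + ip f h"
  by (simp add: ip_def inner_add_right integrable_ip)

lemma ip_diff_left: "f \<in> L2 \<Longrightarrow> g \<in> L2 \<Longrightarrow> h \<in> L2 \<Longrightarrow> ip (\<lambda>x. f x - g x) h = ip f h - ip g h"
  by (simp add: ip_def inner_diff_left integrable_ip)

lemma ip_diff_right: "f \<in> L2 \<Longrightarrow> g \<in> L2 \<Longrightarrow> h \<in> L2 \<Longrightarrow> ip f (\<lambda>x. g x - h x) = ip f g - ip f h"
  by (simp add: ip_def inner_diff_right integrable_ip)

lemma ip_scaleR_left [simp]: "ip (\<lambda>x. c *\<^sub>R f x) g = c * ip f g"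
  by (simp add: ip_def)

lemma ip_scaleR_right [simp]: "ip f (\<lambda>x. c *\<^sub>R g x) = c * ip f g"
  by (simp add: ip_def)

lemma ip_uminus_left [simp]: "ip (\<lambda>x. - f x) g = - ip f g"
  by (simp add: ip_def)

lemma ip_uminus_right [simp]: "ip f (\<lambda>x. - g x) = - ip f g"
  by (simp add: ip_def)

lemma inner_ii: "(\<i> * z) \<bullet> w = - (z \<bullet> (\<i> * w))" for z w :: complex
  by (simp add: inner_complex_def)

lemma inner_ii_self [simp]: "z \<bullet> (\<i> * z) = 0" "(\<i> * z) \<bullet> z = 0" for z :: complex
  by (simp_all add: inner_complex_def)

text \<open>\<open>ip\<close> is the real part of the Hermitian product. Multiplication by
  \<open>\<i>\<close> is skew for it, and \<open>ip f (\<lambda>x. \<i> * g x)\<close> carries the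
  imaginary part; the phase arguments below rest on this.\<close>

lemma ip_ii: "ip (\<lambda>x. \<i> * f x) g = - ip f (\<lambda>x. \<i> * g x)"
  by (simp add: ip_def inner_ii)

lemma ip_sum_left:
  "(\<And>i. i \<in> A \<Longrightarrow> f i \<in> L2) \<Longrightarrow> h \<in> L2 \<Longrightarrow> ip (\<lambda>x. \<Sum>i\<in>A. f i x) h = (\<Sum>i\<in>A. ip (f i) h)"
  by (simp add: ip_def inner_sum_left integrable_ip)

lemma ip_sum_right:
  "(\<And>i. i \<in> A \<Longrightarrow> f i \<in> L2) \<Longrightarrow> h \<in> L2 \<Longrightarrow> ip h (\<lambda>x. \<Sum>i\<in>A. f i x) = (\<Sum>i\<in>A. ip h (f i))"
  by (simp add: ip_def inner_sum_right integrable_ip)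

lemma L2_borel: "f \<in> L2 \<Longrightarrow> f \<in> borel_measurable lborel"
  by (simp add: L2_def)

lemma ip_cong_AE:
  assumes "f \<in> L2" "g \<in> L2" "f' \<in> L2" "g' \<in> L2" "AE x in lborel. f x = f' x" "AE x in lborel. g x = g' x"
  shows "ip f g = ip f' g'"
proof -
  note [measurable] = assms(1-4)[THEN L2_borel]
  show ?thesis unfolding ip_def
    using assms(5,6) by (intro integral_cong_AE) (auto elim!: eventually_elim2)
qed

lemma L2_norm_cong_AE:
  "f \<in> L2 \<Longrightarrow> g \<in> L2 \<Longrightarrow> AE x in lborel. f x = g x \<Longrightarrow> L2_norm f = L2_norm g"
  using ip_cong_AE[of f f g g] by (metis L2_norm_sq L2_norm_nonneg power2_eq_imp_eq)

text \<open>The integral of (s |f| - |g|)^2 is nonnegative. The optimal parameter is s = I / |f|^2;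
  if \<open>f\<close> has norm zero, a large s forces the integral I to vanish.\<close>

lemma integral_norm_mult_le:
  assumes "f \<in> L2" "g \<in> L2"
  shows "(LINT x|lborel. cmod (f x) * cmod (g x)) \<le> L2_norm f * L2_norm g"
proof -
  let ?I = "LINT x|lborel. cmod (f x) * cmod (g x)"
  have *: "2 * s * ?I \<le> s\<^sup>2 * ip f f + ip g g" if "0 \<le> s" for s
  proof -
    have "2 * s * ?I = (LINT x|lborel. 2 * s * (cmod (f x) * cmod (g x)))" by simp
    also have "\<dots> \<le> (LINT x|lborel. s\<^sup>2 * (f x \<bullet> f x) + g x \<bullet> g x)"
    proof (rule integral_mono)
      fix x
      show "2 * s * (cmod (f x) * cmod (g x)) \<le> s\<^sup>2 * (f x \<bullet> f x) + g x \<bullet> g x"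
        using sum_squares_bound[of "s * cmod (f x)" "cmod (g x)"]
        by (simp add: power2_norm_eq_inner[symmetric] power_mult_distrib mult_ac)
    qed (auto intro!: integrable_ip assms)
    also have "\<dots> = s\<^sup>2 * ip f f + ip g g"
      by (simp add: ip_def integrable_ip assms)
    finally show ?thesis .
  qed
  have I0: "0 \<le> ?I" by simp
  show ?thesis
  proof (cases "ip f f = 0")
    case True
    have "?I = 0"
    proof (rule ccontr)
      assume "?I \<noteq> 0"
      then have "?I > 0" using I0 by linarith
      have "2 * ((ip g g + 1) / ?I) * ?I \<le> ip g g"
        using *[of "(ip g g + 1) / ?I"] True I0 by simp
      then show False using \<open>?I > 0\<close> ip_nonneg[of g] by simp
    qed
    then show ?thesis by simp
  next
    case False
    then have p: "0 < ip f f" using ip_nonneg[of f] by linarith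
    have "2 * (?I / ip f f) * ?I \<le> (?I / ip f f)\<^sup>2 * ip f f + ip g g"
      using *[of "?I / ip f f"] I0 p by simp
    then have "?I * ?I \<le> ip g g * ip f f"
      using p by (simp add: field_simps power2_eq_square)
    then have "?I\<^sup>2 \<le> (L2_norm f * L2_norm g)\<^sup>2"
      by (simp add: power_mult_distrib L2_norm_sq) (simp add: power2_eq_square mult_ac)
    then show ?thesis by (rule power2_le_imp_le) simp
  qed
qed

lemma ip_Cauchy_Schwarz:
  assumes "f \<in> L2" "g \<in> L2" shows "\<bar>ip f g\<bar> \<le> L2_norm f * L2_norm g"
proof -
  have "\<bar>ip f g\<bar> \<le> (LINT x|lborel. \<bar>f x \<bullet> g x\<bar>)"
    unfolding ip_def by (rule integral_abs_bound)
  also have "\<dots> \<le> (LINT x|lborel. cmod (f x) * cmod (g x))"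
    by (intro integral_mono) (auto simp: integrable_ip assms Cauchy_Schwarz_ineq2)
  also have "\<dots> \<le> L2_norm f * L2_norm g" by (rule integral_norm_mult_le[OF assms])
  finally show ?thesis .
qed

lemma L2_norm_triangle:
  assumes "f \<in> L2" "g \<in> L2" shows "L2_norm (\<lambda>x. f x + g x) \<le> L2_norm f + L2_norm g"
proof (rule power2_le_imp_le)
  have "(L2_norm (\<lambda>x. f x + g x))\<^sup>2 = ip f f + 2 * ip f g + ip g g"
    using assms by (simp add: L2_norm_sq ip_add_left ip_add_right L2_add ip_commute)
  also have "\<dots> \<le> (L2_norm f + L2_norm g)\<^sup>2"
    using ip_Cauchy_Schwarz[OF assms] by (simp add: power2_sum L2_norm_sq)
  finally show "(L2_norm (\<lambda>x. f x + g x))\<^sup>2 \<le> (L2_norm f + L2_norm g)\<^sup>2" .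
qed simp

lemma L2_norm_mono:
  assumes "g \<in> L2" "f \<in> borel_measurable borel" "AE x in lborel. cmod (f x) \<le> C * cmod (g x)" "0 \<le> C"
  shows "L2_norm f \<le> C * L2_norm g"
proof (rule power2_le_imp_le)
  have f: "f \<in> L2" by (rule L2_bound[OF assms(1-3)])
  have "ip f f \<le> (LINT x|lborel. C\<^sup>2 * (g x \<bullet> g x))" unfolding ip_def
  proof (rule integral_mono_AE)
    show "AE x in lborel. f x \<bullet> f x \<le> C\<^sup>2 * (g x \<bullet> g x)" using assms(3)
      by eventually_elim (auto simp: power2_norm_eq_inner[symmetric] power_mult_distrib[symmetric]
          intro!: power_mono)
  qed (use assms f integrable_ip in auto)
  then show "(L2_norm f)\<^sup>2 \<le> (C * L2_norm g)\<^sup>2"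
    by (simp add: L2_norm_sq power_mult_distrib ip_def)
qed (use assms in simp)

lemma L2_norm_scaleR [simp]: "L2_norm (\<lambda>x. c *\<^sub>R f x) = \<bar>c\<bar> * L2_norm f"
  by (simp add: L2_norm_def power_mult_distrib real_sqrt_mult)

lemma L2_norm_minus_commute: "L2_norm (\<lambda>x. f x - g x) = L2_norm (\<lambda>x. g x - f x)"
  by (simp add: L2_norm_def norm_minus_commute)

lemma L2_norm_cmult [simp]: "L2_norm (\<lambda>x. c * f x) = cmod c * L2_norm f"
  by (simp add: L2_norm_def norm_mult power_mult_distrib real_sqrt_mult)

lemma L2_norm_eq_0:
  assumes "f \<in> L2" "L2_norm f = 0" shows "AE x in lborel. f x = 0"
proof -
  have "(LINT x|lborel. (cmod (f x))\<^sup>2) = 0" using assms(2) by (simp add: L2_norm_def)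
  then have "AE x in lborel. (cmod (f x))\<^sup>2 = 0"
    using integral_nonneg_eq_0_iff_AE[OF L2_integrable[OF assms(1)]] by simp
  then show ?thesis by eventually_elim simp
qed

lemma L2_norm_triangle_diff:
  assumes "f \<in> L2" "g \<in> L2" "h \<in> L2"
  shows "L2_norm (\<lambda>x. f x - h x) \<le> L2_norm (\<lambda>x. f x - g x) + L2_norm (\<lambda>x. g x - h x)"
  using L2_norm_triangle[of "\<lambda>x. f x - g x" "\<lambda>x. g x - h x"] assms by (simp add: L2_diff)

lemma abs_L2_norm_diff:
  assumes "f \<in> L2" "g \<in> L2" shows "\<bar>L2_norm f - L2_norm g\<bar> \<le> L2_norm (\<lambda>x. f x - g x)"
  using L2_norm_triangle_diff[of f g "\<lambda>x. 0"] L2_norm_triangle_diff[of g f "\<lambda>x. 0"] assms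
    L2_norm_minus_commute[of f g]
  by auto

text \<open>Membership is part of the notion because \<open>L2_norm\<close> of a function whose
  square is not integrable is 0 by convention. It is asked eventually, since curves are controlled
  on a time interval only.\<close>

definition L2_conv :: "('i \<Rightarrow> 'a::euclidean_space \<Rightarrow> complex) \<Rightarrow> ('a \<Rightarrow> complex) \<Rightarrow> 'i filter \<Rightarrow> bool" where
  "L2_conv F f net \<longleftrightarrow> f \<in> L2 \<and> (\<forall>\<^sub>F i in net. F i \<in> L2) \<and>
     ((\<lambda>i. L2_norm (\<lambda>x. F i x - f x)) \<longlongrightarrow> 0) net"

lemma L2_convD: "L2_conv F f net \<Longrightarrow> f \<in> L2" "L2_conv F f net \<Longrightarrow> \<forall>\<^sub>F i in net. F i \<in> L2"
  by (auto simp: L2_conv_def)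

lemma L2_conv_const: "f \<in> L2 \<Longrightarrow> L2_conv (\<lambda>i. f) f net"
  by (simp add: L2_conv_def L2_norm_def)

text \<open>A squeeze rule with a free limit \<open>l\<close> and the side condition
  \<open>l = 0\<close>, so that a limit computed by \<open>tendsto_intros\<close> can be used before
  it is simplified.\<close>

lemma tendsto_0_le_eventually:
  fixes f g :: "'i \<Rightarrow> real"
  assumes "(g \<longlongrightarrow> l) net" "l = 0" "\<forall>\<^sub>F i in net. Q i" "\<And>i. Q i \<Longrightarrow> \<bar>f i\<bar> \<le> g i"
  shows "(f \<longlongrightarrow> 0) net"
  by (rule Lim_null_comparison[OF eventually_mono[OF assms(3)]]) (use assms in auto)

lemma L2_conv_add:
  assumes "L2_conv F f net" "L2_conv G g net"
  shows "L2_conv (\<lambda>i x. F i x + G i x) (\<lambda>x. f x + g x) net"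
proof -
  have "((\<lambda>i. L2_norm (\<lambda>x. F i x - f x) + L2_norm (\<lambda>x. G i x - g x)) \<longlongrightarrow> 0 + 0) net"
    using assms by (intro tendsto_add) (auto simp: L2_conv_def)
  then have "((\<lambda>i. L2_norm (\<lambda>x. F i x + G i x - (f x + g x))) \<longlongrightarrow> 0) net"
  proof (rule tendsto_0_le_eventually[OF _ _ eventually_conj
      [OF L2_convD(2)[OF assms(1)] L2_convD(2)[OF assms(2)]]])
    fix i assume "F i \<in> L2 \<and> G i \<in> L2"
    then show "\<bar>L2_norm (\<lambda>x. F i x + G i x - (f x + g x))\<bar>
        \<le> L2_norm (\<lambda>x. F i x - f x) + L2_norm (\<lambda>x. G i x - g x)"
      using L2_norm_triangle[of "\<lambda>x. F i x - f x" "\<lambda>x. G i x - g x"] assms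
      by (auto simp: L2_conv_def algebra_simps L2_diff)
  qed simp
  then show ?thesis using assms
      eventually_conj[OF L2_convD(2)[OF assms(1)] L2_convD(2)[OF assms(2)]]
    by (auto simp: L2_conv_def elim!: eventually_mono)
qed

lemma L2_conv_mult_bounded:
  assumes "L2_conv F f net" "p \<in> borel_measurable borel" "\<And>x. cmod (p x) \<le> C"
  shows "L2_conv (\<lambda>i x. p x * F i x) (\<lambda>x. p x * f x) net"
proof -
  have C: "0 \<le> C" using assms(3)[of undefined] norm_ge_zero order_trans by blast
  have "((\<lambda>i. C * L2_norm (\<lambda>x. F i x - f x)) \<longlongrightarrow> C * 0) net"
    using assms by (intro tendsto_intros) (auto simp: L2_conv_def)
  then have "((\<lambda>i. L2_norm (\<lambda>x. p x * F i x - p x * f x)) \<longlongrightarrow> 0) net"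
  proof (rule tendsto_0_le_eventually[OF _ _ L2_convD(2)[OF assms(1)]])
    fix i assume i: "F i \<in> L2"
    then have "L2_norm (\<lambda>x. p x * (F i x - f x)) \<le> C * L2_norm (\<lambda>x. F i x - f x)"
      using assms C L2_mult_bounded[OF L2_diff[OF i] assms(2,3)]
      by (intro L2_norm_mono) (auto simp: norm_mult L2_conv_def intro!: mult_right_mono L2_measurable)
    then show "\<bar>L2_norm (\<lambda>x. p x * F i x - p x * f x)\<bar> \<le> C * L2_norm (\<lambda>x. F i x - f x)"
      by (simp add: algebra_simps)
  qed simp
  then show ?thesis using assms
    by (auto simp: L2_conv_def elim!: eventually_mono intro: L2_mult_bounded)
qed

lemma L2_conv_cmult: "L2_conv F f net \<Longrightarrow> L2_conv (\<lambda>i x. c * F i x) (\<lambda>x. c * f x) net"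
  by (rule L2_conv_mult_bounded[where C="cmod c"]) auto

lemma L2_conv_scaleR_bounded:
  "L2_conv F f net \<Longrightarrow> p \<in> borel_measurable borel \<Longrightarrow> (\<And>x. \<bar>p x\<bar> \<le> C) \<Longrightarrow>
   L2_conv (\<lambda>i x. p x *\<^sub>R F i x) (\<lambda>x. p x *\<^sub>R f x) net"
  using L2_conv_mult_bounded[of F f net "\<lambda>x. of_real (p x)" C] by (simp add: scaleR_conv_of_real)

lemma L2_conv_diff:
  assumes "L2_conv F f net" "L2_conv G g net"
  shows "L2_conv (\<lambda>i x. F i x - G i x) (\<lambda>x. f x - g x) net"
  using L2_conv_add[OF assms(1) L2_conv_cmult[OF assms(2), of "-1"]] by simp

lemma L2_conv_sum:
  "(\<And>j. j \<in> A \<Longrightarrow> L2_conv (F j) (f j) net) \<Longrightarrow> L2_conv (\<lambda>i x. \<Sum>j\<in>A. F j i x) (\<lambda>x. \<Sum>j\<in>A. f j x) net"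
  by (induction A rule: infinite_finite_induct) (auto intro: L2_conv_add L2_conv_const)

lemma L2_conv_norm:
  assumes "L2_conv F f net" shows "((\<lambda>i. L2_norm (F i)) \<longlongrightarrow> L2_norm f) net"
proof (rule LIM_zero_cancel)
  have m: "f \<in> L2" "((\<lambda>i. L2_norm (\<lambda>x. F i x - f x)) \<longlongrightarrow> 0) net"
    using assms by (auto simp: L2_conv_def)
  show "((\<lambda>i. L2_norm (F i) - L2_norm f) \<longlongrightarrow> 0) net"
  proof (rule tendsto_0_le_eventually[OF m(2) refl L2_convD(2)[OF assms]])
    fix i assume "F i \<in> L2"
    then show "\<bar>L2_norm (F i) - L2_norm f\<bar> \<le> L2_norm (\<lambda>x. F i x - f x)"
      using abs_L2_norm_diff[OF _ m(1), of "F i"] by simp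
  qed
qed

lemma L2_conv_ip:
  assumes "L2_conv F f net" "L2_conv G g net"
  shows "((\<lambda>i. ip (F i) (G i)) \<longlongrightarrow> ip f g) net"
proof (rule LIM_zero_cancel)
  have "((\<lambda>i. L2_norm (\<lambda>x. F i x - f x) * L2_norm (G i) + L2_norm f * L2_norm (\<lambda>x. G i x - g x))
      \<longlongrightarrow> 0 * L2_norm g + L2_norm f * 0) net"
    using assms by (intro tendsto_intros L2_conv_norm) (auto simp: L2_conv_def)
  then show "((\<lambda>i. ip (F i) (G i) - ip f g) \<longlongrightarrow> 0) net"
  proof (rule tendsto_0_le_eventually[OF _ _ eventually_conj
      [OF L2_convD(2)[OF assms(1)] L2_convD(2)[OF assms(2)]]])
    fix i assume i: "F i \<in> L2 \<and> G i \<in> L2"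
    have m: "f \<in> L2" "g \<in> L2" using assms by (auto simp: L2_conv_def)
    have "ip (F i) (G i) - ip f g = ip (\<lambda>x. F i x - f x) (G i) + ip f (\<lambda>x. G i x - g x)"
      using i m by (simp add: ip_diff_left ip_diff_right)
    then show "\<bar>ip (F i) (G i) - ip f g\<bar> \<le>
        L2_norm (\<lambda>x. F i x - f x) * L2_norm (G i) + L2_norm f * L2_norm (\<lambda>x. G i x - g x)"
      using ip_Cauchy_Schwarz[of "\<lambda>x. F i x - f x" "G i"] ip_Cauchy_Schwarz[of f "\<lambda>x. G i x - g x"] i m
      by (auto simp: L2_diff)
  qed simp
qed

lemma L2_conv_unique:
  assumes "L2_conv F f net" "L2_conv F g net" "net \<noteq> bot"
  shows "AE x in lborel. f x = g x"
proof -
  have m: "f \<in> L2" "g \<in> L2" using assms by (auto simp: L2_conv_def)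
  have "((\<lambda>i. L2_norm (\<lambda>x. (F i x - F i x))) \<longlongrightarrow> L2_norm (\<lambda>x. f x - g x)) net"
    by (intro L2_conv_norm L2_conv_diff assms)
  then have "L2_norm (\<lambda>x. f x - g x) = 0"
    using tendsto_unique[OF assms(3) _ tendsto_const] by (fastforce simp: L2_norm_def)
  then show ?thesis using L2_norm_eq_0[OF L2_diff[OF m]] by simp
qed

lemma L2_conv_dominated:
  fixes F :: "nat \<Rightarrow> 'a::euclidean_space \<Rightarrow> complex"
  assumes "w \<in> L2" "\<And>i. F i \<in> borel_measurable borel" "f \<in> borel_measurable borel"
    "AE x in lborel. (\<lambda>i. F i x) \<longlonglongrightarrow> f x" "\<And>i. AE x in lborel. cmod (F i x) \<le> C * cmod (w x)"
  shows "L2_conv F f sequentially"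
proof -
  have FL: "F i \<in> L2" for i by (rule L2_bound[OF assms(1,2,5)])
  have all: "AE x in lborel. \<forall>i. cmod (F i x) \<le> C * cmod (w x)" using assms(5) by (simp add: AE_all_countable)
  have fb: "AE x in lborel. cmod (f x) \<le> C * cmod (w x)" using all assms(4)
  proof eventually_elim
    case (elim x)
    show ?case
      by (rule tendsto_upperbound[OF tendsto_norm[OF elim(2)]]) (use elim in auto)
  qed
  have fL: "f \<in> L2" by (rule L2_bound[OF assms(1,3) fb])
  note [measurable] = assms(2,3)
  have "(\<lambda>i. LINT x|lborel. (cmod (F i x - f x))\<^sup>2) \<longlonglongrightarrow> (LINT x|(lborel::'a measure). 0)"
  proof (rule integral_dominated_convergence)
    show "integrable lborel (\<lambda>x. (2 * C)\<^sup>2 * (cmod (w x))\<^sup>2)" using L2_integrable[OF assms(1)] by simp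
    show "AE x in lborel. (\<lambda>i. (cmod (F i x - f x))\<^sup>2) \<longlonglongrightarrow> 0" using assms(4)
    proof eventually_elim
      case (elim x)
      have "(\<lambda>i. (cmod (F i x - f x))\<^sup>2) \<longlonglongrightarrow> (cmod (f x - f x))\<^sup>2"
        by (intro tendsto_intros elim)
      then show ?case by simp
    qed
    fix i show "AE x in lborel. norm ((cmod (F i x - f x))\<^sup>2) \<le> (2 * C)\<^sup>2 * (cmod (w x))\<^sup>2"
      using assms(5)[of i] fb
    proof eventually_elim
      case (elim x)
      have "cmod (F i x - f x) \<le> 2 * C * cmod (w x)"
        using norm_triangle_ineq4[of "F i x" "f x"] elim by linarith
      then have "(cmod (F i x - f x))\<^sup>2 \<le> (2 * C * cmod (w x))\<^sup>2" by (intro power_mono) auto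
      then show ?case by (simp add: power_mult_distrib)
    qed
  qed measurable
  then have "(\<lambda>i. sqrt (LINT x|lborel. (cmod (F i x - f x))\<^sup>2)) \<longlonglongrightarrow> sqrt 0"
    by (intro tendsto_real_sqrt) simp
  then show ?thesis using FL fL by (simp add: L2_conv_def L2_norm_def)
qed

text \<open>Measurability is not assumed: if \<open>f\<close> is not Borel, neither is its
  translate, and both integrals are 0 by convention.\<close>

lemma lborel_integral_translate:
  fixes f :: "'a::euclidean_space \<Rightarrow> 'b::{banach,second_countable_topology}"
  shows "(LINT x|lborel. f (x + y)) = (LINT x|lborel. f x)"
proof (cases "f \<in> borel_measurable borel")
  case True
  have "(LINT x|lborel. f x) = (LINT x|distr lborel borel ((+) y). f x)"
    by (simp add: lborel_distr_plus)
  also have "\<dots> = (LINT x|lborel. f (y + x))" using True by (subst integral_distr) auto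
  finally show ?thesis by (simp add: add.commute)
next
  case False
  have "(\<lambda>x. f (x + y)) \<notin> borel_measurable borel"
  proof
    assume "(\<lambda>x. f (x + y)) \<in> borel_measurable borel"
    then have "(\<lambda>x. (\<lambda>x. f (x + y)) (x - y)) \<in> borel_measurable borel"
      by (rule measurable_compose[rotated]) simp
    then show False using False by simp
  qed
  then have "\<not> integrable lborel f" "\<not> integrable lborel (\<lambda>x. f (x + y))"
    using False by (auto dest!: borel_measurable_integrable)
  then show ?thesis by (simp add: not_integrable_integral_eq)
qed

lemma lborel_integrable_translate:
  fixes f :: "'a::euclidean_space \<Rightarrow> 'b::{banach,second_countable_topology}"
  assumes "integrable lborel f" shows "integrable lborel (\<lambda>x. f (x + y))"
proof -
  have "integrable (distr lborel borel ((+) y)) f" using assms by (simp add: lborel_distr_plus)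
  then show ?thesis using assms by (simp add: integrable_distr_eq add.commute)
qed

lemma L2_translate [intro]: "f \<in> L2 \<Longrightarrow> (\<lambda>x. f (x + y)) \<in> L2"
  by (rule L2I[OF measurable_compose[OF _ L2_measurable]])
    (simp_all add: lborel_integrable_translate[OF L2_integrable])

lemma ip_translate: "ip (\<lambda>x. f (x + y)) (\<lambda>x. g (x + y)) = ip f g"
  unfolding ip_def by (rule lborel_integral_translate)

lemma L2_norm_translate [simp]: "L2_norm (\<lambda>x. f (x + y)) = L2_norm f"
  unfolding L2_norm_def by (simp add: lborel_integral_translate[of "\<lambda>x. (cmod (f x))\<^sup>2"])

section \<open>Test functions and their density\<close>

lemma Ck_SucI:
  assumes "\<And>x. (f has_derivative D x) (at x)" "\<And>b. b \<in> Basis \<Longrightarrow> Ck k (\<lambda>x. D x b)"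
  shows "Ck (Suc k) f"
proof -
  have "frechet_derivative f (at x) = D x" for x
    using frechet_derivative_at[OF assms(1)] by simp
  then show ?thesis using assms by (auto simp: differentiable_def)
qed

lemma Ck_SucD:
  assumes "Ck (Suc k) f"
  shows "(f has_derivative frechet_derivative f (at x)) (at x)"
    "b \<in> Basis \<Longrightarrow> Ck k (\<lambda>x. frechet_derivative f (at x) b)"
  using assms by (auto simp: frechet_derivative_works)

lemma Ck_Suc_imp: "Ck (Suc k) f \<Longrightarrow> Ck k f"
proof (induction k arbitrary: f)
  case 0
  then show ?case
    using Ck_SucD(1)[OF 0] by (auto intro!: continuous_at_imp_continuous_on has_derivative_continuous)
next
  case (Suc k)
  then show ?case by (metis Ck.simps(2))
qed

lemma Ck_continuous: "Ck k f \<Longrightarrow> continuous_on UNIV f"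
  by (induction k) (use Ck_Suc_imp in auto)

lemma Ck_const [simp]: "Ck k (\<lambda>x. c)"
  by (induction k arbitrary: c) (auto intro!: Ck_SucI[where D="\<lambda>x h. 0"])

lemma Ck_add: "Ck k f \<Longrightarrow> Ck k g \<Longrightarrow> Ck k (\<lambda>x. f x + g x)"
proof (induction k arbitrary: f g)
  case (Suc k)
  show ?case
    by (rule Ck_SucI[OF has_derivative_add[OF Suc.prems[THEN Ck_SucD(1)]]])
      (intro Suc.IH Suc.prems[THEN Ck_SucD(2)])
qed (auto intro: continuous_intros)

lemma Ck_mult: "Ck k f \<Longrightarrow> Ck k g \<Longrightarrow> Ck k (\<lambda>x. f x * g x)"
proof (induction k arbitrary: f g)
  case (Suc k)
  show ?case
    by (rule Ck_SucI[OF has_derivative_mult[OF Suc.prems[THEN Ck_SucD(1)]]])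
      (intro Ck_add Suc.IH Suc.prems[THEN Ck_SucD(2)] Suc.prems[THEN Ck_Suc_imp])
qed (auto intro: continuous_intros)

lemma Ck_sum: "(\<And>i. i \<in> A \<Longrightarrow> Ck k (f i)) \<Longrightarrow> Ck k (\<lambda>x. \<Sum>i\<in>A. f i x)"
  by (induction A rule: infinite_finite_induct) (auto intro: Ck_add)

lemma Ck_prod: "(\<And>i. i \<in> A \<Longrightarrow> Ck k (f i)) \<Longrightarrow> Ck k (\<lambda>x. \<Prod>i\<in>A. f i x)"
  by (induction A rule: infinite_finite_induct) (auto intro: Ck_mult)

text \<open>The induction closes because the derivative along \<open>T b\<close> is expanded in the
  basis: it is a combination of partial derivatives of \<open>f\<close> composed with the same
  affine map.\<close>

lemma Ck_affine:
  assumes "Ck k f" "bounded_linear T"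
  shows "Ck k (\<lambda>x. f (T x + y))"
  using assms(1)
proof (induction k arbitrary: f)
  case 0
  then show ?case
    using continuous_on_compose2[of UNIV f UNIV "\<lambda>x. T x + y"] linear_continuous_on[OF assms(2)]
    by (simp add: continuous_on_add)
next
  case (Suc k)
  let ?D = "frechet_derivative f"
  have T: "((\<lambda>x. T x + y) has_derivative T) (at x)" for x
    using assms(2) by (auto intro!: derivative_eq_intros bounded_linear_imp_has_derivative)
  have D: "((\<lambda>x. f (T x + y)) has_derivative (\<lambda>h. ?D (at (T x + y)) (T h))) (at x)" for x
    using has_derivative_compose[OF T Ck_SucD(1)[OF Suc.prems]] by simp
  show ?case
  proof (rule Ck_SucI[OF D])
    fix b :: 'b assume b: "b \<in> Basis"
    have "?D (at (T x + y)) (T b) = (\<Sum>c\<in>Basis. (T b \<bullet> c) * ?D (at (T x + y)) c)" for x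
    proof -
      have "linear (?D (at (T x + y)))"
        using Ck_SucD(1)[OF Suc.prems] by (rule has_derivative_linear)
      then have "?D (at (T x + y)) (\<Sum>c\<in>Basis. (T b \<bullet> c) *\<^sub>R c)
          = (\<Sum>c\<in>Basis. (T b \<bullet> c) * ?D (at (T x + y)) c)"
        by (simp add: linear_sum linear_scale)
      then show ?thesis by (simp add: euclidean_representation)
    qed
    then show "Ck k (\<lambda>x. ?D (at (T x + y)) (T b))"
      by (auto intro!: Ck_sum Ck_mult Suc.IH Ck_SucD(2)[OF Suc.prems])
  qed
qed

text \<open>The functions p(1/t) exp(-1/t), extended by 0, form a family closed under
  differentiation: the derivative belongs to the polynomial x^2 (p - p'). Smoothness of all orders
  at 0 follows at once.\<close>

definition exp_inv :: "real poly \<Rightarrow> real \<Rightarrow> real" where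
  "exp_inv p t = (if 0 < t then poly p (1 / t) * exp (- (1 / t)) else 0)"

lemma poly_exp_tendsto_0: "((\<lambda>x::real. poly p x * exp (- x)) \<longlongrightarrow> 0) at_top"
proof -
  have "((\<lambda>x::real. \<Sum>i\<le>degree p. coeff p i * (x ^ i / exp x)) \<longlongrightarrow> (\<Sum>i\<le>degree p. coeff p i * 0)) at_top"
    by (intro tendsto_intros tendsto_power_div_exp_0)
  then show ?thesis
    by (simp add: poly_altdef exp_minus divide_inverse sum_distrib_right mult.assoc)
qed

lemma exp_inv_has_derivative:
  "(exp_inv p has_real_derivative exp_inv ([:0, 0, 1:] * (p - pderiv p)) t) (at t)"
proof (rule linorder_cases[of t 0])
  assume t: "t < 0"
  have "\<forall>\<^sub>F s in nhds t. 0 = exp_inv p s"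
    using order_tendstoD(2)[OF filterlim_ident[of "nhds t"] t] by eventually_elim (simp add: exp_inv_def)
  then show ?thesis using t
    by (subst DERIV_cong_ev[OF refl _ refl, where g="\<lambda>_. 0"])
      (auto simp: exp_inv_def eventually_mono)
next
  assume t: "0 < t"
  have ev: "\<forall>\<^sub>F s in nhds t. exp_inv p s = poly p (1 / s) * exp (- (1 / s))"
    using order_tendstoD(1)[OF filterlim_ident[of "nhds t"] t] by eventually_elim (simp add: exp_inv_def)
  have "((\<lambda>s. poly p (1 / s) * exp (- (1 / s))) has_real_derivative
      exp_inv ([:0, 0, 1:] * (p - pderiv p)) t) (at t)"
    using t by (auto intro!: derivative_eq_intros DERIV_chain'[OF _ poly_DERIV]
        simp: exp_inv_def algebra_simps power2_eq_square divide_simps)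
  then show ?thesis by (subst DERIV_cong_ev[OF refl ev refl])
next
  assume t: "t = 0"
  \<comment> \<open>From the right the quotient at 0 is again of the form polynomial in 1/h times
    exp(-1/h); \<open>pCons 0 p\<close> is x p(x).\<close>
  have "((\<lambda>h. poly (pCons 0 p) (inverse h) * exp (- inverse h)) \<longlongrightarrow> 0) (at_right 0)"
    by (rule filterlim_compose[OF poly_exp_tendsto_0 filterlim_inverse_at_top_right])
  then have "((\<lambda>h. exp_inv p h / h) \<longlongrightarrow> 0) (at_right 0)"
    by (rule Lim_transform_eventually)
      (auto simp: eventually_at_right_field exp_inv_def divide_inverse mult_ac intro!: exI[of _ 1])
  moreover have "((\<lambda>h. exp_inv p h / h) \<longlongrightarrow> 0) (at_left 0)"
    by (rule Lim_transform_eventually[OF tendsto_const])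
      (auto simp: eventually_at_left_field exp_inv_def intro!: exI[of _ "-1"])
  ultimately have "((\<lambda>h. exp_inv p h / h) \<longlongrightarrow> 0) (at 0)"
    by (simp add: filterlim_at_split)
  then show ?thesis using t by (simp add: DERIV_def) (simp add: exp_inv_def)
qed

lemma Ck_exp_inv: "Ck k (\<lambda>x. exp_inv p (x \<bullet> y + d))"
proof (induction k arbitrary: p)
  case 0
  have "isCont (exp_inv p) t" for t by (rule DERIV_isCont[OF exp_inv_has_derivative])
  then have "continuous_on UNIV (exp_inv p)" by (simp add: continuous_at_imp_continuous_on)
  then show ?case
    by (auto intro!: continuous_intros continuous_on_compose2[of UNIV "exp_inv p"])
next
  case (Suc k)
  let ?q = "[:0, 0, 1:] * (p - pderiv p)"
  have "((\<lambda>x. exp_inv p (x \<bullet> y + d)) has_derivative (\<lambda>h. exp_inv ?q (x \<bullet> y + d) * (h \<bullet> y))) (at x)" for x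
    by (rule has_derivative_compose[OF _ exp_inv_has_derivative[THEN has_field_derivative_imp_has_derivative]])
      (auto intro!: derivative_eq_intros)
  then show ?case
    by (rule Ck_SucI) (intro Ck_mult Suc.IH Ck_const)
qed

section \<open>Test functions\<close>

lemma test_funI:
  assumes "\<And>k. Ck k \<phi>" "compact S" "\<And>x. x \<notin> S \<Longrightarrow> \<phi> x = 0"
  shows "test_fun \<phi>"
proof -
  have "closure {x. \<phi> x \<noteq> 0} \<subseteq> S"
    using assms by (intro closure_minimal) (auto simp: compact_imp_closed)
  then show ?thesis using assms(1)
    by (auto simp: test_fun_def compact_eq_bounded_closed intro: bounded_subset[OF compact_imp_bounded[OF assms(2)]])
qed

lemma test_fun_support:
  assumes "test_fun \<phi>" obtains S where "compact S" "\<And>x. x \<notin> S \<Longrightarrow> \<phi> x = 0"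
proof (rule that)
  show "compact (closure {x. \<phi> x \<noteq> 0})" using assms by (simp add: test_fun_def)
  show "\<phi> x = 0" if "x \<notin> closure {x. \<phi> x \<noteq> 0}" for x
    using that closure_subset[of "{x. \<phi> x \<noteq> 0}"] by blast
qed

lemma test_fun_zero: "test_fun (\<lambda>x. 0)"
  by (rule test_funI[where S="{}"]) auto

lemma test_fun_Ck: "test_fun f \<Longrightarrow> Ck k f"
  by (simp add: test_fun_def)

lemma test_fun_add: assumes "test_fun f" "test_fun g" shows "test_fun (\<lambda>x. f x + g x)"
proof -
  obtain S where S: "compact S" "\<And>x. x \<notin> S \<Longrightarrow> f x = 0" using test_fun_support[OF assms(1)] by blast
  obtain S' where S': "compact S'" "\<And>x. x \<notin> S' \<Longrightarrow> g x = 0" using test_fun_support[OF assms(2)] by blast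
  show ?thesis
    by (rule test_funI[OF Ck_add[OF test_fun_Ck test_fun_Ck] compact_Un[OF S(1) S'(1)]])
      (use assms S(2) S'(2) in auto)
qed

lemma test_fun_cmult: assumes "test_fun f" shows "test_fun (\<lambda>x. c * f x)"
proof -
  obtain S where S: "compact S" "\<And>x. x \<notin> S \<Longrightarrow> f x = 0" using test_fun_support[OF assms(1)] by blast
  show ?thesis
    by (rule test_funI[OF Ck_mult[OF Ck_const test_fun_Ck] S(1)]) (use assms S(2) in auto)
qed

lemma test_fun_has_derivative:
  "test_fun f \<Longrightarrow> (f has_derivative frechet_derivative f (at x)) (at x)"
  by (rule Ck_SucD(1)[OF test_fun_Ck])

lemma test_fun_deriv:
  assumes "test_fun f" "b \<in> Basis" shows "test_fun (\<lambda>x. frechet_derivative f (at x) b)"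
proof -
  have cl: "compact (closure {x. f x \<noteq> 0})" using assms by (simp add: test_fun_def)
  show ?thesis
  proof (rule test_funI[OF _ cl])
    show "Ck k (\<lambda>x. frechet_derivative f (at x) b)" for k
      by (rule Ck_SucD(2)[OF test_fun_Ck assms(2)]) (rule assms(1))
  next
    \<comment> \<open>The complement of the closed support is open, so \<open>f\<close> vanishes
      near \<open>x\<close> and not merely at \<open>x\<close>.\<close>
    fix x assume x: "x \<notin> closure {x. f x \<noteq> 0}"
    have "(f has_derivative (\<lambda>h. 0)) (at x)"
    proof (rule has_derivative_transform_within_open[of "\<lambda>x. 0" _ _ _ "- closure {x. f x \<noteq> 0}"])
      show "\<And>y. y \<in> - closure {x. f x \<noteq> 0} \<Longrightarrow> 0 = f y"
        using closure_subset[of "{x. f x \<noteq> 0}"] by auto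
    qed (use x in auto)
    then show "frechet_derivative f (at x) b = 0"
      using frechet_derivative_at[of f "\<lambda>h. 0" x] by metis
  qed
qed

lemma test_fun_affine:
  assumes "test_fun f" "bounded_linear T" "bounded_linear T'" "\<And>x. T' (T x) = x"
  shows "test_fun (\<lambda>x. f (T x + y))"
proof -
  obtain S where S: "compact S" "\<And>x. x \<notin> S \<Longrightarrow> f x = 0" using test_fun_support[OF assms(1)] by blast
  have "compact ((\<lambda>z. T' (z - y)) ` S)"
    by (intro compact_continuous_image S(1) continuous_intros linear_continuous_on assms
        continuous_on_compose2[of UNIV T'] ) auto
  then show ?thesis
  proof (rule test_funI[rotated])
    show "Ck k (\<lambda>x. f (T x + y))" for k using assms by (intro Ck_affine) (auto simp: test_fun_def)
    fix x assume "x \<notin> (\<lambda>z. T' (z - y)) ` S"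
    then have "T x + y \<notin> S" using assms(4)[of x] by force
    then show "f (T x + y) = 0" by (rule S)
  qed
qed

lemma test_fun_translate: "test_fun f \<Longrightarrow> test_fun (\<lambda>x. f (x + y))"
  using test_fun_affine[of f "\<lambda>x. x" "\<lambda>x. x" y] by simp

lemma test_fun_continuous: "test_fun f \<Longrightarrow> continuous_on UNIV f"
  using Ck_continuous by (auto simp: test_fun_def)

lemma test_fun_measurable [measurable_dest]: "test_fun f \<Longrightarrow> f \<in> borel_measurable borel"
  by (intro borel_measurable_continuous_onI test_fun_continuous)

lemma test_fun_bounded:
  assumes "test_fun f" obtains C where "\<And>x. \<bar>f x\<bar> \<le> C"
proof -
  obtain S where S: "compact S" "\<And>x. x \<notin> S \<Longrightarrow> f x = 0" using test_fun_support[OF assms(1)] by blast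
  have "bounded (f ` S)"
    using S(1) test_fun_continuous[OF assms] continuous_on_subset
    by (intro compact_imp_bounded compact_continuous_image) auto
  then obtain C where C: "0 < C" "\<And>x. x \<in> S \<Longrightarrow> \<bar>f x\<bar> \<le> C" by (auto simp: bounded_pos)
  have "\<bar>f x\<bar> \<le> C" for x using C S(2) by (cases "x \<in> S") auto
  then show ?thesis by (rule that)
qed

section \<open>Complex test functions and their closure in L2\<close>

definition TF :: "('a::euclidean_space \<Rightarrow> complex) set" where
  "TF = {\<lambda>x. Complex (\<phi> x) (\<eta> x) |\<phi> \<eta>. test_fun \<phi> \<and> test_fun \<eta>}"

lemma test_fun_L2: assumes "test_fun \<phi>" shows "(\<lambda>x. complex_of_real (\<phi> x)) \<in> L2"
proof (rule L2I)
  note [measurable] = test_fun_measurable[OF assms]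
  show "(\<lambda>x. complex_of_real (\<phi> x)) \<in> borel_measurable borel" by measurable
  obtain S where S: "compact S" "\<And>x. x \<notin> S \<Longrightarrow> \<phi> x = 0" using test_fun_support[OF assms(1)] by blast
  have "integrable lborel (\<lambda>x. indicator S x *\<^sub>R (\<phi> x)\<^sup>2)"
    by (intro borel_integrable_compact S(1) continuous_intros
        continuous_on_subset[OF test_fun_continuous[OF assms]]) auto
  also have "(\<lambda>x. indicator S x *\<^sub>R (\<phi> x)\<^sup>2) = (\<lambda>x. (cmod (complex_of_real (\<phi> x)))\<^sup>2)"
    using S(2) by (fastforce simp: indicator_def)
  finally show "integrable lborel (\<lambda>x. (cmod (complex_of_real (\<phi> x)))\<^sup>2)" .
qed

lemma TF_L2: "\<zeta> \<in> TF \<Longrightarrow> \<zeta> \<in> L2"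
proof -
  assume "\<zeta> \<in> TF"
  then obtain \<phi> \<eta> where *: "\<zeta> = (\<lambda>x. Complex (\<phi> x) (\<eta> x))" "test_fun \<phi>" "test_fun \<eta>" by (auto simp: TF_def)
  have "(\<lambda>x. of_real (\<phi> x) + \<i> * of_real (\<eta> x)) \<in> L2"
    using * by (intro L2_add L2_cmult test_fun_L2)
  then show ?thesis using * by (simp add: Complex_eq)
qed

lemma TF_I: "test_fun \<phi> \<Longrightarrow> test_fun \<eta> \<Longrightarrow> f = (\<lambda>x. Complex (\<phi> x) (\<eta> x)) \<Longrightarrow> f \<in> TF"
  by (auto simp: TF_def)

lemma TF_zero: "(\<lambda>x. 0) \<in> TF"
  using test_fun_zero by (auto simp: TF_def zero_complex.code intro!: exI[of _ "\<lambda>x. 0"])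

lemma TF_add: assumes "f \<in> TF" "g \<in> TF" shows "(\<lambda>x. f x + g x) \<in> TF"
proof -
  obtain a b c d where *: "f = (\<lambda>x. Complex (a x) (b x))" "g = (\<lambda>x. Complex (c x) (d x))"
    "test_fun a" "test_fun b" "test_fun c" "test_fun d" using assms by (auto simp: TF_def)
  have "test_fun (\<lambda>x. a x + c x)" "test_fun (\<lambda>x. b x + d x)"
    "(\<lambda>x. f x + g x) = (\<lambda>x. Complex (a x + c x) (b x + d x))"
    using * by (auto simp: complex_eq_iff intro: test_fun_add)
  then show ?thesis by (rule TF_I)
qed

lemma TF_cmult: assumes "f \<in> TF" shows "(\<lambda>x. c * f x) \<in> TF"
proof -
  obtain a b where *: "f = (\<lambda>x. Complex (a x) (b x))"
    "test_fun a" "test_fun b" using assms by (auto simp: TF_def)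
  have "test_fun (\<lambda>x. Re c * a x + (- Im c) * b x)" "test_fun (\<lambda>x. Re c * b x + Im c * a x)"
    "(\<lambda>x. c * f x) = (\<lambda>x. Complex (Re c * a x + (- Im c) * b x) (Re c * b x + Im c * a x))"
    using * test_fun_add[OF test_fun_cmult test_fun_cmult, of a b "Re c" "- Im c"]
      test_fun_add[OF test_fun_cmult test_fun_cmult, of b a "Re c" "Im c"] by (auto simp: complex_eq_iff)
  then show ?thesis by (rule TF_I)
qed

definition TF_closure :: "('a::euclidean_space \<Rightarrow> complex) set" where
  "TF_closure = {f \<in> L2. \<forall>e>0. \<exists>\<zeta>\<in>TF. L2_norm (\<lambda>x. f x - \<zeta> x) < e}"

lemma TF_closureD: "f \<in> TF_closure \<Longrightarrow> 0 < e \<Longrightarrow> \<exists>\<zeta>\<in>TF. L2_norm (\<lambda>x. f x - \<zeta> x) < e"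
  by (simp add: TF_closure_def)

lemma TF_closure_L2: "f \<in> TF_closure \<Longrightarrow> f \<in> L2"
  by (simp add: TF_closure_def)

lemma TF_subset_closure: "\<zeta> \<in> TF \<Longrightarrow> \<zeta> \<in> TF_closure"
  by (auto simp: TF_closure_def TF_L2 L2_norm_def intro!: bexI[of _ \<zeta>])

lemma TF_closure_lim:
  assumes "L2_conv F f sequentially" "\<And>n. F n \<in> TF_closure" shows "f \<in> TF_closure"
proof -
  have f: "f \<in> L2" using assms by (simp add: L2_conv_def)
  have "\<exists>\<zeta>\<in>TF. L2_norm (\<lambda>x. f x - \<zeta> x) < e" if "0 < e" for e
  proof -
    have "(\<lambda>n. L2_norm (\<lambda>x. F n x - f x)) \<longlonglongrightarrow> 0" using assms by (simp add: L2_conv_def)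
    then have "\<forall>\<^sub>F n in sequentially. L2_norm (\<lambda>x. F n x - f x) < e / 2"
      using that by (intro order_tendstoD) auto
    then obtain n where n: "L2_norm (\<lambda>x. f x - F n x) < e / 2"
      using L2_norm_minus_commute[of _ f] by (auto simp: eventually_sequentially)
    obtain \<zeta> where z: "\<zeta> \<in> TF" "L2_norm (\<lambda>x. F n x - \<zeta> x) < e / 2"
      using TF_closureD[OF assms(2), of "e / 2"] \<open>0 < e\<close> by auto
    have "L2_norm (\<lambda>x. f x - \<zeta> x) < e"
      using L2_norm_triangle_diff[OF f TF_closure_L2[OF assms(2)] TF_L2[OF z(1)], of n] n z by linarith
    then show ?thesis using z by auto
  qed
  then show ?thesis using f by (simp add: TF_closure_def)
qed

lemma TF_closure_add:
  assumes "f \<in> TF_closure" "g \<in> TF_closure" shows "(\<lambda>x. f x + g x) \<in> TF_closure"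
proof -
  have "\<exists>\<zeta>\<in>TF. L2_norm (\<lambda>x. f x + g x - \<zeta> x) < e" if e: "0 < e" for e
  proof -
    obtain \<zeta> where z: "\<zeta> \<in> TF" "L2_norm (\<lambda>x. f x - \<zeta> x) < e / 2"
      using TF_closureD[OF assms(1), of "e / 2"] e by auto
    obtain \<xi> where w: "\<xi> \<in> TF" "L2_norm (\<lambda>x. g x - \<xi> x) < e / 2"
      using TF_closureD[OF assms(2), of "e / 2"] e by auto
    have "L2_norm (\<lambda>x. f x - \<zeta> x + (g x - \<xi> x)) < e"
      using L2_norm_triangle[of "\<lambda>x. f x - \<zeta> x" "\<lambda>x. g x - \<xi> x"] assms z w
      by (simp add: L2_diff TF_L2 TF_closure_L2)
    then show ?thesis by (intro bexI[of _ "\<lambda>x. \<zeta> x + \<xi> x"] TF_add z w) (simp add: algebra_simps)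
  qed
  then show ?thesis using assms by (auto simp: TF_closure_def)
qed

lemma TF_closure_cmult:
  assumes "f \<in> TF_closure" shows "(\<lambda>x. c * f x) \<in> TF_closure"
proof -
  have "\<exists>\<zeta>\<in>TF. L2_norm (\<lambda>x. c * f x - \<zeta> x) < e" if e: "0 < e" for e
  proof -
    obtain \<zeta> where z: "\<zeta> \<in> TF" "L2_norm (\<lambda>x. f x - \<zeta> x) < e / (cmod c + 1)"
      using TF_closureD[OF assms(1), of "e / (cmod c + 1)"] e by (auto simp: add_nonneg_pos)
    have "cmod c * L2_norm (\<lambda>x. f x - \<zeta> x) \<le> (cmod c + 1) * L2_norm (\<lambda>x. f x - \<zeta> x)"
      by (intro mult_right_mono) auto
    also have "\<dots> < e" using z(2) by (simp add: pos_less_divide_eq add_nonneg_pos mult.commute)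
    finally have "L2_norm (\<lambda>x. c * (f x - \<zeta> x)) < e" by simp
    then show ?thesis by (intro bexI[of _ "\<lambda>x. c * \<zeta> x"] TF_cmult z) (simp add: algebra_simps)
  qed
  then show ?thesis using assms by (auto simp: TF_closure_def)
qed

lemma TF_closure_sum:
  "(\<And>i. i \<in> A \<Longrightarrow> f i \<in> TF_closure) \<Longrightarrow> (\<lambda>x. \<Sum>i\<in>A. f i x) \<in> TF_closure"
  by (induction A rule: infinite_finite_induct)
    (auto intro: TF_closure_add TF_subset_closure TF_zero)

lemma indicator_L2:
  assumes "A \<in> sets borel" "emeasure lborel A < \<infinity>" shows "(\<lambda>x. indicator A x :: complex) \<in> L2"
proof (rule L2I)
  have "(\<lambda>x. (cmod (indicator A x))\<^sup>2) = (indicator A :: _ \<Rightarrow> real)"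
    by (auto simp: indicator_def)
  then show "integrable lborel (\<lambda>x. (cmod (indicator A x))\<^sup>2)"
    using assms by (simp add: integrable_indicator_iff)
qed (use assms in measurable)

text \<open>Products over the coordinates of \<open>exp_inv\<close> bumps, steepened by the factor n
  + 1, vanish outside the box. Since exp(-1/(n s)) tends to 1 for s > 0, they converge pointwise to
  the indicator and are dominated by it.\<close>

lemma indicator_box_TF_closure:
  "(\<lambda>x. indicator (box a b) x) \<in> (TF_closure :: ('a::euclidean_space \<Rightarrow> complex) set)"
proof -
  let ?e = "exp_inv 1"
  let ?\<phi> = "\<lambda>n x. \<Prod>c\<in>Basis. ?e (x \<bullet> (real (Suc n) *\<^sub>R c) + - (real (Suc n) * (a \<bullet> c)))
    * ?e (x \<bullet> (- real (Suc n) *\<^sub>R c) + real (Suc n) * (b \<bullet> c))"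
  have e: "0 \<le> ?e t" "?e t \<le> 1" for t by (auto simp: exp_inv_def)
  have zero: "?\<phi> n x = 0" if x: "x \<notin> box a b" for n and x :: 'a
  proof -
    obtain c :: 'a where c: "c \<in> Basis" "x \<bullet> c \<le> a \<bullet> c \<or> b \<bullet> c \<le> x \<bullet> c"
      using x by (fastforce simp: mem_box not_less)
    have "real (Suc n) * (x \<bullet> c) \<le> real (Suc n) * (a \<bullet> c) \<or> real (Suc n) * (b \<bullet> c) \<le> real (Suc n) * (x \<bullet> c)"
      using c(2) by (auto intro: mult_left_mono simp del: of_nat_Suc)
    then show ?thesis
      by (intro prod_zero) (use c(1) in \<open>auto simp: exp_inv_def simp del: of_nat_Suc intro!: bexI[of _ c]\<close>)
  qed
  have tf: "test_fun (?\<phi> n)" for n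
  proof (rule test_funI)
    show "Ck k (?\<phi> n)" for k by (intro Ck_prod Ck_mult Ck_exp_inv)
    show "compact (cbox a b)" by simp
    show "?\<phi> n x = 0" if "x \<notin> cbox a b" for x
      using that box_subset_cbox by (intro zero) blast
  qed
  have bd: "0 \<le> ?\<phi> n x \<and> ?\<phi> n x \<le> 1" for n and x :: 'a
    using e by (auto intro!: prod_nonneg prod_le_1 mult_le_one)
  have lim: "(\<lambda>n. ?\<phi> n x) \<longlonglongrightarrow> indicator (box a b) x" for x :: 'a
  proof (cases "x \<in> box a b")
    case True
    have "(\<lambda>n. ?e (real (Suc n) * s)) \<longlonglongrightarrow> 1" if "0 < s" for s
    proof -
      have "(\<lambda>n. exp (- ((1 / real (Suc n)) * (1 / s)))) \<longlonglongrightarrow> exp (- (0 * (1 / s)))"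
        by (intro tendsto_intros LIMSEQ_Suc[OF lim_1_over_n])
      then show ?thesis using that by (simp add: exp_inv_def)
    qed note l = this
    have "(\<lambda>n. \<Prod>c\<in>Basis. ?e (real (Suc n) * (x \<bullet> c - a \<bullet> c)) * ?e (real (Suc n) * (b \<bullet> c - x \<bullet> c)))
        \<longlonglongrightarrow> (\<Prod>c\<in>(Basis::'a set). 1 * 1)"
      using True by (intro tendsto_prod tendsto_mult l) (auto simp: mem_box)
    then show ?thesis using True by (simp add: algebra_simps)
  next
    case False
    then show ?thesis using zero[OF False] by (simp only: indicator_def of_bool_eq tendsto_const not_False_eq_True)
  qed
  have aux: "cmod (of_real t) \<le> 1 * cmod (indicator B x)" if "0 \<le> t \<and> t \<le> 1" "x \<notin> B \<Longrightarrow> t = 0"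
    for t and B :: "'a set" and x
    using that by (cases "x \<in> B") auto
  have "L2_conv (\<lambda>n x. complex_of_real (?\<phi> n x)) (\<lambda>x. indicator (box a b) x) sequentially"
  proof (rule L2_conv_dominated)
    show "(\<lambda>x. indicator (box a b) x :: complex) \<in> L2"
      by (rule indicator_L2) (use emeasure_lborel_box_finite in auto)
    show "(\<lambda>x. complex_of_real (?\<phi> i x)) \<in> borel_measurable borel" for i
      using test_fun_measurable[OF tf] by measurable
    have "(\<lambda>n. complex_of_real (?\<phi> n x)) \<longlonglongrightarrow> of_real (indicator (box a b) x)" for x :: 'a
      by (rule tendsto_of_real[OF lim])
    then show "AE x in lborel. (\<lambda>n. complex_of_real (?\<phi> n x)) \<longlonglongrightarrow> indicator (box a b) x"
      by (simp only: of_real_indicator AE_I2)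
    show "AE x in lborel. cmod (of_real (?\<phi> i x)) \<le> 1 * cmod (indicator (box a b) x)" for i
      using bd zero by (intro AE_I2 aux) blast+
  qed simp
  moreover have "(\<lambda>x. complex_of_real (?\<phi> n x)) \<in> TF_closure" for n
    using tf[of n] test_fun_zero
    by (intro TF_subset_closure) (auto simp: TF_def complex_of_real_def)
  ultimately show ?thesis by (rule TF_closure_lim)
qed

text \<open>Dynkin's argument over the intersection-stable family of boxes. Every set is cut with
  one fixed box containing \<open>A\<close>, which keeps measures finite: the complement step
  subtracts two elements of the closure, and the union step is dominated.\<close>

lemma indicator_TF_closure:
  fixes A :: "'a::euclidean_space set"
  assumes "A \<in> sets borel" "bounded A"
  shows "(\<lambda>x. indicator A x) \<in> TF_closure"
proof -
  obtain a where a: "A \<subseteq> box (- a) a" using bounded_subset_box_symmetric[OF assms(2)] by auto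
  let ?B = "box (- a) a"
  have fin: "emeasure lborel (X \<inter> ?B) < \<infinity>" for X
    using emeasure_mono[of "X \<inter> ?B" ?B lborel] emeasure_lborel_box_finite[of "-a" a] by (auto simp: less_top top_unique)
  have IS: "Int_stable (range (\<lambda>(a, b). box a b :: 'a set))"
    by (auto simp: Int_stable_def box_Int_box)
  have "(\<lambda>x. indicator (X \<inter> ?B) x) \<in> TF_closure" if X: "X \<in> sigma_sets UNIV (range (\<lambda>(a, b). box a b :: 'a set))" for X
    using IS _ X
  proof (induct rule: sigma_sets_induct_disjoint)
    fix X assume "X \<in> range (\<lambda>(a, b). box a b :: 'a set)"
    then show "(\<lambda>x. indicator (X \<inter> ?B) x) \<in> TF_closure"
      by (auto simp: box_Int_box indicator_box_TF_closure)
  next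
    show "(\<lambda>x. indicator ({} \<inter> ?B) x) \<in> TF_closure" by (simp add: TF_subset_closure TF_zero)
  next
    fix X assume "(\<lambda>x. indicator (X \<inter> ?B) x) \<in> TF_closure"
    then have "(\<lambda>x. indicator ?B x + (-1) * indicator (X \<inter> ?B) x) \<in> TF_closure"
      by (intro TF_closure_add TF_closure_cmult indicator_box_TF_closure)
    also have "(\<lambda>x. indicator ?B x + (-1) * indicator (X \<inter> ?B) x) = (\<lambda>x. indicator ((UNIV - X) \<inter> ?B) x :: complex)"
      by (auto simp: indicator_def)
    finally show "(\<lambda>x. indicator ((UNIV - X) \<inter> ?B) x) \<in> TF_closure" .
  next
    fix X :: "nat \<Rightarrow> 'a set"
    assume X: "disjoint_family X" "range X \<subseteq> sigma_sets UNIV (range (\<lambda>(a, b). box a b))"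
      "\<And>i. (\<lambda>x. indicator (X i \<inter> ?B) x) \<in> TF_closure"
    have Xm [measurable]: "X i \<in> sets borel" for i using X(2) by (auto simp: borel_eq_box)
    have "L2_conv (\<lambda>n x. \<Sum>i<n. indicator (X i \<inter> ?B) x) (\<lambda>x. indicator (\<Union>(range X) \<inter> ?B) x :: complex) sequentially"
    proof (rule L2_conv_dominated)
      show "(\<lambda>x. indicator ?B x :: complex) \<in> L2"
        by (rule indicator_L2) (use emeasure_lborel_box_finite in auto)
      have sum: "(\<Sum>i<n. indicator (X i \<inter> ?B) x) = (indicator ((\<Union>i<n. X i) \<inter> ?B) x :: complex)" for n x
      proof -
        have "disjoint_family_on (\<lambda>i. X i \<inter> ?B) {..<n}"
          using X(1) by (fastforce simp: disjoint_family_on_def)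
        then show ?thesis
          by (subst indicator_UN_disjoint[symmetric]) (auto simp: indicator_def)
      qed
      show "AE x in lborel. (\<lambda>n. \<Sum>i<n. indicator (X i \<inter> ?B) x) \<longlonglongrightarrow> (indicator (\<Union>(range X) \<inter> ?B) x :: complex)"
        unfolding sum
      proof (rule AE_I2)
        fix x :: 'a
        show "(\<lambda>n. indicator ((\<Union>i<n. X i) \<inter> ?B) x :: complex) \<longlonglongrightarrow> indicator (\<Union>(range X) \<inter> ?B) x"
        proof (cases "x \<in> \<Union>(range X) \<inter> ?B")
          case True
          then obtain i where "x \<in> X i" "x \<in> ?B" by auto
          then have "\<forall>\<^sub>F n in sequentially. indicator ((\<Union>i<n. X i) \<inter> ?B) x = (1::complex)"
            by (intro eventually_sequentiallyI[of "Suc i"]) (auto simp: indicator_def)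
          then show ?thesis using True by (simp add: tendsto_eventually)
        next
          case False
          then have "indicator ((\<Union>i<n. X i) \<inter> ?B) x = (0::complex)" for n by (auto simp: indicator_def)
          then show ?thesis using False by simp
        qed
      qed
      show "AE x in lborel. cmod (\<Sum>i<n. indicator (X i \<inter> ?B) x) \<le> 1 * cmod (indicator ?B x)" for n
        unfolding sum by (auto simp: indicator_def)
    qed measurable
    then show "(\<lambda>x. indicator (\<Union>(range X) \<inter> ?B) x) \<in> TF_closure"
      by (rule TF_closure_lim) (intro TF_closure_sum X)
  qed auto
  then have "(\<lambda>x. indicator (A \<inter> ?B) x) \<in> TF_closure" using assms(1) by (simp add: borel_eq_box)
  then show ?thesis using a by (simp add: Int_absorb2)
qed

text \<open>Simple functions bounded by 2 |f|, cut off by growing balls, converge to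
  \<open>f\<close> in L2. Each is a finite combination of indicators of bounded Borel sets.\<close>

theorem TF_dense: "f \<in> L2 \<Longrightarrow> f \<in> TF_closure"
proof -
  assume f: "f \<in> L2"
  obtain s where s: "\<And>i. simple_function borel (s i)" "\<And>x. (\<lambda>i. s i x) \<longlonglongrightarrow> f x"
      "\<And>i x. cmod (s i x) \<le> 2 * cmod (f x)"
    using borel_measurable_implies_sequence_metric[OF L2_measurable[OF f], of 0] by (auto simp: dist_norm)
  have sm [measurable]: "s i \<in> borel_measurable borel" for i using s(1) by (rule borel_measurable_simple_function)
  have "L2_conv (\<lambda>i x. indicator (ball 0 (real i)) x * s i x) f sequentially"
  proof (rule L2_conv_dominated[OF f, where C=2])
    show "AE x in lborel. (\<lambda>i. indicator (ball 0 (real i)) x * s i x) \<longlonglongrightarrow> f x"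
    proof (rule AE_I2)
      fix x :: 'a
      obtain n where "norm x < real n" using reals_Archimedean2 by blast
      then have "\<forall>\<^sub>F i in sequentially. s i x = indicator (ball 0 (real i)) x * s i x"
        by (intro eventually_sequentiallyI[of n]) (auto simp: indicator_def)
      with s(2)[of x] show "(\<lambda>i. indicator (ball 0 (real i)) x * s i x) \<longlonglongrightarrow> f x"
        by (rule Lim_transform_eventually)
    qed
    show "AE x in lborel. cmod (indicator (ball 0 (real i)) x * s i x) \<le> 2 * cmod (f x)" for i
      using s(3)[of i] by (auto simp: indicator_def)
  qed (auto intro!: borel_measurable_times borel_measurable_indicator sm L2_measurable[OF f])
  moreover have "(\<lambda>x. indicator (ball 0 (real i)) x * s i x) \<in> TF_closure" for i
  proof -
    have "(\<lambda>x. \<Sum>y\<in>range (s i). y * indicator (s i -` {y} \<inter> ball 0 (real i)) x) \<in> TF_closure"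
    proof (intro TF_closure_sum TF_closure_cmult indicator_TF_closure)
      fix y
      show "s i -` {y} \<inter> ball 0 (real i) \<in> sets borel"
        using measurable_sets[OF sm, of "{y}" i] by (intro sets.Int) auto
      show "bounded (s i -` {y} \<inter> ball 0 (real i))" by (intro bounded_Int) auto
    qed
    also have "(\<lambda>x. \<Sum>y\<in>range (s i). y * indicator (s i -` {y} \<inter> ball 0 (real i)) x)
        = (\<lambda>x. indicator (ball 0 (real i)) x * s i x)"
    proof
      fix x
      have "finite (range (s i))" using s(1)[of i] by (auto simp: simple_function_def)
      then show "(\<Sum>y\<in>range (s i). y * indicator (s i -` {y} \<inter> ball 0 (real i)) x)
        = indicator (ball 0 (real i)) x * s i x"
        by (subst sum.remove[of _ "s i x"]) (auto simp: indicator_def intro!: sum.neutral)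
    qed
    finally show ?thesis .
  qed
  ultimately show ?thesis by (rule TF_closure_lim)
qed

section \<open>Weak derivatives and difference quotients\<close>

definition diff_quot :: "'a::euclidean_space \<Rightarrow> real \<Rightarrow> ('a \<Rightarrow> complex) \<Rightarrow> 'a \<Rightarrow> complex" where
  "diff_quot b h f x = (f (x + h *\<^sub>R b) - f x) /\<^sub>R h"

lemma diff_quot_L2 [intro]: "f \<in> L2 \<Longrightarrow> diff_quot b h f \<in> L2"
  unfolding diff_quot_def by (intro L2_scaleR L2_diff L2_translate)

text \<open>Test functions are real-valued, so a complex one is differentiated through its real and
  imaginary parts; a relation records both at once.\<close>

definition TF_deriv :: "'a::euclidean_space \<Rightarrow> ('a \<Rightarrow> complex) \<Rightarrow> ('a \<Rightarrow> complex) \<Rightarrow> bool" where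
  "TF_deriv b \<zeta> \<zeta>' \<longleftrightarrow> (\<exists>\<phi> \<eta>. test_fun \<phi> \<and> test_fun \<eta> \<and> \<zeta> = (\<lambda>x. of_real (\<phi> x) + \<i> * of_real (\<eta> x)) \<and>
     \<zeta>' = (\<lambda>x. of_real (frechet_derivative \<phi> (at x) b) + \<i> * of_real (frechet_derivative \<eta> (at x) b)))"

lemma TF_derivE: assumes "\<zeta> \<in> TF" obtains \<zeta>' where "TF_deriv b \<zeta> \<zeta>'"
  using assms unfolding TF_def TF_deriv_def Complex_eq by blast

lemma TF_deriv_TF: "TF_deriv b \<zeta> \<zeta>' \<Longrightarrow> \<zeta> \<in> TF"
  unfolding TF_def TF_deriv_def Complex_eq by blast

lemma frechet_derivative_translate:
  assumes "test_fun \<phi>"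
  shows "frechet_derivative (\<lambda>x. \<phi> (x + y)) (at x) = frechet_derivative \<phi> (at (x + y))"
proof (rule frechet_derivative_at[symmetric])
  have "((\<lambda>x. x + y) has_derivative (\<lambda>h. h)) (at x)" by (auto intro!: derivative_eq_intros)
  from has_derivative_compose[OF this test_fun_has_derivative[OF assms]]
  show "((\<lambda>x. \<phi> (x + y)) has_derivative frechet_derivative \<phi> (at (x + y))) (at x)" by simp
qed

lemma TF_deriv_translate:
  assumes "TF_deriv b \<zeta> \<zeta>'" shows "TF_deriv b (\<lambda>x. \<zeta> (x + y)) (\<lambda>x. \<zeta>' (x + y))"
proof -
  obtain \<phi> \<eta> where *: "test_fun \<phi>" "test_fun \<eta>" "\<zeta> = (\<lambda>x. of_real (\<phi> x) + \<i> * of_real (\<eta> x))"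
     "\<zeta>' = (\<lambda>x. of_real (frechet_derivative \<phi> (at x) b) + \<i> * of_real (frechet_derivative \<eta> (at x) b))"
    using assms by (auto simp: TF_deriv_def)
  show ?thesis unfolding TF_deriv_def
    by (rule exI[of _ "\<lambda>x. \<phi> (x + y)"], rule exI[of _ "\<lambda>x. \<eta> (x + y)"])
      (use * in \<open>simp add: test_fun_translate frechet_derivative_translate\<close>)
qed

lemma TF_translate: "\<zeta> \<in> TF \<Longrightarrow> (\<lambda>x. \<zeta> (x + y)) \<in> TF"
  by (erule TF_derivE[where b=0]) (rule TF_deriv_TF[OF TF_deriv_translate])

section \<open>Difference quotients and translations in L2\<close>

lemma test_fun_bounded_support:
  assumes "test_fun \<phi>" obtains r where "0 < r" "\<And>x. r \<le> norm x \<Longrightarrow> \<phi> x = 0"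
proof -
  obtain S where S: "compact S" "\<And>x. x \<notin> S \<Longrightarrow> \<phi> x = 0" using test_fun_support[OF assms] by blast
  obtain r where "0 < r" "\<And>x. x \<in> S \<Longrightarrow> norm x \<le> r"
    using compact_imp_bounded[OF S(1)] by (auto simp: bounded_pos)
  then show ?thesis using S(2) by (intro that[of "r + 1"]) force+
qed

lemma indicator_ball_L2: "(\<lambda>x. indicator (ball 0 r) x) \<in> L2"
  using emeasure_bounded_finite[of "ball 0 r"] by (intro indicator_L2) auto

lemma test_fun_diff_quot_bound:
  assumes "test_fun \<phi>" "\<And>x. \<bar>frechet_derivative \<phi> (at x) b\<bar> \<le> C"
  shows "\<bar>\<phi> (x + h *\<^sub>R b) - \<phi> x\<bar> \<le> C * \<bar>h\<bar>"
proof -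
  let ?g = "\<lambda>t. \<phi> (x + t *\<^sub>R b)"
  have "(?g has_real_derivative frechet_derivative \<phi> (at (x + t *\<^sub>R b)) b) (at t)" for t
  proof -
    have 1: "((\<lambda>t. x + t *\<^sub>R b) has_derivative (\<lambda>h. h *\<^sub>R b)) (at t)"
      by (auto intro!: derivative_eq_intros)
    have lin: "linear (frechet_derivative \<phi> (at (x + t *\<^sub>R b)))"
      by (rule has_derivative_linear[OF test_fun_has_derivative[OF assms(1)]])
    from has_derivative_compose[OF 1 test_fun_has_derivative[OF assms(1)]]
    show ?thesis
      by (simp add: has_field_derivative_def linear_scale[OF lin] mult.commute[of _ "frechet_derivative _ _ _"])
  qed
  then have "norm (?g h - ?g 0) \<le> C * norm (h - 0)"
    by (intro field_differentiable_bound[of UNIV ?g]) (use assms(2) in auto)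
  then show ?thesis by simp
qed

lemma test_fun_diff_quot_conv:
  assumes \<phi>: "test_fun \<phi>" and b: "b \<in> Basis" and h: "h \<longlonglongrightarrow> 0" "\<And>n. h n \<noteq> 0"
  shows "L2_conv (\<lambda>n. diff_quot b (h n) (\<lambda>x. of_real (\<phi> x))) (\<lambda>x. of_real (frechet_derivative \<phi> (at x) b)) sequentially"
proof -
  let ?\<phi>' = "\<lambda>x. frechet_derivative \<phi> (at x) b"
  note [measurable] = test_fun_measurable[OF \<phi>] test_fun_measurable[OF test_fun_deriv[OF \<phi> b]]
  obtain C where C: "\<And>x. \<bar>?\<phi>' x\<bar> \<le> C" using test_fun_bounded[OF test_fun_deriv[OF \<phi> b]] by blast
  have C0: "0 \<le> C" using C[of 0] by linarith
  obtain r where r: "0 < r" "\<And>x. r \<le> norm x \<Longrightarrow> \<phi> x = 0" using test_fun_bounded_support[OF \<phi>] by blast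
  \<comment> \<open>A bound on the steps puts the supports of all translates into one ball, on which
    the constant \<open>C\<close> dominates the quotients.\<close>
  obtain H where H: "\<And>n. \<bar>h n\<bar> \<le> H"
    using convergent_imp_Bseq[of h] h(1) by (auto simp: convergent_def Bseq_def)
  show ?thesis
  proof (rule L2_conv_dominated[OF indicator_ball_L2[of "r + H"], where C=C])
    show "diff_quot b (h i) (\<lambda>x. of_real (\<phi> x)) \<in> borel_measurable borel" for i
      unfolding diff_quot_def by measurable
    show "AE x in lborel. (\<lambda>i. diff_quot b (h i) (\<lambda>x. complex_of_real (\<phi> x)) x) \<longlonglongrightarrow> complex_of_real (?\<phi>' x)"
    proof (rule AE_I2)
      fix x
      have 1: "((\<lambda>t. x + t *\<^sub>R b) has_derivative (\<lambda>h. h *\<^sub>R b)) (at 0)"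
        by (auto intro!: derivative_eq_intros)
      have lin: "linear (frechet_derivative \<phi> (at (x + 0 *\<^sub>R b)))"
        by (rule has_derivative_linear[OF test_fun_has_derivative[OF \<phi>]])
      from has_derivative_compose[OF 1 test_fun_has_derivative[OF \<phi>]]
      have "((\<lambda>t. \<phi> (x + t *\<^sub>R b)) has_real_derivative ?\<phi>' x) (at 0)"
        using linear_scale[OF lin] by (simp add: has_field_derivative_def mult_commute_abs)
      then have "((\<lambda>t. (\<phi> (x + t *\<^sub>R b) - \<phi> x) / t) \<longlongrightarrow> ?\<phi>' x) (at 0)"
        by (simp add: DERIV_def)
      moreover have "filterlim h (at 0) sequentially" using h by (simp add: filterlim_at)
      ultimately have "(\<lambda>i. (\<phi> (x + h i *\<^sub>R b) - \<phi> x) / h i) \<longlonglongrightarrow> ?\<phi>' x"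
        by (rule filterlim_compose)
      then have "(\<lambda>i. complex_of_real ((\<phi> (x + h i *\<^sub>R b) - \<phi> x) / h i)) \<longlonglongrightarrow> complex_of_real (?\<phi>' x)"
        by (rule tendsto_of_real)
      then show "(\<lambda>i. diff_quot b (h i) (\<lambda>x. complex_of_real (\<phi> x)) x) \<longlonglongrightarrow> complex_of_real (?\<phi>' x)"
        by (simp add: diff_quot_def scaleR_conv_of_real divide_inverse mult.commute)
    qed
    show "AE x in lborel. cmod (diff_quot b (h i) (\<lambda>x. of_real (\<phi> x)) x) \<le> C * cmod (indicator (ball 0 (r + H)) x)" for i
    proof (rule AE_I2)
      fix x
      show "cmod (diff_quot b (h i) (\<lambda>x. of_real (\<phi> x)) x) \<le> C * cmod (indicator (ball 0 (r + H)) x)"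
      proof (cases "x \<in> ball 0 (r + H)")
        case True
        have "cmod (diff_quot b (h i) (\<lambda>x. of_real (\<phi> x)) x) = \<bar>\<phi> (x + h i *\<^sub>R b) - \<phi> x\<bar> / \<bar>h i\<bar>"
          by (simp add: diff_quot_def divide_inverse mult.commute flip: of_real_diff)
        also have "\<dots> \<le> C" using test_fun_diff_quot_bound[OF \<phi> C, of x "h i"] h(2)[of i]
          by (simp add: divide_le_eq)
        finally show ?thesis using True by simp
      next
        case False
        have n: "norm x \<ge> r + H" using False by simp
        have "norm (h i *\<^sub>R b) \<le> H" using H[of i] b by simp
        then have "r \<le> norm (x + h i *\<^sub>R b)"
          using n norm_triangle_ineq2[of x "- (h i *\<^sub>R b)"] by simp
        moreover have "r \<le> norm x" using n H[of i] by linarith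
        ultimately show ?thesis using r(2) C0 by (simp add: diff_quot_def)
      qed
    qed
  qed measurable
qed

lemma TF_diff_quot_conv:
  assumes "TF_deriv b \<zeta> \<zeta>'" "b \<in> Basis" "h \<longlonglongrightarrow> 0" "\<And>n. h n \<noteq> 0"
  shows "L2_conv (\<lambda>n. diff_quot b (h n) \<zeta>) \<zeta>' sequentially"
proof -
  obtain \<phi> \<eta> where *: "test_fun \<phi>" "test_fun \<eta>" "\<zeta> = (\<lambda>x. of_real (\<phi> x) + \<i> * of_real (\<eta> x))"
     "\<zeta>' = (\<lambda>x. of_real (frechet_derivative \<phi> (at x) b) + \<i> * of_real (frechet_derivative \<eta> (at x) b))"
    using assms by (auto simp: TF_deriv_def)
  have "L2_conv (\<lambda>n x. diff_quot b (h n) (\<lambda>x. of_real (\<phi> x)) x + \<i> * diff_quot b (h n) (\<lambda>x. of_real (\<eta> x)) x) \<zeta>' sequentially"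
    unfolding *(4) using * assms by (intro L2_conv_add L2_conv_cmult test_fun_diff_quot_conv)
  also have "(\<lambda>n x. diff_quot b (h n) (\<lambda>x. of_real (\<phi> x)) x + \<i> * diff_quot b (h n) (\<lambda>x. of_real (\<eta> x)) x) = (\<lambda>n. diff_quot b (h n) \<zeta>)"
    by (auto simp: *(3) diff_quot_def fun_eq_iff algebra_simps)
  finally show ?thesis .
qed

lemma TF_translation_conv:
  assumes "\<zeta> \<in> TF" "y \<longlonglongrightarrow> 0" shows "L2_conv (\<lambda>n x. \<zeta> (x + y n)) \<zeta> sequentially"
proof -
  obtain \<phi> \<eta> where *: "\<zeta> = (\<lambda>x. Complex (\<phi> x) (\<eta> x))" "test_fun \<phi>" "test_fun \<eta>" using assms by (auto simp: TF_def)
  note [measurable] = L2_measurable[OF TF_L2[OF assms(1)]]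
  have c: "isCont \<zeta> x" for x
    using test_fun_continuous[OF *(2)] test_fun_continuous[OF *(3)] unfolding *(1) Complex_eq
    by (auto intro!: continuous_intros simp: continuous_on_eq_continuous_at)
  obtain r where r: "0 < r" "\<And>x. r \<le> norm x \<Longrightarrow> \<phi> x = 0" using test_fun_bounded_support[OF *(2)] by blast
  obtain r' where r': "0 < r'" "\<And>x. r' \<le> norm x \<Longrightarrow> \<eta> x = 0" using test_fun_bounded_support[OF *(3)] by blast
  obtain C where C: "\<And>x. \<bar>\<phi> x\<bar> \<le> C" using test_fun_bounded[OF *(2)] by blast
  obtain C' where C': "\<And>x. \<bar>\<eta> x\<bar> \<le> C'" using test_fun_bounded[OF *(3)] by blast
  obtain H where H: "\<And>n. norm (y n) \<le> H"
    using convergent_imp_Bseq[of y] assms(2) by (auto simp: convergent_def Bseq_def)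
  show ?thesis
  proof (rule L2_conv_dominated[OF indicator_ball_L2[of "r + r' + H"], where C="C + C'"])
    show "AE x in lborel. (\<lambda>n. \<zeta> (x + y n)) \<longlonglongrightarrow> \<zeta> x"
    proof (rule AE_I2)
      fix x
      have "(\<lambda>n. x + y n) \<longlonglongrightarrow> x + 0" by (intro tendsto_intros assms)
      then show "(\<lambda>n. \<zeta> (x + y n)) \<longlonglongrightarrow> \<zeta> x" using isCont_tendsto_compose[OF c] by fastforce
    qed
    show "AE x in lborel. cmod (\<zeta> (x + y i)) \<le> (C + C') * cmod (indicator (ball 0 (r + r' + H)) x)" for i
    proof (rule AE_I2)
      fix x
      show "cmod (\<zeta> (x + y i)) \<le> (C + C') * cmod (indicator (ball 0 (r + r' + H)) x)"
      proof (cases "x \<in> ball 0 (r + r' + H)")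
        case True
        then show ?thesis using C[of "x + y i"] C'[of "x + y i"] cmod_le[of "\<zeta> (x + y i)"]
          by (simp add: *(1))
      next
        case False
        then have "r + r' \<le> norm (x + y i)" using H[of i] norm_triangle_ineq2[of x "- y i"] by simp
        then have "\<phi> (x + y i) = 0" "\<eta> (x + y i) = 0" using r r' by auto
        then show ?thesis using False by (simp add: *(1) complex_eq_iff)
      qed
    qed
  qed measurable
qed

text \<open>Translations are isometries, so the statement passes from the dense test functions to
  all of L2 with an error of three times e/3.\<close>

theorem L2_translation_conv:
  assumes "f \<in> L2" "y \<longlonglongrightarrow> 0" shows "L2_conv (\<lambda>n x. f (x + y n)) f sequentially"
proof -
  have "(\<lambda>n. L2_norm (\<lambda>x. f (x + y n) - f x)) \<longlonglongrightarrow> 0"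
  proof (rule LIMSEQ_I)
    fix e :: real assume e: "0 < e"
    obtain \<zeta> where z: "\<zeta> \<in> TF" "L2_norm (\<lambda>x. f x - \<zeta> x) < e / 3"
      using TF_closureD[OF TF_dense[OF assms(1)], of "e / 3"] e by auto
    have "(\<lambda>n. L2_norm (\<lambda>x. \<zeta> (x + y n) - \<zeta> x)) \<longlonglongrightarrow> 0"
      using TF_translation_conv[OF z(1) assms(2)] by (simp add: L2_conv_def)
    then obtain N where N: "\<And>n. n \<ge> N \<Longrightarrow> L2_norm (\<lambda>x. \<zeta> (x + y n) - \<zeta> x) < e / 3"
      using LIMSEQ_D[of _ 0 "e / 3"] e by fastforce
    have "L2_norm (\<lambda>x. f (x + y n) - f x) < e" if "n \<ge> N" for n
    proof -
      have L: "\<zeta> \<in> L2" "(\<lambda>x. f (x + y n)) \<in> L2" "(\<lambda>x. \<zeta> (x + y n)) \<in> L2" using z assms TF_L2 by auto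
      have "L2_norm (\<lambda>x. f (x + y n) - \<zeta> (x + y n)) < e / 3"
        using z(2) L2_norm_translate[of "\<lambda>x. f x - \<zeta> x" "y n"] by simp
      then show ?thesis
        using L2_norm_triangle_diff[OF L(2) L(3) assms(1)] L2_norm_triangle_diff[OF L(3) L(1) assms(1)]
          N[OF that] z(2) L2_norm_minus_commute[of f \<zeta>] by linarith
    qed
    then show "\<exists>N. \<forall>n\<ge>N. norm (L2_norm (\<lambda>x. f (x + y n) - f x) - 0) < e" by auto
  qed
  then show ?thesis using assms by (auto simp: L2_conv_def intro!: always_eventually)
qed

text \<open>Duality: a test function close to \<open>w\<close> itself recovers nearly the square of
  the norm of \<open>w\<close>.\<close>

lemma L2_norm_le_by_TF:
  assumes "w \<in> L2" "\<And>\<zeta>. \<zeta> \<in> TF \<Longrightarrow> ip w \<zeta> \<le> e * L2_norm \<zeta>" "0 \<le> e"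
  shows "L2_norm w \<le> e"
proof (rule ccontr)
  assume "\<not> L2_norm w \<le> e"
  then have c: "e < L2_norm w" by simp
  have key: "(L2_norm w)\<^sup>2 \<le> e * L2_norm w + (L2_norm w + e) * s" if s: "0 < s" for s
  proof -
    obtain \<zeta> where z: "\<zeta> \<in> TF" "L2_norm (\<lambda>x. w x - \<zeta> x) < s"
      using TF_closureD[OF TF_dense[OF assms(1)] s] by auto
    have zL: "\<zeta> \<in> L2" using z TF_L2 by auto
    have "(L2_norm w)\<^sup>2 = ip w (\<lambda>x. w x - \<zeta> x) + ip w \<zeta>"
      by (simp add: L2_norm_sq ip_diff_right assms zL)
    also have "ip w (\<lambda>x. w x - \<zeta> x) \<le> L2_norm w * s"
      using ip_Cauchy_Schwarz[OF assms(1) L2_diff[OF assms(1) zL]] z(2)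
        mult_left_mono[of "L2_norm (\<lambda>x. w x - \<zeta> x)" s "L2_norm w"] by simp
    also have "ip w \<zeta> \<le> e * L2_norm \<zeta>" by (rule assms(2)[OF z(1)])
    also have "e * L2_norm \<zeta> \<le> e * (L2_norm w + s)"
      using abs_L2_norm_diff[OF assms(1) zL] z(2) assms(3) by (intro mult_left_mono) auto
    finally show ?thesis by (simp add: algebra_simps)
  qed
  have "L2_norm w * (L2_norm w - e) \<le> (L2_norm w + e) * s" if "0 < s" for s
    using key[OF that] by (simp add: algebra_simps power2_eq_square)
  \<comment> \<open>This value of s turns the estimate into 4 |w| <= |w| + e, against e <
    |w|.\<close>
  from this[of "(L2_norm w - e) / 4"] c assms(3)
  have "L2_norm w * (L2_norm w - e) \<le> ((L2_norm w + e) / 4) * (L2_norm w - e)" by simp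
  then have "4 * L2_norm w \<le> L2_norm w + e" using c by simp
  then show False using c assms(3) by linarith
qed

lemma integrable_test_scaleR:
  assumes "w \<in> L2" "test_fun p" shows "integrable lborel (\<lambda>x. p x *\<^sub>R w x)"
proof -
  note [measurable] = L2_measurable[OF assms(1)] test_fun_measurable[OF assms(2)]
  show ?thesis
    by (rule Bochner_Integration.integrable_bound[OF integrable_ip(2)[OF test_fun_L2[OF assms(2)] assms(1)]])
      (auto simp: norm_mult)
qed

lemma ip_test_fun:
  assumes w: "w \<in> L2" and ac: "test_fun a" "test_fun c"
  shows "ip w (\<lambda>x. of_real (a x) + \<i> * of_real (c x)) =
      Re (LINT x|lborel. a x *\<^sub>R w x) + Im (LINT x|lborel. c x *\<^sub>R w x)"
proof -
  note int = integrable_test_scaleR[OF w]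
  have "ip w (\<lambda>x. of_real (a x) + \<i> * of_real (c x)) =
    ip w (\<lambda>x. of_real (a x)) + ip w (\<lambda>x. \<i> * of_real (c x))"
    using w ac by (intro ip_add_right) (auto intro: test_fun_L2)
  also have "ip w (\<lambda>x. of_real (a x)) = Re (LINT x|lborel. a x *\<^sub>R w x)"
    by (simp add: ip_def inner_complex_def mult.commute integral_bounded_linear[OF bounded_linear_Re int[OF ac(1)], symmetric])
  also have "ip w (\<lambda>x. \<i> * of_real (c x)) = Im (LINT x|lborel. c x *\<^sub>R w x)"
    by (simp add: ip_def inner_complex_def mult.commute integral_bounded_linear[OF bounded_linear_Im int[OF ac(2)], symmetric])
  finally show ?thesis .
qed

text \<open>Testing with complex functions through \<open>ip\<close> packs the real and imaginary
  parts of the defining identity into one scalar. Conversely, test functions with one vanishing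
  component separate them again.\<close>

lemma has_weak_deriv_iff_TF:
  assumes b: "b \<in> Basis"
  shows "has_weak_deriv f b g \<longleftrightarrow> f \<in> L2 \<and> g \<in> L2 \<and> (\<forall>\<zeta> \<zeta>'. TF_deriv b \<zeta> \<zeta>' \<longrightarrow> ip f \<zeta>' = - ip g \<zeta>)"
proof (intro iffI conjI allI impI; (elim conjE)?)
  assume wd: "has_weak_deriv f b g"
  show fg: "f \<in> L2" "g \<in> L2" using wd by (auto simp: has_weak_deriv_def)
  fix \<zeta> \<zeta>' assume "TF_deriv b \<zeta> \<zeta>'"
  then obtain \<phi> \<eta> where *: "test_fun \<phi>" "test_fun \<eta>" "\<zeta> = (\<lambda>x. of_real (\<phi> x) + \<i> * of_real (\<eta> x))"
     "\<zeta>' = (\<lambda>x. of_real (frechet_derivative \<phi> (at x) b) + \<i> * of_real (frechet_derivative \<eta> (at x) b))"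
    by (auto simp: TF_deriv_def)
  have "(LINT x|lborel. frechet_derivative \<phi> (at x) b *\<^sub>R f x) = - (LINT x|lborel. \<phi> x *\<^sub>R g x)"
    if "test_fun \<phi>" for \<phi> using wd that by (auto simp: has_weak_deriv_def)
  then show "ip f \<zeta>' = - ip g \<zeta>" unfolding *(3,4)
    by (simp add: ip_test_fun fg * test_fun_deriv b)
next
  assume fg: "f \<in> L2" "g \<in> L2" and i: "\<forall>\<zeta> \<zeta>'. TF_deriv b \<zeta> \<zeta>' \<longrightarrow> ip f \<zeta>' = - ip g \<zeta>"
  have "(LINT x|lborel. frechet_derivative \<phi> (at x) b *\<^sub>R f x) = - (LINT x|lborel. \<phi> x *\<^sub>R g x)"
    if \<phi>: "test_fun \<phi>" for \<phi>
  proof -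
    have d: "test_fun (\<lambda>x. frechet_derivative \<phi> (at x) b)" by (rule test_fun_deriv[OF \<phi> b])
    have 0: "frechet_derivative (\<lambda>x. 0) (at x) b = 0" for x :: 'a by simp
    have "TF_deriv b (\<lambda>x. of_real (\<phi> x) + \<i> * of_real 0)
        (\<lambda>x. of_real (frechet_derivative \<phi> (at x) b) + \<i> * of_real 0)"
      unfolding TF_deriv_def
      by (rule exI[of _ \<phi>], rule exI[of _ "\<lambda>x. 0"]) (use \<phi> in \<open>simp add: test_fun_zero\<close>)
    from i[rule_format, OF this] have 1: "Re (LINT x|lborel. frechet_derivative \<phi> (at x) b *\<^sub>R f x) = - Re (LINT x|lborel. \<phi> x *\<^sub>R g x)"
      by (subst (asm) (1 2) ip_test_fun) (use fg \<phi> d test_fun_zero in auto)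
    have "TF_deriv b (\<lambda>x. of_real 0 + \<i> * of_real (\<phi> x))
        (\<lambda>x. of_real 0 + \<i> * of_real (frechet_derivative \<phi> (at x) b))"
      unfolding TF_deriv_def
      by (rule exI[of _ "\<lambda>x. 0"], rule exI[of _ \<phi>]) (use \<phi> in \<open>simp add: test_fun_zero\<close>)
    from i[rule_format, OF this] have 2: "Im (LINT x|lborel. frechet_derivative \<phi> (at x) b *\<^sub>R f x) = - Im (LINT x|lborel. \<phi> x *\<^sub>R g x)"
      by (subst (asm) (1 2) ip_test_fun) (use fg \<phi> d test_fun_zero in auto)
    show ?thesis using 1 2 by (simp add: complex_eq_iff)
  qed
  then show "has_weak_deriv f b g" using fg by (simp add: has_weak_deriv_def)
qed

lemma weak_deriv_ip_TF:
  "has_weak_deriv f b g \<Longrightarrow> TF_deriv b \<zeta> \<zeta>' \<Longrightarrow> b \<in> Basis \<Longrightarrow> ip f \<zeta>' = - ip g \<zeta>"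
  by (simp add: has_weak_deriv_iff_TF)

text \<open>Paired with a test function, the translate of \<open>f\<close> by t b has derivative
  given by the translate of \<open>g\<close>, so the scalar mean value theorem replaces an integral
  of \<open>g\<close> along a segment. The intermediate point depends on the test function, which is
  harmless because \<open>e\<close> bounds all shifts up to \<open>h\<close>; duality then returns
  to the norm.\<close>

theorem weak_deriv_diff_quot_estimate:
  assumes f: "has_weak_deriv f b g" and b: "b \<in> Basis" and h: "h \<noteq> 0"
    and e: "\<And>s. \<bar>s\<bar> \<le> \<bar>h\<bar> \<Longrightarrow> L2_norm (\<lambda>x. g (x + s *\<^sub>R b) - g x) \<le> e"
  shows "L2_norm (\<lambda>x. diff_quot b h f x - g x) \<le> e"
proof (rule L2_norm_le_by_TF)
  have fg: "f \<in> L2" "g \<in> L2" using f by (auto simp: has_weak_deriv_def)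
  show "(\<lambda>x. diff_quot b h f x - g x) \<in> L2" using fg by auto
  show "0 \<le> e" by (rule order_trans[OF L2_norm_nonneg e[of 0]]) simp
  fix \<zeta> :: "'a \<Rightarrow> complex" assume z: "\<zeta> \<in> TF"
  then obtain \<zeta>' where z': "TF_deriv b \<zeta> \<zeta>'" by (rule TF_derivE)
  have zL: "\<zeta> \<in> L2" using TF_L2[OF z] .
  define m where "m t = ip (\<lambda>x. f (x + t *\<^sub>R b)) \<zeta>" for t
  \<comment> \<open>Moving the translation onto the test function makes \<open>m\<close>
    differentiable by the smoothness of the latter.\<close>
  have m: "m t = ip f (\<lambda>x. \<zeta> (x - t *\<^sub>R b))" for t
    using ip_translate[of "\<lambda>x. f (x + t *\<^sub>R b)" "- (t *\<^sub>R b)" \<zeta>] by (simp add: m_def)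
  have D: "(m has_real_derivative ip (\<lambda>x. g (x + t *\<^sub>R b)) \<zeta>) (at t)" for t
    unfolding DERIV_def tendsto_at_iff_sequentially comp_def
  proof (intro allI impI)
    fix k :: "nat \<Rightarrow> real" assume k: "\<forall>i. k i \<in> UNIV - {0}" "k \<longlonglongrightarrow> 0"
    have tz: "TF_deriv b (\<lambda>x. \<zeta> (x + - (t *\<^sub>R b))) (\<lambda>x. \<zeta>' (x + - (t *\<^sub>R b)))"
      by (rule TF_deriv_translate[OF z'])
    have "L2_conv (\<lambda>n. diff_quot b (- k n) (\<lambda>x. \<zeta> (x + - (t *\<^sub>R b)))) (\<lambda>x. \<zeta>' (x + - (t *\<^sub>R b))) sequentially"
      using k by (intro TF_diff_quot_conv[OF tz b]) (auto intro: tendsto_eq_intros)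
    then have "(\<lambda>n. - ip f (diff_quot b (- k n) (\<lambda>x. \<zeta> (x + - (t *\<^sub>R b))))) \<longlonglongrightarrow> - ip f (\<lambda>x. \<zeta>' (x + - (t *\<^sub>R b)))"
      by (intro tendsto_minus L2_conv_ip L2_conv_const fg)
    also have "- ip f (\<lambda>x. \<zeta>' (x + - (t *\<^sub>R b))) = ip g (\<lambda>x. \<zeta> (x + - (t *\<^sub>R b)))"
      using weak_deriv_ip_TF[OF f tz b] by simp
    also have "\<dots> = ip (\<lambda>x. g (x + t *\<^sub>R b)) \<zeta>"
      using ip_translate[of "\<lambda>x. g (x + t *\<^sub>R b)" "- (t *\<^sub>R b)" \<zeta>] by simp
    also have "(\<lambda>n. - ip f (diff_quot b (- k n) (\<lambda>x. \<zeta> (x + - (t *\<^sub>R b))))) = (\<lambda>n. (m (t + k n) - m t) / k n)"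
    proof
      fix n
      have "ip f (diff_quot b (- k n) (\<lambda>x. \<zeta> (x + - (t *\<^sub>R b)))) =
        inverse (- k n) * (ip f (\<lambda>x. \<zeta> (x - (t + k n) *\<^sub>R b)) - ip f (\<lambda>x. \<zeta> (x - t *\<^sub>R b)))"
        unfolding diff_quot_def ip_scaleR_right
        using fg TF_translate[OF z, THEN TF_L2, of "- (t *\<^sub>R b)"] TF_translate[OF z, THEN TF_L2, of "- ((t + k n) *\<^sub>R b)"]
        by (subst ip_diff_right[symmetric]) (auto simp: algebra_simps)
      then show "- ip f (diff_quot b (- k n) (\<lambda>x. \<zeta> (x + - (t *\<^sub>R b)))) = (m (t + k n) - m t) / k n"
        by (simp add: m divide_inverse mult.commute)
    qed
    finally show "(\<lambda>n. (m (t + k n) - m t) / k n) \<longlonglongrightarrow> ip (\<lambda>x. g (x + t *\<^sub>R b)) \<zeta>" .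
  qed
  obtain s where s: "\<bar>s\<bar> \<le> \<bar>h\<bar>" "m h - m 0 = h * ip (\<lambda>x. g (x + s *\<^sub>R b)) \<zeta>"
  proof (cases "0 < h")
    case True
    obtain s where "0 < s" "s < h" "m h - m 0 = (h - 0) * ip (\<lambda>x. g (x + s *\<^sub>R b)) \<zeta>"
      using MVT2[OF True D] by blast
    then show ?thesis by (intro that[of s]) auto
  next
    case False
    then have "h < 0" using h by simp
    obtain s where "h < s" "s < 0" "m 0 - m h = (0 - h) * ip (\<lambda>x. g (x + s *\<^sub>R b)) \<zeta>"
      using MVT2[OF \<open>h < 0\<close> D] by blast
    then show ?thesis by (intro that[of s]) auto
  qed
  have "ip (\<lambda>x. diff_quot b h f x - g x) \<zeta> = (m h - m 0) / h - ip g \<zeta>"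
    unfolding m_def using fg zL diff_quot_L2[OF fg(1), of b h]
    by (simp add: ip_diff_left) (simp add: diff_quot_def[abs_def] ip_diff_left L2_translate divide_inverse mult.commute)
  also have "\<dots> = ip (\<lambda>x. g (x + s *\<^sub>R b) - g x) \<zeta>" using s h fg zL by (simp add: ip_diff_left L2_translate)
  also have "\<dots> \<le> L2_norm (\<lambda>x. g (x + s *\<^sub>R b) - g x) * L2_norm \<zeta>"
    using ip_Cauchy_Schwarz[of "\<lambda>x. g (x + s *\<^sub>R b) - g x" \<zeta>] fg zL by (simp add: L2_diff L2_translate)
  also have "\<dots> \<le> e * L2_norm \<zeta>" using e[OF s(1)] by (intro mult_right_mono) auto
  finally show "ip (\<lambda>x. diff_quot b h f x - g x) \<zeta> \<le> e * L2_norm \<zeta>" .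
qed

lemma L2_translation_continuous:
  assumes "g \<in> L2" "0 < e" shows "\<exists>d>0. \<forall>y. norm y < d \<longrightarrow> L2_norm (\<lambda>x. g (x + y) - g x) < e"
proof -
  have "((\<lambda>y. L2_norm (\<lambda>x. g (x + y) - g x)) \<longlongrightarrow> 0) (at 0)"
    unfolding tendsto_at_iff_sequentially comp_def
    using L2_translation_conv[OF assms(1)] by (auto simp: L2_conv_def)
  then obtain d where "d > 0" "\<And>y. y \<noteq> 0 \<Longrightarrow> norm y < d \<Longrightarrow> L2_norm (\<lambda>x. g (x + y) - g x) < e"
    using assms(2) unfolding LIM_def by (auto simp: dist_norm)
  moreover have "L2_norm (\<lambda>x. g (x + 0) - g x) < e" using assms(2) by (simp add: L2_norm_def)
  ultimately show ?thesis by (metis)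
qed

theorem weak_deriv_diff_quot_conv:
  assumes f: "has_weak_deriv f b g" and b: "b \<in> Basis" and h: "h \<longlonglongrightarrow> 0" "\<And>n. h n \<noteq> 0"
  shows "L2_conv (\<lambda>n. diff_quot b (h n) f) g sequentially"
proof -
  have fg: "f \<in> L2" "g \<in> L2" using f by (auto simp: has_weak_deriv_def)
  have "(\<lambda>n. L2_norm (\<lambda>x. diff_quot b (h n) f x - g x)) \<longlonglongrightarrow> 0"
  proof (rule LIMSEQ_I)
    fix e :: real assume e: "0 < e"
    obtain d where d: "d > 0" "\<And>y. norm y < d \<Longrightarrow> L2_norm (\<lambda>x. g (x + y) - g x) < e / 2"
      using L2_translation_continuous[OF fg(2), of "e / 2"] e by auto
    obtain N where N: "\<And>n. n \<ge> N \<Longrightarrow> \<bar>h n\<bar> < d" using LIMSEQ_D[OF h(1) d(1)] by auto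
    have "L2_norm (\<lambda>x. diff_quot b (h n) f x - g x) \<le> e / 2" if "n \<ge> N" for n
    proof (rule weak_deriv_diff_quot_estimate[OF f b h(2)])
      fix s assume "\<bar>s\<bar> \<le> \<bar>h n\<bar>"
      then have "norm (s *\<^sub>R b) < d" using N[OF that] b by simp
      then show "L2_norm (\<lambda>x. g (x + s *\<^sub>R b) - g x) \<le> e / 2" using d(2) by fastforce
    qed
    then show "\<exists>N. \<forall>n\<ge>N. norm (L2_norm (\<lambda>x. diff_quot b (h n) f x - g x) - 0) < e"
      using e by (intro exI[of _ N]) fastforce
  qed
  then show ?thesis using fg by (auto simp: L2_conv_def intro!: always_eventually)
qed

lemma inverse_Suc_tendsto: "(\<lambda>n. inverse (real (Suc n))) \<longlonglongrightarrow> 0" "inverse (real (Suc n)) \<noteq> 0"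
  using LIMSEQ_inverse_real_of_nat by auto

lemma has_weak_deriv_unique:
  assumes "has_weak_deriv f b g" "has_weak_deriv f b g'" "b \<in> Basis"
  shows "AE x in lborel. g x = g' x"
  by (rule L2_conv_unique[OF weak_deriv_diff_quot_conv[OF assms(1,3) inverse_Suc_tendsto]
    weak_deriv_diff_quot_conv[OF assms(2,3) inverse_Suc_tendsto]]) simp

section \<open>The Leibniz rule and the nonlinearity\<close>

lemma TF_deriv_L2:
  assumes "TF_deriv b \<zeta> \<zeta>'" "b \<in> Basis" shows "\<zeta> \<in> L2" "\<zeta>' \<in> L2"
  using L2_convD(1)[OF TF_diff_quot_conv[OF assms inverse_Suc_tendsto]] TF_L2[OF TF_deriv_TF[OF assms(1)]] by auto

lemma has_weak_deriv_L2: "has_weak_deriv f b g \<Longrightarrow> f \<in> L2" "has_weak_deriv f b g \<Longrightarrow> g \<in> L2"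
  by (auto simp: has_weak_deriv_def)

lemma has_weak_deriv_add:
  assumes "has_weak_deriv f b f'" "has_weak_deriv g b g'" "b \<in> Basis"
  shows "has_weak_deriv (\<lambda>x. f x + g x) b (\<lambda>x. f' x + g' x)"
proof -
  note m = has_weak_deriv_L2[OF assms(1)] has_weak_deriv_L2[OF assms(2)]
  have "ip (\<lambda>x. f x + g x) \<zeta>' = - ip (\<lambda>x. f' x + g' x) \<zeta>" if z: "TF_deriv b \<zeta> \<zeta>'" for \<zeta> \<zeta>'
    using weak_deriv_ip_TF[OF assms(1) z assms(3)] weak_deriv_ip_TF[OF assms(2) z assms(3)]
    by (simp add: ip_add_left m TF_deriv_L2[OF z assms(3)])
  then show ?thesis using m assms(3) by (auto simp: has_weak_deriv_iff_TF)
qed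

lemma ip_cmult_left: "ip (\<lambda>x. c * f x) g = ip f (\<lambda>x. cnj c * g x)"
  by (simp add: ip_def inner_complex_def algebra_simps)

lemma TF_deriv_cmult:
  assumes "TF_deriv b \<zeta> \<zeta>'" shows "TF_deriv b (\<lambda>x. c * \<zeta> x) (\<lambda>x. c * \<zeta>' x)"
proof -
  obtain \<phi> \<eta> where *: "test_fun \<phi>" "test_fun \<eta>" "\<zeta> = (\<lambda>x. of_real (\<phi> x) + \<i> * of_real (\<eta> x))"
     "\<zeta>' = (\<lambda>x. of_real (frechet_derivative \<phi> (at x) b) + \<i> * of_real (frechet_derivative \<eta> (at x) b))"
    using assms by (auto simp: TF_deriv_def)
  have d: "frechet_derivative (\<lambda>x. r * \<phi> x + s * \<eta> x) (at x) b =
      r * frechet_derivative \<phi> (at x) b + s * frechet_derivative \<eta> (at x) b" for r s x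
  proof -
    have "((\<lambda>x. r * \<phi> x + s * \<eta> x) has_derivative
      (\<lambda>h. r * frechet_derivative \<phi> (at x) h + s * frechet_derivative \<eta> (at x) h)) (at x)"
      by (intro has_derivative_add has_derivative_mult_right test_fun_has_derivative *)
    from frechet_derivative_at[OF this] show ?thesis by metis
  qed
  have t: "test_fun (\<lambda>x. r * \<phi> x + s * \<eta> x)" for r s
    by (intro test_fun_add test_fun_cmult *)
  show ?thesis unfolding TF_deriv_def
    by (rule exI[of _ "\<lambda>x. Re c * \<phi> x + (- Im c) * \<eta> x"], rule exI[of _ "\<lambda>x. Im c * \<phi> x + Re c * \<eta> x"])
      (simp only: d t *(3,4), simp add: complex_eq_iff fun_eq_iff)
qed

lemma has_weak_deriv_cmult:
  assumes "has_weak_deriv f b f'" "b \<in> Basis"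
  shows "has_weak_deriv (\<lambda>x. c * f x) b (\<lambda>x. c * f' x)"
  using assms by (auto simp: has_weak_deriv_iff_TF ip_cmult_left dest: TF_deriv_cmult[where c="cnj c"])

lemma has_weak_deriv_diff:
  assumes "has_weak_deriv f b f'" "has_weak_deriv g b g'" "b \<in> Basis"
  shows "has_weak_deriv (\<lambda>x. f x - g x) b (\<lambda>x. f' x - g' x)"
  using has_weak_deriv_add[OF assms(1) has_weak_deriv_cmult[OF assms(2,3), of "-1"] assms(3)] by simp

lemma has_weak_deriv_AE:
  assumes "has_weak_deriv f b f'" "b \<in> Basis" "g \<in> L2" "g' \<in> L2" "AE x in lborel. f x = g x" "AE x in lborel. f' x = g' x"
  shows "has_weak_deriv g b g'"
proof -
  note m = has_weak_deriv_L2[OF assms(1)]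
  have "ip g \<zeta>' = - ip g' \<zeta>" if "TF_deriv b \<zeta> \<zeta>'" for \<zeta> \<zeta>'
    using weak_deriv_ip_TF[OF assms(1) that assms(2)] TF_deriv_L2[OF that assms(2)] m assms
      ip_cong_AE[of f \<zeta>' g \<zeta>'] ip_cong_AE[of f' \<zeta> g' \<zeta>] by auto
  then show ?thesis using assms by (auto simp: has_weak_deriv_iff_TF)
qed

lemma ip_translate': "ip (\<lambda>x. f (x + y)) g = ip f (\<lambda>x. g (x + - y))"
  using ip_translate[of f y "\<lambda>x. g (x + - y)"] by simp

lemma has_weak_deriv_translate:
  assumes "has_weak_deriv f b f'" "b \<in> Basis" shows "has_weak_deriv (\<lambda>x. f (x + y)) b (\<lambda>x. f' (x + y))"
  using assms TF_deriv_translate[of b _ _ "- y"]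
  by (auto simp: has_weak_deriv_iff_TF ip_translate' simp del: add_uminus_conv_diff)

lemma has_weak_deriv_diff_quot:
  assumes "has_weak_deriv f c f'" "c \<in> Basis" shows "has_weak_deriv (diff_quot b h f) c (diff_quot b h f')"
proof -
  have "has_weak_deriv (\<lambda>x. of_real (inverse h) * (f (x + h *\<^sub>R b) - f x)) c
    (\<lambda>x. of_real (inverse h) * (f' (x + h *\<^sub>R b) - f' x))"
    by (intro has_weak_deriv_cmult has_weak_deriv_diff has_weak_deriv_translate assms)
  then show ?thesis by (simp only: diff_quot_def[abs_def] scaleR_conv_of_real)
qed

lemma has_weak_deriv_conv:
  assumes "L2_conv F f sequentially" "L2_conv F' f' sequentially" "\<And>n. has_weak_deriv (F n) b (F' n)" "b \<in> Basis"
  shows "has_weak_deriv f b f'"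
proof -
  have "ip f \<zeta>' = - ip f' \<zeta>" if z: "TF_deriv b \<zeta> \<zeta>'" for \<zeta> \<zeta>'
  proof (rule LIMSEQ_unique)
    show "(\<lambda>n. ip (F n) \<zeta>') \<longlonglongrightarrow> ip f \<zeta>'"
      by (intro L2_conv_ip assms L2_conv_const TF_deriv_L2[OF z])
    have "(\<lambda>n. - ip (F' n) \<zeta>) \<longlonglongrightarrow> - ip f' \<zeta>"
      by (intro tendsto_minus L2_conv_ip assms L2_conv_const TF_deriv_L2[OF z])
    then show "(\<lambda>n. ip (F n) \<zeta>') \<longlonglongrightarrow> - ip f' \<zeta>"
      using weak_deriv_ip_TF[OF assms(3) z assms(4)] by simp
  qed
  then show ?thesis using assms(1,2,4) by (auto simp: has_weak_deriv_iff_TF L2_conv_def)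
qed

text \<open>Symmetry of second derivatives: the quotients of \<open>u\<close> in direction
  \<open>b\<close> tend to \<open>ub\<close>, while their derivatives along \<open>c\<close>, being
  quotients of \<open>uc\<close>, tend to \<open>ucb\<close>. Weak derivatives are closed under such
  limits.\<close>

lemma has_weak_deriv_commute:
  assumes "has_weak_deriv u b ub" "has_weak_deriv u c uc" "has_weak_deriv uc b ucb" "b \<in> Basis" "c \<in> Basis"
  shows "has_weak_deriv ub c ucb"
  by (rule has_weak_deriv_conv[OF weak_deriv_diff_quot_conv[OF assms(1,4) inverse_Suc_tendsto]
    weak_deriv_diff_quot_conv[OF assms(3,4) inverse_Suc_tendsto] has_weak_deriv_diff_quot[OF assms(2,5)] assms(5)])

lemma H1_weak_deriv: "f \<in> H1 \<Longrightarrow> b \<in> Basis \<Longrightarrow> has_weak_deriv f b (weak_deriv b f)"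
  using someI_ex[of "has_weak_deriv f b"] by (auto simp: H1_def weak_deriv_def)

lemma H1_L2: "f \<in> H1 \<Longrightarrow> f \<in> L2"
  by (simp add: H1_def)

definition has_dir_deriv :: "('a::euclidean_space \<Rightarrow> real) \<Rightarrow> 'a \<Rightarrow> ('a \<Rightarrow> real) \<Rightarrow> bool" where
  "has_dir_deriv p b p' \<longleftrightarrow> (\<forall>x. ((\<lambda>t. p (x + t *\<^sub>R b)) has_real_derivative p' x) (at 0))"

text \<open>The multipliers of the product rule. A bounded derivative along the single direction
  \<open>b\<close> makes \<open>p\<close> Lipschitz on lines parallel to \<open>b\<close>, which is
  what difference quotients in that direction see.\<close>

definition weight :: "('a::euclidean_space \<Rightarrow> real) \<Rightarrow> 'a \<Rightarrow> ('a \<Rightarrow> real) \<Rightarrow> bool" where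
  "weight p b p' \<longleftrightarrow> p \<in> borel_measurable borel \<and> (\<exists>C. \<forall>x. \<bar>p x\<bar> \<le> C \<and> \<bar>p' x\<bar> \<le> C) \<and> has_dir_deriv p b p'"

lemma weightI:
  assumes "p \<in> borel_measurable borel" "\<And>x. \<bar>p x\<bar> \<le> C" "\<And>x. \<bar>p' x\<bar> \<le> D"
    "\<And>x. ((\<lambda>t. p (x + t *\<^sub>R b)) has_real_derivative p' x) (at 0)"
  shows "weight p b p'"
  unfolding weight_def has_dir_deriv_def using assms
  by (auto intro!: exI[of _ "max C D"] simp: le_max_iff_disj)

lemma weight_const: "weight (\<lambda>x. c) b (\<lambda>x. 0)"
  by (rule weightI[where C="\<bar>c\<bar>" and D=0]) auto

lemma weightE:
  assumes "weight p b p'"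
  obtains C where "\<And>x. \<bar>p x\<bar> \<le> C" "\<And>x. \<bar>p' x\<bar> \<le> C"
    "\<And>x h. \<bar>p (x + h *\<^sub>R b) - p x\<bar> \<le> C * \<bar>h\<bar>" "0 \<le> C" "p \<in> borel_measurable borel" "p' \<in> borel_measurable borel"
    "\<And>x h. h \<longlonglongrightarrow> 0 \<Longrightarrow> (\<And>n. h n \<noteq> 0) \<Longrightarrow> (\<lambda>n. (p (x + h n *\<^sub>R b) - p x) / h n) \<longlonglongrightarrow> p' x"
proof -
  obtain C where C: "\<And>x. \<bar>p x\<bar> \<le> C" "\<And>x. \<bar>p' x\<bar> \<le> C"
    using assms by (auto simp: weight_def)
  have m: "p \<in> borel_measurable borel" using assms by (auto simp: weight_def)
  have D0: "((\<lambda>t. p (x + t *\<^sub>R b)) has_real_derivative p' x) (at 0)" for x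
    using assms by (auto simp: weight_def has_dir_deriv_def)
  have D: "((\<lambda>t. p (x + t *\<^sub>R b)) has_real_derivative p' (x + t *\<^sub>R b)) (at t)" for x t
    using D0[of "x + t *\<^sub>R b"] DERIV_at_within_shift[of "\<lambda>s. p (x + s *\<^sub>R b)" "p' (x + t *\<^sub>R b)" t 0 UNIV]
    by (simp add: algebra_simps)
  have bd: "\<bar>p (x + h *\<^sub>R b) - p x\<bar> \<le> C * \<bar>h\<bar>" for x h
  proof -
    let ?g = "\<lambda>t. p (x + t *\<^sub>R b)"
    have "norm (?g h - ?g 0) \<le> C * norm (h - 0)"
      by (rule field_differentiable_bound[of UNIV ?g, OF _ D]) (use C in auto)
    then show ?thesis by simp
  qed
  have lim: "(\<lambda>n. (p (x + h n *\<^sub>R b) - p x) / h n) \<longlonglongrightarrow> p' x" if h: "h \<longlonglongrightarrow> 0" "\<And>n. h n \<noteq> 0" for x h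
  proof -
    have "((\<lambda>t. (p (x + t *\<^sub>R b) - p x) / t) \<longlongrightarrow> p' x) (at 0)" using D0[of x] by (simp add: DERIV_def)
    moreover have "filterlim h (at 0) sequentially" using h by (simp add: filterlim_at)
    ultimately show ?thesis by (rule filterlim_compose)
  qed
  have "p' \<in> borel_measurable borel"
  proof (rule borel_measurable_LIMSEQ_real)
    show "(\<lambda>n. (p (x + inverse (real (Suc n)) *\<^sub>R b) - p x) / inverse (real (Suc n))) \<longlonglongrightarrow> p' x" for x
      by (rule lim[OF inverse_Suc_tendsto])
    show "(\<lambda>x. (p (x + inverse (real (Suc i)) *\<^sub>R b) - p x) / inverse (real (Suc i))) \<in> borel_measurable borel" for i
      using m by measurable
  qed
  then show ?thesis using that C bd lim m order_trans[OF abs_ge_zero C(1)] by blast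
qed

text \<open>Translating the integral turns the forward quotient of \<open>p\<close> against a
  shifted \<open>F\<close> into the backward quotient against \<open>F\<close> itself, to which
  dominated convergence with \<open>C * \<bar>F x\<bar>\<close> applies.\<close>

lemma weight_diff_conv:
  assumes "weight p b p'" "integrable lborel F"
  shows "(\<lambda>n. LINT x|lborel. (p (x + inverse (real (Suc n)) *\<^sub>R b) - p x) / inverse (real (Suc n)) * F (x + inverse (real (Suc n)) *\<^sub>R b))
    \<longlonglongrightarrow> (LINT x|lborel. p' x * F x)"
proof -
  let ?h = "\<lambda>n. inverse (real (Suc n))"
  obtain C where C: "\<And>x. \<bar>p x\<bar> \<le> C" "\<And>x. \<bar>p' x\<bar> \<le> C"
    "\<And>x h. \<bar>p (x + h *\<^sub>R b) - p x\<bar> \<le> C * \<bar>h\<bar>" "0 \<le> C" "p \<in> borel_measurable borel" "p' \<in> borel_measurable borel"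
    "\<And>x h. h \<longlonglongrightarrow> 0 \<Longrightarrow> (\<And>n. h n \<noteq> 0) \<Longrightarrow> (\<lambda>n. (p (x + h n *\<^sub>R b) - p x) / h n) \<longlonglongrightarrow> p' x"
    using weightE[OF assms(1)] by blast
  note [measurable] = C(5,6) borel_measurable_integrable[OF assms(2), simplified]
  have "(\<lambda>n. LINT x|lborel. (p (x + - ?h n *\<^sub>R b) - p x) / (- ?h n) * F x) \<longlonglongrightarrow> (LINT x|lborel. p' x * F x)"
  proof (rule integral_dominated_convergence)
    show "integrable lborel (\<lambda>x. C * \<bar>F x\<bar>)" using assms(2) by simp
    show "AE x in lborel. (\<lambda>n. (p (x + - ?h n *\<^sub>R b) - p x) / (- ?h n) * F x) \<longlonglongrightarrow> p' x * F x"
    proof (rule AE_I2)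
      fix x
      have "(\<lambda>n. - ?h n) \<longlonglongrightarrow> - 0" by (intro tendsto_minus inverse_Suc_tendsto)
      then show "(\<lambda>n. (p (x + - ?h n *\<^sub>R b) - p x) / (- ?h n) * F x) \<longlonglongrightarrow> p' x * F x"
        by (intro tendsto_mult_right C(7)) (simp, metis inverse_Suc_tendsto(2) neg_equal_0_iff_equal)
    qed
    show "AE x in lborel. norm ((p (x + - ?h i *\<^sub>R b) - p x) / (- ?h i) * F x) \<le> C * \<bar>F x\<bar>" for i
    proof (rule AE_I2)
      fix x
      have "\<bar>(p (x + - ?h i *\<^sub>R b) - p x) / (- ?h i)\<bar> \<le> C"
        using C(3)[of x "- ?h i"] by (simp add: abs_divide divide_le_eq del: of_nat_Suc)
      then show "norm ((p (x + - ?h i *\<^sub>R b) - p x) / (- ?h i) * F x) \<le> C * \<bar>F x\<bar>"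
        unfolding real_norm_def abs_mult by (intro mult_right_mono) auto
    qed
  qed measurable
  also have "(\<lambda>n. LINT x|lborel. (p (x + - ?h n *\<^sub>R b) - p x) / (- ?h n) * F x) =
    (\<lambda>n. LINT x|lborel. (p (x + ?h n *\<^sub>R b) - p x) / ?h n * F (x + ?h n *\<^sub>R b))"
  proof
    fix n
    show "(LINT x|lborel. (p (x + - ?h n *\<^sub>R b) - p x) / (- ?h n) * F x) =
      (LINT x|lborel. (p (x + ?h n *\<^sub>R b) - p x) / ?h n * F (x + ?h n *\<^sub>R b))"
      by (subst lborel_integral_translate[of _ "?h n *\<^sub>R b", symmetric])
        (simp add: divide_inverse algebra_simps del: of_nat_Suc)
  qed
  finally show ?thesis .
qed

text \<open>Before the limit the product rule is exact: the three quotient terms add up to the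
  quotient of \<open>p x * (f x \<bullet> g x)\<close>, whose integral is zero by translation
  invariance. Each term then converges separately.\<close>

theorem weak_Leibniz:
  assumes p: "weight p b p'" and f: "has_weak_deriv f b f'" and g: "has_weak_deriv g b g'" and b: "b \<in> Basis"
  shows "ip (\<lambda>x. p x *\<^sub>R f' x) g + ip (\<lambda>x. p x *\<^sub>R f x) g' + ip (\<lambda>x. p' x *\<^sub>R f x) g = 0"
proof -
  let ?h = "\<lambda>n. inverse (real (Suc n))"
  obtain C where C: "\<And>x. \<bar>p x\<bar> \<le> C" "\<And>x. \<bar>p' x\<bar> \<le> C"
"\<And>x h. \<bar>p (x + h *\<^sub>R b) - p x\<bar> \<le> C * \<bar>h\<bar>" "p \<in> borel_measurable borel" "0 \<le> C"
    using weightE[OF p] by metis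
  note L = has_weak_deriv_L2[OF f] has_weak_deriv_L2[OF g]
  have fg: "integrable lborel (\<lambda>x. f x \<bullet> g x)" by (rule integrable_ip[OF L(1,3)])
  note [measurable] = C(4) L2_measurable[OF L(1)] L2_measurable[OF L(3)]
  have F: "integrable lborel (\<lambda>x. p x * (f x \<bullet> g x))"
    using integrable_ip(1)[OF L2_scaleR_bounded[OF L(1) C(4,1)] L(3)] by simp
  let ?A = "\<lambda>n. LINT x|lborel. (p (x + ?h n *\<^sub>R b) - p x) / ?h n * (f (x + ?h n *\<^sub>R b) \<bullet> g (x + ?h n *\<^sub>R b))"
  let ?B = "\<lambda>n. ip (\<lambda>x. p x *\<^sub>R diff_quot b (?h n) f x) (\<lambda>x. g (x + ?h n *\<^sub>R b))"
  let ?C = "\<lambda>n. ip (\<lambda>x. p x *\<^sub>R f x) (diff_quot b (?h n) g)"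
  have sum0: "?B n + ?C n + ?A n = 0" for n
  proof -
    have iA: "integrable lborel (\<lambda>x. (p (x + ?h n *\<^sub>R b) - p x) / ?h n * (f (x + ?h n *\<^sub>R b) \<bullet> g (x + ?h n *\<^sub>R b)))"
    proof (rule Bochner_Integration.integrable_bound)
      show "integrable lborel (\<lambda>x. C * (f (x + ?h n *\<^sub>R b) \<bullet> g (x + ?h n *\<^sub>R b)))"
        using lborel_integrable_translate[OF fg, of "?h n *\<^sub>R b"] by simp
      show "AE x in lborel. norm ((p (x + ?h n *\<^sub>R b) - p x) / ?h n * (f (x + ?h n *\<^sub>R b) \<bullet> g (x + ?h n *\<^sub>R b)))
        \<le> norm (C * (f (x + ?h n *\<^sub>R b) \<bullet> g (x + ?h n *\<^sub>R b)))"
      proof (rule AE_I2)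
        fix x
        have "\<bar>(p (x + ?h n *\<^sub>R b) - p x) / ?h n\<bar> \<le> \<bar>C\<bar>"
          using C(3)[of x "?h n"] C(5) by (simp add: abs_divide divide_le_eq del: of_nat_Suc)
        then show "norm ((p (x + ?h n *\<^sub>R b) - p x) / ?h n * (f (x + ?h n *\<^sub>R b) \<bullet> g (x + ?h n *\<^sub>R b)))
          \<le> norm (C * (f (x + ?h n *\<^sub>R b) \<bullet> g (x + ?h n *\<^sub>R b)))"
          unfolding real_norm_def abs_mult by (intro mult_right_mono) auto
      qed
    qed measurable
    have iB: "integrable lborel (\<lambda>x. (p x *\<^sub>R diff_quot b (?h n) f x) \<bullet> g (x + ?h n *\<^sub>R b))"
      by (intro integrable_ip L2_scaleR_bounded[where p=p and C=C, OF _ C(4) C(1)] diff_quot_L2 L L2_translate)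
    have iC: "integrable lborel (\<lambda>x. (p x *\<^sub>R f x) \<bullet> diff_quot b (?h n) g x)"
      by (intro integrable_ip L2_scaleR_bounded[where p=p and C=C, OF _ C(4) C(1)] diff_quot_L2 L L2_translate)
    have "?B n + ?C n + ?A n = (LINT x|lborel. (p x *\<^sub>R diff_quot b (?h n) f x) \<bullet> g (x + ?h n *\<^sub>R b) +
       (p x *\<^sub>R f x) \<bullet> diff_quot b (?h n) g x + (p (x + ?h n *\<^sub>R b) - p x) / ?h n * (f (x + ?h n *\<^sub>R b) \<bullet> g (x + ?h n *\<^sub>R b)))"
      unfolding ip_def using iA iB iC by simp
    also have "\<dots> = (LINT x|lborel. (p (x + ?h n *\<^sub>R b) * (f (x + ?h n *\<^sub>R b) \<bullet> g (x + ?h n *\<^sub>R b)) -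
        p x * (f x \<bullet> g x)) / ?h n)"
      by (rule Bochner_Integration.integral_cong)
        (auto simp: diff_quot_def divide_inverse algebra_simps inner_diff_left inner_diff_right simp del: of_nat_Suc)
    also have "\<dots> = 0"
      using F lborel_integrable_translate[OF F, of "?h n *\<^sub>R b"]
        lborel_integral_translate[of "\<lambda>x. p x * (f x \<bullet> g x)" "?h n *\<^sub>R b"] by simp
    finally show ?thesis .
  qed
  have pf: "(\<lambda>x. p x *\<^sub>R f x) \<in> L2"
    by (rule L2_scaleR_bounded[where C=C]) (use L C in auto)
  note pc = L2_conv_scaleR_bounded[where p=p and C=C, OF _ C(4) C(1)]
  have "(\<lambda>n. ?B n + ?C n + ?A n) \<longlonglongrightarrow>
    ip (\<lambda>x. p x *\<^sub>R f' x) g + ip (\<lambda>x. p x *\<^sub>R f x) g' + (LINT x|lborel. p' x * (f x \<bullet> g x))"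
  proof (intro tendsto_add L2_conv_ip L2_conv_const pc weak_deriv_diff_quot_conv f g b inverse_Suc_tendsto
      weight_diff_conv p fg pf L L2_translation_conv)
    have "(\<lambda>n. ?h n *\<^sub>R b) \<longlonglongrightarrow> 0 *\<^sub>R b" by (intro tendsto_intros inverse_Suc_tendsto)
    then show "(\<lambda>n. ?h n *\<^sub>R b) \<longlonglongrightarrow> 0" by simp
  qed
  then have "(\<lambda>n. 0) \<longlonglongrightarrow>
    ip (\<lambda>x. p x *\<^sub>R f' x) g + ip (\<lambda>x. p x *\<^sub>R f x) g' + (LINT x|lborel. p' x * (f x \<bullet> g x))"
    unfolding sum0 .
  from LIMSEQ_unique[OF this tendsto_const] show ?thesis by (simp add: ip_def)
qed

corollary weak_integration_by_parts:
  assumes "has_weak_deriv f b f'" "has_weak_deriv g b g'" "b \<in> Basis" shows "ip f' g = - ip f g'"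
  using weak_Leibniz[OF weight_const[of 1] assms] by (simp add: ip_def)

section \<open>The nonlinearity and its potential\<close>

definition nl :: "real \<Rightarrow> complex \<Rightarrow> complex" where
  "nl \<alpha> z = of_real (cmod z powr \<alpha>) * z"

lemma nl_inner: "0 < \<alpha> \<Longrightarrow> nl \<alpha> z \<bullet> z = cmod z powr (\<alpha> + 2)"
  by (cases "z = 0") (auto simp: nl_def powr_add power2_norm_eq_inner[symmetric] scaleR_conv_of_real[symmetric])

text \<open>The graph of the convex function r^q lies above its tangent at \<open>s\<close>.
  Arguments equal to 0 are split off because the derivative of \<open>powr\<close> is used at
  positive points.\<close>

lemma powr_gap_lower:
  assumes "1 \<le> q" "0 \<le> r" "0 \<le> s" shows "q * s powr (q - 1) * (r - s) \<le> r powr q - s powr (q::real)"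
proof (cases "s = 0")
  case True then show ?thesis using assms by simp
next
  case False
  then have s: "0 < s" using assms by simp
  have sq: "s powr (q - 1) * s = s powr q" using s by (simp add: powr_diff)
  show ?thesis
  proof (cases "r = 0")
    case True
    have "s powr q \<le> q * s powr q" using mult_right_mono[of 1 q "s powr q"] assms by simp
    then show ?thesis using True sq assms by (simp add: mult.assoc)
  next
    case False
    then have r: "0 < r" using assms by simp
    have D: "((\<lambda>x. x powr q) has_real_derivative q * x powr (q - 1)) (at x)" if "0 < x" for x
      using that by (auto intro!: derivative_eq_intros)
    consider "r = s" | "r < s" | "s < r" by linarith
    then show ?thesis
    proof cases
      case 1 then show ?thesis by simp
    next
      case 2
      then obtain z where z: "r < z" "z < s" "s powr q - r powr q = (s - r) * (q * z powr (q - 1))"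
        using MVT2[of r s "\<lambda>x. x powr q" "\<lambda>x. q * x powr (q - 1)"] D r by auto
      have "(s - r) * (q * z powr (q - 1)) \<le> (s - r) * (q * s powr (q - 1))"
        using z r assms by (intro mult_left_mono powr_mono2) auto
      then show ?thesis using z by (simp add: algebra_simps)
    next
      case 3
      then obtain z where z: "s < z" "z < r" "r powr q - s powr q = (r - s) * (q * z powr (q - 1))"
        using MVT2[of s r "\<lambda>x. x powr q" "\<lambda>x. q * x powr (q - 1)"] D s by auto
      have "(r - s) * (q * s powr (q - 1)) \<le> (r - s) * (q * z powr (q - 1))"
        using z s assms by (intro mult_left_mono powr_mono2) auto
      then show ?thesis using z by (simp add: algebra_simps)
    qed
  qed
qed

lemma nl_lipschitz:
  assumes a: "0 < \<alpha>" and "cmod z \<le> B" "cmod w \<le> B"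
  shows "cmod (nl \<alpha> z - nl \<alpha> w) \<le> (1 + \<alpha>) * B powr \<alpha> * cmod (z - w)"
proof -
  have key: "cmod (nl \<alpha> z - nl \<alpha> w) \<le> (1 + \<alpha>) * B powr \<alpha> * cmod (z - w)"
    if z: "cmod z \<le> B" and le: "cmod w \<le> cmod z" for z w
  proof -
    have zB: "cmod z powr \<alpha> \<le> B powr \<alpha>" using a z by (intro powr_mono2) auto
    have "nl \<alpha> z - nl \<alpha> w = of_real (cmod z powr \<alpha>) * (z - w) + of_real (cmod z powr \<alpha> - cmod w powr \<alpha>) * w"
      by (simp add: nl_def algebra_simps)
    then have "cmod (nl \<alpha> z - nl \<alpha> w) \<le> cmod z powr \<alpha> * cmod (z - w) + \<bar>cmod z powr \<alpha> - cmod w powr \<alpha>\<bar> * cmod w"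
      using norm_triangle_ineq by (metis norm_mult norm_of_real abs_of_nonneg powr_ge_zero)
    moreover have "cmod z powr \<alpha> * cmod (z - w) \<le> B powr \<alpha> * cmod (z - w)"
      using zB by (intro mult_right_mono) auto
    moreover have "\<bar>cmod z powr \<alpha> - cmod w powr \<alpha>\<bar> * cmod w \<le> \<alpha> * B powr \<alpha> * cmod (z - w)"
    proof (cases "cmod w = 0 \<or> cmod w = cmod z")
      case True then show ?thesis using a by auto
    next
      case False
      then have w: "0 < cmod w" "cmod w < cmod z" using le by auto
      have D: "((\<lambda>x. x powr \<alpha>) has_real_derivative \<alpha> * x powr (\<alpha> - 1)) (at x)" if "0 < x" for x
        using that by (auto intro!: derivative_eq_intros)
      obtain t where t: "cmod w < t" "t < cmod z" "cmod z powr \<alpha> - cmod w powr \<alpha> = (cmod z - cmod w) * (\<alpha> * t powr (\<alpha> - 1))"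
        using MVT2[OF w(2), of "\<lambda>x. x powr \<alpha>" "\<lambda>x. \<alpha> * x powr (\<alpha> - 1)"] D w by auto
      \<comment> \<open>\<alpha> may be below 1, and then t^(\<alpha> - 1) is unbounded near 0; the
        factor |w| <= t compensates for this.\<close>
      have "(\<alpha> * t powr (\<alpha> - 1)) * cmod w \<le> (\<alpha> * t powr (\<alpha> - 1)) * t"
        using t a by (intro mult_left_mono) auto
      also have "\<dots> = \<alpha> * t powr \<alpha>" using order.strict_trans[OF w(1) t(1)] by (simp add: powr_diff)
      also have "\<dots> \<le> \<alpha> * B powr \<alpha>" using t(2) z a
        by (intro mult_left_mono powr_mono2 less_imp_le[OF order.strict_trans[OF w(1) t(1)]]) linarith+
      finally have 1: "(\<alpha> * t powr (\<alpha> - 1)) * cmod w \<le> \<alpha> * B powr \<alpha>" .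
      have "\<bar>cmod z powr \<alpha> - cmod w powr \<alpha>\<bar> * cmod w = (cmod z - cmod w) * ((\<alpha> * t powr (\<alpha> - 1)) * cmod w)"
        using t w a by (simp add: abs_mult)
      also have "\<dots> \<le> cmod (z - w) * (\<alpha> * B powr \<alpha>)"
        by (rule mult_mono[OF norm_triangle_ineq2 1]) (use a in auto)
      finally show ?thesis by (simp add: mult_ac)
    qed
    ultimately show ?thesis by (simp add: algebra_simps)
  qed
  show ?thesis
  proof (cases "cmod w \<le> cmod z")
    case False
    then show ?thesis using key[of w z] assms by (simp add: norm_minus_commute)
  qed (use key assms in auto)
qed

lemma powr_norm_gap_lower:
  assumes a: "0 < \<alpha>"
  shows "(\<alpha> + 2) * (nl \<alpha> w \<bullet> (z - w)) \<le> cmod z powr (\<alpha> + 2) - cmod w powr (\<alpha> + 2)"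
proof -
  have "nl \<alpha> w \<bullet> (z - w) = cmod w powr \<alpha> * (w \<bullet> z - cmod w * cmod w)"
    by (simp add: nl_def scaleR_conv_of_real[symmetric] inner_diff_right power2_norm_eq_inner[symmetric] power2_eq_square right_diff_distrib)
  also have "\<dots> \<le> cmod w powr \<alpha> * (cmod w * cmod z - cmod w * cmod w)"
    using norm_cauchy_schwarz[of w z] by (intro mult_left_mono) auto
  also have "\<dots> = cmod w powr (\<alpha> + 2 - 1) * (cmod z - cmod w)"
    by (cases "w = 0") (auto simp: powr_add algebra_simps)
  finally have "(\<alpha> + 2) * (nl \<alpha> w \<bullet> (z - w)) \<le> (\<alpha> + 2) * (cmod w powr (\<alpha> + 2 - 1) * (cmod z - cmod w))"
    using a by (intro mult_left_mono) auto
  also have "\<dots> \<le> cmod z powr (\<alpha> + 2) - cmod w powr (\<alpha> + 2)"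
    using powr_gap_lower[of "\<alpha> + 2" "cmod z" "cmod w"] a by (simp add: mult.assoc)
  finally show ?thesis .
qed

text \<open>Convexity at both endpoints traps the first order remainder between 0 and (\<alpha> + 2)
  times the pairing of nl(z) - nl(w) with z - w. The Lipschitz bound makes the latter
  quadratic.\<close>

lemma powr_norm_gap:
  assumes a: "0 < \<alpha>" and "cmod z \<le> B" "cmod w \<le> B"
  shows "\<bar>cmod z powr (\<alpha> + 2) - cmod w powr (\<alpha> + 2) - (\<alpha> + 2) * (nl \<alpha> w \<bullet> (z - w))\<bar>
    \<le> (\<alpha> + 2) * ((1 + \<alpha>) * B powr \<alpha>) * (cmod (z - w))\<^sup>2"
proof -
  have "(nl \<alpha> z - nl \<alpha> w) \<bullet> (z - w) \<le> cmod (nl \<alpha> z - nl \<alpha> w) * cmod (z - w)"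
    by (rule norm_cauchy_schwarz)
  also have "\<dots> \<le> ((1 + \<alpha>) * B powr \<alpha> * cmod (z - w)) * cmod (z - w)"
    by (intro mult_right_mono nl_lipschitz assms) auto
  finally have "(\<alpha> + 2) * ((nl \<alpha> z - nl \<alpha> w) \<bullet> (z - w)) \<le> (\<alpha> + 2) * (((1 + \<alpha>) * B powr \<alpha> * cmod (z - w)) * cmod (z - w))"
    using a by (intro mult_left_mono) auto
  moreover have "(\<alpha> + 2) * (nl \<alpha> z \<bullet> (w - z)) = - ((\<alpha> + 2) * (nl \<alpha> z \<bullet> (z - w)))"
    by (simp add: inner_diff_right algebra_simps)
  ultimately show ?thesis
    using powr_norm_gap_lower[OF a, of w z] powr_norm_gap_lower[OF a, of z w]
    by (simp add: inner_diff_left algebra_simps power2_eq_square)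
qed

lemma nl_measurable [measurable]: "nl \<alpha> \<in> borel_measurable borel"
  unfolding nl_def by measurable

lemma nl_bound: "0 < \<alpha> \<Longrightarrow> cmod z \<le> B \<Longrightarrow> cmod (nl \<alpha> z) \<le> B powr \<alpha> * cmod z"
  by (auto simp: nl_def norm_mult intro!: mult_right_mono powr_mono2)

lemma nl_L2:
  assumes "0 < \<alpha>" "u \<in> L2" "\<And>x. cmod (u x) \<le> B" shows "(\<lambda>x. nl \<alpha> (u x)) \<in> L2"
  using assms L2_measurable[OF assms(2)]
  by (intro L2_bound[OF assms(2), where C="B powr \<alpha>"]) (auto intro!: nl_bound)

lemma integrable_powr_norm:
  assumes "0 < \<alpha>" "u \<in> L2" "\<And>x. cmod (u x) \<le> B" shows "integrable lborel (\<lambda>x. cmod (u x) powr (\<alpha> + 2))"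
  using integrable_ip(1)[OF nl_L2[OF assms] assms(2)] assms(1) by (simp add: nl_inner)

text \<open>A chain rule integrated against a weight. Translation invariance moves the quotient from
  the weight to |u|^(\<alpha>+2); replacing that quotient by its first order expansion costs a
  multiple of h times the squared norm of the quotient of \<open>u\<close>, which tends to
  0.\<close>

theorem weak_deriv_powr:
  assumes p: "weight p b p'" and u: "has_weak_deriv u b u'" and b: "b \<in> Basis"
    and a: "0 < \<alpha>" and B: "\<And>x. cmod (u x) \<le> B"
  shows "(LINT x|lborel. p' x * cmod (u x) powr (\<alpha> + 2)) = - (\<alpha> + 2) * ip (\<lambda>x. p x *\<^sub>R nl \<alpha> (u x)) u'"
proof -
  let ?h = "\<lambda>n. inverse (real (Suc n))"
  let ?F = "\<lambda>x. cmod (u x) powr (\<alpha> + 2)"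
  obtain C where C: "\<And>x. \<bar>p x\<bar> \<le> C" "\<And>x. \<bar>p' x\<bar> \<le> C"
    "\<And>x h. \<bar>p (x + h *\<^sub>R b) - p x\<bar> \<le> C * \<bar>h\<bar>" "p \<in> borel_measurable borel" "0 \<le> C"
    using weightE[OF p] by metis
  note L = has_weak_deriv_L2[OF u]
  note N = nl_L2[OF a L(1) B]
  have F: "integrable lborel ?F" by (rule integrable_powr_norm[OF a L(1) B])
  note [measurable] = C(4) L2_measurable[OF L(1)] L2_measurable[OF N]
  have pF: "integrable lborel (\<lambda>x. p x * F x)" if "integrable lborel F" for F :: "'a \<Rightarrow> real"
  proof (rule Bochner_Integration.integrable_bound)
    show "integrable lborel (\<lambda>x. C * F x)" using that by simp
    show "AE x in lborel. norm (p x * F x) \<le> norm (C * F x)"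
      using C(1,5) by (auto simp: abs_mult intro!: mult_right_mono)
  qed (use borel_measurable_integrable[OF that] in measurable)
  let ?A = "\<lambda>n. LINT x|lborel. (p (x + ?h n *\<^sub>R b) - p x) / ?h n * ?F (x + ?h n *\<^sub>R b)"
  let ?D = "\<lambda>n. LINT x|lborel. p x * ((?F (x + ?h n *\<^sub>R b) - ?F x) / ?h n)"
  let ?I = "\<lambda>n. (\<alpha> + 2) * ip (\<lambda>x. p x *\<^sub>R nl \<alpha> (u x)) (diff_quot b (?h n) u)"
  define L where "L = (\<alpha> + 2) * ((1 + \<alpha>) * B powr \<alpha>)"
  have iF: "integrable lborel (\<lambda>x. (?F (x + ?h n *\<^sub>R b) - ?F x) / ?h n)" for n
    using F lborel_integrable_translate[OF F, of "?h n *\<^sub>R b"] by simp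
  have A: "?A n = - ?D n" for n
  proof -
    have "?A n = (LINT x|lborel. (p (x + ?h n *\<^sub>R b) * ?F (x + ?h n *\<^sub>R b) - p x * ?F x) / ?h n - p x * ((?F (x + ?h n *\<^sub>R b) - ?F x) / ?h n))"
      by (rule Bochner_Integration.integral_cong) (auto simp: divide_inverse algebra_simps simp del: of_nat_Suc)
    also have "\<dots> = - ?D n"
      using pF[OF F] lborel_integrable_translate[OF pF[OF F], of "?h n *\<^sub>R b"] pF[OF iF[of n]]
        lborel_integral_translate[of "\<lambda>x. p x * ?F x" "?h n *\<^sub>R b"] by simp
    finally show ?thesis .
  qed
  have err: "\<bar>?D n - ?I n\<bar> \<le> C * L * ?h n * (L2_norm (diff_quot b (?h n) u))\<^sup>2" for n
  proof -
    have i1: "integrable lborel (\<lambda>x. (p x *\<^sub>R nl \<alpha> (u x)) \<bullet> diff_quot b (?h n) u x)"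
      by (intro integrable_ip L2_scaleR_bounded[where p=p and C=C, OF _ C(4) C(1)] N diff_quot_L2 \<open>u \<in> L2\<close>)
    have "\<bar>?D n - ?I n\<bar> = \<bar>LINT x|lborel. p x * ((?F (x + ?h n *\<^sub>R b) - ?F x) / ?h n) - (\<alpha> + 2) * ((p x *\<^sub>R nl \<alpha> (u x)) \<bullet> diff_quot b (?h n) u x)\<bar>"
      unfolding ip_def using i1 pF[OF iF[of n]] by simp
    also have "\<dots> \<le> (LINT x|lborel. \<bar>p x * ((?F (x + ?h n *\<^sub>R b) - ?F x) / ?h n) - (\<alpha> + 2) * ((p x *\<^sub>R nl \<alpha> (u x)) \<bullet> diff_quot b (?h n) u x)\<bar>)"
      by (rule integral_abs_bound)
    also have "\<dots> \<le> (LINT x|lborel. C * L * ?h n * (cmod (diff_quot b (?h n) u x))\<^sup>2)"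
    proof (rule integral_mono)
      show "integrable lborel (\<lambda>x. \<bar>p x * ((?F (x + ?h n *\<^sub>R b) - ?F x) / ?h n) - (\<alpha> + 2) * ((p x *\<^sub>R nl \<alpha> (u x)) \<bullet> diff_quot b (?h n) u x)\<bar>)"
        using i1 pF[OF iF[of n]] by simp
      show "integrable lborel (\<lambda>x. C * L * ?h n * (cmod (diff_quot b (?h n) u x))\<^sup>2)"
        using L2_integrable[OF diff_quot_L2[OF \<open>u \<in> L2\<close>]] by simp
      fix x
      let ?d = "u (x + ?h n *\<^sub>R b) - u x"
      have h: "0 < ?h n" by simp
      have d: "diff_quot b (?h n) u x = ?d /\<^sub>R ?h n" by (simp add: diff_quot_def)
      have "p x * ((?F (x + ?h n *\<^sub>R b) - ?F x) / ?h n) - (\<alpha> + 2) * ((p x *\<^sub>R nl \<alpha> (u x)) \<bullet> diff_quot b (?h n) u x)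
        = p x * ((?F (x + ?h n *\<^sub>R b) - ?F x - (\<alpha> + 2) * (nl \<alpha> (u x) \<bullet> ?d)) / ?h n)"
        unfolding d by (simp add: divide_inverse algebra_simps del: of_nat_Suc)
      also have "\<bar>\<dots>\<bar> \<le> C * (L * (cmod ?d)\<^sup>2 / ?h n)"
        unfolding abs_mult abs_divide using C(1)[of x] C(5) powr_norm_gap[OF a B B, of "x + ?h n *\<^sub>R b" x] h
        by (intro mult_mono divide_mono) (auto simp: L_def simp del: of_nat_Suc)
      also have "\<dots> = C * L * ?h n * (cmod (diff_quot b (?h n) u x))\<^sup>2"
      proof -
        have "cmod (diff_quot b (?h n) u x) = cmod ?d / ?h n" unfolding d by (simp add: divide_inverse mult.commute)
        moreover have "C * (L * D\<^sup>2 / h) = C * L * h * (D / h)\<^sup>2" if "0 < h" for D h :: real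
          using that by (simp add: power2_eq_square field_simps)
        ultimately show ?thesis using h by metis
      qed
      finally show "\<bar>p x * ((?F (x + ?h n *\<^sub>R b) - ?F x) / ?h n) - (\<alpha> + 2) * ((p x *\<^sub>R nl \<alpha> (u x)) \<bullet> diff_quot b (?h n) u x)\<bar>
        \<le> C * L * ?h n * (cmod (diff_quot b (?h n) u x))\<^sup>2" .
    qed
    also have "\<dots> = C * L * ?h n * (L2_norm (diff_quot b (?h n) u))\<^sup>2"
      by (simp add: L2_norm_def del: of_nat_Suc)
    finally show ?thesis .
  qed
  note dqc = weak_deriv_diff_quot_conv[OF u b inverse_Suc_tendsto]
  have "(\<lambda>n. C * L * ?h n * (L2_norm (diff_quot b (?h n) u))\<^sup>2) \<longlonglongrightarrow> C * L * 0 * (L2_norm u')\<^sup>2"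
    by (intro tendsto_mult tendsto_power tendsto_const inverse_Suc_tendsto L2_conv_norm dqc)
  then have DI: "(\<lambda>n. ?D n - ?I n) \<longlonglongrightarrow> 0"
    by (rule tendsto_0_le_eventually[where Q="\<lambda>_. True"]) (use err in auto)
  have pN: "(\<lambda>x. p x *\<^sub>R nl \<alpha> (u x)) \<in> L2"
    by (rule L2_scaleR_bounded[where C=C]) (use N C in auto)
  have "?I \<longlonglongrightarrow> (\<alpha> + 2) * ip (\<lambda>x. p x *\<^sub>R nl \<alpha> (u x)) u'"
    by (intro tendsto_mult tendsto_const L2_conv_ip L2_conv_const dqc pN)
  with DI have "(\<lambda>n. - ((?D n - ?I n) + ?I n)) \<longlonglongrightarrow> - (0 + (\<alpha> + 2) * ip (\<lambda>x. p x *\<^sub>R nl \<alpha> (u x)) u')"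
    by (intro tendsto_minus tendsto_add)
  then have "?A \<longlonglongrightarrow> - ((\<alpha> + 2) * ip (\<lambda>x. p x *\<^sub>R nl \<alpha> (u x)) u')"
    by (simp only: A diff_add_cancel add_0)
  from LIMSEQ_unique[OF weight_diff_conv[OF p F] this] show ?thesis by (simp only: mult_minus_left)
qed

section \<open>Reflections\<close>

lemma nn_integral_lborel_translate:
  fixes f :: "'a::euclidean_space \<Rightarrow> ennreal"
  assumes [measurable]: "f \<in> borel_measurable borel"
  shows "(\<integral>\<^sup>+x. f (x + y) \<partial>lborel) = (\<integral>\<^sup>+x. f x \<partial>lborel)"
proof -
  have "(\<integral>\<^sup>+x. f x \<partial>lborel) = (\<integral>\<^sup>+x. f x \<partial>distr lborel borel ((+) y))" by (simp add: lborel_distr_plus)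
  also have "\<dots> = (\<integral>\<^sup>+x. f (y + x) \<partial>lborel)" by (subst nn_integral_distr) auto
  finally show ?thesis by (simp add: add.commute)
qed

text \<open>An involution that is symmetric for the inner product is an isometry. Symmetry and
  involutivity are also what allows moving \<open>S\<close> from one factor of \<open>ip\<close> to
  the other.\<close>

locale reflection =
  fixes S :: "'a::euclidean_space \<Rightarrow> 'a"
  assumes lin: "linear S" and invol [simp]: "S (S x) = x" and sym: "S x \<bullet> y = x \<bullet> S y"
begin

lemma inner_S: "S x \<bullet> S y = x \<bullet> y"
  by (simp add: sym)

lemma norm_S [simp]: "norm (S x) = norm x"
  by (simp add: norm_eq_sqrt_inner inner_S)

lemma bounded_linear_S: "bounded_linear S"
  using lin by (rule linear_conv_bounded_linear[THEN iffD1])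

lemma S_measurable [measurable]: "S \<in> borel_measurable borel"
  by (intro borel_measurable_continuous_onI linear_continuous_on bounded_linear_S)

text \<open>A translation invariant measure is a multiple of Lebesgue measure (by Fubini), and here the unit
  ball shows that the factor is 1.\<close>

lemma nn_integral_S:
  fixes f :: "'a \<Rightarrow> ennreal"
  assumes [measurable]: "f \<in> borel_measurable borel"
  shows "(\<integral>\<^sup>+x. f (S x) \<partial>lborel) = (\<integral>\<^sup>+x. f x \<partial>lborel)"
proof -
  let ?g = "\<lambda>x. indicator (ball (0::'a) 1) x :: ennreal"
  let ?w = "emeasure lborel (ball (0::'a) 1)"
  have bm [measurable]: "ball (0::'a) 1 \<in> sets borel" by simp
  have w: "(\<integral>\<^sup>+x. ?g x \<partial>lborel) = ?w" by simp
  have "(\<integral>\<^sup>+x. f (S x) \<partial>lborel) * ?w = (\<integral>\<^sup>+y. (\<integral>\<^sup>+x. f (S x) \<partial>lborel) * ?g y \<partial>lborel)"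
    by (subst nn_integral_cmult) (auto simp: w)
  also have "\<dots> = (\<integral>\<^sup>+y. (\<integral>\<^sup>+x. f (S x + y) * ?g y \<partial>lborel) \<partial>lborel)"
  proof (rule nn_integral_cong)
    fix y :: 'a
    have "(\<integral>\<^sup>+x. f (S x) \<partial>lborel) = (\<integral>\<^sup>+x. f (S (x + S y)) \<partial>lborel)"
      by (rule nn_integral_lborel_translate[symmetric]) measurable
    also have "\<dots> = (\<integral>\<^sup>+x. f (S x + y) \<partial>lborel)" by (simp add: linear_add[OF lin])
    finally show "(\<integral>\<^sup>+x. f (S x) \<partial>lborel) * ?g y = (\<integral>\<^sup>+x. f (S x + y) * ?g y \<partial>lborel)"
      by (simp add: nn_integral_multc)
  qed
  also have "\<dots> = (\<integral>\<^sup>+x. (\<integral>\<^sup>+y. f (S x + y) * ?g y \<partial>lborel) \<partial>lborel)"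
    by (rule lborel_pair.Fubini') measurable
  also have "\<dots> = (\<integral>\<^sup>+x. (\<integral>\<^sup>+y. f y * ?g (y - S x) \<partial>lborel) \<partial>lborel)"
  proof (rule nn_integral_cong)
    fix x
    have "(\<integral>\<^sup>+y. f y * ?g (y - S x) \<partial>lborel) = (\<integral>\<^sup>+y. f (y + S x) * ?g (y + S x - S x) \<partial>lborel)"
      by (rule nn_integral_lborel_translate[symmetric]) measurable
    then show "(\<integral>\<^sup>+y. f (S x + y) * ?g y \<partial>lborel) = (\<integral>\<^sup>+y. f y * ?g (y - S x) \<partial>lborel)"
      by (simp add: add.commute)
  qed
  also have "\<dots> = (\<integral>\<^sup>+y. (\<integral>\<^sup>+x. f y * ?g (y - S x) \<partial>lborel) \<partial>lborel)"
    by (rule lborel_pair.Fubini'[symmetric]) measurable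
  also have "\<dots> = (\<integral>\<^sup>+y. f y * ?w \<partial>lborel)"
  proof (rule nn_integral_cong)
    fix y :: 'a
    have "?g (y - S x) = ?g (x + - S y)" for x
    proof -
      have "norm (y - S x) = norm (S (y - S x))" by simp
      also have "S (y - S x) = - (x + - S y)" by (simp add: linear_diff[OF lin])
      finally have "norm (y - S x) = norm (x + - S y)" by (simp only: norm_minus_cancel)
      then show ?thesis by (simp add: indicator_def)
    qed
    then have "(\<integral>\<^sup>+x. f y * ?g (y - S x) \<partial>lborel) = f y * (\<integral>\<^sup>+x. ?g (x + - S y) \<partial>lborel)"
      by (simp only:) (rule nn_integral_cmult, measurable)
    also have "(\<integral>\<^sup>+x. ?g (x + - S y) \<partial>lborel) = ?w"
      by (subst nn_integral_lborel_translate) (auto simp: w)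
    finally show "(\<integral>\<^sup>+x. f y * ?g (y - S x) \<partial>lborel) = f y * ?w" .
  qed
  also have "\<dots> = (\<integral>\<^sup>+y. f y \<partial>lborel) * ?w" by (simp add: nn_integral_multc)
  finally have "(\<integral>\<^sup>+x. f (S x) \<partial>lborel) * ?w = (\<integral>\<^sup>+y. f y \<partial>lborel) * ?w" .
  moreover have "?w \<noteq> 0"
  proof
    assume "?w = 0"
    then have "ball (0::'a) 1 = {}"
      using open_not_negligible[of "ball (0::'a) 1"] by (auto simp: negligible_iff_null_sets null_sets_def emeasure_completion)
    then show False by simp
  qed
  moreover have "?w \<noteq> \<infinity>" using emeasure_bounded_finite[of "ball (0::'a) 1"] by auto
  ultimately show ?thesis by (metis mult_divide_eq_ennreal infinity_ennreal_def)
qed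

lemma distr_S: "distr lborel borel S = (lborel :: 'a measure)"
proof (rule measure_eqI)
  fix A assume "A \<in> sets (distr lborel borel S)"
  then have [measurable]: "A \<in> sets borel" by simp
  have "emeasure (distr lborel borel S) A = (\<integral>\<^sup>+x. indicator A x \<partial>distr lborel borel S)" by simp
  also have "\<dots> = (\<integral>\<^sup>+x. indicator A (S x) \<partial>lborel)" by (rule nn_integral_distr) auto
  also have "\<dots> = emeasure lborel A" by (subst nn_integral_S) auto
  finally show "emeasure (distr lborel borel S) A = emeasure lborel A" .
qed simp

lemma integral_S:
  fixes f :: "'a \<Rightarrow> 'b::{banach,second_countable_topology}"
  assumes "f \<in> borel_measurable borel"
  shows "(LINT x|lborel. f (S x)) = (LINT x|lborel. f x)"
  using integral_distr[of S lborel borel f] assms by (simp add: distr_S)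

lemma integrable_S:
  fixes f :: "'a \<Rightarrow> 'b::{banach,second_countable_topology}"
  assumes "integrable lborel f" shows "integrable lborel (\<lambda>x. f (S x))"
  using integrable_distr_eq[of S lborel borel f] assms by (simp add: distr_S)

lemma L2_S [intro]: "f \<in> L2 \<Longrightarrow> (\<lambda>x. f (S x)) \<in> L2"
  by (rule L2I[OF measurable_compose[OF S_measurable L2_measurable]])
    (simp_all add: integrable_S[OF L2_integrable])

lemma ip_S: "f \<in> L2 \<Longrightarrow> g \<in> L2 \<Longrightarrow> ip (\<lambda>x. f (S x)) (\<lambda>x. g (S x)) = ip f g"
  unfolding ip_def by (rule integral_S) (auto dest!: L2_measurable)

lemma ip_S': "f \<in> L2 \<Longrightarrow> g \<in> L2 \<Longrightarrow> ip (\<lambda>x. f (S x)) g = ip f (\<lambda>x. g (S x))"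
  using ip_S[of f "\<lambda>x. g (S x)"] by auto

lemma AE_S: assumes "AE x in lborel. P x" shows "AE x in lborel. P (S x)"
proof -
  obtain N where N: "{x \<in> space lborel. \<not> P x} \<subseteq> N" "emeasure lborel N = 0" "N \<in> sets lborel"
    using AE_E[OF assms] .
  have "AE x in distr lborel borel S. x \<notin> N" unfolding distr_S by (rule AE_not_in) (use N in \<open>simp add: null_sets_def\<close>)
  moreover have "{x. x \<notin> N} \<in> sets borel" using sets.compl_sets[of N borel] N(3) by (simp add: Compl_eq[symmetric] Compl_eq_Diff_UNIV)
  ultimately have "AE x in lborel. S x \<notin> N" by (simp add: AE_distr_iff)
  then show ?thesis using N(1) by (auto elim: eventually_mono)
qed

text \<open>A chain rule by duality: the change of variables moves \<open>S\<close> onto the test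
  function. Expanding b = S(S b) in the basis expresses the derivative of \<phi> along
  \<open>b\<close> through those of \<phi> composed with \<open>S\<close>.\<close>

lemma has_weak_deriv_S:
  assumes f: "\<And>c. c \<in> Basis \<Longrightarrow> has_weak_deriv f c (f' c)" and b: "b \<in> Basis"
  shows "has_weak_deriv (\<lambda>x. f (S x)) b (\<lambda>x. \<Sum>c\<in>Basis. (S b \<bullet> c) *\<^sub>R f' c (S x))"
  unfolding has_weak_deriv_def
proof (intro conjI allI impI)
  have fL: "f \<in> L2" "\<And>c. c \<in> Basis \<Longrightarrow> f' c \<in> L2" using has_weak_deriv_L2[OF f] b by auto
  show "(\<lambda>x. f (S x)) \<in> L2" using fL by auto
  show "(\<lambda>x. \<Sum>c\<in>Basis. (S b \<bullet> c) *\<^sub>R f' c (S x)) \<in> L2" using fL by (intro L2_sum L2_scaleR L2_S)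
  fix \<phi> :: "'a \<Rightarrow> real" assume \<phi>: "test_fun \<phi>"
  have t: "test_fun (\<lambda>x. \<phi> (S x))" using test_fun_affine[OF \<phi> bounded_linear_S bounded_linear_S, of 0] by simp
  note [measurable] = L2_measurable[OF fL(1)] test_fun_measurable[OF test_fun_deriv[OF \<phi> b]] test_fun_measurable[OF \<phi>]
  have d: "frechet_derivative (\<lambda>x. \<phi> (S x)) (at x) = (\<lambda>h. frechet_derivative \<phi> (at (S x)) (S h))" for x
    by (rule frechet_derivative_at[symmetric], rule has_derivative_compose[OF
      bounded_linear_imp_has_derivative[OF bounded_linear_S] test_fun_has_derivative[OF \<phi>]])
  have e: "frechet_derivative \<phi> (at (S x)) b = (\<Sum>c\<in>Basis. (S b \<bullet> c) * frechet_derivative (\<lambda>x. \<phi> (S x)) (at x) c)" for x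
  proof -
    have lin': "linear (frechet_derivative \<phi> (at (S x)))"
      by (rule has_derivative_linear[OF test_fun_has_derivative[OF \<phi>]])
    have "frechet_derivative \<phi> (at (S x)) b = frechet_derivative \<phi> (at (S x)) (S (\<Sum>c\<in>Basis. (S b \<bullet> c) *\<^sub>R c))"
      by (simp add: euclidean_representation)
    also have "\<dots> = (\<Sum>c\<in>Basis. (S b \<bullet> c) * frechet_derivative \<phi> (at (S x)) (S c))"
      by (simp add: linear_sum[OF lin] linear_sum[OF lin'] linear_scale[OF lin] linear_scale[OF lin'])
    finally show ?thesis by (simp add: d)
  qed
  have "(LINT x|lborel. frechet_derivative \<phi> (at x) b *\<^sub>R f (S x)) = (LINT x|lborel. frechet_derivative \<phi> (at (S x)) b *\<^sub>R f x)"
    by (subst integral_S[symmetric]) auto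
  also have "\<dots> = (\<Sum>c\<in>Basis. (S b \<bullet> c) *\<^sub>R (LINT x|lborel. frechet_derivative (\<lambda>x. \<phi> (S x)) (at x) c *\<^sub>R f x))"
    unfolding e scaleR_sum_left scaleR_scaleR[symmetric]
    by (simp add: integrable_test_scaleR[OF fL(1) test_fun_deriv[OF t]] del: scaleR_scaleR)
  also have "\<dots> = (\<Sum>c\<in>Basis. (S b \<bullet> c) *\<^sub>R - (LINT x|lborel. \<phi> x *\<^sub>R f' c (S x)))"
  proof (rule sum.cong[OF refl])
    fix c :: 'a assume c: "c \<in> Basis"
    note [measurable] = L2_measurable[OF fL(2)[OF c]]
    have "(LINT x|lborel. frechet_derivative (\<lambda>x. \<phi> (S x)) (at x) c *\<^sub>R f x) = - (LINT x|lborel. \<phi> (S x) *\<^sub>R f' c x)"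
      using f[OF c] t by (auto simp: has_weak_deriv_def)
    also have "(LINT x|lborel. \<phi> (S x) *\<^sub>R f' c x) = (LINT x|lborel. \<phi> x *\<^sub>R f' c (S x))"
      by (subst integral_S[symmetric]) auto
    finally show "(S b \<bullet> c) *\<^sub>R (LINT x|lborel. frechet_derivative (\<lambda>x. \<phi> (S x)) (at x) c *\<^sub>R f x) =
      (S b \<bullet> c) *\<^sub>R - (LINT x|lborel. \<phi> x *\<^sub>R f' c (S x))" by simp
  qed
  also have "\<dots> = - (LINT x|lborel. \<phi> x *\<^sub>R (\<Sum>c\<in>Basis. (S b \<bullet> c) *\<^sub>R f' c (S x)))"
  proof -
    have "(LINT x|lborel. \<phi> x *\<^sub>R (\<Sum>c\<in>Basis. (S b \<bullet> c) *\<^sub>R f' c (S x))) =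
      (LINT x|lborel. (\<Sum>c\<in>Basis. (S b \<bullet> c) *\<^sub>R (\<phi> x *\<^sub>R f' c (S x))))"
      by (simp add: scaleR_sum_right mult.commute)
    also have "\<dots> = (\<Sum>c\<in>Basis. (S b \<bullet> c) *\<^sub>R (LINT x|lborel. \<phi> x *\<^sub>R f' c (S x)))"
      by (simp add: integrable_test_scaleR[OF L2_S[OF fL(2)] \<phi>] del: scaleR_scaleR)
    finally show ?thesis by (simp add: sum_negf)
  qed
  finally show "(LINT x|lborel. frechet_derivative \<phi> (at x) b *\<^sub>R f (S x)) =
    - (LINT x|lborel. \<phi> x *\<^sub>R (\<Sum>c\<in>Basis. (S b \<bullet> c) *\<^sub>R f' c (S x)))" .
qed

end

text \<open>The reflection along a = x - y. Equal norms give 2 x . a = a . a, so \<open>x\<close>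
  loses exactly \<open>a\<close>.\<close>

lemma householder:
  fixes x y :: "'a::euclidean_space"
  assumes "norm x = norm y" "x \<noteq> y"
  obtains S where "reflection S" "S x = y"
proof -
  define a where "a = x - y"
  define S where "S z = z - (2 * (z \<bullet> a) / (a \<bullet> a)) *\<^sub>R a" for z
  have a: "a \<bullet> a \<noteq> 0" using assms by (simp add: a_def)
  have "reflection S"
  proof (rule reflection.intro)
    show "linear S" by (rule linearI) (simp_all add: S_def algebra_simps inner_add_left add_divide_distrib)
    show "S (S z) = z" for z using a by (simp add: S_def inner_diff_left algebra_simps)
    show "S z \<bullet> w = z \<bullet> S w" for z w by (simp add: S_def inner_diff_left inner_diff_right inner_commute)
  qed
  moreover have "S x = y"
  proof -
    have "x \<bullet> x = y \<bullet> y" using assms(1) by (simp add: norm_eq_sqrt_inner)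
    then have "2 * (x \<bullet> a) = a \<bullet> a" by (simp add: a_def inner_diff_left inner_diff_right inner_commute)
    then show ?thesis using a by (simp add: S_def a_def)
  qed
  ultimately show ?thesis by (rule that)
qed

section \<open>Second weak derivatives and the Laplacian\<close>

lemma weak_deriv_eqI:
  assumes "has_weak_deriv f b g" "b \<in> Basis"
  shows "has_weak_deriv f b (weak_deriv b f)" "AE x in lborel. weak_deriv b f x = g x"
proof -
  show 1: "has_weak_deriv f b (weak_deriv b f)"
    unfolding weak_deriv_def by (rule someI[of "has_weak_deriv f b", OF assms(1)])
  show "AE x in lborel. weak_deriv b f x = g x" by (rule has_weak_deriv_unique[OF 1 assms])
qed

lemma H2_H1: "f \<in> H2 \<Longrightarrow> f \<in> H1"
  by (simp add: H2_def)

lemma H2_weak_deriv2: "f \<in> H2 \<Longrightarrow> b \<in> Basis \<Longrightarrow> c \<in> Basis \<Longrightarrow>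
    has_weak_deriv (weak_deriv b f) c (weak_deriv c (weak_deriv b f))"
  by (auto simp: H2_def intro: H1_weak_deriv)

lemma laplacian_L2: "f \<in> H2 \<Longrightarrow> laplacian f \<in> L2"
  unfolding laplacian_def[abs_def] by (intro L2_sum has_weak_deriv_L2(2)[OF H2_weak_deriv2])

lemma ip_laplacian:
  assumes f: "f \<in> H2" and g: "\<And>b. b \<in> Basis \<Longrightarrow> has_weak_deriv g b (g' b)"
  shows "ip (laplacian f) g = - (\<Sum>b\<in>Basis. ip (weak_deriv b f) (g' b))"
proof -
  obtain b :: 'a where b: "b \<in> Basis" using nonempty_Basis by blast
  have gL: "g \<in> L2" using has_weak_deriv_L2[OF g[OF b]] by simp
  have "ip (laplacian f) g = (\<Sum>b\<in>Basis. ip (weak_deriv b (weak_deriv b f)) g)"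
    unfolding laplacian_def[abs_def] by (intro ip_sum_left gL has_weak_deriv_L2(2)[OF H2_weak_deriv2[OF f]])
  also have "\<dots> = (\<Sum>b\<in>Basis. - ip (weak_deriv b f) (g' b))"
    by (intro sum.cong refl weak_integration_by_parts[OF H2_weak_deriv2[OF f] g])
  finally show ?thesis by (simp add: sum_negf)
qed

lemma ip_rot:
  assumes "f \<in> L2" "g \<in> L2"
  shows "ip f (\<lambda>x. cis \<theta> * g x) = cos \<theta> * ip f g + sin \<theta> * ip f (\<lambda>x. \<i> * g x)"
proof -
  have "(\<lambda>x. cis \<theta> * g x) = (\<lambda>x. cos \<theta> *\<^sub>R g x + sin \<theta> *\<^sub>R (\<i> * g x))"
    by (simp add: cis_conv_exp exp_Euler scaleR_conv_of_real algebra_simps cos_of_real sin_of_real)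
  then show ?thesis using assms by (simp only:) (subst ip_add_right, auto)
qed

lemma ip_diff_self:
  assumes "f \<in> L2" "g \<in> L2" shows "ip (\<lambda>x. f x - g x) (\<lambda>x. f x - g x) = ip f f - 2 * ip g f + ip g g"
  using assms by (simp add: ip_diff_left ip_diff_right L2_diff ip_commute[of f g])

context reflection begin

text \<open>With \<open>w = u \<circ> S - u\<close> one has \<open>w \<circ> S = - w\<close>, which turns all terms into Dirichlet forms of \<open>u\<close> itself.\<close>

lemma laplacian_dissipative:
  assumes u: "u \<in> H2" and c: "0 \<le> cos \<theta>"
  shows "ip (\<lambda>x. u (S x) - u x) (\<lambda>x. cis \<theta> * (laplacian u (S x) - laplacian u x)) \<le> 0"
proof -
  let ?w = "\<lambda>x. u (S x) - u x"
  let ?L = "laplacian u"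
  let ?D = "\<lambda>b. weak_deriv b u"
  let ?DS = "\<lambda>b x. \<Sum>c\<in>Basis. (S b \<bullet> c) *\<^sub>R ?D c (S x)"
  have LL: "?L \<in> L2" by (rule laplacian_L2[OF u])
  have uL: "u \<in> L2" using u by (simp add: H2_def H1_def)
  have D: "has_weak_deriv u b (?D b)" if "b \<in> Basis" for b by (rule H1_weak_deriv[OF H2_H1[OF u] that])
  have DL: "?D b \<in> L2" if "b \<in> Basis" for b using has_weak_deriv_L2(2)[OF D[OF that]] .
  have DS: "has_weak_deriv (\<lambda>x. u (S x)) b (?DS b)" if "b \<in> Basis" for b by (rule has_weak_deriv_S[OF D that])
  have DSL: "?DS b \<in> L2" if "b \<in> Basis" for b using has_weak_deriv_L2(2)[OF DS[OF that]] .
  have w: "has_weak_deriv ?w b (\<lambda>x. ?DS b x - ?D b x)" if "b \<in> Basis" for b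
    by (intro has_weak_deriv_diff DS D that)
  have wL: "?w \<in> L2" using uL by auto
  have LS: "ip ?w (\<lambda>x. g (S x) - g x) = -2 * ip ?w g" if g: "g \<in> L2" for g
  proof -
    have "ip ?w (\<lambda>x. g (S x)) = ip (\<lambda>x. ?w (S x)) g" by (rule ip_S'[symmetric, OF wL g])
    also have "\<dots> = - ip ?w g" using ip_uminus_left[of ?w g] by simp
    finally show ?thesis using g wL by (simp add: ip_diff_right L2_S)
  qed
  have one: "ip (?DS b) (?DS b) = (\<Sum>c\<in>Basis. \<Sum>d\<in>Basis. (S b \<bullet> c) * (S b \<bullet> d) * ip (?D c) (?D d))" if "b \<in> Basis" for b
    using DL by (simp add: ip_sum_left ip_sum_right L2_S L2_scaleR L2_sum ip_S sum_distrib_left mult.assoc)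
  have SS: "(\<Sum>b\<in>Basis. (b \<bullet> S c) * (b \<bullet> S d)) = c \<bullet> d" for c d
    by (subst inner_S[symmetric], subst euclidean_inner) (simp add: inner_commute)
  have "(\<Sum>b\<in>Basis. ip (?DS b) (?DS b)) = (\<Sum>b\<in>Basis. \<Sum>c\<in>Basis. \<Sum>d\<in>Basis. (S b \<bullet> c) * (S b \<bullet> d) * ip (?D c) (?D d))"
    by (intro sum.cong refl one)
  also have "\<dots> = (\<Sum>c\<in>Basis. \<Sum>d\<in>Basis. (\<Sum>b\<in>Basis. (b \<bullet> S c) * (b \<bullet> S d)) * ip (?D c) (?D d))"
    by (subst sum.swap, rule sum.cong[OF refl], subst sum.swap) (simp add: sum_distrib_right sym)
  also have "\<dots> = (\<Sum>c\<in>Basis. \<Sum>d\<in>Basis. (c \<bullet> d) * ip (?D c) (?D d))"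
    by (simp only: SS)
  also have "\<dots> = (\<Sum>c\<in>Basis. ip (?D c) (?D c))"
    by (intro sum.cong refl) (simp add: inner_Basis if_distrib[of "\<lambda>z. z * _"] cong: if_cong)
  finally have eq: "(\<Sum>b\<in>Basis. ip (?DS b) (?DS b)) = (\<Sum>b\<in>Basis. ip (?D b) (?D b))" .
  have wLap: "ip ?L ?w = - (\<Sum>b\<in>Basis. ip (?D b) (\<lambda>x. ?DS b x - ?D b x))" by (rule ip_laplacian[OF u w])
  \<comment> \<open>Expanding the square of \<open>?DS b - ?D b\<close> bounds each summand by half
    a difference of squared norms. These differences sum to zero, since \<open>S\<close> preserves
    the Dirichlet integral.\<close>
  have "(\<Sum>b\<in>Basis. ip (?D b) (\<lambda>x. ?DS b x - ?D b x)) \<le>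
      (\<Sum>b\<in>Basis. (ip (?DS b) (?DS b) - ip (?D b) (?D b)) / 2)"
  proof (rule sum_mono)
    fix b :: 'a assume b: "b \<in> Basis"
    have "0 \<le> ip (\<lambda>x. ?DS b x - ?D b x) (\<lambda>x. ?DS b x - ?D b x)" by simp
    also have "\<dots> = ip (?DS b) (?DS b) - 2 * ip (?D b) (?DS b) + ip (?D b) (?D b)"
      by (rule ip_diff_self[OF DSL[OF b] DL[OF b]])
    finally show "ip (?D b) (\<lambda>x. ?DS b x - ?D b x) \<le> (ip (?DS b) (?DS b) - ip (?D b) (?D b)) / 2"
      using DL[OF b] DSL[OF b] by (simp add: ip_diff_right)
  qed
  also have "\<dots> = 0" using eq by (simp add: sum_subtractf flip: sum_divide_distrib)
  finally have pos: "0 \<le> ip ?w ?L" using wLap ip_commute[of ?w ?L] by linarith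
  have iw: "has_weak_deriv (\<lambda>x. \<i> * ?w x) b (\<lambda>x. \<i> * (?DS b x - ?D b x))" if "b \<in> Basis" for b
    by (rule has_weak_deriv_cmult[OF w[OF that] that])
  have "ip ?w (\<lambda>x. \<i> * ?L x) = - ip ?L (\<lambda>x. \<i> * ?w x)" using ip_ii[of ?L ?w] ip_commute by metis
  also have "\<dots> = (\<Sum>b\<in>Basis. ip (?D b) (\<lambda>x. \<i> * (?DS b x - ?D b x)))"
    using ip_laplacian[OF u iw] by simp
  also have "\<dots> = (\<Sum>b\<in>Basis. ip (?D b) (\<lambda>x. \<i> * ?DS b x))"
  proof (rule sum.cong[OF refl])
    fix b :: 'a assume b: "b \<in> Basis"
    have "ip (?D b) (\<lambda>x. \<i> * ?D b x) = 0" by (simp add: ip_def)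
    then show "ip (?D b) (\<lambda>x. \<i> * (?DS b x - ?D b x)) = ip (?D b) (\<lambda>x. \<i> * ?DS b x)"
      using DL[OF b] DSL[OF b] by (simp add: right_diff_distrib ip_diff_right L2_cmult)
  qed
  also have "\<dots> = (\<Sum>b\<in>Basis. \<Sum>c\<in>Basis. (S b \<bullet> c) * ip (?D b) (\<lambda>x. \<i> * ?D c (S x)))" (is "_ = ?R")
  proof (rule sum.cong[OF refl])
    fix b :: 'a assume b: "b \<in> Basis"
    have "(\<lambda>x. \<i> * ?DS b x) = (\<lambda>x. \<Sum>c\<in>Basis. (S b \<bullet> c) *\<^sub>R (\<i> * ?D c (S x)))"
      by (simp add: sum_distrib_left)
    moreover have "(\<lambda>x. (S b \<bullet> c) *\<^sub>R (\<i> * ?D c (S x))) \<in> L2" if "c \<in> Basis" for c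
      by (intro L2_scaleR L2_cmult L2_S DL that)
    ultimately show "ip (?D b) (\<lambda>x. \<i> * ?DS b x) = (\<Sum>c\<in>Basis. (S b \<bullet> c) * ip (?D b) (\<lambda>x. \<i> * ?D c (S x)))"
      using DL[OF b] by (simp only: ip_sum_right ip_scaleR_right)
  qed
  \<comment> \<open>Exchanging \<open>b\<close> and \<open>c\<close> and moving \<open>S\<close> to
    the other factor leaves the coefficient unchanged but reverses the sign, because multiplication
    by \<open>\<i>\<close> is skew.\<close>
  also have "?R = - ?R"
  proof -
    have "?R = (\<Sum>c\<in>Basis. \<Sum>b\<in>Basis. (S b \<bullet> c) * ip (?D b) (\<lambda>x. \<i> * ?D c (S x)))" by (rule sum.swap)
    also have "\<dots> = (\<Sum>c\<in>Basis. \<Sum>b\<in>Basis. - ((S c \<bullet> b) * ip (?D c) (\<lambda>x. \<i> * ?D b (S x))))"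
    proof (intro sum.cong refl)
      fix b c :: 'a assume b: "b \<in> Basis" and c: "c \<in> Basis"
      have "ip (?D b) (\<lambda>x. \<i> * ?D c (S x)) = - ip (\<lambda>x. \<i> * ?D b x) (\<lambda>x. ?D c (S x))"
        using ip_ii[of "?D b" "\<lambda>x. ?D c (S x)"] by simp
      also have "\<dots> = - ip (\<lambda>x. ?D c (S x)) (\<lambda>x. \<i> * ?D b x)" by (simp add: ip_commute)
      also have "\<dots> = - ip (?D c) (\<lambda>x. \<i> * ?D b (S x))"
        using ip_S'[of "?D c" "\<lambda>x. \<i> * ?D b x"] DL b c by auto
      finally show "(S b \<bullet> c) * ip (?D b) (\<lambda>x. \<i> * ?D c (S x)) = - ((S c \<bullet> b) * ip (?D c) (\<lambda>x. \<i> * ?D b (S x)))"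
        using sym[of c b] by (simp add: inner_commute)
    qed
    finally show ?thesis by (simp add: sum_negf)
  qed
  then have "?R = 0" by linarith
  finally have im: "ip ?w (\<lambda>x. \<i> * ?L x) = 0" .
  have "ip ?w (\<lambda>x. cis \<theta> * (?L (S x) - ?L x)) = cos \<theta> * ip ?w (\<lambda>x. ?L (S x) - ?L x) + sin \<theta> * ip ?w (\<lambda>x. \<i> * ?L (S x) - \<i> * ?L x)"
    using ip_rot[OF wL, of "\<lambda>x. ?L (S x) - ?L x" \<theta>] LL by (simp add: L2_S L2_diff right_diff_distrib)
  also have "\<dots> = - 2 * cos \<theta> * ip ?w ?L"
    using LS[OF LL] LS[OF L2_cmult[OF LL, of \<i>]] im by simp
  also have "\<dots> \<le> 0" using pos c by simp
  finally show ?thesis .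
qed

end

section \<open>Mass, energy and symmetry of solutions\<close>

text \<open>A solution on a closed time interval with a fixed witness \<open>v\<close> for its time
  derivative. The range of \<theta> enters as the positivity of cos \<theta>, the strength of the
  dissipation.\<close>

locale gl_solution =
  fixes \<alpha> \<theta> T :: real and u v :: "real \<Rightarrow> 'a::euclidean_space \<Rightarrow> complex"
  assumes alpha: "0 < \<alpha>" and cos_pos: "0 < cos \<theta>" and T_pos: "0 < T"
    and curve_H1: "continuous_curve (C0 \<inter> H1) (\<lambda>f. sup_norm f + H1_norm f) {0..T} u"
    and curve_H2: "continuous_curve H2 H2_norm {0<..<T} u"
    and v_L2: "t \<in> {0<..<T} \<Longrightarrow> v t \<in> L2"
    and time_deriv: "t \<in> {0<..<T} \<Longrightarrow> has_L2_derivative u (v t) t"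
    and equation: "t \<in> {0<..<T} \<Longrightarrow> AE x in lborel. exp (- \<i> * of_real \<theta>) * v t x =
        laplacian (u t) x + of_real (cmod (u t x) powr \<alpha>) * u t x"

text \<open>\<open>sup_norm\<close> is a supremum in a conditionally complete order, so it bounds
  pointwise values once the range is known to be bounded above.\<close>

lemma C0_bounded: assumes "f \<in> C0" shows "bdd_above (range (\<lambda>x. cmod (f x)))"
proof -
  have "continuous_on UNIV f" and lim: "(f \<longlongrightarrow> 0) at_infinity" using assms by (auto simp: C0_def)
  obtain R where R: "\<And>x. R \<le> norm x \<Longrightarrow> cmod (f x) < 1"
    using order_tendstoD(2)[OF tendsto_norm[OF lim], of 1] by (auto simp: eventually_at_infinity)
  have "compact (f ` cball 0 R)"
    by (intro compact_continuous_image continuous_on_subset[OF \<open>continuous_on UNIV f\<close>]) auto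
  then obtain B where B: "\<forall>x\<in>cball 0 R. cmod (f x) \<le> B"
    using compact_imp_bounded[of "f ` cball 0 R"] by (auto simp: bounded_iff)
  have "cmod (f x) \<le> max B 1" for x
    using R[of x] B by (cases "norm x \<le> R") (auto simp: le_max_iff_disj)
  then show ?thesis by (auto simp: bdd_above_def)
qed

lemma C0_le_sup_norm: "f \<in> C0 \<Longrightarrow> cmod (f x) \<le> sup_norm f"
  unfolding sup_norm_def by (intro cSUP_upper C0_bounded) auto

lemma C0_diff: "f \<in> C0 \<Longrightarrow> g \<in> C0 \<Longrightarrow> (\<lambda>x. f x - g x) \<in> C0"
  unfolding C0_def using tendsto_diff[of f 0 at_infinity g 0] by (auto intro: continuous_intros)

lemma L2_norm_le_H1_norm: "b \<in> Basis \<Longrightarrow> L2_norm (weak_deriv b f) \<le> H1_norm f" "L2_norm f \<le> H1_norm f"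
proof -
  have s: "0 \<le> (\<Sum>b\<in>Basis. (L2_norm (weak_deriv b f))\<^sup>2)" by (intro sum_nonneg) auto
  then show "L2_norm f \<le> H1_norm f" unfolding H1_norm_def by (intro real_le_rsqrt) auto
  assume b: "b \<in> Basis"
  have "(L2_norm (weak_deriv b f))\<^sup>2 \<le> (\<Sum>b\<in>Basis. (L2_norm (weak_deriv b f))\<^sup>2)"
    by (rule member_le_sum[OF b]) auto
  then show "L2_norm (weak_deriv b f) \<le> H1_norm f"
    unfolding H1_norm_def by (intro real_le_rsqrt) (simp add: add_increasing)
qed

lemma H1_norm_le_H2_norm: "b \<in> Basis \<Longrightarrow> H1_norm (weak_deriv b f) \<le> H2_norm f"
proof -
  assume b: "b \<in> Basis"
  have "(H1_norm (weak_deriv b f))\<^sup>2 \<le> (\<Sum>b\<in>Basis. (H1_norm (weak_deriv b f))\<^sup>2)"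
    by (rule member_le_sum[OF b]) auto
  then show "H1_norm (weak_deriv b f) \<le> H2_norm f"
    unfolding H2_norm_def by (intro real_le_rsqrt) (simp add: add_increasing)
qed

lemma sup_norm_nonneg: "f \<in> C0 \<Longrightarrow> 0 \<le> sup_norm f"
  using C0_le_sup_norm[of f 0] norm_ge_zero order_trans by blast

lemma H1_norm_nonneg: "0 \<le> H1_norm f"
  by (simp add: H1_norm_def sum_nonneg)

text \<open>\<open>weak_deriv\<close> picks a representative and is therefore linear only almost
  everywhere, which norms do not see. This reads the \<open>H1_norm\<close> of a difference as a sum
  over differences of derivatives.\<close>

lemma weak_deriv_diff_norm:
  assumes "f \<in> H1" "g \<in> H1" "b \<in> Basis"
  shows "L2_norm (weak_deriv b (\<lambda>x. f x - g x)) = L2_norm (\<lambda>x. weak_deriv b f x - weak_deriv b g x)"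
proof -
  have wd: "has_weak_deriv (\<lambda>x. f x - g x) b (\<lambda>x. weak_deriv b f x - weak_deriv b g x)"
    by (intro has_weak_deriv_diff H1_weak_deriv assms)
  show ?thesis
    by (intro L2_norm_cong_AE weak_deriv_eqI(2)[OF wd assms(3)] has_weak_deriv_L2(2)[OF wd]
        has_weak_deriv_L2(2)[OF weak_deriv_eqI(1)[OF wd assms(3)]])
qed

lemma weak_deriv2_diff_norm:
  assumes "f \<in> H2" "g \<in> H2" "b \<in> Basis" "c \<in> Basis"
  shows "L2_norm (weak_deriv c (weak_deriv b (\<lambda>x. f x - g x))) =
    L2_norm (\<lambda>x. weak_deriv c (weak_deriv b f) x - weak_deriv c (weak_deriv b g) x)"
proof -
  have wd: "has_weak_deriv (\<lambda>x. f x - g x) b (\<lambda>x. weak_deriv b f x - weak_deriv b g x)"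
    by (intro has_weak_deriv_diff H1_weak_deriv H2_H1 assms)
  note w1 = weak_deriv_eqI[OF wd assms(3)]
  have wd2: "has_weak_deriv (\<lambda>x. weak_deriv b f x - weak_deriv b g x) c
      (\<lambda>x. weak_deriv c (weak_deriv b f) x - weak_deriv c (weak_deriv b g) x)"
    by (intro has_weak_deriv_diff H2_weak_deriv2 assms)
  have ae: "AE x in lborel. weak_deriv b f x - weak_deriv b g x = weak_deriv b (\<lambda>x. f x - g x) x"
    using w1(2) by eventually_elim simp
  \<comment> \<open>The chosen derivative of the difference agrees almost everywhere with the
    difference of the chosen derivatives; the second derivative is transported along this
    equality.\<close>
  have wd3: "has_weak_deriv (weak_deriv b (\<lambda>x. f x - g x)) c
      (\<lambda>x. weak_deriv c (weak_deriv b f) x - weak_deriv c (weak_deriv b g) x)"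
    by (rule has_weak_deriv_AE[OF wd2 assms(4) has_weak_deriv_L2(2)[OF w1(1)] has_weak_deriv_L2(2)[OF wd2] ae]) simp
  show ?thesis
    by (intro L2_norm_cong_AE weak_deriv_eqI(2)[OF wd3 assms(4)] has_weak_deriv_L2(2)[OF wd3]
        has_weak_deriv_L2(2)[OF weak_deriv_eqI(1)[OF wd3 assms(4)]])
qed

section \<open>Continuity in time of the solution and its derivatives\<close>

context gl_solution begin

abbreviation Icl :: "real set" where "Icl \<equiv> {0..T}"
abbreviation Iop :: "real set" where "Iop \<equiv> {0<..<T}"
abbreviation D :: "'a \<Rightarrow> real \<Rightarrow> 'a \<Rightarrow> complex" where "D b t \<equiv> weak_deriv b (u t)"
abbreviation DD :: "'a \<Rightarrow> 'a \<Rightarrow> real \<Rightarrow> 'a \<Rightarrow> complex" where "DD c b t \<equiv> weak_deriv c (weak_deriv b (u t))"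
text \<open>The right-hand side of the equation, so that v = exp(i \<theta>) G almost everywhere and
  \<open>v\<close>, \<open>G\<close> have equal norms.\<close>

definition G :: "real \<Rightarrow> 'a \<Rightarrow> complex" where "G t x = laplacian (u t) x + nl \<alpha> (u t x)"
definition mass :: "real \<Rightarrow> real" where "mass t = ip (u t) (u t)"
definition grad :: "real \<Rightarrow> real" where "grad t = (\<Sum>b\<in>Basis. ip (D b t) (D b t))"
definition pot :: "real \<Rightarrow> real" where "pot t = (LINT x|lborel. cmod (u t x) powr (\<alpha> + 2))"

lemma Iop_Icl: "t \<in> Iop \<Longrightarrow> t \<in> Icl" by auto

lemma at_Iop: "t \<in> Iop \<Longrightarrow> at t within Icl = at t"
  by (rule at_within_interior) (simp add: interior_atLeastAtMost_real)

lemma u_C0: "t \<in> Icl \<Longrightarrow> u t \<in> C0" and u_H1: "t \<in> Icl \<Longrightarrow> u t \<in> H1"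
  using curve_H1 by (auto simp: continuous_curve_def)

lemma u_L2: "t \<in> Icl \<Longrightarrow> u t \<in> L2"
  by (rule H1_L2[OF u_H1])

lemma u_H2: "t \<in> Iop \<Longrightarrow> u t \<in> H2"
  using curve_H2 by (auto simp: continuous_curve_def)

lemma D_weak: "t \<in> Icl \<Longrightarrow> b \<in> Basis \<Longrightarrow> has_weak_deriv (u t) b (D b t)"
  by (intro H1_weak_deriv u_H1)

lemma D_L2: "t \<in> Icl \<Longrightarrow> b \<in> Basis \<Longrightarrow> D b t \<in> L2"
  by (rule has_weak_deriv_L2(2)[OF D_weak])

lemma DD_weak: "t \<in> Iop \<Longrightarrow> b \<in> Basis \<Longrightarrow> c \<in> Basis \<Longrightarrow> has_weak_deriv (D b t) c (DD c b t)"
  by (intro H2_weak_deriv2 u_H2)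

lemma sup_conv: "t \<in> Icl \<Longrightarrow> ((\<lambda>s. sup_norm (\<lambda>x. u s x - u t x)) \<longlongrightarrow> 0) (at t within Icl)"
  and H1_conv: "t \<in> Icl \<Longrightarrow> ((\<lambda>s. H1_norm (\<lambda>x. u s x - u t x)) \<longlongrightarrow> 0) (at t within Icl)"
proof -
  assume t: "t \<in> Icl"
  have lim: "((\<lambda>s. sup_norm (\<lambda>x. u s x - u t x) + H1_norm (\<lambda>x. u s x - u t x)) \<longlongrightarrow> 0) (at t within Icl)"
    using curve_H1 t by (auto simp: continuous_curve_def)
  have ev: "\<forall>\<^sub>F s in at t within Icl. s \<in> Icl" by (auto simp: eventually_at_filter)
  show "((\<lambda>s. sup_norm (\<lambda>x. u s x - u t x)) \<longlongrightarrow> 0) (at t within Icl)"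
    by (rule tendsto_0_le_eventually[OF lim refl ev])
      (use t in \<open>auto simp: H1_norm_nonneg abs_of_nonneg sup_norm_nonneg C0_diff u_C0\<close>)
  show "((\<lambda>s. H1_norm (\<lambda>x. u s x - u t x)) \<longlongrightarrow> 0) (at t within Icl)"
    by (rule tendsto_0_le_eventually[OF lim refl ev])
      (use t in \<open>auto simp: H1_norm_nonneg abs_of_nonneg sup_norm_nonneg C0_diff u_C0\<close>)
qed

lemma u_conv: assumes t: "t \<in> Icl" shows "L2_conv u (u t) (at t within Icl)"
proof -
  have ev: "\<forall>\<^sub>F s in at t within Icl. s \<in> Icl" by (auto simp: eventually_at_filter)
  have "((\<lambda>s. L2_norm (\<lambda>x. u s x - u t x)) \<longlongrightarrow> 0) (at t within Icl)"
    by (rule tendsto_0_le_eventually[OF H1_conv[OF t] refl ev]) (simp add: L2_norm_le_H1_norm)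
  then show ?thesis using t ev by (auto simp: L2_conv_def u_L2 elim!: eventually_mono)
qed

lemma D_conv: assumes t: "t \<in> Icl" and b: "b \<in> Basis" shows "L2_conv (D b) (D b t) (at t within Icl)"
proof -
  have ev: "\<forall>\<^sub>F s in at t within Icl. s \<in> Icl" by (auto simp: eventually_at_filter)
  have "((\<lambda>s. L2_norm (\<lambda>x. D b s x - D b t x)) \<longlongrightarrow> 0) (at t within Icl)"
  proof (rule tendsto_0_le_eventually[OF H1_conv[OF t] refl ev])
    fix s assume "s \<in> Icl"
    then show "\<bar>L2_norm (\<lambda>x. D b s x - D b t x)\<bar> \<le> H1_norm (\<lambda>x. u s x - u t x)"
      using L2_norm_le_H1_norm(1)[OF b, of "\<lambda>x. u s x - u t x"] weak_deriv_diff_norm[OF u_H1 u_H1[OF t] b] by simp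
  qed
  then show ?thesis using t b ev by (auto simp: L2_conv_def D_L2 elim!: eventually_mono)
qed

lemma eventually_Iop: "t \<in> Iop \<Longrightarrow> \<forall>\<^sub>F s in at t. s \<in> Iop"
  using eventually_at_in_open[of Iop t] by (auto elim: eventually_mono)

lemma DD_conv: assumes t: "t \<in> Iop" and b: "b \<in> Basis" "c \<in> Basis" shows "L2_conv (DD c b) (DD c b t) (at t)"
proof -
  have "at t within Iop = at t" by (rule at_within_open[OF t]) simp
  then have lim: "((\<lambda>s. H2_norm (\<lambda>x. u s x - u t x)) \<longlongrightarrow> 0) (at t)"
    using curve_H2 t unfolding continuous_curve_def by metis
  have "((\<lambda>s. L2_norm (\<lambda>x. DD c b s x - DD c b t x)) \<longlongrightarrow> 0) (at t)"
  proof (rule tendsto_0_le_eventually[OF lim refl eventually_Iop[OF t]])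
    fix s assume "s \<in> Iop"
    then show "\<bar>L2_norm (\<lambda>x. DD c b s x - DD c b t x)\<bar> \<le> H2_norm (\<lambda>x. u s x - u t x)"
      using L2_norm_le_H1_norm(1)[OF b(2), of "weak_deriv b (\<lambda>x. u s x - u t x)"]
        H1_norm_le_H2_norm[OF b(1), of "\<lambda>x. u s x - u t x"]
        weak_deriv2_diff_norm[OF u_H2 u_H2[OF t] b] by simp
  qed
  moreover have "DD c b s \<in> L2" if "s \<in> Iop" for s by (rule has_weak_deriv_L2(2)[OF DD_weak[OF that b]])
  ultimately show ?thesis using t eventually_Iop[OF t] by (auto simp: L2_conv_def elim!: eventually_mono)
qed

lemma laplacian_conv: "t \<in> Iop \<Longrightarrow> L2_conv (\<lambda>s. laplacian (u s)) (laplacian (u t)) (at t)"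
  unfolding laplacian_def[abs_def] by (intro L2_conv_sum DD_conv)

lemma quotient_conv: assumes t: "t \<in> Iop" shows "L2_conv (\<lambda>s x. (u s x - u t x) /\<^sub>R (s - t)) (v t) (at t)"
proof -
  have "(\<lambda>x. (u s x - u t x) /\<^sub>R (s - t)) \<in> L2" if "s \<in> Iop" for s
    using that t by (intro L2_scaleR L2_diff u_L2 Iop_Icl)
  then show ?thesis using t time_deriv[OF t] v_L2[OF t] eventually_Iop[OF t]
    by (auto simp: L2_conv_def has_L2_derivative_def elim!: eventually_mono)
qed

text \<open>Continuity in the sup norm over a compact time interval gives one bound for all times,
  hence a Lipschitz constant of the nonlinearity that is uniform in time.\<close>

lemma bounded_u: "\<exists>B. \<forall>t x. t \<in> Icl \<longrightarrow> cmod (u t x) \<le> B"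
proof -
  have "continuous_on Icl (\<lambda>t. sup_norm (u t))"
    unfolding continuous_on_def
  proof
    fix t assume t: "t \<in> Icl"
    have ev: "\<forall>\<^sub>F s in at t within Icl. s \<in> Icl" by (auto simp: eventually_at_filter)
    show "((\<lambda>s. sup_norm (u s)) \<longlongrightarrow> sup_norm (u t)) (at t within Icl)"
    proof (rule LIM_zero_cancel, rule tendsto_0_le_eventually[OF sup_conv[OF t] refl ev])
      fix s assume s: "s \<in> Icl"
      have tri: "sup_norm f \<le> sup_norm g + sup_norm (\<lambda>x. h x)" if "g \<in> C0" "h \<in> C0" "\<And>x. cmod (f x) \<le> cmod (g x) + cmod (h x)" for f g h :: "'a \<Rightarrow> complex"
        unfolding sup_norm_def[of f]
        by (rule cSUP_least) (auto intro!: order_trans[OF that(3)] add_mono C0_le_sup_norm that)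
      have d: "(\<lambda>x. u s x - u t x) \<in> C0" by (intro C0_diff u_C0 s t)
      have "sup_norm (u s) \<le> sup_norm (u t) + sup_norm (\<lambda>x. u s x - u t x)"
        by (rule tri[OF u_C0[OF t] d]) (rule norm_triangle_sub)
      moreover have "sup_norm (u t) \<le> sup_norm (u s) + sup_norm (\<lambda>x. u s x - u t x)"
        by (rule tri[OF u_C0[OF s] d]) (subst norm_minus_commute, rule norm_triangle_sub)
      ultimately show "\<bar>sup_norm (u s) - sup_norm (u t)\<bar> \<le> sup_norm (\<lambda>x. u s x - u t x)" by linarith
    qed
  qed
  then have "bounded ((\<lambda>t. sup_norm (u t)) ` Icl)"
    by (intro compact_imp_bounded compact_continuous_image) auto
  then obtain B where B: "B > 0" "\<And>t. t \<in> Icl \<Longrightarrow> \<bar>sup_norm (u t)\<bar> \<le> B" by (auto simp: bounded_pos)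
  have "cmod (u t x) \<le> B" if "t \<in> Icl" for t x
    using C0_le_sup_norm[OF u_C0[OF that], of x] B(2)[OF that] by linarith
  then show ?thesis by blast
qed

lemma u_bounded: assumes "t \<in> Icl" obtains B where "\<And>x. cmod (u t x) \<le> B"
  using C0_le_sup_norm[OF u_C0[OF assms]] that by blast

lemma nl_u_L2: "t \<in> Icl \<Longrightarrow> (\<lambda>x. nl \<alpha> (u t x)) \<in> L2"
  by (rule u_bounded, assumption) (rule nl_L2[OF alpha u_L2])

lemma G_L2: "t \<in> Iop \<Longrightarrow> G t \<in> L2"
  unfolding G_def[abs_def] by (intro L2_add laplacian_L2 u_H2 nl_u_L2 Iop_Icl)

lemma v_eq: assumes t: "t \<in> Iop" shows "AE x in lborel. v t x = cis \<theta> * G t x"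
  using equation[OF t]
proof eventually_elim
  case (elim x)
  have "cis \<theta> * exp (- \<i> * of_real \<theta>) = 1"
    by (simp add: exp_minus cis_conv_exp[symmetric] cis_mult)
  then have "cis \<theta> * (exp (- \<i> * of_real \<theta>) * v t x) = v t x"
    by (simp only: mult.assoc[symmetric] mult_1)
  then show ?case unfolding elim by (simp add: G_def nl_def)
qed

lemma ip_v: assumes t: "t \<in> Iop" and w: "w \<in> L2"
  shows "ip w (v t) = cos \<theta> * ip w (G t) + sin \<theta> * ip w (\<lambda>x. \<i> * G t x)"
  using ip_cong_AE[OF w v_L2[OF t] w L2_cmult[OF G_L2[OF t]] _ v_eq[OF t]] ip_rot[OF w G_L2[OF t]] by simp

lemma norm_v: assumes t: "t \<in> Iop" shows "L2_norm (v t) = L2_norm (G t)"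
  using L2_norm_cong_AE[OF v_L2[OF t] L2_cmult[OF G_L2[OF t]] v_eq[OF t]] by simp

text \<open>\<open>G\<close> is orthogonal to i G, so rotating it by the angle \<theta> leaves the
  factor cos \<theta>.\<close>

lemma ip_G_v: assumes t: "t \<in> Iop" shows "ip (G t) (v t) = cos \<theta> * ip (v t) (v t)"
proof -
  have "ip (G t) (\<lambda>x. \<i> * G t x) = 0" by (simp add: ip_def)
  then show ?thesis using ip_v[OF t G_L2[OF t]] norm_v[OF t] by (simp add: L2_norm_sq[symmetric])
qed

text \<open>Letting \<open>W\<close> depend on \<open>s\<close> covers quadratic functionals such as \<open>grad\<close> that are not bounded on \<open>L\<^sup>2\<close>.\<close>

lemma functional_derivative:
  assumes t: "t \<in> Iop" and W: "L2_conv W w (at t)"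
    and F: "\<And>s. s \<in> Iop \<Longrightarrow> W s \<in> L2 \<Longrightarrow> \<bar>F s - F t - ip (\<lambda>x. u s x - u t x) (W s)\<bar> \<le> C * (L2_norm (\<lambda>x. u s x - u t x))\<^sup>2"
  shows "(F has_real_derivative ip (v t) w) (at t)"
  unfolding has_field_derivative_iff
proof -
  let ?q = "\<lambda>s x. (u s x - u t x) /\<^sub>R (s - t)"
  have "((\<lambda>s. \<bar>s - t\<bar>) \<longlongrightarrow> \<bar>t - t\<bar>) (at t)" by (intro tendsto_intros)
  then have 1: "((\<lambda>s. C * \<bar>s - t\<bar> * (L2_norm (?q s))\<^sup>2) \<longlongrightarrow> C * \<bar>t - t\<bar> * (L2_norm (v t))\<^sup>2) (at t)"
    by (intro tendsto_mult tendsto_power L2_conv_norm quotient_conv[OF t] tendsto_const)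
  have ev: "\<forall>\<^sub>F s in at t. s \<in> Iop \<and> W s \<in> L2 \<and> s \<noteq> t"
    using eventually_Iop[OF t] L2_convD(2)[OF W] by (auto simp: eventually_conj_iff eventually_at_filter)
  have "((\<lambda>s. (F s - F t) / (s - t) - ip (?q s) (W s)) \<longlongrightarrow> 0) (at t)"
  proof (rule tendsto_0_le_eventually[OF 1 _ ev])
    fix s assume s: "s \<in> Iop \<and> W s \<in> L2 \<and> s \<noteq> t"
    have "(F s - F t) / (s - t) - ip (?q s) (W s) = (F s - F t - ip (\<lambda>x. u s x - u t x) (W s)) / (s - t)"
      using s by (simp add: divide_inverse algebra_simps del: scaleR_right_diff_distrib)
    also have "\<bar>\<dots>\<bar> \<le> C * (L2_norm (\<lambda>x. u s x - u t x))\<^sup>2 / \<bar>s - t\<bar>"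
      unfolding abs_divide using s F[of s] by (intro divide_right_mono) auto
    also have "\<dots> = C * \<bar>s - t\<bar> * (L2_norm (?q s))\<^sup>2"
    proof -
      have "L2_norm (?q s) = L2_norm (\<lambda>x. u s x - u t x) / \<bar>s - t\<bar>"
        unfolding L2_norm_scaleR by (simp add: divide_inverse mult.commute)
      moreover have "C * d\<^sup>2 / h = C * h * (d / h)\<^sup>2" if "0 < h" for d h :: real
        using that by (simp add: power2_eq_square field_simps)
      ultimately show ?thesis using s by simp
    qed
    finally show "\<bar>(F s - F t) / (s - t) - ip (?q s) (W s)\<bar> \<le> C * \<bar>s - t\<bar> * (L2_norm (?q s))\<^sup>2" .
  qed simp
  from tendsto_add[OF this L2_conv_ip[OF quotient_conv[OF t] W]]
  show "((\<lambda>y. (F y - F t) / (y - t)) \<longlongrightarrow> ip (v t) w) (at t)" by simp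
qed

section \<open>Time derivatives of mass, gradient and potential terms\<close>

lemma u_conv_at: "t \<in> Iop \<Longrightarrow> L2_conv u (u t) (at t)"
  using u_conv[OF Iop_Icl] at_Iop by metis

lemma D_conv_at: "t \<in> Iop \<Longrightarrow> b \<in> Basis \<Longrightarrow> L2_conv (D b) (D b t) (at t)"
  using D_conv[OF Iop_Icl] at_Iop by metis

text \<open>Polarisation is exact: the increment is the pairing of u(s) - u(t) with p (u(s) + u(t)),
  so \<open>functional_derivative\<close> applies with error constant 0.\<close>

lemma weighted_mass_derivative:
  assumes t: "t \<in> Iop" and p: "p \<in> borel_measurable borel" "\<And>x. \<bar>p x\<bar> \<le> C"
  shows "((\<lambda>t. ip (\<lambda>x. p x *\<^sub>R u t x) (u t)) has_real_derivative 2 * ip (\<lambda>x. p x *\<^sub>R u t x) (v t)) (at t)"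
proof -
  note pL = L2_scaleR_bounded[OF _ p] and tc = Iop_Icl[OF t]
  have "((\<lambda>t. ip (\<lambda>x. p x *\<^sub>R u t x) (u t)) has_real_derivative ip (v t) (\<lambda>x. p x *\<^sub>R (u t x + u t x))) (at t)"
  proof (rule functional_derivative[OF t, where C=0])
    show "L2_conv (\<lambda>s x. p x *\<^sub>R (u s x + u t x)) (\<lambda>x. p x *\<^sub>R (u t x + u t x)) (at t)"
      by (intro L2_conv_scaleR_bounded[OF _ p] L2_conv_add u_conv_at t L2_conv_const u_L2 tc)
    fix s assume s: "s \<in> Iop"
    have L: "u s \<in> L2" "u t \<in> L2" using s t u_L2 Iop_Icl by auto
    have "ip (\<lambda>x. u s x - u t x) (\<lambda>x. p x *\<^sub>R (u s x + u t x)) =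
      (LINT x|lborel. (p x *\<^sub>R u s x) \<bullet> u s x - (p x *\<^sub>R u t x) \<bullet> u t x)"
      unfolding ip_def by (rule Bochner_Integration.integral_cong) (auto simp: inner_simps inner_commute algebra_simps)
    also have "\<dots> = ip (\<lambda>x. p x *\<^sub>R u s x) (u s) - ip (\<lambda>x. p x *\<^sub>R u t x) (u t)"
      unfolding ip_def by (intro Bochner_Integration.integral_diff integrable_ip pL L)
    finally show "\<bar>ip (\<lambda>x. p x *\<^sub>R u s x) (u s) - ip (\<lambda>x. p x *\<^sub>R u t x) (u t) -
       ip (\<lambda>x. u s x - u t x) (\<lambda>x. p x *\<^sub>R (u s x + u t x))\<bar> \<le> 0 * (L2_norm (\<lambda>x. u s x - u t x))\<^sup>2" by simp
  qed
  also have "ip (v t) (\<lambda>x. p x *\<^sub>R (u t x + u t x)) = 2 * ip (\<lambda>x. p x *\<^sub>R u t x) (v t)"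
  proof -
    have "(\<lambda>x. p x *\<^sub>R (u t x + u t x)) = (\<lambda>x. 2 *\<^sub>R (p x *\<^sub>R u t x))"
      by (simp add: scaleR_conv_of_real mult.left_commute)
    then show ?thesis by (simp only: ip_scaleR_right ip_commute[of "v t"])
  qed
  finally show ?thesis .
qed

lemma ip_D_diff:
  assumes "f \<in> L2" "g \<in> L2" shows "ip f f - ip g g = ip (\<lambda>x. f x + g x) (\<lambda>x. f x - g x)"
  using assms by (simp add: ip_add_left ip_diff_right L2_add L2_diff ip_commute[of f g])

text \<open>No time derivative of the gradient is available. Polarisation and one integration by
  parts express the increment as the pairing of u(s) - u(t) with -(\<Delta>u(s) + \<Delta>u(t)),
  which converges because the curve is continuous in H2.\<close>

lemma grad_derivative:
  assumes t: "t \<in> Iop" shows "(grad has_real_derivative - 2 * ip (v t) (laplacian (u t))) (at t)"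
proof -
  note tc = Iop_Icl[OF t]
  have "(grad has_real_derivative ip (v t) (\<lambda>x. - 1 * (laplacian (u t) x + laplacian (u t) x))) (at t)"
  proof (rule functional_derivative[OF t, where C=0])
    show "L2_conv (\<lambda>s x. - 1 * (laplacian (u s) x + laplacian (u t) x)) (\<lambda>x. - 1 * (laplacian (u t) x + laplacian (u t) x)) (at t)"
      by (intro L2_conv_cmult L2_conv_add laplacian_conv t L2_conv_const laplacian_L2 u_H2)
    fix s assume s: "s \<in> Iop"
    note sc = Iop_Icl[OF s]
    have L: "laplacian (u s) \<in> L2" "laplacian (u t) \<in> L2" "(\<lambda>x. u s x - u t x) \<in> L2"
      by (intro laplacian_L2 u_H2 s t L2_diff u_L2 sc tc)+
    have d: "has_weak_deriv (\<lambda>x. u s x - u t x) b (\<lambda>x. D b s x - D b t x)" if "b \<in> Basis" for b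
      by (intro has_weak_deriv_diff D_weak sc tc that)
    have "grad s - grad t = (\<Sum>b\<in>Basis. ip (D b s) (\<lambda>x. D b s x - D b t x)) + (\<Sum>b\<in>Basis. ip (D b t) (\<lambda>x. D b s x - D b t x))"
      unfolding grad_def sum_subtractf[symmetric] sum.distrib[symmetric]
    proof (rule sum.cong[OF refl])
      fix b :: 'a assume b: "b \<in> Basis"
      note L = D_L2[OF sc b] D_L2[OF tc b]
      show "ip (D b s) (D b s) - ip (D b t) (D b t) =
        ip (D b s) (\<lambda>x. D b s x - D b t x) + ip (D b t) (\<lambda>x. D b s x - D b t x)"
        unfolding ip_D_diff[OF L] by (rule ip_add_left[OF L L2_diff[OF L]])
    qed
    also have "\<dots> = - ip (laplacian (u s)) (\<lambda>x. u s x - u t x) - ip (laplacian (u t)) (\<lambda>x. u s x - u t x)"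
      by (simp add: ip_laplacian[OF u_H2[OF s] d] ip_laplacian[OF u_H2[OF t] d])
    also have "\<dots> = ip (\<lambda>x. u s x - u t x) (\<lambda>x. - 1 * (laplacian (u s) x + laplacian (u t) x))"
      using L by (simp add: ip_add_right ip_commute[of "laplacian _"] ip_diff_right del: minus_add_distrib) 
    finally show "\<bar>grad s - grad t - ip (\<lambda>x. u s x - u t x) (\<lambda>x. - 1 * (laplacian (u s) x + laplacian (u t) x))\<bar>
       \<le> 0 * (L2_norm (\<lambda>x. u s x - u t x))\<^sup>2" by simp
  qed
  also have "ip (v t) (\<lambda>x. - 1 * (laplacian (u t) x + laplacian (u t) x)) = - 2 * ip (v t) (laplacian (u t))"
  proof -
    have "(\<lambda>x. - 1 * (laplacian (u t) x + laplacian (u t) x)) = (\<lambda>x. (- 2) *\<^sub>R laplacian (u t) x)" by (simp add: scaleR_conv_of_real)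
    then show ?thesis by (simp only: ip_scaleR_right)
  qed
  finally show ?thesis .
qed

lemma pot_expansion:
  assumes B: "\<And>x. cmod (u t x) \<le> B" "\<And>x. cmod (u s x) \<le> B" and s: "s \<in> Icl" and t: "t \<in> Icl"
  shows "\<bar>pot s - pot t - ip (\<lambda>x. u s x - u t x) (\<lambda>x. (\<alpha> + 2) *\<^sub>R nl \<alpha> (u t x))\<bar>
    \<le> (\<alpha> + 2) * ((1 + \<alpha>) * B powr \<alpha>) * (L2_norm (\<lambda>x. u s x - u t x))\<^sup>2"
proof -
  have L: "u s \<in> L2" "u t \<in> L2" by (intro u_L2 s t)+
  have P: "integrable lborel (\<lambda>x. cmod (u s x) powr (\<alpha> + 2))" "integrable lborel (\<lambda>x. cmod (u t x) powr (\<alpha> + 2))"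
    by (rule integrable_powr_norm[OF alpha L(1) B(2)], rule integrable_powr_norm[OF alpha L(2) B(1)])
  have I: "integrable lborel (\<lambda>x. (u s x - u t x) \<bullet> ((\<alpha> + 2) *\<^sub>R nl \<alpha> (u t x)))"
    by (intro integrable_ip L2_diff L L2_scaleR nl_u_L2 t)
  have "\<bar>pot s - pot t - ip (\<lambda>x. u s x - u t x) (\<lambda>x. (\<alpha> + 2) *\<^sub>R nl \<alpha> (u t x))\<bar> =
    \<bar>LINT x|lborel. cmod (u s x) powr (\<alpha> + 2) - cmod (u t x) powr (\<alpha> + 2) - (u s x - u t x) \<bullet> ((\<alpha> + 2) *\<^sub>R nl \<alpha> (u t x))\<bar>"
    unfolding pot_def ip_def using P I by simp
  also have "\<dots> \<le> (LINT x|lborel. \<bar>cmod (u s x) powr (\<alpha> + 2) - cmod (u t x) powr (\<alpha> + 2) - (u s x - u t x) \<bullet> ((\<alpha> + 2) *\<^sub>R nl \<alpha> (u t x))\<bar>)"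
    by (rule integral_abs_bound)
  also have "\<dots> \<le> (LINT x|lborel. (\<alpha> + 2) * ((1 + \<alpha>) * B powr \<alpha>) * (cmod (u s x - u t x))\<^sup>2)"
  proof (rule integral_mono)
    show "integrable lborel (\<lambda>x. (\<alpha> + 2) * ((1 + \<alpha>) * B powr \<alpha>) * (cmod (u s x - u t x))\<^sup>2)"
      using L2_integrable[OF L2_diff[OF L]] by simp
    show "\<bar>cmod (u s x) powr (\<alpha> + 2) - cmod (u t x) powr (\<alpha> + 2) - (u s x - u t x) \<bullet> ((\<alpha> + 2) *\<^sub>R nl \<alpha> (u t x))\<bar>
      \<le> (\<alpha> + 2) * ((1 + \<alpha>) * B powr \<alpha>) * (cmod (u s x - u t x))\<^sup>2" for x
      using powr_norm_gap[OF alpha B(2) B(1), of x x] by (simp add: inner_commute)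
  qed (use P I in simp)
  also have "\<dots> = (\<alpha> + 2) * ((1 + \<alpha>) * B powr \<alpha>) * (L2_norm (\<lambda>x. u s x - u t x))\<^sup>2"
    by (simp add: L2_norm_def)
  finally show ?thesis .
qed

lemma pot_derivative:
  assumes t: "t \<in> Iop" shows "(pot has_real_derivative (\<alpha> + 2) * ip (v t) (\<lambda>x. nl \<alpha> (u t x))) (at t)"
proof -
  obtain B where B: "\<And>t x. t \<in> Icl \<Longrightarrow> cmod (u t x) \<le> B" using bounded_u by blast
  have "(pot has_real_derivative ip (v t) (\<lambda>x. (\<alpha> + 2) *\<^sub>R nl \<alpha> (u t x))) (at t)"
  proof (rule functional_derivative[OF t])
    show "L2_conv (\<lambda>s x. (\<alpha> + 2) *\<^sub>R nl \<alpha> (u t x)) (\<lambda>x. (\<alpha> + 2) *\<^sub>R nl \<alpha> (u t x)) (at t)"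
      by (intro L2_conv_const L2_scaleR nl_u_L2 Iop_Icl t)
    fix s assume "s \<in> Iop"
    then show "\<bar>pot s - pot t - ip (\<lambda>x. u s x - u t x) (\<lambda>x. (\<alpha> + 2) *\<^sub>R nl \<alpha> (u t x))\<bar>
      \<le> (\<alpha> + 2) * ((1 + \<alpha>) * B powr \<alpha>) * (L2_norm (\<lambda>x. u s x - u t x))\<^sup>2"
      using pot_expansion[of t B s] B t Iop_Icl by blast
  qed
  then show ?thesis by (simp only: ip_scaleR_right)
qed

lemma grad_continuous: "continuous_on Icl grad"
  unfolding continuous_on_def grad_def by (intro ballI tendsto_sum L2_conv_ip D_conv)

lemma weighted_mass_continuous:
  assumes p: "p \<in> borel_measurable borel" "\<And>x. \<bar>p x\<bar> \<le> C"
  shows "continuous_on Icl (\<lambda>t. ip (\<lambda>x. p x *\<^sub>R u t x) (u t))"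
  unfolding continuous_on_def by (intro ballI L2_conv_ip L2_conv_scaleR_bounded[OF _ p] u_conv)

lemma mass_continuous: "continuous_on Icl mass"
  unfolding continuous_on_def mass_def[abs_def] by (intro ballI L2_conv_ip u_conv)

lemma pot_continuous: "continuous_on Icl pot"
  unfolding continuous_on_def
proof
  fix t assume t: "t \<in> Icl"
  obtain B where B: "\<And>t x. t \<in> Icl \<Longrightarrow> cmod (u t x) \<le> B" using bounded_u by blast
  let ?n = "\<lambda>s. L2_norm (\<lambda>x. u s x - u t x)" and ?w = "\<lambda>x. (\<alpha> + 2) *\<^sub>R nl \<alpha> (u t x)"
  let ?C = "(\<alpha> + 2) * ((1 + \<alpha>) * B powr \<alpha>)"
  have lim: "((\<lambda>s. ?C * (?n s)\<^sup>2 + ?n s * L2_norm ?w) \<longlongrightarrow> ?C * 0\<^sup>2 + 0 * L2_norm ?w) (at t within Icl)"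
    using u_conv[OF t] by (intro tendsto_intros) (auto simp: L2_conv_def)
  have ev: "\<forall>\<^sub>F s in at t within Icl. s \<in> Icl" by (auto simp: eventually_at_filter)
  show "(pot \<longlongrightarrow> pot t) (at t within Icl)"
  proof (rule LIM_zero_cancel, rule tendsto_0_le_eventually[OF lim _ ev])
    fix s assume s: "s \<in> Icl"
    have "\<bar>ip (\<lambda>x. u s x - u t x) ?w\<bar> \<le> ?n s * L2_norm ?w"
      by (intro ip_Cauchy_Schwarz L2_diff u_L2 s t L2_scaleR nl_u_L2)
    moreover have "\<bar>pot s - pot t - ip (\<lambda>x. u s x - u t x) ?w\<bar> \<le> ?C * (?n s)\<^sup>2"
      by (rule pot_expansion) (use B s t in auto)
    ultimately show "\<bar>pot s - pot t\<bar> \<le> ?C * (?n s)\<^sup>2 + ?n s * L2_norm ?w" by linarith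
  qed simp
qed

lemma mass_derivative:
  assumes t: "t \<in> Iop" shows "(mass has_real_derivative 2 * ip (u t) (v t)) (at t)"
  using weighted_mass_derivative[OF t, of "\<lambda>x. 1" 1] by (simp add: mass_def[abs_def])

lemma ip_u_G: assumes t: "t \<in> Iop" shows "ip (u t) (G t) = pot t - grad t"
proof -
  have "ip (u t) (G t) = ip (laplacian (u t)) (u t) + ip (\<lambda>x. nl \<alpha> (u t x)) (u t)"
    unfolding G_def[abs_def] by (subst ip_add_right) (auto intro!: u_L2 laplacian_L2 u_H2 nl_u_L2 Iop_Icl t simp: ip_commute)
  also have "ip (laplacian (u t)) (u t) = - grad t"
    unfolding grad_def by (intro ip_laplacian u_H2 t D_weak Iop_Icl)
  also have "ip (\<lambda>x. nl \<alpha> (u t x)) (u t) = pot t" by (simp add: ip_def pot_def nl_inner[OF alpha])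
  finally show ?thesis by simp
qed

text \<open>Gauge invariance: both the Dirichlet form and the nonlinearity pair to zero with i
  u.\<close>

lemma ip_u_iG: assumes t: "t \<in> Iop" shows "ip (u t) (\<lambda>x. \<i> * G t x) = 0"
proof -
  have iu: "has_weak_deriv (\<lambda>x. \<i> * u t x) b (\<lambda>x. \<i> * D b t x)" if "b \<in> Basis" for b
    by (intro has_weak_deriv_cmult D_weak Iop_Icl t that)
  have "ip (u t) (\<lambda>x. \<i> * G t x) = - ip (G t) (\<lambda>x. \<i> * u t x)" using ip_ii[of "G t" "u t"] ip_commute by metis
  also have "ip (G t) (\<lambda>x. \<i> * u t x) = ip (laplacian (u t)) (\<lambda>x. \<i> * u t x) + ip (\<lambda>x. nl \<alpha> (u t x)) (\<lambda>x. \<i> * u t x)"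
    unfolding G_def[abs_def] by (intro ip_add_left laplacian_L2 u_H2 nl_u_L2 Iop_Icl t L2_cmult u_L2)
  also have "ip (laplacian (u t)) (\<lambda>x. \<i> * u t x) = 0"
    by (subst ip_laplacian[OF u_H2[OF t] iu]) (simp_all add: ip_def)
  also have "ip (\<lambda>x. nl \<alpha> (u t x)) (\<lambda>x. \<i> * u t x) = 0"
    by (simp add: ip_def nl_def flip: scaleR_conv_of_real)
  finally show ?thesis by simp
qed

lemma ip_u_v: "t \<in> Iop \<Longrightarrow> ip (u t) (v t) = cos \<theta> * (pot t - grad t)"
  by (simp add: ip_v ip_u_G ip_u_iG u_L2)

text \<open>Cauchy-Schwarz is applied to \<open>G\<close>, whose norm is that of \<open>v\<close>.
  Applied to \<open>v\<close> directly it would cost a factor 1 / cos \<theta>; the concavity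
  argument is uniform in \<theta> thanks to this.\<close>

lemma pot_grad_le: assumes t: "t \<in> Iop" shows "\<bar>pot t - grad t\<bar> \<le> L2_norm (u t) * L2_norm (v t)"
  using ip_Cauchy_Schwarz[OF u_L2[OF Iop_Icl[OF t]] G_L2[OF t]] ip_u_G[OF t] norm_v[OF t] by simp

lemma energy_eq: assumes t: "t \<in> Icl" shows "energy \<alpha> (u t) = 1 / 2 * grad t - 1 / (\<alpha> + 2) * pot t"
proof -
  have "(LINT x|lborel. (\<Sum>b\<in>Basis. (cmod (D b t x))\<^sup>2)) = grad t"
    unfolding grad_def ip_def power2_norm_eq_inner
    by (rule Bochner_Integration.integral_sum) (intro integrable_ip D_L2 t)
  then show ?thesis by (simp add: energy_def pot_def)
qed

text \<open>Minus the energy: it is positive and nondecreasing along the solutions of interest.\<close>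

definition neg_energy :: "real \<Rightarrow> real" where "neg_energy t = 1 / (\<alpha> + 2) * pot t - 1 / 2 * grad t"

lemma neg_energy_derivative:
  assumes t: "t \<in> Iop" shows "(neg_energy has_real_derivative cos \<theta> * ip (v t) (v t)) (at t)"
proof -
  have "(neg_energy has_real_derivative 1 / (\<alpha> + 2) * ((\<alpha> + 2) * ip (v t) (\<lambda>x. nl \<alpha> (u t x))) - 1 / 2 * (- 2 * ip (v t) (laplacian (u t)))) (at t)"
    unfolding neg_energy_def[abs_def] by (intro DERIV_diff DERIV_cmult pot_derivative grad_derivative t)
  also have "1 / (\<alpha> + 2) * ((\<alpha> + 2) * ip (v t) (\<lambda>x. nl \<alpha> (u t x))) - 1 / 2 * (- 2 * ip (v t) (laplacian (u t))) =
      ip (v t) (laplacian (u t)) + ip (v t) (\<lambda>x. nl \<alpha> (u t x))"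
    using alpha by (simp add: field_simps)
  also have "\<dots> = ip (v t) (G t)"
    unfolding G_def[abs_def] by (intro ip_add_right[symmetric] v_L2 laplacian_L2 u_H2 nl_u_L2 Iop_Icl t)
  also have "\<dots> = cos \<theta> * ip (v t) (v t)" using ip_G_v[OF t] by (simp add: ip_commute)
  finally show ?thesis .
qed

lemma neg_energy_continuous: "continuous_on Icl neg_energy"
  unfolding neg_energy_def[abs_def] by (intro continuous_intros pot_continuous grad_continuous)

text \<open>Gronwall's inequality for \<open>u \<circ> S - u\<close>.\<close>

theorem reflection_invariant:
  assumes S: "reflection S" and u0: "\<And>x. u 0 (S x) = u 0 x" and t: "t \<in> Iop"
  shows "u t (S x) = u t x"
proof -
  interpret reflection S by (rule S)
  let ?w = "\<lambda>t x. u t (S x) - u t x"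
  let ?y = "\<lambda>t. ip (?w t) (?w t)"
  obtain B where B: "\<And>t x. t \<in> Icl \<Longrightarrow> cmod (u t x) \<le> B" using bounded_u by blast
  define K where "K = 2 * ((1 + \<alpha>) * B powr \<alpha>)"
  have wL: "?w s \<in> L2" if "s \<in> Icl" for s by (intro L2_diff L2_S u_L2 that)
  have eq: "?y s = 2 * mass s - 2 * ip (\<lambda>x. u s (S x)) (u s)" if s: "s \<in> Icl" for s
    using ip_diff_self[OF L2_S[OF u_L2[OF s]] u_L2[OF s]] ip_S[OF u_L2[OF s] u_L2[OF s]]
      ip_commute[of "u s" "\<lambda>x. u s (S x)"] by (simp add: mass_def)
  have Sconv: "L2_conv (\<lambda>s x. u s (S x)) (\<lambda>x. u r (S x)) net" if "L2_conv u (u r) net" for r net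
  proof -
    have n: "L2_norm (\<lambda>x. f (S x)) = L2_norm f" if "f \<in> L2" for f
      using ip_S[OF that that] by (metis L2_norm_sq L2_norm_nonneg power2_eq_imp_eq)
    have "\<forall>\<^sub>F s in net. L2_norm (\<lambda>x. u s x - u r x) = L2_norm (\<lambda>x. u s (S x) - u r (S x))"
      using L2_convD(2)[OF that]
    proof eventually_elim
      case (elim s)
      show ?case using n[OF L2_diff[OF elim L2_convD(1)[OF that]]] by simp
    qed
    then show ?thesis using that
      by (auto simp: L2_conv_def elim: Lim_transform_eventually eventually_mono)
  qed
  have ycont: "continuous_on Icl ?y"
    unfolding continuous_on_def by (intro ballI L2_conv_ip L2_conv_diff Sconv u_conv)
  have yderiv: "(?y has_real_derivative 2 * ip (?w r) (\<lambda>x. v r (S x) - v r x)) (at r)" if r: "r \<in> Iop" for r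
  proof -
    note rc = Iop_Icl[OF r]
    \<comment> \<open>Since \<open>S\<close> can be moved between the factors of \<open>ip\<close>,
      this quadratic functional polarises exactly and the cross terms cancel.\<close>
    have "((\<lambda>s. ip (\<lambda>x. u s (S x)) (u s)) has_real_derivative ip (v r) (\<lambda>x. u r (S x) + u r (S x))) (at r)"
    proof (rule functional_derivative[OF r, where C=0])
      show "L2_conv (\<lambda>s x. u s (S x) + u r (S x)) (\<lambda>x. u r (S x) + u r (S x)) (at r)"
        by (intro L2_conv_add L2_conv_const Sconv u_conv_at r L2_S u_L2 rc)
      fix s assume s: "s \<in> Iop"
      have L: "u s \<in> L2" "u r \<in> L2" "(\<lambda>x. u s (S x)) \<in> L2" "(\<lambda>x. u r (S x)) \<in> L2" using s r by (auto intro!: u_L2)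
      have "ip (\<lambda>x. u s x - u r x) (\<lambda>x. u s (S x) + u r (S x)) =
        ip (\<lambda>x. u s (S x)) (u s) - ip (\<lambda>x. u r (S x)) (u r)"
        using L ip_S'[OF L(1,2)] ip_commute[of "\<lambda>x. u s (S x)" "u s"] ip_commute[of "\<lambda>x. u s (S x)" "u r"]
          ip_commute[of "\<lambda>x. u r (S x)" "u r"]
        by (simp add: ip_diff_left ip_add_right L2_add)
      then show "\<bar>ip (\<lambda>x. u s (S x)) (u s) - ip (\<lambda>x. u r (S x)) (u r) - ip (\<lambda>x. u s x - u r x) (\<lambda>x. u s (S x) + u r (S x))\<bar>
        \<le> 0 * (L2_norm (\<lambda>x. u s x - u r x))\<^sup>2" by simp
    qed
    then have "((\<lambda>s. 2 * mass s - 2 * ip (\<lambda>x. u s (S x)) (u s)) has_real_derivative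
       2 * (2 * ip (u r) (v r)) - 2 * ip (v r) (\<lambda>x. u r (S x) + u r (S x))) (at r)"
      by (intro DERIV_diff DERIV_cmult mass_derivative r)
    moreover have "\<forall>\<^sub>F s in nhds r. ?y s = 2 * mass s - 2 * ip (\<lambda>x. u s (S x)) (u s)"
      using eventually_nhds_in_open[of Iop r] r by (auto intro!: eq elim!: eventually_mono)
    ultimately have "(?y has_real_derivative
       2 * (2 * ip (u r) (v r)) - 2 * ip (v r) (\<lambda>x. u r (S x) + u r (S x))) (at r)"
      by (subst DERIV_cong_ev[OF refl _ refl])
    also have "2 * (2 * ip (u r) (v r)) - 2 * ip (v r) (\<lambda>x. u r (S x) + u r (S x)) = 2 * ip (?w r) (\<lambda>x. v r (S x) - v r x)"
      using u_L2[OF rc] v_L2[OF r] ip_S[OF u_L2[OF rc] v_L2[OF r]] ip_S'[OF u_L2[OF rc] v_L2[OF r]]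
        ip_commute[of "v r" "\<lambda>x. u r (S x)"] ip_add_right[OF v_L2[OF r] L2_S[OF u_L2[OF rc]] L2_S[OF u_L2[OF rc]]]
      by (simp add: ip_diff_left ip_diff_right L2_S L2_diff)
    finally show ?thesis .
  qed
  have ybound: "2 * ip (?w r) (\<lambda>x. v r (S x) - v r x) \<le> K * ?y r" if r: "r \<in> Iop" for r
  proof -
    note rc = Iop_Icl[OF r]
    let ?L = "\<lambda>x. cis \<theta> * (laplacian (u r) (S x) - laplacian (u r) x)"
    let ?N = "\<lambda>x. cis \<theta> * (nl \<alpha> (u r (S x)) - nl \<alpha> (u r x))"
    have LL: "?L \<in> L2" "?N \<in> L2" by (intro L2_cmult L2_diff L2_S laplacian_L2 u_H2 r nl_u_L2 rc)+
    have "AE x in lborel. v r (S x) - v r x = ?L x + ?N x"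
      using v_eq[OF r] AE_S[OF v_eq[OF r]] by eventually_elim (simp add: G_def algebra_simps)
    then have "ip (?w r) (\<lambda>x. v r (S x) - v r x) = ip (?w r) (\<lambda>x. ?L x + ?N x)"
      by (intro ip_cong_AE wL rc L2_diff L2_S v_L2 r L2_add LL) auto
    also have "\<dots> = ip (?w r) ?L + ip (?w r) ?N" by (intro ip_add_right wL rc LL)
    finally have split: "ip (?w r) (\<lambda>x. v r (S x) - v r x) = ip (?w r) ?L + ip (?w r) ?N" .
    have lap: "ip (?w r) ?L \<le> 0" by (rule laplacian_dissipative[OF u_H2[OF r]]) (use cos_pos in simp)
    have "L2_norm ?N \<le> (1 + \<alpha>) * B powr \<alpha> * L2_norm (?w r)"
    proof (rule L2_norm_mono[OF wL[OF rc]])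
      show "?N \<in> borel_measurable borel" using LL(2) by (rule L2_measurable)
      show "AE x in lborel. cmod (?N x) \<le> (1 + \<alpha>) * B powr \<alpha> * cmod (?w r x)"
        using nl_lipschitz[OF alpha B[OF rc] B[OF rc]] by (simp add: norm_mult)
    qed (use alpha in simp)
    then have "L2_norm (?w r) * L2_norm ?N \<le> L2_norm (?w r) * ((1 + \<alpha>) * B powr \<alpha> * L2_norm (?w r))"
      by (rule mult_left_mono) simp
    also have "\<dots> = (1 + \<alpha>) * B powr \<alpha> * ?y r"
      by (simp add: L2_norm_sq[symmetric] power2_eq_square)
    finally show ?thesis
      using split lap ip_Cauchy_Schwarz[OF wL[OF rc] LL(2)] by (simp add: K_def)
  qed
  have "?y t \<le> 0"
  proof -
    let ?z = "\<lambda>s. ?y s * exp (- K * s)"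
    have "?z t \<le> ?z 0"
    proof (rule DERIV_nonpos_imp_decreasing_open[of 0 t ?z])
      fix r assume "0 < r" "r < t"
      then have r: "r \<in> Iop" using t by auto
      have "(?z has_real_derivative 2 * ip (?w r) (\<lambda>x. v r (S x) - v r x) * exp (- K * r) + exp (- K * r) * (- K) * ?y r) (at r)"
        by (rule derivative_eq_intros yderiv r refl | simp)+
      moreover have "2 * ip (?w r) (\<lambda>x. v r (S x) - v r x) * exp (- K * r) + exp (- K * r) * (- K) * ?y r \<le> 0"
      proof -
        have "(2 * ip (?w r) (\<lambda>x. v r (S x) - v r x)) * exp (- K * r) \<le> (K * ?y r) * exp (- K * r)"
          by (rule mult_right_mono[OF ybound[OF r]]) simp
        then show ?thesis by (simp add: mult_ac)
      qed
      ultimately show "\<exists>y. (?z has_real_derivative y) (at r) \<and> y \<le> 0" by blast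
    next
      show "continuous_on {0..t} ?z"
        using t by (intro continuous_intros continuous_on_subset[OF ycont]) auto
    qed (use t in auto)
    also have "?z 0 = 0" using u0 by (simp add: ip_def)
    finally show ?thesis by (simp add: mult_le_0_iff)
  qed
  then have "L2_norm (?w t) = 0" using ip_nonneg[of "?w t"] by (simp add: L2_norm_sq[symmetric])
  then have ae: "AE x in lborel. ?w t x = 0" by (intro L2_norm_eq_0 wL Iop_Icl t)
  have cont: "continuous_on UNIV (u t)" using u_C0[OF Iop_Icl[OF t]] by (simp add: C0_def)
  have wc: "continuous_on UNIV (?w t)"
    by (intro continuous_intros cont continuous_on_compose2[OF cont] linear_continuous_on bounded_linear_S) auto
  \<comment> \<open>By continuity the set where the reflected solution differs is open. An open null
    set is empty, which upgrades the equality from almost every point to every point.\<close>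
  have op: "open {x. ?w t x \<noteq> 0}"
    using open_vimage[OF open_Compl[OF closed_singleton[of 0]] wc] by (simp add: vimage_def)
  have ng: "negligible {x. ?w t x \<noteq> 0}"
  proof -
    obtain N where N: "{x \<in> space lborel. \<not> ?w t x = 0} \<subseteq> N" "emeasure lborel N = 0" "N \<in> sets lborel"
      using AE_E[OF ae] .
    then have "negligible N"
      by (auto simp: negligible_iff_null_sets intro!: null_sets_completionI)
    then show ?thesis by (rule negligible_subset) (use N in simp)
  qed
  have E: "{x. ?w t x \<noteq> 0} = {}"
  proof (rule ccontr)
    assume "{x. ?w t x \<noteq> 0} \<noteq> {}"
    from open_not_negligible[OF op this] ng show False by (rule notE)
  qed
  have "x \<notin> {x. ?w t x \<noteq> 0}" by (subst E) (rule notI, erule emptyE)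
  then show ?thesis by simp
qed

corollary radial:
  assumes "radially_symmetric (u 0)" "t \<in> Iop" "norm x = norm y" shows "u t x = u t y"
proof (cases "x = y")
  case False
  then obtain S where S: "reflection S" "S x = y" using householder[OF assms(3)] by blast
  interpret reflection S by (rule S)
  have "u 0 (S z) = u 0 z" for z
    using assms(1) norm_S[of z] unfolding radially_symmetric_def by blast
  from reflection_invariant[OF S(1) this assms(2), of x] show ?thesis using S(2) by simp
qed simp

end

section \<open>The truncated virial weight\<close>

definition rmp :: "real \<Rightarrow> real" where "rmp s = max 0 (s - 1)"

text \<open>The virial weight is \<open>\<psi>(x) = R\<^sup>2 vG(|x|\<^sup>2/R\<^sup>2)\<close>; it equals \<open>|x|\<^sup>2\<close> plus a constant for \<open>|x| \<le> R\<close>, and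
  \<open>vG\<close>' = \<open>vg\<close>, \<open>vg\<close>' = \<open>vg1\<close>, \<open>vg1\<close>' = \<open>vg2\<close>. The function \<open>veta\<close>, with derivative \<open>veta1\<close>, measures the
  deficit of \<open>\<psi>\<close> from \<open>|x|\<^sup>2\<close>.\<close>

definition vg :: "real \<Rightarrow> real" where "vg s = 1 / (1 + rmp s ^ 5)"
definition vg1 :: "real \<Rightarrow> real" where "vg1 s = - 5 * rmp s ^ 4 / (1 + rmp s ^ 5)\<^sup>2"
definition vg2 :: "real \<Rightarrow> real" where "vg2 s = (30 * rmp s ^ 8 - 20 * rmp s ^ 3) / (1 + rmp s ^ 5) ^ 3"
definition vG :: "real \<Rightarrow> real" where "vG s = integral {-1..s} vg"
definition veta :: "real \<Rightarrow> real" where "veta s = (rmp s)\<^sup>2 / (1 + (rmp s)\<^sup>2)"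
definition veta1 :: "real \<Rightarrow> real" where "veta1 s = 2 * rmp s / (1 + (rmp s)\<^sup>2)\<^sup>2"

lemma rmp_nonneg [simp]: "0 \<le> rmp s"
  by (simp add: rmp_def)

text \<open>The kink of \<open>rmp\<close> at 1 is removed by composing with a function whose
  derivative vanishes at 0: the quotient is 0 from the left and that of \<open>f\<close> from the
  right. One formula in \<open>rmp s\<close> then serves on both sides.\<close>

lemma DERIV_rmp:
  assumes D: "(f has_real_derivative f' (rmp s)) (at (rmp s))" and 0: "f' 0 = 0"
  shows "((\<lambda>s. f (rmp s)) has_real_derivative f' (rmp s)) (at s)"
proof (rule linorder_cases[of s 1])
  assume s: "s < 1"
  have "\<forall>\<^sub>F x in nhds s. f (rmp x) = f 0"
    using order_tendstoD(2)[OF filterlim_ident[of "nhds s"] s] by eventually_elim (simp add: rmp_def)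
  then show ?thesis using s 0
    by (subst DERIV_cong_ev[OF refl _ refl, where g="\<lambda>_. f 0"]) (auto simp: rmp_def)
next
  assume s: "1 < s"
  have ev: "\<forall>\<^sub>F x in nhds s. f (rmp x) = f (x - 1)"
    using order_tendstoD(1)[OF filterlim_ident[of "nhds s"] s] by eventually_elim (simp add: rmp_def)
  have "((\<lambda>x. f (x - 1)) has_real_derivative f' (rmp s) * 1) (at s)"
    using D s by (intro DERIV_chain2[where f=f]) (auto simp: rmp_def intro!: derivative_eq_intros)
  then show ?thesis by (subst DERIV_cong_ev[OF refl ev refl]) simp
next
  assume s: "s = 1"
  have "((\<lambda>h. (f h - f 0) / h) \<longlongrightarrow> 0) (at 0)"
    using D 0 s by (simp add: DERIV_def rmp_def)
  then have lim: "((\<lambda>h. \<bar>(f h - f 0) / h\<bar>) \<longlongrightarrow> 0) (at 0)"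
    by (rule tendsto_rabs_zero)
  have "((\<lambda>h. (f (rmp (1 + h)) - f 0) / h) \<longlongrightarrow> 0) (at 0)"
    by (rule tendsto_0_le_eventually[OF lim refl, where Q="\<lambda>_. True"])
      (auto simp: rmp_def max_def divide_nonneg_neg not_le)
  then show ?thesis using s 0 by (simp add: DERIV_def rmp_def)
qed

lemma one_add_pow_pos [simp]: "0 < 1 + rmp s ^ n" "1 + rmp s ^ n \<noteq> 0"
  using zero_le_power[OF rmp_nonneg, of s n] by linarith+

lemma DERIV_vg: "(vg has_real_derivative vg1 s) (at s)"
proof -
  let ?f' = "\<lambda>q::real. - 5 * q ^ 4 / (1 + q ^ 5)\<^sup>2"
  have "((\<lambda>q. 1 / (1 + q ^ 5)) has_real_derivative ?f' (rmp s)) (at (rmp s))"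
    by (auto intro!: derivative_eq_intros simp: power2_eq_square)
  from DERIV_rmp[where f'="?f'", OF this] show ?thesis by (simp add: vg_def[abs_def] vg1_def)
qed

lemma DERIV_vg1: "(vg1 has_real_derivative vg2 s) (at s)"
proof -
  let ?f' = "\<lambda>q::real. (30 * q ^ 8 - 20 * q ^ 3) / (1 + q ^ 5) ^ 3"
  let ?q = "rmp s"
  have "((\<lambda>q. - 5 * q ^ 4 / (1 + q ^ 5)\<^sup>2) has_real_derivative
     ((- 20 * ?q ^ 3) * (1 + ?q ^ 5)\<^sup>2 - (- 5 * ?q ^ 4) * (2 * (1 + ?q ^ 5) * (5 * ?q ^ 4))) / ((1 + ?q ^ 5)\<^sup>2 * (1 + ?q ^ 5)\<^sup>2)) (at ?q)"
  proof (rule DERIV_divide)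
    show "((\<lambda>q. - 5 * q ^ 4) has_real_derivative - 20 * ?q ^ 3) (at ?q)"
      by (auto intro!: derivative_eq_intros)
    show "((\<lambda>q. (1 + q ^ 5)\<^sup>2) has_real_derivative 2 * (1 + ?q ^ 5) * (5 * ?q ^ 4)) (at ?q)"
      by (auto intro!: derivative_eq_intros)
  qed simp
  also have "((- 20 * ?q ^ 3) * (1 + ?q ^ 5)\<^sup>2 - (- 5 * ?q ^ 4) * (2 * (1 + ?q ^ 5) * (5 * ?q ^ 4))) / ((1 + ?q ^ 5)\<^sup>2 * (1 + ?q ^ 5)\<^sup>2)
      = ?f' ?q"
  proof -
    have k: "((- 20 * q ^ 3) * p\<^sup>2 - (- 5 * q ^ 4) * (2 * p * (5 * q ^ 4))) / (p\<^sup>2 * p\<^sup>2) = ((- 20 * q ^ 3) * p + 50 * q ^ 8) / p ^ 3"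
      if "p \<noteq> 0" for p q :: real
      using that by (simp add: divide_simps) (simp add: algebra_simps eval_nat_numeral)
    show ?thesis by (simp only: k[OF one_add_pow_pos(2)]) (simp add: algebra_simps flip: power_add)
  qed
  finally have "((\<lambda>q. - 5 * q ^ 4 / (1 + q ^ 5)\<^sup>2) has_real_derivative ?f' ?q) (at ?q)" .
  from DERIV_rmp[where f'="?f'", OF this] show ?thesis by (simp add: vg1_def[abs_def] vg2_def)
qed

lemma DERIV_veta: "(veta has_real_derivative veta1 s) (at s)"
proof -
  let ?f' = "\<lambda>q::real. 2 * q / (1 + q\<^sup>2)\<^sup>2"
  have "((\<lambda>q. q\<^sup>2 / (1 + q\<^sup>2)) has_real_derivative ?f' (rmp s)) (at (rmp s))"
  proof -
    let ?q = "rmp s"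
    have "((\<lambda>q. q\<^sup>2 / (1 + q\<^sup>2)) has_real_derivative
      (2 * ?q * (1 + ?q\<^sup>2) - ?q\<^sup>2 * (2 * ?q)) / ((1 + ?q\<^sup>2) * (1 + ?q\<^sup>2))) (at ?q)"
      by (rule DERIV_divide) (auto intro!: derivative_eq_intros)
    then show ?thesis by (simp add: algebra_simps flip: power2_eq_square)
  qed
  from DERIV_rmp[where f'="?f'", OF this] show ?thesis by (simp add: veta_def[abs_def] veta1_def)
qed

lemma v_measurable [measurable]:
  "vg \<in> borel_measurable borel" "vg1 \<in> borel_measurable borel" "vg2 \<in> borel_measurable borel"
  "veta \<in> borel_measurable borel" "veta1 \<in> borel_measurable borel"
proof -
  have [measurable]: "rmp \<in> borel_measurable borel" unfolding rmp_def[abs_def] by measurable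
  show "vg \<in> borel_measurable borel" "vg1 \<in> borel_measurable borel" "vg2 \<in> borel_measurable borel"
    "veta \<in> borel_measurable borel" "veta1 \<in> borel_measurable borel"
    unfolding vg_def[abs_def] vg1_def[abs_def] vg2_def[abs_def] veta_def[abs_def] veta1_def[abs_def] by measurable
qed

lemma vg_range: "0 \<le> vg s" "vg s \<le> 1"
  by (auto simp: vg_def divide_le_eq)

lemma vg1_nonpos: "vg1 s \<le> 0"
  by (simp add: vg1_def)

lemma veta_range: "0 \<le> veta s" "veta s \<le> 1"
  by (auto simp: veta_def divide_le_eq)

lemma veta1_nonneg: "0 \<le> veta1 s"
  by (simp add: veta1_def)

lemma v_zero: assumes "s \<le> 1" shows "veta s = 0" "veta1 s = 0"
proof -
  have "rmp s = 0" using assms by (simp add: rmp_def)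
  then show "veta s = 0" "veta1 s = 0" by (simp_all add: veta_def veta1_def)
qed

lemma pow_le_one_add: "0 \<le> q \<Longrightarrow> m \<le> n \<Longrightarrow> q ^ m \<le> 1 + (q :: real) ^ n"
proof (cases "q \<le> 1")
  assume "0 \<le> q" "q \<le> 1"
  then show ?thesis using power_le_one[of q m] zero_le_power[of q n] by linarith
next
  assume "m \<le> n" "\<not> q \<le> 1"
  then show ?thesis using power_increasing[of m n q] by linarith
qed

text \<open>Integration starts at -1 so that \<open>vG\<close> is differentiable from both sides at
  s = 0, the value of \<open>rad\<close> at the origin. Boundedness comes from the decay of
  \<open>vg\<close>.\<close>

lemma vG_bounds: assumes s: "-1 < s"
  shows "(vG has_real_derivative vg s) (at s)" "0 \<le> vG s" "vG s \<le> 20"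
proof -
  have c: "continuous_on A vg" for A
    by (intro continuous_at_imp_continuous_on ballI DERIV_isCont[OF DERIV_vg])
  have D: "(vG has_real_derivative vg t) (at t within {-1..r})" if "t \<in> {-1..r}" for t r
    unfolding vG_def[abs_def] by (rule integral_has_real_derivative[OF c that])
  have D': "(vG has_real_derivative vg s) (at s)" if "-1 < s" for s
    using D[of s "s + 1"] that at_within_interior[of s "{-1..s + 1}"] by (simp add: interior_atLeastAtMost_real)
  show "(vG has_real_derivative vg s) (at s)" by (rule D'[OF s])
  show "0 \<le> vG s" unfolding vG_def
    by (intro Henstock_Kurzweil_Integration.integral_nonneg integrable_continuous_real c vg_range)
  \<comment> \<open>The derivative of -20 / (t + 2) dominates \<open>vg\<close>, so this sum
    decreases from its value 20 at t = -1.\<close>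
  let ?m = "\<lambda>t. vG t + 20 / (t + 2)"
  have "?m s \<le> ?m (-1)"
  proof (rule DERIV_nonpos_imp_decreasing_open[of "-1" s ?m])
    fix t :: real assume t: "-1 < t" "t < s"
    have "(?m has_real_derivative vg t - 20 / (t + 2)\<^sup>2) (at t)"
      using t by (auto intro!: derivative_eq_intros D' simp: power2_eq_square)
    moreover have "vg t - 20 / (t + 2)\<^sup>2 \<le> 0"
    proof -
      have "(t + 2)\<^sup>2 \<le> 20 * (1 + rmp t ^ 5)"
      proof (cases "t \<le> 1")
        case True
        have "(t + 2)\<^sup>2 \<le> 3\<^sup>2" using t True by (intro power_mono) auto
        then show ?thesis using True by (simp add: rmp_def)
      next
        case False
        then have "t + 2 = rmp t + 3" by (simp add: rmp_def)
        then have "(t + 2)\<^sup>2 = (rmp t + 3)\<^sup>2" by (rule arg_cong)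
        moreover have "(rmp t + 3)\<^sup>2 \<le> 2 * (rmp t ^ 2 + 9)"
          using sum_squares_bound[of "rmp t" 3] by (simp add: power2_sum)
        moreover have "rmp t ^ 2 \<le> 1 + rmp t ^ 5"
          by (rule pow_le_one_add) auto
        ultimately show ?thesis using zero_le_power[OF rmp_nonneg, of t 5]
          unfolding distrib_left by linarith
      qed
      then have "1 / (1 + rmp t ^ 5) \<le> 20 / (t + 2)\<^sup>2" using t by (simp add: field_simps)
      then show ?thesis by (simp add: vg_def)
    qed
    ultimately show "\<exists>y. (?m has_real_derivative y) (at t) \<and> y \<le> 0" by blast
  next
    have "continuous_on {-1..s} vG" using D by (intro DERIV_continuous_on) auto
    then show "continuous_on {-1..s} ?m" by (intro continuous_intros) auto
  qed (use s in simp)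
  also have "?m (-1) = 20" by (simp add: vG_def)
  finally show "vG s \<le> 20" using s by (smt (verit) divide_nonneg_pos)
qed

lemma frac_le: "0 < (d::real) \<Longrightarrow> 0 < e \<Longrightarrow> a * e \<le> c * d \<Longrightarrow> a / d \<le> c / e"
  by (simp add: divide_simps mult.commute)

text \<open>The middle expression is what the Hessian of \<psi> falls short of that of |x|^2 in the
  radial direction. In q = \<open>rmp s\<close> it vanishes like q^4 at q = 0 and tends to a
  positive limit at infinity, as does the square of \<open>veta\<close>; the fifth power in
  \<open>vg\<close> and the square in \<open>veta\<close> are matched for this.\<close>

lemma v_deficit:
  assumes s: "0 \<le> s"
  shows "(veta s)\<^sup>2 \<le> 2 * (1 - vg s) - 4 * s * vg1 s" "2 * (1 - vg s) - 4 * s * vg1 s \<le> 176 * (veta s)\<^sup>2"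
proof -
  define q where "q = rmp s"
  have q: "0 \<le> q" by (simp add: q_def)
  have p: "0 < 1 + q ^ 5" "0 < 1 + q\<^sup>2" using q by (simp_all add: add_pos_nonneg)
  \<comment> \<open>For s < 1 the relation s = 1 + q fails, but then q = 0 and both sides
    vanish.\<close>
  have "4 * s * vg1 s = - 20 * (1 + q) * q ^ 4 / (1 + q ^ 5)\<^sup>2"
  proof (cases "q = 0")
    case False
    then have sq: "s = 1 + q" by (auto simp: q_def rmp_def max_def split: if_splits)
    have v: "vg1 s = - 5 * q ^ 4 / (1 + q ^ 5)\<^sup>2" by (simp add: vg1_def q_def)
    show ?thesis unfolding v by (subst sq) (simp add: divide_inverse algebra_simps)
  qed (simp add: vg1_def q_def[symmetric])
  then have k: "2 * (1 - vg s) - 4 * s * vg1 s = (20 * q ^ 4 + 22 * q ^ 5 + 2 * q ^ 10) / (1 + q ^ 5)\<^sup>2"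
  proof -
    have "2 * (1 - 1 / d) - - 20 * (1 + q) * q ^ 4 / d\<^sup>2 = (2 * d * (d - 1) + 20 * (1 + q) * q ^ 4) / d\<^sup>2" if "d \<noteq> 0" for d
      using that by (simp add: field_simps power2_eq_square)
    moreover have "2 * (1 + q ^ 5) * (1 + q ^ 5 - 1) + 20 * (1 + q) * q ^ 4 = 20 * q ^ 4 + 22 * q ^ 5 + 2 * q ^ 10"
      by (simp add: algebra_simps eval_nat_numeral)
    moreover have "vg s = 1 / (1 + q ^ 5)" by (simp add: vg_def q_def)
    ultimately show ?thesis
      using p \<open>4 * s * vg1 s = - 20 * (1 + q) * q ^ 4 / (1 + q ^ 5)\<^sup>2\<close> by (metis less_irrefl)
  qed
  have e: "(veta s)\<^sup>2 = q ^ 4 / (1 + q\<^sup>2)\<^sup>2" by (simp add: veta_def q_def[symmetric] power_divide)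
  have nn: "0 \<le> q ^ n" for n using q by simp
  have le10: "q ^ n \<le> 1 + q ^ 10" if "n \<le> 10" for n by (rule pow_le_one_add[OF q that])
  show "(veta s)\<^sup>2 \<le> 2 * (1 - vg s) - 4 * s * vg1 s"
    unfolding k e
  proof (rule frac_le)
    have "q ^ 4 * (1 + q ^ 5)\<^sup>2 = q ^ 4 + 2 * q ^ 9 + q ^ 14" by (simp add: algebra_simps eval_nat_numeral)
    moreover have "(20 * q ^ 4 + 22 * q ^ 5 + 2 * q ^ 10) * (1 + q\<^sup>2)\<^sup>2 =
      20 * q ^ 4 + 22 * q ^ 5 + 40 * q ^ 6 + 44 * q ^ 7 + 20 * q ^ 8 + 22 * q ^ 9 + 2 * q ^ 10 + 4 * q ^ 12 + 2 * q ^ 14"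
      by (simp add: algebra_simps eval_nat_numeral)
    ultimately show "q ^ 4 * (1 + q ^ 5)\<^sup>2 \<le> (20 * q ^ 4 + 22 * q ^ 5 + 2 * q ^ 10) * (1 + q\<^sup>2)\<^sup>2"
      using nn[of 4] nn[of 5] nn[of 6] nn[of 7] nn[of 8] nn[of 9] nn[of 10] nn[of 12] nn[of 14] by linarith
  qed (use p in auto)
  have "(20 * q ^ 4 + 22 * q ^ 5 + 2 * q ^ 10) / (1 + q ^ 5)\<^sup>2 \<le> (176 * q ^ 4) / (1 + q\<^sup>2)\<^sup>2"
  proof (rule frac_le)
    have 1: "(20 * q ^ 4 + 22 * q ^ 5 + 2 * q ^ 10) * (1 + q\<^sup>2)\<^sup>2 = q ^ 4 *
      (20 + 22 * q + 40 * q ^ 2 + 44 * q ^ 3 + 20 * q ^ 4 + 22 * q ^ 5 + 2 * q ^ 6 + 4 * q ^ 8 + 2 * q ^ 10)"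
      by (simp add: algebra_simps eval_nat_numeral)
    have 2: "176 * q ^ 4 * (1 + q ^ 5)\<^sup>2 = q ^ 4 * (176 + 352 * q ^ 5 + 176 * q ^ 10)"
      by (simp add: algebra_simps eval_nat_numeral)
    \<comment> \<open>Each power on the left is at most \<open>1 + q ^ 10\<close>, and 176 is the
      sum of its coefficients.\<close>
    have "20 + 22 * q + 40 * q ^ 2 + 44 * q ^ 3 + 20 * q ^ 4 + 22 * q ^ 5 + 2 * q ^ 6 + 4 * q ^ 8 + 2 * q ^ 10
      \<le> 176 + 352 * q ^ 5 + 176 * q ^ 10"
      using le10[of 1, simplified] le10[of 2, simplified] le10[of 3, simplified] le10[of 4, simplified] le10[of 6, simplified] le10[of 8, simplified] nn[of 5] nn[of 10]
      by linarith
    then show "(20 * q ^ 4 + 22 * q ^ 5 + 2 * q ^ 10) * (1 + q\<^sup>2)\<^sup>2 \<le> 176 * q ^ 4 * (1 + q ^ 5)\<^sup>2"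
      unfolding 1 2 by (intro mult_left_mono nn)
  qed (use p in auto)
  then show "2 * (1 - vg s) - 4 * s * vg1 s \<le> 176 * (veta s)\<^sup>2" unfolding k e by simp
qed

lemma rmp_cases: assumes "0 \<le> s" obtains "rmp s = 0" "s \<le> 1" | "s = 1 + rmp s" "1 < s" "sqrt s \<le> 1 + rmp s"
proof (cases "s \<le> 1")
  case True then show ?thesis using that(1) by (simp add: rmp_def)
next
  case False
  then have "sqrt s \<le> s" by (intro real_le_lsqrt) (auto simp: power2_eq_square)
  then show ?thesis using that(2) False by (simp add: rmp_def)
qed

lemma vg1_bound: assumes "0 \<le> s" shows "s * \<bar>vg1 s\<bar> \<le> 10"
proof (rule rmp_cases[OF assms])
  assume "rmp s = 0" then show ?thesis by (simp add: vg1_def)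
next
  assume s: "s = 1 + rmp s"
  define q where "q = rmp s"
  have q: "0 \<le> q" by (simp add: q_def)
  have p: "0 < 1 + q ^ 5" using q by (simp add: add_pos_nonneg)
  have nn: "0 \<le> q ^ n" for n using q by simp
  have "5 * (1 + q) * q ^ 4 \<le> 10 * (1 + q ^ 5)"
  proof -
    have "q ^ 4 \<le> 1 + q ^ 5" by (rule pow_le_one_add[OF q]) simp
    then show ?thesis by (simp add: algebra_simps eval_nat_numeral)
  qed
  also have "\<dots> \<le> 10 * (1 + q ^ 5)\<^sup>2" using nn[of 5] by (simp add: power2_eq_square mult_left_mono algebra_simps)
  finally have "5 * (1 + q) * q ^ 4 / (1 + q ^ 5)\<^sup>2 \<le> 10" using p by (simp add: divide_le_eq)
  moreover have "\<bar>vg1 s\<bar> = 5 * q ^ 4 / (1 + q ^ 5)\<^sup>2" using q by (simp add: vg1_def q_def[symmetric] abs_mult)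
  moreover have "s = 1 + q" using s unfolding q_def .
  ultimately show ?thesis by (simp add: algebra_simps)
qed

text \<open>With s = |x|^2 / R^2 this bounds the gradient of \<psi>, of length 2 |x| vg, by 4
  R.\<close>

lemma vg_sqrt_bound: assumes "0 \<le> s" shows "sqrt s * vg s \<le> 2"
proof (rule rmp_cases[OF assms])
  assume "rmp s = 0" "s \<le> 1" then show ?thesis by (simp add: vg_def real_le_lsqrt)
next
  assume s: "sqrt s \<le> 1 + rmp s"
  define q where "q = rmp s"
  have q: "0 \<le> q" by (simp add: q_def)
  have nn: "0 \<le> q ^ n" for n using q by simp
  have "q \<le> 1 + q ^ 5" using pow_le_one_add[OF q, of 1 5] by simp
  then have "1 + q \<le> 2 * (1 + q ^ 5)" using nn[of 5] unfolding distrib_left by linarith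
  then have "(1 + q) * (1 / (1 + q ^ 5)) \<le> 2" using nn[of 5] by (simp add: divide_le_eq)
  moreover have "sqrt s * vg s \<le> (1 + q) * (1 / (1 + q ^ 5))"
    using s q by (intro mult_mono) (auto simp: vg_def q_def)
  ultimately show ?thesis by linarith
qed

lemma veta1_bound: "veta1 s \<le> 2"
proof -
  define q where "q = rmp s"
  have "2 * q \<le> 2 * (1 + q\<^sup>2)" using sum_squares_bound[of q 1] zero_le_power2[of q] unfolding power_one mult_1_right distrib_left by linarith
  also have "\<dots> \<le> 2 * (1 + q\<^sup>2)\<^sup>2" using self_le_power[of "1 + q\<^sup>2" 2] by simp
  finally have "2 * q / (1 + q\<^sup>2)\<^sup>2 \<le> 2" by (simp add: divide_le_eq)
  then show ?thesis by (simp add: veta1_def q_def)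
qed

text \<open>The expression in absolute value is the derivative of the profile of \<Delta>\<psi>
  (\<open>vdiv\<close> below). Bounding it by \<open>veta\<close> and not by a constant lets the
  resulting error pair with the radial derivative weighted by \<open>veta\<close>.\<close>

lemma vg2_bound:
  assumes "0 \<le> s" "0 \<le> n"
  shows "sqrt s * \<bar>(2 * n + 4) * vg1 s + 4 * s * vg2 s\<bar> \<le> (20 * (2 * n + 4) + 1600) * veta s"
proof (rule rmp_cases[OF assms(1)])
  assume "rmp s = 0" then show ?thesis by (simp add: vg1_def vg2_def veta_def)
next
  assume s: "sqrt s \<le> 1 + rmp s" "s = 1 + rmp s"
  define q where "q = rmp s"
  have q: "0 \<le> q" by (simp add: q_def)
  have nn: "0 \<le> q ^ k" for k using q by simp
  have p: "0 < 1 + q ^ 5" "0 < 1 + q\<^sup>2" using nn[of 5] nn[of 2] by linarith+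
  have le10: "q ^ n \<le> 1 + q ^ 10" if "n \<le> 10" for n by (rule pow_le_one_add[OF q that])
  \<comment> \<open>The constants 20 and, in the next estimate, 1600 are the sums of the
    coefficients after clearing denominators and dividing by q^2; every power is compared with
    \<open>1 + q ^ 10\<close>.\<close>
  have A: "(1 + q) * (5 * q ^ 4 / (1 + q ^ 5)\<^sup>2) \<le> 20 * (q\<^sup>2 / (1 + q\<^sup>2))"
  proof -
    have 1: "(1 + q) * (5 * q ^ 4) * (1 + q\<^sup>2) = q\<^sup>2 * (5 * q ^ 2 + 5 * q ^ 3 + 5 * q ^ 4 + 5 * q ^ 5)"
      by (simp add: algebra_simps eval_nat_numeral)
    have 2: "20 * q\<^sup>2 * (1 + q ^ 5)\<^sup>2 = q\<^sup>2 * (20 + 40 * q ^ 5 + 20 * q ^ 10)" by (simp add: algebra_simps eval_nat_numeral)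
    have "5 * q ^ 2 + 5 * q ^ 3 + 5 * q ^ 4 + 5 * q ^ 5 \<le> 20 + 40 * q ^ 5 + 20 * q ^ 10"
      using le10[of 2, simplified] le10[of 3, simplified] le10[of 4, simplified] nn[of 5] nn[of 10] by linarith
    then have "(1 + q) * (5 * q ^ 4) * (1 + q\<^sup>2) \<le> 20 * q\<^sup>2 * (1 + q ^ 5)\<^sup>2"
      unfolding 1 2 by (intro mult_left_mono nn)
    then have "((1 + q) * (5 * q ^ 4)) / (1 + q ^ 5)\<^sup>2 \<le> (20 * q\<^sup>2) / (1 + q\<^sup>2)"
      using p by (intro frac_le) auto
    then show ?thesis by simp
  qed
  have B: "(1 + q) * (4 * (1 + q) * ((30 * q ^ 8 + 20 * q ^ 3) / (1 + q ^ 5) ^ 3)) \<le> 1600 * (q\<^sup>2 / (1 + q\<^sup>2))"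
  proof -
    have 1: "(1 + q) * (4 * (1 + q) * (30 * q ^ 8 + 20 * q ^ 3)) * (1 + q\<^sup>2) = q\<^sup>2 *
      (80 * q + 160 * q ^ 2 + 160 * q ^ 3 + 160 * q ^ 4 + 80 * q ^ 5 + 120 * q ^ 6 + 240 * q ^ 7 + 240 * q ^ 8 + 240 * q ^ 9 + 120 * q ^ 10)"
      by (simp add: algebra_simps eval_nat_numeral)
    have 2: "1600 * q\<^sup>2 * (1 + q ^ 5) ^ 3 = q\<^sup>2 * (1600 + 4800 * q ^ 5 + 4800 * q ^ 10 + 1600 * q ^ 15)"
      by (simp add: algebra_simps eval_nat_numeral)
    have "80 * q + 160 * q ^ 2 + 160 * q ^ 3 + 160 * q ^ 4 + 80 * q ^ 5 + 120 * q ^ 6 + 240 * q ^ 7 + 240 * q ^ 8 + 240 * q ^ 9 + 120 * q ^ 10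
      \<le> 1600 + 4800 * q ^ 5 + 4800 * q ^ 10 + 1600 * q ^ 15"
      using le10[of 1, simplified] le10[of 2, simplified] le10[of 3, simplified] le10[of 4, simplified] le10[of 6, simplified] le10[of 7, simplified] le10[of 8, simplified] le10[of 9, simplified]
        nn[of 5] nn[of 10] nn[of 15] by linarith
    then have "(1 + q) * (4 * (1 + q) * (30 * q ^ 8 + 20 * q ^ 3)) * (1 + q\<^sup>2) \<le> 1600 * q\<^sup>2 * (1 + q ^ 5) ^ 3"
      unfolding 1 2 by (intro mult_left_mono nn)
    then have "((1 + q) * (4 * (1 + q) * (30 * q ^ 8 + 20 * q ^ 3))) / (1 + q ^ 5) ^ 3 \<le> (1600 * q\<^sup>2) / (1 + q\<^sup>2)"
      using p by (intro frac_le) auto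
    then show ?thesis by simp
  qed
  have v1: "\<bar>vg1 s\<bar> = 5 * q ^ 4 / (1 + q ^ 5)\<^sup>2"
    using q by (simp add: vg1_def q_def[symmetric] abs_mult)
  have "\<bar>30 * q ^ 8 - 20 * q ^ 3\<bar> \<le> 30 * q ^ 8 + 20 * q ^ 3" using nn[of 8] nn[of 3] by linarith
  then have v2: "\<bar>vg2 s\<bar> \<le> (30 * q ^ 8 + 20 * q ^ 3) / (1 + q ^ 5) ^ 3"
    using p by (simp add: vg2_def q_def[symmetric] abs_divide divide_right_mono)
  have "\<bar>(2 * n + 4) * vg1 s + 4 * s * vg2 s\<bar> \<le> (2 * n + 4) * \<bar>vg1 s\<bar> + 4 * s * \<bar>vg2 s\<bar>"
    using assms abs_triangle_ineq[of "(2 * n + 4) * vg1 s" "4 * s * vg2 s"] by (simp add: abs_mult)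
  then have "sqrt s * \<bar>(2 * n + 4) * vg1 s + 4 * s * vg2 s\<bar> \<le> (1 + q) * ((2 * n + 4) * \<bar>vg1 s\<bar> + 4 * s * \<bar>vg2 s\<bar>)"
    using s q assms by (intro mult_mono) (auto simp: q_def)
  also have "\<dots> = (2 * n + 4) * ((1 + q) * \<bar>vg1 s\<bar>) + (1 + q) * (4 * (1 + q) * \<bar>vg2 s\<bar>)"
    using s(2) by (simp add: q_def algebra_simps)
  also have "(2 * n + 4) * ((1 + q) * \<bar>vg1 s\<bar>) \<le> (2 * n + 4) * (20 * (q\<^sup>2 / (1 + q\<^sup>2)))"
    using A assms unfolding v1 by (intro mult_left_mono) auto
  also have "(1 + q) * (4 * (1 + q) * \<bar>vg2 s\<bar>) \<le> 1600 * (q\<^sup>2 / (1 + q\<^sup>2))"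
    by (rule order_trans[OF mult_left_mono[OF mult_left_mono[OF v2]] B]) (use q in auto)
  finally show ?thesis by (simp add: veta_def q_def[symmetric] algebra_simps add_divide_distrib)
qed

section \<open>Strauss' inequality\<close>

text \<open>The squared radius in units of R: unlike the norm it is smooth at the origin.\<close>

definition rad :: "real \<Rightarrow> 'a::euclidean_space \<Rightarrow> real" where "rad R x = (norm x)\<^sup>2 / R\<^sup>2"

lemma rad_nonneg [simp]: "0 \<le> rad R x"
  by (simp add: rad_def)

lemma rad_measurable [measurable]: "rad R \<in> borel_measurable borel"
  unfolding rad_def[abs_def] by measurable

lemma rad_continuous: "isCont (rad R) x"
proof -
  have eq: "rad R = (\<lambda>x. (norm x)\<^sup>2 * inverse (R\<^sup>2))" by (simp add: rad_def fun_eq_iff divide_inverse)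
  show ?thesis unfolding eq by (intro continuous_intros)
qed

lemma sqrt_rad: "0 < R \<Longrightarrow> sqrt (rad R x) = norm x / R"
  by (simp add: rad_def real_sqrt_divide)

lemma dir_norm_sq: "((\<lambda>t. (norm (x + t *\<^sub>R b))\<^sup>2) has_real_derivative 2 * (x \<bullet> b)) (at 0)"
proof -
  have "(\<lambda>t. (norm (x + t *\<^sub>R b))\<^sup>2) = (\<lambda>t. x \<bullet> x + 2 * t * (x \<bullet> b) + t * t * (b \<bullet> b))"
    by (simp add: power2_norm_eq_inner inner_add_left inner_add_right inner_commute[of b x] distrib_left fun_eq_iff)
  then show ?thesis by (auto intro!: derivative_eq_intros)
qed

lemma dir_rad:
  assumes "(f has_real_derivative f') (at (rad R x))"
  shows "((\<lambda>t. f (rad R (x + t *\<^sub>R b))) has_real_derivative f' * (2 * (x \<bullet> b) / R\<^sup>2)) (at 0)"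
proof (rule DERIV_chain2[where f=f and g="\<lambda>t. rad R (x + t *\<^sub>R b)" and x=0])
  show "(f has_real_derivative f') (at (rad R (x + 0 *\<^sub>R b)))" using assms by simp
  show "((\<lambda>t. rad R (x + t *\<^sub>R b)) has_real_derivative 2 * (x \<bullet> b) / R\<^sup>2) (at 0)"
    unfolding rad_def by (rule DERIV_cdivide[OF dir_norm_sq])
qed

lemma dir_inner: "((\<lambda>t. (x + t *\<^sub>R b) \<bullet> c) has_real_derivative b \<bullet> c) (at 0)"
  unfolding inner_add_left by (auto intro!: derivative_eq_intros)

lemma dir_norm:
  fixes x b :: "'a::euclidean_space"
  assumes "x \<noteq> 0" shows "((\<lambda>t. norm (x + t *\<^sub>R b)) has_real_derivative (x \<bullet> b) / norm x) (at 0)"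
proof -
  have 1: "((\<lambda>t. x + t *\<^sub>R b) has_derivative (\<lambda>h. h *\<^sub>R b)) (at 0)"
    by (auto intro!: derivative_eq_intros)
  have 2: "(norm has_derivative (\<lambda>h. h \<bullet> sgn x)) (at (x + 0 *\<^sub>R b))"
    using has_derivative_norm[OF assms] by simp
  have "((\<lambda>t. norm (x + t *\<^sub>R b)) has_derivative (\<lambda>h. (h *\<^sub>R b) \<bullet> sgn x)) (at 0)"
    by (rule has_derivative_compose[OF 1 2])
  moreover have "(\<lambda>h. (h *\<^sub>R b) \<bullet> sgn x) = (*) ((x \<bullet> b) / norm x)"
    by (simp add: fun_eq_iff sgn_div_norm inner_commute divide_inverse)
  ultimately show ?thesis unfolding has_field_derivative_def by (rule back_subst)
qed

lemma abs_inner_Basis_le: "b \<in> Basis \<Longrightarrow> \<bar>x \<bullet> b\<bar> \<le> norm x"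
  by (rule Basis_le_norm)

lemma weight_psi:
  fixes b :: "'a::euclidean_space"
  assumes R: "0 < R" and b: "b \<in> Basis"
  shows "weight (\<lambda>x. R\<^sup>2 * vG (rad R x)) b (\<lambda>x. 2 * vg (rad R x) * (x \<bullet> b))"
proof (rule weightI)
  have c: "isCont (\<lambda>x. vG (rad R x)) x" for x :: 'a
    by (rule isCont_o2[OF rad_continuous DERIV_isCont[OF vG_bounds(1)]]) (rule less_le_trans[OF _ rad_nonneg], simp)
  show "(\<lambda>x::'a. R\<^sup>2 * vG (rad R x)) \<in> borel_measurable borel"
    by (intro borel_measurable_continuous_onI continuous_at_imp_continuous_on ballI continuous_intros c)
  have s: "-1 < rad R x" for x :: 'a using rad_nonneg[of R x] by linarith
  show "\<bar>R\<^sup>2 * vG (rad R x)\<bar> \<le> R\<^sup>2 * 20" for x :: 'a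
    using vG_bounds(2,3)[OF s[of x]] by (simp add: abs_mult mult_left_mono)
  show "((\<lambda>t. R\<^sup>2 * vG (rad R (x + t *\<^sub>R b))) has_real_derivative 2 * vg (rad R x) * (x \<bullet> b)) (at 0)" for x
    by (rule DERIV_cong[OF DERIV_cmult[OF dir_rad[OF vG_bounds(1)[OF s]]]]) (use R in simp)
  show "\<bar>2 * vg (rad R x) * (x \<bullet> b)\<bar> \<le> 4 * R" for x
  proof -
    have "\<bar>2 * vg (rad R x) * (x \<bullet> b)\<bar> \<le> 2 * vg (rad R x) * norm x"
      using vg_range[of "rad R x"] abs_inner_Basis_le[OF b, of x] by (simp add: abs_mult mult_left_mono)
    also have "\<dots> = 2 * R * (sqrt (rad R x) * vg (rad R x))" using R by (simp add: sqrt_rad)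
    also have "\<dots> \<le> 2 * R * 2" using R vg_sqrt_bound[OF rad_nonneg] by (intro mult_left_mono) auto
    finally show ?thesis by simp
  qed
qed

lemma weight_grad:
  fixes b :: "'a::euclidean_space"
  assumes R: "0 < R" and b: "b \<in> Basis" and c: "c \<in> Basis"
  shows "weight (\<lambda>x. 2 * vg (rad R x) * (x \<bullet> c)) b
    (\<lambda>x. 2 * vg (rad R x) * (b \<bullet> c) + 4 / R\<^sup>2 * vg1 (rad R x) * (x \<bullet> b) * (x \<bullet> c))"
proof (rule weightI)
  show "(\<lambda>x. 2 * vg (rad R x) * (x \<bullet> c)) \<in> borel_measurable borel" by measurable
  show "\<bar>2 * vg (rad R x) * (x \<bullet> c)\<bar> \<le> 4 * R" for x
  proof -
    have "\<bar>2 * vg (rad R x) * (x \<bullet> c)\<bar> \<le> 2 * vg (rad R x) * norm x"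
      using vg_range[of "rad R x"] abs_inner_Basis_le[OF c, of x] by (simp add: abs_mult mult_left_mono)
    also have "\<dots> = 2 * R * (sqrt (rad R x) * vg (rad R x))" using R by (simp add: sqrt_rad)
    also have "\<dots> \<le> 2 * R * 2" using R vg_sqrt_bound[OF rad_nonneg] by (intro mult_left_mono) auto
    finally show ?thesis by simp
  qed
  show "((\<lambda>t. 2 * vg (rad R (x + t *\<^sub>R b)) * ((x + t *\<^sub>R b) \<bullet> c)) has_real_derivative
    2 * vg (rad R x) * (b \<bullet> c) + 4 / R\<^sup>2 * vg1 (rad R x) * (x \<bullet> b) * (x \<bullet> c)) (at 0)" for x
    by (rule DERIV_cong[OF DERIV_mult[OF DERIV_cmult[OF dir_rad[OF DERIV_vg]] dir_inner]]) simp
  show "\<bar>2 * vg (rad R x) * (b \<bullet> c) + 4 / R\<^sup>2 * vg1 (rad R x) * (x \<bullet> b) * (x \<bullet> c)\<bar> \<le> 2 + 40" for x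
  proof -
    have "\<bar>b \<bullet> c\<bar> \<le> 1" using b c by (simp add: inner_Basis)
    then have 1: "\<bar>2 * vg (rad R x) * (b \<bullet> c)\<bar> \<le> 2 * 1 * 1"
      unfolding abs_mult using vg_range[of "rad R x"] by (intro mult_mono) auto
    have "\<bar>x \<bullet> b\<bar> * \<bar>x \<bullet> c\<bar> \<le> norm x * norm x"
      by (intro mult_mono abs_inner_Basis_le b c) auto
    then have "\<bar>4 / R\<^sup>2 * vg1 (rad R x) * (x \<bullet> b) * (x \<bullet> c)\<bar> \<le> 4 / R\<^sup>2 * \<bar>vg1 (rad R x)\<bar> * (norm x * norm x)"
      by (simp add: abs_mult mult.assoc mult_left_mono divide_right_mono)
    also have "\<dots> = 4 * (rad R x * \<bar>vg1 (rad R x)\<bar>)"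
      using R by (simp add: rad_def power2_eq_square field_simps)
    also have "\<dots> \<le> 4 * 10" using vg1_bound[OF rad_nonneg] by (intro mult_left_mono) auto
    finally show ?thesis using 1 abs_triangle_ineq[of "2 * vg (rad R x) * (b \<bullet> c)" "4 / R\<^sup>2 * vg1 (rad R x) * (x \<bullet> b) * (x \<bullet> c)"] by linarith
  qed
qed

text \<open>In dimension n, \<open>vdiv n (rad R x)\<close> is the Laplacian of \<psi>; see
  \<open>sum_hess\<close>.\<close>

definition vdiv :: "real \<Rightarrow> real \<Rightarrow> real" where "vdiv n s = 2 * n * vg s + 4 * s * vg1 s"

abbreviation "vdiv1 n s \<equiv> (2 * n + 4) * vg1 s + 4 * s * vg2 s"

abbreviation "vconst n \<equiv> (20 * (2 * n + 4) + 1600) :: real"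

lemma vdiv_measurable [measurable]: "vdiv n \<in> borel_measurable borel"
  unfolding vdiv_def[abs_def] by measurable

lemma weight_div_bound:
  assumes R: "0 < R" and n: "0 \<le> n"
  shows "\<bar>2 / R\<^sup>2 * vdiv1 n (rad R x)\<bar> * norm x \<le> 2 / R * (vconst n * veta (rad R x))"
proof -
  have "\<bar>2 / R\<^sup>2 * vdiv1 n (rad R x)\<bar> * norm x = 2 / R * (sqrt (rad R x) * \<bar>vdiv1 n (rad R x)\<bar>)"
  proof -
    have "\<bar>2 / R\<^sup>2 * z\<bar> * norm x = 2 / R * (norm x / R * \<bar>z\<bar>)" for z
      using R by (simp add: abs_mult power2_eq_square)
    then show ?thesis using R by (simp only: sqrt_rad)
  qed
  also have "\<dots> \<le> 2 / R * (vconst n * veta (rad R x))"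
    using R by (intro mult_left_mono vg2_bound n) auto
  finally show ?thesis .
qed

lemma vdiv_bound: assumes "0 \<le> n" "0 \<le> s" shows "\<bar>vdiv n s\<bar> \<le> 2 * n + 40"
proof -
  have "\<bar>2 * n * vg s\<bar> \<le> 2 * n * 1"
    using vg_range[of s] assms by (simp add: abs_mult mult_left_le)
  moreover have "\<bar>4 * s * vg1 s\<bar> \<le> 40" using vg1_bound[OF assms(2)] assms by (simp add: abs_mult)
  ultimately show ?thesis unfolding vdiv_def
    using abs_triangle_ineq[of "2 * n * vg s" "4 * s * vg1 s"] by linarith
qed

lemma weight_div:
  fixes b :: "'a::euclidean_space"
  assumes R: "0 < R" and b: "b \<in> Basis" and n: "0 \<le> n"
  shows "weight (\<lambda>x. vdiv n (rad R x)) b (\<lambda>x. 2 / R\<^sup>2 * vdiv1 n (rad R x) * (x \<bullet> b))"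
proof (rule weightI)
  show "(\<lambda>x. vdiv n (rad R x)) \<in> borel_measurable borel" by measurable
  show "\<bar>vdiv n (rad R x)\<bar> \<le> 2 * n + 40" for x by (rule vdiv_bound[OF n rad_nonneg])
  have "(vdiv n has_real_derivative vdiv1 n s) (at s)" for s
    unfolding vdiv_def[abs_def]
    by (rule DERIV_cong[OF DERIV_add[OF DERIV_cmult[OF DERIV_vg] DERIV_mult[OF DERIV_cmult[OF DERIV_ident] DERIV_vg1]]])
      (simp add: algebra_simps)
  then show "((\<lambda>t. vdiv n (rad R (x + t *\<^sub>R b))) has_real_derivative 2 / R\<^sup>2 * vdiv1 n (rad R x) * (x \<bullet> b)) (at 0)" for x
    by (rule DERIV_cong[OF dir_rad]) simp
  show "\<bar>2 / R\<^sup>2 * vdiv1 n (rad R x) * (x \<bullet> b)\<bar> \<le> 2 / R * (vconst n * 1)" for x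
  proof -
    have "\<bar>2 / R\<^sup>2 * vdiv1 n (rad R x) * (x \<bullet> b)\<bar> \<le> \<bar>2 / R\<^sup>2 * vdiv1 n (rad R x)\<bar> * norm x"
      unfolding abs_mult[of _ "x \<bullet> b"] using abs_inner_Basis_le[OF b] by (intro mult_left_mono) auto
    also have "\<dots> \<le> 2 / R * (vconst n * veta (rad R x))" by (rule weight_div_bound[OF R n])
    also have "\<dots> \<le> 2 / R * (vconst n * 1)"
      using R n veta_range[of "rad R x"] by (intro mult_left_mono) auto
    finally show ?thesis .
  qed
qed

text \<open>As \<open>inverse 0 = 0\<close>, the value at the origin is 0. It is used with a factor
  |x| or \<open>veta\<close>, which vanishes there too.\<close>

definition radial_deriv :: "('a::euclidean_space \<Rightarrow> 'a \<Rightarrow> complex) \<Rightarrow> 'a \<Rightarrow> complex" where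
  "radial_deriv D x = (\<Sum>b\<in>Basis. ((x \<bullet> b) * inverse (norm x)) *\<^sub>R D b x)"

lemma radial_deriv_L2:
  fixes D :: "'a::euclidean_space \<Rightarrow> 'a \<Rightarrow> complex"
  assumes "\<And>b. b \<in> Basis \<Longrightarrow> D b \<in> L2" shows "radial_deriv D \<in> L2"
  unfolding radial_deriv_def[abs_def]
proof (intro L2_sum L2_scaleR_bounded[where C=1] assms)
  fix b x :: 'a assume b: "b \<in> Basis"
  show "\<bar>x \<bullet> b * inverse (norm x)\<bar> \<le> 1"
    using abs_inner_Basis_le[OF b, of x] by (simp add: abs_mult divide_inverse[symmetric] divide_le_eq)
qed auto

lemma sum_inner_Basis_sq: "(\<Sum>b\<in>Basis. (x \<bullet> b)\<^sup>2) = (norm x)\<^sup>2" for x :: "'a::euclidean_space"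
  by (simp only: power2_norm_eq_inner euclidean_inner[of x x]) (simp add: power2_eq_square)

lemma radial_deriv_le: "(cmod (radial_deriv D x))\<^sup>2 \<le> (\<Sum>b\<in>Basis. (cmod (D b x))\<^sup>2)"
proof -
  have "cmod (radial_deriv D x) \<le> (\<Sum>b\<in>Basis. \<bar>(x \<bullet> b) * inverse (norm x)\<bar> * cmod (D b x))"
    unfolding radial_deriv_def by (rule order_trans[OF norm_sum]) simp
  then have "(cmod (radial_deriv D x))\<^sup>2 \<le> (\<Sum>b\<in>Basis. \<bar>(x \<bullet> b) * inverse (norm x)\<bar> * cmod (D b x))\<^sup>2"
    by (intro power_mono) auto
  also have "\<dots> \<le> (\<Sum>b\<in>Basis. \<bar>(x \<bullet> b) * inverse (norm x)\<bar>\<^sup>2) * (\<Sum>b\<in>Basis. (cmod (D b x))\<^sup>2)"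
    by (rule Cauchy_Schwarz_ineq_sum)
  also have "\<dots> \<le> 1 * (\<Sum>b\<in>Basis. (cmod (D b x))\<^sup>2)"
  proof (intro mult_right_mono sum_nonneg)
    show "(\<Sum>b\<in>Basis. \<bar>(x \<bullet> b) * inverse (norm x)\<bar>\<^sup>2) \<le> 1"
      by (simp add: power_mult_distrib flip: sum_distrib_right) (cases "x = 0", simp_all add: sum_inner_Basis_sq flip: power_mult_distrib)
  qed auto
  finally show ?thesis by simp
qed

text \<open>At the origin both sides are 0, because \<open>inverse 0 = 0\<close> and the exponent is
  positive.\<close>

lemma inv_norm_pow:
  assumes "0 < n" shows "(norm x)\<^sup>2 * inverse (norm x) ^ (n + 2) = inverse (norm x) ^ n"
  using assms by (cases "x = 0") (auto simp: power_add power2_eq_square field_simps)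

text \<open>The weight \<open>E(x) x / |x|\<^sup>n\<close>, with \<open>E\<close> nondecreasing in \<open>|x|\<close>, has divergence \<open>2 E'(|x|\<^sup>2) |x|\<^sup>2 / |x|\<^sup>n \<ge> 0\<close>;
  in the Leibniz formula it replaces integration along rays in Strauss' inequality.\<close>

context
  fixes R S \<delta> :: real and n :: nat
  assumes R: "0 < R" and \<delta>: "0 < \<delta>" and n: "2 \<le> n"
begin

text \<open>The first factor vanishes on the ball of radius R and so removes the singularity of x /
  |x|^n. The second rises from 0 across |x|^2 = S on the scale \<delta>; the derivative in |x|^2,
  \<open>flux_coeff1\<close>, is of order 1/\<delta> just outside, where the flux formula acts like
  a surface integral.\<close>

definition "flux_coeff x = veta (rad R x) * veta (((norm x)\<^sup>2 - S) / \<delta> + 1)"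
definition "flux_coeff1 x = veta1 (rad R x) / R\<^sup>2 * veta (((norm x)\<^sup>2 - S) / \<delta> + 1)
   + veta (rad R x) * (veta1 (((norm x)\<^sup>2 - S) / \<delta> + 1) / \<delta>)"

lemma flux_coeff_range: "0 \<le> flux_coeff x" "flux_coeff x \<le> veta (rad R x)" "flux_coeff x \<le> 1" "0 \<le> flux_coeff1 x" "flux_coeff1 x \<le> 2 / R\<^sup>2 + 2 / \<delta>"
proof -
  let ?s = "((norm x)\<^sup>2 - S) / \<delta> + 1"
  show "0 \<le> flux_coeff x" "0 \<le> flux_coeff1 x" unfolding flux_coeff_def flux_coeff1_def using \<delta> by (auto simp: veta_range veta1_nonneg)
  show 1: "flux_coeff x \<le> veta (rad R x)" unfolding flux_coeff_def by (simp add: veta_range mult_left_le)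
  show "flux_coeff x \<le> 1" using 1 veta_range(2) order_trans by blast
  have "veta1 (rad R x) / R\<^sup>2 * veta ?s \<le> 2 / R\<^sup>2 * 1"
    using R by (intro mult_mono divide_right_mono veta1_bound veta_range) (auto simp: veta1_nonneg)
  moreover have "veta (rad R x) * (veta1 ?s / \<delta>) \<le> 1 * (2 / \<delta>)"
    using \<delta> by (intro mult_mono divide_right_mono veta1_bound veta_range) (auto simp: veta1_nonneg)
  ultimately show "flux_coeff1 x \<le> 2 / R\<^sup>2 + 2 / \<delta>" unfolding flux_coeff1_def by linarith
qed

lemma flux_coeff_zero: "norm x \<le> R \<Longrightarrow> flux_coeff x = 0" "norm x \<le> R \<Longrightarrow> flux_coeff1 x = 0"
proof -
  assume "norm x \<le> R"
  then have "rad R x \<le> 1" using R by (simp add: rad_def power_mono)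
  then show "flux_coeff x = 0" "flux_coeff1 x = 0" unfolding flux_coeff_def flux_coeff1_def by (simp_all add: v_zero)
qed

lemma dir_flux_coeff: "((\<lambda>t. flux_coeff (x + t *\<^sub>R b)) has_real_derivative flux_coeff1 x * (2 * (x \<bullet> b))) (at 0)"
proof -
  have 1: "((\<lambda>t. ((norm (x + t *\<^sub>R b))\<^sup>2 - S) / \<delta> + 1) has_real_derivative 2 * (x \<bullet> b) / \<delta>) (at 0)"
    by (rule DERIV_cong[OF DERIV_add[OF DERIV_cdivide[OF DERIV_diff[OF dir_norm_sq DERIV_const]] DERIV_const]]) simp
  have 2: "((\<lambda>t. veta (((norm (x + t *\<^sub>R b))\<^sup>2 - S) / \<delta> + 1)) has_real_derivative
      veta1 (((norm (x + 0 *\<^sub>R b))\<^sup>2 - S) / \<delta> + 1) * (2 * (x \<bullet> b) / \<delta>)) (at 0)"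
    by (rule DERIV_chain2[OF DERIV_veta 1])
  show ?thesis unfolding flux_coeff_def
    by (rule DERIV_cong[OF DERIV_mult[OF dir_rad[OF DERIV_veta] 2]]) (simp add: flux_coeff1_def algebra_simps add_divide_distrib)
qed

definition "flux_weight b x = flux_coeff x * (x \<bullet> b) * inverse (norm x) ^ n"
definition "flux_weight1 b x = flux_coeff1 x * (2 * (x \<bullet> b)\<^sup>2) * inverse (norm x) ^ n + flux_coeff x * inverse (norm x) ^ n
   - real n * flux_coeff x * (x \<bullet> b)\<^sup>2 * inverse (norm x) ^ (n + 2)"

lemma inv_le: "R \<le> norm x \<Longrightarrow> inverse (norm x) ^ k \<le> inverse R ^ k" for x :: "'a::euclidean_space"
  using R by (intro power_mono le_imp_inverse_le) auto

text \<open>The coefficients vanish for |x| <= R, so negative powers of |x| are bounded by those of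
  R. At the origin the weight is locally zero, which gives its derivative although the norm is not
  differentiable there.\<close>

lemma weight_flux_weight:
  fixes b :: "'a::euclidean_space"
  assumes b: "b \<in> Basis" shows "weight (flux_weight b) b (flux_weight1 b)"
proof (rule weightI)
  show "flux_weight b \<in> borel_measurable borel" unfolding flux_weight_def[abs_def] flux_coeff_def[abs_def] by measurable
  have xb: "(x \<bullet> b)\<^sup>2 \<le> (norm x)\<^sup>2" for x using abs_inner_Basis_le[OF b, of x] by (simp add: abs_le_square_iff[symmetric])
  show "\<bar>flux_weight b x\<bar> \<le> inverse R ^ (n - 1)" for x
  proof (cases "norm x \<le> R")
    case True then show ?thesis using R by (simp add: flux_weight_def flux_coeff_zero)
  next
    case False
    then have x: "x \<noteq> 0" using R by auto
    have "\<bar>flux_weight b x\<bar> = flux_coeff x * (\<bar>x \<bullet> b\<bar> * inverse (norm x) ^ n)" by (simp add: flux_weight_def abs_mult flux_coeff_range)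
    also have "\<dots> \<le> 1 * (norm x * inverse (norm x) ^ n)"
      using abs_inner_Basis_le[OF b, of x] by (intro mult_mono flux_coeff_range mult_right_mono) (auto intro!: mult_nonneg_nonneg)
    also have "\<dots> = inverse (norm x) ^ (n - 1)" using x n by (cases n) auto
    also have "\<dots> \<le> inverse R ^ (n - 1)" using False by (intro inv_le) auto
    finally show ?thesis .
  qed
  show "\<bar>flux_weight1 b x\<bar> \<le> (2 / R\<^sup>2 + 2 / \<delta>) * 2 * inverse R ^ (n - 2) + inverse R ^ n + real n * inverse R ^ n" for x
  proof (cases "norm x \<le> R")
    case True then show ?thesis using R \<delta> by (simp add: flux_weight1_def flux_coeff_zero add_nonneg_nonneg)
  next
    case False
    then have x: "x \<noteq> 0" using R by auto
    have i: "(norm x)\<^sup>2 * inverse (norm x) ^ n = inverse (norm x) ^ (n - 2)"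
      using x n by (auto simp: power_diff power_inverse field_simps)
    have "flux_coeff1 x * (2 * (x \<bullet> b)\<^sup>2) * inverse (norm x) ^ n \<le> (2 / R\<^sup>2 + 2 / \<delta>) * (2 * (norm x)\<^sup>2) * inverse (norm x) ^ n"
      using xb[of x] flux_coeff_range[of x] R \<delta> by (intro mult_right_mono mult_mono) (auto intro: add_nonneg_nonneg)
    also have "\<dots> = (2 / R\<^sup>2 + 2 / \<delta>) * 2 * inverse (norm x) ^ (n - 2)" using i by (simp add: mult.assoc)
    also have "\<dots> \<le> (2 / R\<^sup>2 + 2 / \<delta>) * 2 * inverse R ^ (n - 2)"
      using False R \<delta> by (intro mult_left_mono inv_le) (auto intro: add_nonneg_nonneg)
    finally have 1: "flux_coeff1 x * (2 * (x \<bullet> b)\<^sup>2) * inverse (norm x) ^ n \<le> (2 / R\<^sup>2 + 2 / \<delta>) * 2 * inverse R ^ (n - 2)" .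
    have 2: "flux_coeff x * inverse (norm x) ^ n \<le> 1 * inverse R ^ n"
      using False by (intro mult_mono flux_coeff_range inv_le) auto
    have "real n * flux_coeff x * (x \<bullet> b)\<^sup>2 * inverse (norm x) ^ (n + 2) = real n * (flux_coeff x * ((x \<bullet> b)\<^sup>2 * inverse (norm x) ^ (n + 2)))"
      by (simp add: mult.assoc)
    also have "\<dots> \<le> real n * (1 * ((norm x)\<^sup>2 * inverse (norm x) ^ (n + 2)))"
      by (intro mult_left_mono mult_mono flux_coeff_range mult_right_mono xb) auto
    also have "\<dots> = real n * inverse (norm x) ^ n" using inv_norm_pow[of n x] n by simp
    also have "\<dots> \<le> real n * inverse R ^ n" using False by (intro mult_left_mono inv_le) auto
    finally have 3: "real n * flux_coeff x * (x \<bullet> b)\<^sup>2 * inverse (norm x) ^ (n + 2) \<le> real n * inverse R ^ n" .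
    have "0 \<le> flux_coeff1 x * (2 * (x \<bullet> b)\<^sup>2) * inverse (norm x) ^ n" "0 \<le> flux_coeff x * inverse (norm x) ^ n"
      "0 \<le> real n * flux_coeff x * (x \<bullet> b)\<^sup>2 * inverse (norm x) ^ (n + 2)"
      using flux_coeff_range[of x] by auto
    then show ?thesis unfolding flux_weight1_def using 1 2 3 by linarith
  qed
  show "((\<lambda>t. flux_weight b (x + t *\<^sub>R b)) has_real_derivative flux_weight1 b x) (at 0)" for x
  proof (cases "x = 0")
    case True
    have "((\<lambda>t. x + t *\<^sub>R b) \<longlongrightarrow> x + 0 *\<^sub>R b) (nhds 0)" by (intro tendsto_intros filterlim_ident)
    then have "\<forall>\<^sub>F t in nhds 0. norm (x + t *\<^sub>R b) < R"
      using R True by (intro order_tendstoD(2)[OF tendsto_norm]) auto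
    then have "\<forall>\<^sub>F t in nhds 0. flux_weight b (x + t *\<^sub>R b) = 0"
      by eventually_elim (simp add: flux_weight_def flux_coeff_zero)
    moreover have "flux_weight1 b x = 0" using True n by (simp add: flux_weight1_def)
    ultimately show ?thesis by (subst DERIV_cong_ev[OF refl, where g="\<lambda>_. 0"]) auto
  next
    case False
    obtain k where k: "n = Suc k" using n by (cases n) auto
    have x: "norm x \<noteq> 0" using False by simp
    have I: "((\<lambda>t. inverse (norm (x + t *\<^sub>R b)) ^ n) has_real_derivative
      real n * inverse (norm x) ^ k * - (inverse (norm x) * (x \<bullet> b / norm x) * inverse (norm x))) (at 0)"
      unfolding k
      by (rule DERIV_cong[OF DERIV_power_Suc[OF DERIV_inverse'[OF dir_norm[OF False]]]]) (use False in auto)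
    show ?thesis unfolding flux_weight_def flux_weight1_def
      by (rule DERIV_cong[OF DERIV_mult[OF DERIV_mult[OF dir_flux_coeff dir_inner] I]])
        (use b in \<open>simp add: k divide_inverse power2_eq_square algebra_simps\<close>)
  qed
qed

lemma sum_flux_weight1:
  fixes x :: "'a::euclidean_space"
  assumes "n = DIM('a)" shows "(\<Sum>b\<in>Basis. flux_weight1 b x) = 2 * flux_coeff1 x * (norm x)\<^sup>2 * inverse (norm x) ^ n"
proof -
  have "(\<Sum>b\<in>Basis. flux_weight1 b x) = flux_coeff1 x * (2 * (\<Sum>b\<in>Basis. (x \<bullet> b)\<^sup>2)) * inverse (norm x) ^ n + real n * (flux_coeff x * inverse (norm x) ^ n)
   - real n * flux_coeff x * (\<Sum>b\<in>Basis. (x \<bullet> b)\<^sup>2) * inverse (norm x) ^ (n + 2)"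
    unfolding flux_weight1_def sum_subtractf sum.distrib by (simp add: assms sum_distrib_left sum_distrib_right)
  also have "\<dots> = 2 * flux_coeff1 x * (norm x)\<^sup>2 * inverse (norm x) ^ n"
    using inv_norm_pow[of n x] n by (simp add: sum_inner_Basis_sq mult.assoc)
  finally show ?thesis .
qed

text \<open>The Leibniz formula with both functions equal to \<open>u\<close>, summed over the
  coordinates: the divergence of the weight against |u|^2 equals minus twice the flux of
  \<open>u\<close> against its radial derivative. On the support of the weight |x|^(1-n) is at most
  R^(1-n).\<close>

lemma radial_flux_le:
  fixes u :: "'a::euclidean_space \<Rightarrow> complex"
  assumes D: "\<And>b. b \<in> Basis \<Longrightarrow> has_weak_deriv u b (D b)" and n_eq: "n = DIM('a)"
  shows "integrable lborel (\<lambda>x. flux_coeff1 x * (norm x)\<^sup>2 * inverse (norm x) ^ n * (cmod (u x))\<^sup>2)" (is ?I)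
    "(LINT x|lborel. flux_coeff1 x * (norm x)\<^sup>2 * inverse (norm x) ^ n * (cmod (u x))\<^sup>2) \<le>
      inverse R ^ (n - 1) * (L2_norm u * L2_norm (\<lambda>x. veta (rad R x) *\<^sub>R radial_deriv D x))" (is ?J)
proof -
  let ?U = "radial_deriv D"
  obtain b0 :: 'a where b0: "b0 \<in> Basis" using nonempty_Basis by blast
  have uL: "u \<in> L2" using has_weak_deriv_L2[OF D[OF b0]] by simp
  have DL: "D b \<in> L2" if "b \<in> Basis" for b using has_weak_deriv_L2[OF D[OF that]] by simp
  have UL: "?U \<in> L2" by (rule radial_deriv_L2[OF DL])
  have wL: "(\<lambda>x. flux_weight b x *\<^sub>R f x) \<in> L2" "(\<lambda>x. flux_weight1 b x *\<^sub>R f x) \<in> L2" if b: "b \<in> Basis" and "f \<in> L2" for b f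
    using weightE[OF weight_flux_weight[OF b]] L2_scaleR_bounded[OF \<open>f \<in> L2\<close>] by metis+
  have leib: "2 * ip (\<lambda>x. flux_weight b x *\<^sub>R u x) (D b) + ip (\<lambda>x. flux_weight1 b x *\<^sub>R u x) u = 0" if b: "b \<in> Basis" for b
  proof -
    have "ip (\<lambda>x. flux_weight b x *\<^sub>R D b x) u = ip (\<lambda>x. flux_weight b x *\<^sub>R u x) (D b)" by (simp add: ip_def inner_commute)
    then show ?thesis using weak_Leibniz[OF weight_flux_weight[OF b] D[OF b] D[OF b] b] by simp
  qed
  have i1: "integrable lborel (\<lambda>x. (flux_weight1 b x *\<^sub>R u x) \<bullet> u x)" if "b \<in> Basis" for b
    by (intro integrable_ip wL uL that)
  have e1: "(\<Sum>b\<in>Basis. (flux_weight1 b x *\<^sub>R u x) \<bullet> u x) = 2 * (flux_coeff1 x * (norm x)\<^sup>2 * inverse (norm x) ^ n * (cmod (u x))\<^sup>2)" for x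
    using sum_flux_weight1[OF n_eq, of x] by (simp add: power2_norm_eq_inner flip: sum_distrib_right)
  have "integrable lborel (\<lambda>x. 2 * (flux_coeff1 x * (norm x)\<^sup>2 * inverse (norm x) ^ n * (cmod (u x))\<^sup>2))"
    unfolding e1[symmetric] by (rule Bochner_Integration.integrable_sum) (rule i1)
  then show ?I by simp
  have s1: "(\<Sum>b\<in>Basis. ip (\<lambda>x. flux_weight1 b x *\<^sub>R u x) u) =
     2 * (LINT x|lborel. flux_coeff1 x * (norm x)\<^sup>2 * inverse (norm x) ^ n * (cmod (u x))\<^sup>2)"
    unfolding ip_def by (subst Bochner_Integration.integral_sum[symmetric, OF i1]) (simp_all add: e1 del: inner_scaleR_left)
  have i2: "integrable lborel (\<lambda>x. (flux_weight b x *\<^sub>R u x) \<bullet> D b x)" if "b \<in> Basis" for b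
    by (intro integrable_ip wL uL DL that)
  have e2: "(\<Sum>b\<in>Basis. (flux_weight b x *\<^sub>R u x) \<bullet> D b x) = flux_coeff x * inverse (norm x) ^ (n - 1) * (u x \<bullet> ?U x)" for x
  proof -
    have "inverse (norm x) ^ n = inverse (norm x) ^ (n - 1) * inverse (norm x)" using n by (cases n) auto
    then show ?thesis
      by (simp add: flux_weight_def radial_deriv_def inner_sum_right sum_distrib_left mult_ac)
  qed
  have s2: "(\<Sum>b\<in>Basis. ip (\<lambda>x. flux_weight b x *\<^sub>R u x) (D b)) = (LINT x|lborel. flux_coeff x * inverse (norm x) ^ (n - 1) * (u x \<bullet> ?U x))"
    unfolding ip_def by (subst Bochner_Integration.integral_sum[symmetric, OF i2]) (simp_all add: e2 del: inner_scaleR_left)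
  have i3: "integrable lborel (\<lambda>x. flux_coeff x * inverse (norm x) ^ (n - 1) * (u x \<bullet> ?U x))"
    unfolding e2[symmetric] by (rule Bochner_Integration.integrable_sum) (rule i2)
  have vUL: "(\<lambda>x. veta (rad R x) *\<^sub>R ?U x) \<in> L2"
    by (rule L2_scaleR_bounded[OF UL, where C=1]) (auto simp: veta_range)
  have "0 = (\<Sum>b\<in>Basis. 2 * ip (\<lambda>x. flux_weight b x *\<^sub>R u x) (D b) + ip (\<lambda>x. flux_weight1 b x *\<^sub>R u x) u)"
    using leib by simp
  also have "\<dots> = 2 * (LINT x|lborel. flux_coeff x * inverse (norm x) ^ (n - 1) * (u x \<bullet> ?U x)) +
     2 * (LINT x|lborel. flux_coeff1 x * (norm x)\<^sup>2 * inverse (norm x) ^ n * (cmod (u x))\<^sup>2)"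
    by (simp add: sum.distrib s1 s2 flip: sum_distrib_left)
  finally have "(LINT x|lborel. flux_coeff1 x * (norm x)\<^sup>2 * inverse (norm x) ^ n * (cmod (u x))\<^sup>2) =
     (LINT x|lborel. - (flux_coeff x * inverse (norm x) ^ (n - 1) * (u x \<bullet> ?U x)))" by simp
  also have "\<dots> \<le> (LINT x|lborel. inverse R ^ (n - 1) * (cmod (u x) * cmod (veta (rad R x) *\<^sub>R ?U x)))"
  proof (rule integral_mono)
    show "integrable lborel (\<lambda>x. inverse R ^ (n - 1) * (cmod (u x) * cmod (veta (rad R x) *\<^sub>R ?U x)))"
      using integrable_ip(2)[OF uL vUL] by simp
    fix x
    show "- (flux_coeff x * inverse (norm x) ^ (n - 1) * (u x \<bullet> ?U x)) \<le> inverse R ^ (n - 1) * (cmod (u x) * cmod (veta (rad R x) *\<^sub>R ?U x))"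
    proof (cases "norm x \<le> R")
      case True then show ?thesis using R by (simp add: flux_coeff_zero)
    next
      case False
      have "- (flux_coeff x * inverse (norm x) ^ (n - 1) * (u x \<bullet> ?U x)) \<le> (flux_coeff x * inverse (norm x) ^ (n - 1)) * (cmod (u x) * cmod (?U x))"
        using Cauchy_Schwarz_ineq2[of "u x" "?U x"] flux_coeff_range(1)[of x]
          mult_left_mono[of "- (u x \<bullet> ?U x)" "cmod (u x) * cmod (?U x)" "flux_coeff x * inverse (norm x) ^ (n - 1)"] by simp
      also have "\<dots> \<le> (veta (rad R x) * inverse R ^ (n - 1)) * (cmod (u x) * cmod (?U x))"
        using False by (intro mult_right_mono mult_mono flux_coeff_range inv_le) (auto simp: veta_range)
      also have "\<dots> = inverse R ^ (n - 1) * (cmod (u x) * cmod (veta (rad R x) *\<^sub>R ?U x))"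
        by (simp add: veta_range)
      finally show ?thesis .
    qed
  qed (use i3 in simp)
  also have "\<dots> \<le> inverse R ^ (n - 1) * (L2_norm u * L2_norm (\<lambda>x. veta (rad R x) *\<^sub>R ?U x))"
    using integral_norm_mult_le[OF uL vUL] R by (simp only: integral_mult_right_zero) (intro mult_left_mono, auto)
  finally show ?J .
qed

end

text \<open>Splitting r^n as r^2 r^(n-2) isolates the difference of squares. The thickness is
  measured this way so that it cancels against the 1/\<delta> of \<open>flux_coeff1\<close>.\<close>

lemma shell_measure:
  assumes "0 \<le> r1" "r1 \<le> r2" "2 \<le> DIM('a::euclidean_space)"
  shows "cball (0::'a) r2 - ball 0 r1 \<in> fmeasurable lborel"
    "unit_ball_vol (real DIM('a)) * (r2\<^sup>2 - r1\<^sup>2) * r1 ^ (DIM('a) - 2) \<le> measure lborel (cball (0::'a) r2 - ball 0 r1)"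
proof -
  let ?n = "DIM('a)"
  have fm: "cball (0::'a) r2 \<in> fmeasurable lborel" "ball (0::'a) r1 \<in> fmeasurable lborel"
    using emeasure_bounded_finite[of "cball (0::'a) r2"] emeasure_bounded_finite[of "ball (0::'a) r1"]
    by (auto intro!: fmeasurableI)
  then show "cball (0::'a) r2 - ball 0 r1 \<in> fmeasurable lborel"
    by (intro fmeasurable.Diff)
  have "measure lborel (cball (0::'a) r2 - ball 0 r1) = measure lborel (cball (0::'a) r2) - measure lborel (ball (0::'a) r1)"
    by (rule measurable_measure_Diff) (use fm assms in auto)
  also have "\<dots> = unit_ball_vol (real ?n) * (r2 ^ ?n - r1 ^ ?n)"
    using assms by (simp add: content_cball content_ball algebra_simps)
  finally have m: "measure lborel (cball (0::'a) r2 - ball 0 r1) = unit_ball_vol (real ?n) * (r2 ^ ?n - r1 ^ ?n)" .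
  have "r2\<^sup>2 * r1 ^ (?n - 2) \<le> r2\<^sup>2 * r2 ^ (?n - 2)" using assms by (intro mult_left_mono power_mono) auto
  moreover have "r\<^sup>2 * r ^ (?n - 2) = r ^ ?n" for r :: real
    using assms(3) by (metis le_add_diff_inverse power_add)
  ultimately have "(r2\<^sup>2 - r1\<^sup>2) * r1 ^ (?n - 2) \<le> r2 ^ ?n - r1 ^ ?n" by (simp add: left_diff_distrib)
  then show "unit_ball_vol (real ?n) * (r2\<^sup>2 - r1\<^sup>2) * r1 ^ (?n - 2) \<le> measure lborel (cball (0::'a) r2 - ball 0 r1)"
    unfolding m by (simp add: mult.assoc mult_left_mono)
qed

text \<open>25/2 inverts the lower bound 2/25 for \<open>veta1\<close> on the shell, the power of 2
  comes from r2 <= 2 r1, and the volume from \<open>shell_measure\<close>.\<close>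

abbreviation strauss_const :: "nat \<Rightarrow> real" where
  "strauss_const n \<equiv> 25 * 2 ^ (n - 2) / (2 * unit_ball_vol (real n))"

text \<open>If the bound failed at \<open>x\<close>, continuity and radial symmetry would make it
  fail with a margin on a whole shell just outside |x|, and the flux integral over that shell would
  be too large. The shell may be arbitrarily thin, since its thickness cancels.\<close>

lemma strauss:
  fixes u :: "'a::euclidean_space \<Rightarrow> complex"
  assumes D: "\<And>b. b \<in> Basis \<Longrightarrow> has_weak_deriv u b (D b)" and dim: "2 \<le> DIM('a)" and R: "0 < R"
    and cont: "continuous_on UNIV u" and radial: "\<And>x y. norm x = norm y \<Longrightarrow> u x = u y"
  shows "veta (rad R x) * (cmod (u x))\<^sup>2 \<le> strauss_const DIM('a) *
    (inverse R ^ (DIM('a) - 1) * (L2_norm u * L2_norm (\<lambda>x. veta (rad R x) *\<^sub>R radial_deriv D x)))"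
proof (rule ccontr)
  let ?n = "DIM('a)"
  let ?w = "unit_ball_vol (real ?n)"
  define F where "F x = veta (rad R x) * (cmod (u x))\<^sup>2" for x
  define B where "B = inverse R ^ (?n - 1) * (L2_norm u * L2_norm (\<lambda>x. veta (rad R x) *\<^sub>R radial_deriv D x))"
  assume "\<not> ?thesis"
  then have gt: "strauss_const ?n * B < F x" by (simp add: F_def B_def)
  have B0: "0 \<le> B" using R by (simp add: B_def)
  have w0: "0 < ?w" by simp
  define m where "m = (F x + strauss_const ?n * B) / 2"
  define K where "K = strauss_const ?n * B"
  have K0: "0 \<le> K" using B0 by (simp add: K_def)
  have m: "K < m" "m < F x" "0 < m"
    using gt K0 unfolding m_def K_def[symmetric] by (auto simp: field_simps)
  have "R < norm x"
  proof (rule ccontr)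
    assume "\<not> R < norm x"
    then have "rad R x \<le> 1" using R by (simp add: rad_def power_mono)
    then show False using m by (simp add: F_def v_zero)
  qed
  then have x: "0 < norm x" using R by linarith
  define S where "S = (norm x)\<^sup>2"
  have S: "0 < S" using x by (simp add: S_def)
  have Fc: "isCont F x"
  proof -
    have 1: "isCont (\<lambda>x. veta (rad R x)) x"
      by (rule isCont_o2[OF rad_continuous DERIV_isCont[OF DERIV_veta]])
    have "isCont u x" using cont by (simp add: continuous_on_eq_continuous_at)
    then show ?thesis unfolding F_def[abs_def] by (intro continuous_intros 1)
  qed
  have "((\<lambda>l. F (l *\<^sub>R x)) \<longlongrightarrow> F x) (nhds 1)"
  proof -
    have "((\<lambda>l. l *\<^sub>R x) \<longlongrightarrow> 1 *\<^sub>R x) (nhds 1)" by (intro tendsto_intros filterlim_ident)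
    then show ?thesis using isCont_tendsto_compose[OF Fc] by simp
  qed
  then have "\<forall>\<^sub>F l in nhds 1. m < F (l *\<^sub>R x)" by (rule order_tendstoD(1)) (rule m)
  then obtain d where d: "0 < d" "\<And>l. dist l 1 < d \<Longrightarrow> m < F (l *\<^sub>R x)" by (auto simp: eventually_nhds_metric)
  \<comment> \<open>The bound d S / 4 keeps |z| / |x| within d of 1 on the shell, where
    \<open>F\<close> stays above \<open>m\<close>.\<close>
  define \<delta> where "\<delta> = min (S / 2) (d * S / 4)"
  have \<delta>: "0 < \<delta>" "\<delta> \<le> S / 2" "4 * \<delta> \<le> d * S" using S d by (auto simp: \<delta>_def min_def)
  define r1 r2 where "r1 = sqrt (S + \<delta>)" and "r2 = sqrt (S + 2 * \<delta>)"
  have r: "0 < r1" "r1 \<le> r2" "r1\<^sup>2 = S + \<delta>" "r2\<^sup>2 = S + 2 * \<delta>" using S \<delta> by (auto simp: r1_def r2_def)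
  have r21: "r2 \<le> 2 * r1"
    by (rule power2_le_imp_le) (use r S \<delta> in \<open>auto simp: power_mult_distrib\<close>)
  let ?Sh = "cball (0::'a) r2 - ball 0 r1"
  have shell: "m < F z" "S + \<delta> \<le> (norm z)\<^sup>2" "(norm z)\<^sup>2 \<le> S + 2 * \<delta>" "0 < norm z" "norm z \<le> r2" if "z \<in> ?Sh" for z
  proof -
    have z: "r1 \<le> norm z" "norm z \<le> r2" using that by auto
    show "0 < norm z" "norm z \<le> r2" using z r by auto
    show sq: "S + \<delta> \<le> (norm z)\<^sup>2" "(norm z)\<^sup>2 \<le> S + 2 * \<delta>"
      using power_mono[OF z(1), of 2] power_mono[OF z(2), of 2] r by auto
    define l where "l = norm z / norm x"
    have l2: "l\<^sup>2 = (norm z)\<^sup>2 / S" by (simp add: l_def S_def power_divide)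
    have l0: "0 \<le> l" by (simp add: l_def)
    have "1 \<le> l\<^sup>2" using sq S \<delta> by (simp add: l2)
    then have l1: "1 \<le> l" using l0 by (smt (verit) power2_eq_square mult_left_le_one_le power_le_one_iff)
    have "l\<^sup>2 \<le> 1 + 2 * \<delta> / S" using sq S by (simp add: l2 field_simps)
    moreover have "2 * \<delta> / S < d" using \<delta> S d(1) by (simp add: field_simps)
    moreover have "l \<le> l\<^sup>2" using l1 by (simp add: self_le_power)
    ultimately have "dist l 1 < d" using l1 by (simp add: dist_real_def)
    then have "m < F (l *\<^sub>R x)" by (rule d)
    also have "norm (l *\<^sub>R x) = norm z" using l0 x by (simp add: l_def)
    then have "F (l *\<^sub>R x) = F z" using radial[of "l *\<^sub>R x" z] by (simp add: F_def rad_def)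
    finally show "m < F z" .
  qed
  note flux = radial_flux_le[where R=R and \<delta>="\<delta>" and n="?n" and u=u and D=D and S=S, OF R \<delta>(1) dim D refl]
  let ?f = "\<lambda>z. flux_coeff1 R S \<delta> z * (norm z)\<^sup>2 * inverse (norm z) ^ ?n * (cmod (u z))\<^sup>2"
  let ?c = "2 / 25 / \<delta> * inverse r2 ^ (?n - 2) * m"
  have c0: "0 \<le> ?c" using \<delta> r m by simp
  have low: "?c * indicator ?Sh z \<le> ?f z" for z
  proof (cases "z \<in> ?Sh")
    case False
    then show ?thesis using flux_coeff_range(4)[OF R \<delta>(1) dim, of S z] by simp
  next
    case True
    note z = shell[OF True]
    let ?s = "((norm z)\<^sup>2 - S) / \<delta> + 1"
    \<comment> \<open>On the shell \<open>?s\<close> lies in [2, 3], so q = \<open>rmp ?s\<close>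
      lies in [1, 2], where 2 q / (1 + q^2)^2 is at least 2/25.\<close>
    have q: "1 \<le> rmp ?s" "rmp ?s \<le> 2" using z \<delta> by (auto simp: rmp_def field_simps)
    have "(1 + (rmp ?s)\<^sup>2)\<^sup>2 \<le> (1 + 2\<^sup>2)\<^sup>2" using q by (intro power_mono add_left_mono) auto
    then have "2 / 25 \<le> veta1 ?s" unfolding veta1_def using q by (intro frac_le) auto
    then have "veta (rad R z) * (2 / 25 / \<delta>) \<le> veta (rad R z) * (veta1 ?s / \<delta>)"
      using \<delta> by (intro mult_left_mono divide_right_mono) (auto simp: veta_range)
    also have "\<dots> \<le> flux_coeff1 R S \<delta> z" unfolding flux_coeff1_def[OF R \<delta>(1) dim] by (simp add: veta_range veta1_nonneg)
    finally have 1: "veta (rad R z) * (2 / 25 / \<delta>) \<le> flux_coeff1 R S \<delta> z" .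
    have 2: "(norm z)\<^sup>2 * inverse (norm z) ^ ?n = inverse (norm z) ^ (?n - 2)"
      using z(4) dim by (simp add: power_diff power_inverse divide_inverse)
    have 3: "inverse r2 ^ (?n - 2) \<le> inverse (norm z) ^ (?n - 2)"
      using z by (intro power_mono le_imp_inverse_le) (use r in auto)
    have "?c \<le> (2 / 25 / \<delta> * inverse (norm z) ^ (?n - 2)) * F z"
      using 3 z(1) m \<delta> r by (intro mult_mono mult_left_mono) auto
    also have "\<dots> = veta (rad R z) * (2 / 25 / \<delta>) * ((norm z)\<^sup>2 * inverse (norm z) ^ ?n) * (cmod (u z))\<^sup>2"
      unfolding 2 by (simp add: F_def)
    also have "\<dots> \<le> flux_coeff1 R S \<delta> z * ((norm z)\<^sup>2 * inverse (norm z) ^ ?n) * (cmod (u z))\<^sup>2"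
      by (intro mult_right_mono 1) auto
    finally show ?thesis using True by (simp add: mult.assoc)
  qed
  note sm = shell_measure[OF less_imp_le[OF r(1)] r(2) dim]
  have "m * (2 / 25 * ?w * (1 / 2) ^ (?n - 2)) \<le> m * (2 / 25 * ?w * (inverse r2 * r1) ^ (?n - 2))"
    using r r21 m by (intro mult_left_mono power_mono) (auto simp: field_simps)
  also have "\<dots> = ?c * (?w * (r2\<^sup>2 - r1\<^sup>2) * r1 ^ (?n - 2))"
    using \<delta> by (simp add: r power_mult_distrib field_simps)
  also have "\<dots> \<le> ?c * measure lborel ?Sh" by (rule mult_left_mono[OF sm(2) c0])
  also have "\<dots> = (LINT z|lborel. ?c * indicator ?Sh z)" by simp
  also have "\<dots> \<le> (LINT z|lborel. ?f z)"
    using sm(1) by (intro integral_mono low flux(1)) (auto simp: integrable_indicator_iff fmeasurable_def)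
  also have "\<dots> \<le> B" using flux(2) by (simp add: B_def)
  finally have "m * (2 / 25 * ?w * (1 / 2) ^ (?n - 2)) \<le> B" .
  then have "m \<le> K" unfolding K_def using w0 by (simp add: field_simps power_one_over)
  then show False using m by linarith
qed

section \<open>The virial identity\<close>

definition hess :: "real \<Rightarrow> 'a::euclidean_space \<Rightarrow> 'a \<Rightarrow> 'a \<Rightarrow> real" where
  "hess R b c x = 2 * vg (rad R x) * (b \<bullet> c) + 4 / R\<^sup>2 * vg1 (rad R x) * (x \<bullet> b) * (x \<bullet> c)"

definition dirY :: "real \<Rightarrow> ('a::euclidean_space \<Rightarrow> 'a \<Rightarrow> complex) \<Rightarrow> 'a \<Rightarrow> complex" where
  "dirY R D x = (\<Sum>b\<in>Basis. (2 * vg (rad R x) * (x \<bullet> b)) *\<^sub>R D b x)"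

text \<open>With \<open>D = \<nabla>u\<close>, \<open>dirY\<close> is \<open>\<nabla>\<psi> \<cdot> \<nabla>u\<close> and \<open>dirW\<close> is \<open>2 \<nabla>\<psi> \<cdot> \<nabla>u + (\<Delta>\<psi>) u\<close>.\<close>

definition dirW :: "real \<Rightarrow> ('a::euclidean_space \<Rightarrow> 'a \<Rightarrow> complex) \<Rightarrow> ('a \<Rightarrow> complex) \<Rightarrow> 'a \<Rightarrow> complex" where
  "dirW R D u x = 2 *\<^sub>R dirY R D x + vdiv (real DIM('a)) (rad R x) *\<^sub>R u x"

section \<open>Bounds for the multipliers built from \<psi>\<close>

lemma weight_hess:
  "0 < R \<Longrightarrow> b \<in> Basis \<Longrightarrow> c \<in> Basis \<Longrightarrow> weight (\<lambda>x. 2 * vg (rad R x) * (x \<bullet> c)) b (hess R b c)"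
  using weight_grad[of R b c] by (simp add: hess_def[abs_def])

lemma weight_L2:
  assumes "weight p b p'" "f \<in> L2" shows "(\<lambda>x. p x *\<^sub>R f x) \<in> L2" "(\<lambda>x. p' x *\<^sub>R f x) \<in> L2"
  using weightE[OF assms(1)] L2_scaleR_bounded[OF assms(2)] by metis+

lemma sum_hess: assumes "0 < R"
  shows "(\<Sum>b\<in>Basis. hess R b b x) = vdiv (real DIM('a)) (rad R (x::'a::euclidean_space))"
proof -
  have "(\<Sum>b\<in>Basis. hess R b b x) = (\<Sum>b\<in>(Basis::'a set). 2 * vg (rad R x)) + 4 / R\<^sup>2 * vg1 (rad R x) * (\<Sum>b\<in>Basis. (x \<bullet> b)\<^sup>2)"
    unfolding hess_def sum.distrib sum_distrib_left by (simp add: power2_eq_square mult.assoc)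
  then show ?thesis using assms by (simp add: vdiv_def sum_inner_Basis_sq rad_def)
qed

text \<open>\<psi> is radial, so its gradient sees only the radial derivative.\<close>

lemma dirY_eq: "dirY R D x = (2 * vg (rad R x) * norm x) *\<^sub>R radial_deriv D x"
proof (cases "x = 0")
  case False
  then have "(2 * vg (rad R x) * norm x) * ((x \<bullet> b) * inverse (norm x)) = 2 * vg (rad R x) * (x \<bullet> b)" for b by simp
  then show ?thesis unfolding dirY_def radial_deriv_def scaleR_sum_right scaleR_scaleR by (simp only:)
qed (simp add: dirY_def)

lemma sum_inner_deriv: "(\<Sum>b\<in>Basis. (x \<bullet> b) *\<^sub>R D b x) = norm x *\<^sub>R radial_deriv D x"
proof (cases "x = 0")
  case False
  then have "norm x * ((x \<bullet> b) * inverse (norm x)) = x \<bullet> b" for b by simp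
  then show ?thesis unfolding radial_deriv_def scaleR_sum_right scaleR_scaleR by (simp only:)
qed simp

lemma dirY_weight_bound: assumes "0 < R" shows "\<bar>2 * vg (rad R x) * norm x\<bar> \<le> 4 * R"
proof -
  have "\<bar>2 * vg (rad R x) * norm x\<bar> = 2 * R * (sqrt (rad R x) * vg (rad R x))"
    using assms vg_range[of "rad R x"] by (simp add: sqrt_rad abs_mult)
  also have "\<dots> \<le> 2 * R * 2" using assms vg_sqrt_bound[OF rad_nonneg] by (intro mult_left_mono) auto
  finally show ?thesis by simp
qed

lemma dirY_L2:
  fixes D :: "'a::euclidean_space \<Rightarrow> 'a \<Rightarrow> complex"
  assumes "0 < R" "\<And>b. b \<in> Basis \<Longrightarrow> D b \<in> L2" shows "dirY R D \<in> L2"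
  unfolding dirY_def[abs_def] using weight_L2(1)[OF weight_hess[OF assms(1)]] assms(2) by (intro L2_sum) blast

lemma dirY_norm:
  fixes D :: "'a::euclidean_space \<Rightarrow> 'a \<Rightarrow> complex"
  assumes R: "0 < R" and D: "\<And>b. b \<in> Basis \<Longrightarrow> D b \<in> L2"
  shows "L2_norm (dirY R D) \<le> 4 * R * sqrt (\<Sum>b\<in>Basis. ip (D b) (D b))"
proof -
  have U: "radial_deriv D \<in> L2" by (rule radial_deriv_L2[OF D])
  have "L2_norm (dirY R D) \<le> 4 * R * L2_norm (radial_deriv D)"
  proof (rule L2_norm_mono[OF U])
    show "dirY R D \<in> borel_measurable borel" by (rule L2_measurable[OF dirY_L2[OF R D]])
    show "AE x in lborel. cmod (dirY R D x) \<le> 4 * R * cmod (radial_deriv D x)"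
      unfolding dirY_eq norm_scaleR by (intro AE_I2 mult_right_mono dirY_weight_bound R) auto
  qed (use R in simp)
  also have "L2_norm (radial_deriv D) \<le> sqrt (\<Sum>b\<in>Basis. ip (D b) (D b))"
  proof (rule real_le_rsqrt)
    have "(L2_norm (radial_deriv D))\<^sup>2 \<le> (LINT x|lborel. (\<Sum>b\<in>Basis. D b x \<bullet> D b x))"
      unfolding L2_norm_sq ip_def
      by (intro integral_mono integrable_ip U Bochner_Integration.integrable_sum D
        radial_deriv_le[of D, unfolded power2_norm_eq_inner])
    then show "(L2_norm (radial_deriv D))\<^sup>2 \<le> (\<Sum>b\<in>Basis. ip (D b) (D b))"
      unfolding ip_def by (simp add: integrable_ip D)
  qed
  finally show ?thesis using R by (simp add: mult_left_mono)
qed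

lemma vdiv_rad_L2: "f \<in> L2 \<Longrightarrow> (\<lambda>x::'a::euclidean_space. vdiv (real DIM('a)) (rad R x) *\<^sub>R f x) \<in> L2"
  by (rule L2_scaleR_bounded[where C="2 * real DIM('a) + 40"]) (auto intro!: vdiv_bound)

lemma dirW_L2:
  fixes D :: "'a::euclidean_space \<Rightarrow> 'a \<Rightarrow> complex"
  assumes "0 < R" "\<And>b. b \<in> Basis \<Longrightarrow> D b \<in> L2" "u \<in> L2" shows "dirW R D u \<in> L2"
  unfolding dirW_def[abs_def] by (intro L2_add L2_scaleR dirY_L2 vdiv_rad_L2 assms)

lemma dirW_norm:
  fixes D :: "'a::euclidean_space \<Rightarrow> 'a \<Rightarrow> complex"
  assumes R: "0 < R" and D: "\<And>b. b \<in> Basis \<Longrightarrow> D b \<in> L2" and u: "u \<in> L2"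
  shows "L2_norm (dirW R D u) \<le> 8 * R * sqrt (\<Sum>b\<in>Basis. ip (D b) (D b)) + (2 * real DIM('a) + 40) * L2_norm u"
proof -
  let ?d = "\<lambda>x. vdiv (real DIM('a)) (rad R x) *\<^sub>R u x"
  have "L2_norm (dirW R D u) \<le> L2_norm (\<lambda>x. 2 *\<^sub>R dirY R D x) + L2_norm ?d"
    unfolding dirW_def[abs_def] by (intro L2_norm_triangle L2_scaleR dirY_L2 vdiv_rad_L2 R D u)
  moreover have "L2_norm ?d \<le> (2 * real DIM('a) + 40) * L2_norm u"
    by (rule L2_norm_mono[OF u L2_measurable[OF vdiv_rad_L2[OF u]]]) (auto intro!: mult_right_mono vdiv_bound)
  ultimately show ?thesis using dirY_norm[where D=D, OF R D] by (simp add: mult.assoc)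
qed

text \<open>Pairing \<Delta>u with 2 grad \<psi> . grad u produces the Hessian form and a multiple
  of (\<Delta>\<psi>) |grad u|^2, which the part (\<Delta>\<psi>) u of \<open>dirW\<close> cancels.
  The last linear term is left as grad \<Delta>\<psi> . grad u paired with \<open>u\<close>, so
  fourth derivatives of \<psi> never occur.\<close>

lemma virial_identity:
  fixes u :: "'a::euclidean_space \<Rightarrow> complex"
  assumes u: "u \<in> H2" and B: "\<And>x. cmod (u x) \<le> B" and a: "0 < \<alpha>" and R: "0 < R"
  defines "D \<equiv> \<lambda>b. weak_deriv b u"
  shows "ip (\<lambda>x. laplacian u x + nl \<alpha> (u x)) (dirW R D u) =
    - 2 * (\<Sum>b\<in>Basis. \<Sum>c\<in>Basis. ip (\<lambda>x. hess R b c x *\<^sub>R D b x) (D c))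
    - (\<Sum>b\<in>Basis. ip (\<lambda>x. (2 / R\<^sup>2 * vdiv1 (real DIM('a)) (rad R x) * (x \<bullet> b)) *\<^sub>R D b x) u)
    + \<alpha> / (\<alpha> + 2) * (LINT x|lborel. vdiv (real DIM('a)) (rad R x) * cmod (u x) powr (\<alpha> + 2))"
proof -
  let ?a = "\<lambda>c x. 2 * vg (rad R x) * (x \<bullet> c)"
  let ?d = "\<lambda>x::'a. vdiv (real DIM('a)) (rad R x)"
  let ?d1 = "\<lambda>b x::'a. 2 / R\<^sup>2 * vdiv1 (real DIM('a)) (rad R x) * (x \<bullet> b)"
  let ?DD = "\<lambda>c b. weak_deriv c (D b)"
  have D_eq: "weak_deriv b u = D b" for b by (simp add: D_def)
  have Dw: "has_weak_deriv u b (D b)" if "b \<in> Basis" for b unfolding D_def by (intro H1_weak_deriv H2_H1 u that)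
  have DDw: "has_weak_deriv (D b) c (?DD c b)" if "b \<in> Basis" "c \<in> Basis" for b c
    unfolding D_def by (intro H2_weak_deriv2 u that)
  have uL: "u \<in> L2" by (intro H1_L2 H2_H1 u)
  have DL: "D b \<in> L2" if "b \<in> Basis" for b using has_weak_deriv_L2[OF Dw[OF that]] by simp
  have DDL: "?DD c b \<in> L2" if "b \<in> Basis" "c \<in> Basis" for b c using has_weak_deriv_L2[OF DDw[OF that]] by simp
  have NL: "(\<lambda>x. nl \<alpha> (u x)) \<in> L2" by (rule nl_L2[OF a uL B])
  have LL: "laplacian u \<in> L2" by (rule laplacian_L2[OF u])
  have YL: "dirY R D \<in> L2" by (rule dirY_L2[OF R DL])
  have duL: "(\<lambda>x. ?d x *\<^sub>R u x) \<in> L2" by (rule vdiv_rad_L2[OF uL])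
  have aL: "(\<lambda>x. ?a c x *\<^sub>R f x) \<in> L2" if "f \<in> L2" "c \<in> Basis" for f c
    by (rule weight_L2(1)[OF weight_hess[OF R that(2) that(2)] that(1)])
  have hL: "(\<lambda>x. hess R b c x *\<^sub>R f x) \<in> L2" if "f \<in> L2" "c \<in> Basis" "b \<in> Basis" for f b c
    by (rule weight_L2(2)[OF weight_hess[OF R that(3,2)] that(1)])
  have pull: "ip f (\<lambda>x. p x *\<^sub>R g x) = ip (\<lambda>x. p x *\<^sub>R f x) g" for p :: "'a \<Rightarrow> real" and f g :: "'a \<Rightarrow> complex"
    by (simp add: ip_def)
  have hsum: "(\<Sum>c\<in>Basis. ip (\<lambda>x. hess R c c x *\<^sub>R f x) f) = ip (\<lambda>x. ?d x *\<^sub>R f x) f" if f: "f \<in> L2" for f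
  proof -
    have "(\<Sum>c\<in>Basis. ip (\<lambda>x. hess R c c x *\<^sub>R f x) f) = ip (\<lambda>x. \<Sum>c\<in>Basis. hess R c c x *\<^sub>R f x) f"
      by (rule ip_sum_left[symmetric]) (auto intro: hL f)
    then show ?thesis by (simp only: sum_hess[OF R] flip: scaleR_sum_left)
  qed
  have lap_u: "ip (laplacian u) (\<lambda>x. ?d x *\<^sub>R u x) = - (\<Sum>b\<in>Basis. ip (\<lambda>x. ?d x *\<^sub>R D b x) (D b)) - (\<Sum>b\<in>Basis. ip (\<lambda>x. ?d1 b x *\<^sub>R D b x) u)"
  proof -
    have "ip (laplacian u) (\<lambda>x. ?d x *\<^sub>R u x) = (\<Sum>b\<in>Basis. ip (?DD b b) (\<lambda>x. ?d x *\<^sub>R u x))"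
      unfolding laplacian_def[abs_def] D_eq by (rule ip_sum_left) (auto intro: DDL duL)
    also have "\<dots> = (\<Sum>b\<in>Basis. - ip (\<lambda>x. ?d x *\<^sub>R D b x) (D b) - ip (\<lambda>x. ?d1 b x *\<^sub>R D b x) u)"
    proof (rule sum.cong[OF refl])
      fix b :: 'a assume b: "b \<in> Basis"
      show "ip (?DD b b) (\<lambda>x. ?d x *\<^sub>R u x) = - ip (\<lambda>x. ?d x *\<^sub>R D b x) (D b) - ip (\<lambda>x. ?d1 b x *\<^sub>R D b x) u"
        using weak_Leibniz[OF weight_div[OF R b, of "real DIM('a)"] DDw[OF b b] Dw[OF b] b] by (simp add: pull)
    qed
    finally show ?thesis by (simp only: sum_subtractf sum_negf)
  qed
  have lap_Y: "ip (laplacian u) (dirY R D) = - (\<Sum>b\<in>Basis. \<Sum>c\<in>Basis. ip (\<lambda>x. hess R b c x *\<^sub>R D b x) (D c))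
    + 1 / 2 * (\<Sum>b\<in>Basis. ip (\<lambda>x. ?d x *\<^sub>R D b x) (D b))"
  proof -
    have "ip (laplacian u) (dirY R D) = (\<Sum>b\<in>Basis. ip (?DD b b) (dirY R D))"
      unfolding laplacian_def[abs_def] D_eq by (rule ip_sum_left) (auto intro: DDL YL)
    also have "\<dots> = (\<Sum>b\<in>Basis. \<Sum>c\<in>Basis. ip (?DD b b) (\<lambda>x. ?a c x *\<^sub>R D c x))"
      unfolding dirY_def[abs_def] by (intro sum.cong refl ip_sum_right aL DL DDL)
    also have "\<dots> = (\<Sum>b\<in>Basis. (\<Sum>c\<in>Basis. - ip (\<lambda>x. hess R b c x *\<^sub>R D b x) (D c)) + 1 / 2 * ip (\<lambda>x. ?d x *\<^sub>R D b x) (D b))"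
    proof (rule sum.cong[OF refl])
      fix b :: 'a assume b: "b \<in> Basis"
      have 1: "ip (?DD b b) (\<lambda>x. ?a c x *\<^sub>R D c x) = - ip (\<lambda>x. ?a c x *\<^sub>R D b x) (?DD c b) - ip (\<lambda>x. hess R b c x *\<^sub>R D b x) (D c)"
        if c: "c \<in> Basis" for c
      proof -
        \<comment> \<open>The mixed derivatives in the two orders are separate choices of
          representatives; they are identified almost everywhere.\<close>
        have "has_weak_deriv (D b) c (?DD b c)"
          by (rule has_weak_deriv_commute[OF Dw[OF b] Dw[OF c] DDw[OF c b] b c])
        then have "AE x in lborel. ?DD b c x = ?DD c b x"
          using has_weak_deriv_unique[OF _ DDw[OF b c] c] by blast
        then have "ip (\<lambda>x. ?a c x *\<^sub>R D b x) (?DD b c) = ip (\<lambda>x. ?a c x *\<^sub>R D b x) (?DD c b)"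
          by (intro ip_cong_AE aL DL DDL b c) auto
        then show ?thesis
          using weak_Leibniz[OF weight_hess[OF R b c] DDw[OF b b] DDw[OF c b] b] by (simp add: pull)
      qed
      \<comment> \<open>Pairing a derivative with its own derivative gives half the derivative of a
        square: the Leibniz rule with both functions equal to \<open>D b\<close>.\<close>
      have 2: "- ip (\<lambda>x. ?a c x *\<^sub>R D b x) (?DD c b) = 1 / 2 * ip (\<lambda>x. hess R c c x *\<^sub>R D b x) (D b)" if c: "c \<in> Basis" for c
      proof -
        have "ip (\<lambda>x. ?a c x *\<^sub>R ?DD c b x) (D b) = ip (\<lambda>x. ?a c x *\<^sub>R D b x) (?DD c b)"
          by (simp add: ip_def inner_commute)
        then show ?thesis using weak_Leibniz[OF weight_hess[OF R c c] DDw[OF b c] DDw[OF b c] c] by linarith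
      qed
      have "(\<Sum>c\<in>Basis. ip (?DD b b) (\<lambda>x. ?a c x *\<^sub>R D c x)) = (\<Sum>c\<in>Basis. 1 / 2 * ip (\<lambda>x. hess R c c x *\<^sub>R D b x) (D b) + - ip (\<lambda>x. hess R b c x *\<^sub>R D b x) (D c))"
        using 1 2 by (intro sum.cong refl) simp
      also have "\<dots> = 1 / 2 * ip (\<lambda>x. ?d x *\<^sub>R D b x) (D b) + (\<Sum>c\<in>Basis. - ip (\<lambda>x. hess R b c x *\<^sub>R D b x) (D c))"
        unfolding sum.distrib hsum[OF DL[OF b], symmetric] by (simp only: sum_distrib_left)
      finally show "(\<Sum>c\<in>Basis. ip (?DD b b) (\<lambda>x. ?a c x *\<^sub>R D c x)) =
        (\<Sum>c\<in>Basis. - ip (\<lambda>x. hess R b c x *\<^sub>R D b x) (D c)) + 1 / 2 * ip (\<lambda>x. ?d x *\<^sub>R D b x) (D b)" by simp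
    qed
    finally show ?thesis by (simp only: sum.distrib sum_negf sum_distrib_left)
  qed
  have pint: "integrable lborel (\<lambda>x. hess R b b x * cmod (u x) powr (\<alpha> + 2))" if b: "b \<in> Basis" for b
    using integrable_ip(1)[OF hL[OF NL b b] uL] by (simp add: nl_inner[OF a])
  have nl_Y: "ip (\<lambda>x. nl \<alpha> (u x)) (dirY R D) = - 1 / (\<alpha> + 2) * (LINT x|lborel. ?d x * cmod (u x) powr (\<alpha> + 2))"
  proof -
    have "(LINT x|lborel. ?d x * cmod (u x) powr (\<alpha> + 2)) = (LINT x|lborel. (\<Sum>b\<in>Basis. hess R b b x * cmod (u x) powr (\<alpha> + 2)))"
      by (simp only: sum_hess[OF R] flip: sum_distrib_right)
    also have "\<dots> = (\<Sum>b\<in>Basis. LINT x|lborel. hess R b b x * cmod (u x) powr (\<alpha> + 2))"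
      by (rule Bochner_Integration.integral_sum) (rule pint)
    also have "\<dots> = (\<Sum>b\<in>Basis. - (\<alpha> + 2) * ip (\<lambda>x. nl \<alpha> (u x)) (\<lambda>x. ?a b x *\<^sub>R D b x))"
      unfolding pull by (intro sum.cong refl weak_deriv_powr[OF weight_hess[OF R] Dw _ a B])
    also have "\<dots> = - (\<alpha> + 2) * ip (\<lambda>x. nl \<alpha> (u x)) (dirY R D)"
      unfolding dirY_def[abs_def] sum_distrib_left[symmetric] by (subst ip_sum_right) (auto intro: aL DL NL)
    finally show ?thesis using a by (simp add: field_simps)
  qed
  have nl_u: "ip (\<lambda>x. nl \<alpha> (u x)) (\<lambda>x. ?d x *\<^sub>R u x) = (LINT x|lborel. ?d x * cmod (u x) powr (\<alpha> + 2))"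
    by (simp add: ip_def nl_inner[OF a])
  have "ip (\<lambda>x. laplacian u x + nl \<alpha> (u x)) (dirW R D u) = 2 * ip (laplacian u) (dirY R D) + ip (laplacian u) (\<lambda>x. ?d x *\<^sub>R u x)
     + (2 * ip (\<lambda>x. nl \<alpha> (u x)) (dirY R D) + ip (\<lambda>x. nl \<alpha> (u x)) (\<lambda>x. ?d x *\<^sub>R u x))"
    unfolding dirW_def[abs_def]
    by (simp only: ip_add_left ip_add_right LL NL L2_add L2_scaleR YL duL ip_scaleR_right)
  also have "\<dots> = - 2 * (\<Sum>b\<in>Basis. \<Sum>c\<in>Basis. ip (\<lambda>x. hess R b c x *\<^sub>R D b x) (D c))
    - (\<Sum>b\<in>Basis. ip (\<lambda>x. ?d1 b x *\<^sub>R D b x) u)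
    + (1 - 2 / (\<alpha> + 2)) * (LINT x|lborel. ?d x * cmod (u x) powr (\<alpha> + 2))"
    unfolding lap_u lap_Y nl_Y nl_u by (simp add: algebra_simps)
  also have "1 - 2 / (\<alpha> + 2) = \<alpha> / (\<alpha> + 2)" using a by (simp add: field_simps)
  finally show ?thesis .
qed

text \<open>All truncation effects are expressed by d, the norm of the radial derivative weighted by
  \<open>veta\<close>. The Hessian deficit yields the gain 2 d^2, the gradient of \<Delta>\<psi>
  costs a multiple of |u| d, and the missing potential energy is estimated pointwise by Strauss'
  inequality, again through d.\<close>

lemma virial_lower:
  fixes u :: "'a::euclidean_space \<Rightarrow> complex"
  assumes u: "u \<in> H2" and B: "\<And>x. cmod (u x) \<le> B" and a: "0 < \<alpha>" "\<alpha> \<le> 4" and R: "0 < R"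
    and dim: "2 \<le> DIM('a)" and cont: "continuous_on UNIV u" and radial: "\<And>x y. norm x = norm y \<Longrightarrow> u x = u y"
  defines "D \<equiv> \<lambda>b. weak_deriv b u"
  defines "\<kappa> \<equiv> strauss_const DIM('a) * inverse R ^ (DIM('a) - 1)"
  defines "d \<equiv> L2_norm (\<lambda>x. veta (rad R x) *\<^sub>R radial_deriv D x)"
  shows "- 4 * (\<Sum>b\<in>Basis. ip (D b) (D b)) + 2 * d\<^sup>2 - 2 / R * vconst (real DIM('a)) * (L2_norm u * d)
     + \<alpha> / (\<alpha> + 2) * (2 * real DIM('a) * (LINT x|lborel. cmod (u x) powr (\<alpha> + 2))
         - 176 * real DIM('a) * (\<kappa> * (L2_norm u * d)) powr (\<alpha> / 2) * (L2_norm u)\<^sup>2)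
    \<le> ip (\<lambda>x. laplacian u x + nl \<alpha> (u x)) (dirW R D u)"
proof -
  let ?n = "real DIM('a)"
  let ?U = "radial_deriv D"
  let ?e = "\<lambda>x::'a. veta (rad R x)"
  let ?d1 = "\<lambda>b x::'a. 2 / R\<^sup>2 * vdiv1 ?n (rad R x) * (x \<bullet> b)"
  let ?P = "\<lambda>x. cmod (u x) powr (\<alpha> + 2)"
  have Dw: "has_weak_deriv u b (D b)" if "b \<in> Basis" for b unfolding D_def by (intro H1_weak_deriv H2_H1 u that)
  have uL: "u \<in> L2" by (intro H1_L2 H2_H1 u)
  have DL: "D b \<in> L2" if "b \<in> Basis" for b using has_weak_deriv_L2[OF Dw[OF that]] by simp
  have UL: "?U \<in> L2" by (rule radial_deriv_L2[OF DL])
  have eUL: "(\<lambda>x. ?e x *\<^sub>R ?U x) \<in> L2" by (rule L2_scaleR_bounded[OF UL, where C=1]) (auto simp: veta_range)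
  have hL: "(\<lambda>x. hess R b c x *\<^sub>R D b x) \<in> L2" if "c \<in> Basis" "b \<in> Basis" for b c
    by (rule weight_L2(2)[OF weight_hess[OF R that(2,1)] DL[OF that(2)]])
  have d1L: "(\<lambda>x. ?d1 b x *\<^sub>R D b x) \<in> L2" if "b \<in> Basis" for b
    by (rule weight_L2(2)[OF weight_div[OF R that] DL[OF that]]) simp
  have Pint: "integrable lborel ?P" by (rule integrable_powr_norm[OF a(1) uL B])
  have hess_part: "- 4 * (\<Sum>b\<in>Basis. ip (D b) (D b)) + 2 * d\<^sup>2 \<le> - 2 * (\<Sum>b\<in>Basis. \<Sum>c\<in>Basis. ip (\<lambda>x. hess R b c x *\<^sub>R D b x) (D c))"
  proof -
    have hi: "integrable lborel (\<lambda>x. \<Sum>b\<in>Basis. \<Sum>c\<in>Basis. (hess R b c x *\<^sub>R D b x) \<bullet> D c x)"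
      by (intro Bochner_Integration.integrable_sum integrable_ip hL DL)
    have Di: "integrable lborel (\<lambda>x. \<Sum>b\<in>Basis. D b x \<bullet> D b x)"
      by (intro Bochner_Integration.integrable_sum integrable_ip DL)
    have ei: "integrable lborel (\<lambda>x. (?e x *\<^sub>R ?U x) \<bullet> (?e x *\<^sub>R ?U x))" by (intro integrable_ip eUL)
    have "2 * (\<Sum>b\<in>Basis. \<Sum>c\<in>Basis. ip (\<lambda>x. hess R b c x *\<^sub>R D b x) (D c)) + 2 * d\<^sup>2 =
      (LINT x|lborel. 2 * (\<Sum>b\<in>Basis. \<Sum>c\<in>Basis. (hess R b c x *\<^sub>R D b x) \<bullet> D c x) + 2 * ((?e x *\<^sub>R ?U x) \<bullet> (?e x *\<^sub>R ?U x)))"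
    proof -
      have "(LINT x|lborel. (\<Sum>b\<in>Basis. \<Sum>c\<in>Basis. (hess R b c x *\<^sub>R D b x) \<bullet> D c x)) =
        (\<Sum>b\<in>Basis. \<Sum>c\<in>Basis. ip (\<lambda>x. hess R b c x *\<^sub>R D b x) (D c))"
        unfolding ip_def
        by (subst Bochner_Integration.integral_sum, intro Bochner_Integration.integrable_sum integrable_ip hL DL, assumption+)
          (intro sum.cong refl Bochner_Integration.integral_sum integrable_ip hL DL)
      then show ?thesis using hi ei by (simp add: d_def L2_norm_sq ip_def del: inner_scaleR_left inner_scaleR_right)
    qed
    also have "\<dots> \<le> (LINT x|lborel. 4 * (\<Sum>b\<in>Basis. D b x \<bullet> D b x))"
    proof (rule integral_mono)
      show "integrable lborel (\<lambda>x. 2 * (\<Sum>b\<in>Basis. \<Sum>c\<in>Basis. (hess R b c x *\<^sub>R D b x) \<bullet> D c x) + 2 * ((?e x *\<^sub>R ?U x) \<bullet> (?e x *\<^sub>R ?U x)))"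
        using hi ei by simp
      show "integrable lborel (\<lambda>x. 4 * (\<Sum>b\<in>Basis. D b x \<bullet> D b x))" using Di by simp
      fix x
      let ?s = "rad R x" and ?K = "\<Sum>b\<in>Basis. D b x \<bullet> D b x" and ?q = "?U x \<bullet> ?U x"
      have "(\<Sum>b\<in>Basis. \<Sum>c\<in>Basis. (hess R b c x *\<^sub>R D b x) \<bullet> D c x) =
         2 * vg ?s * (\<Sum>b\<in>Basis. \<Sum>c\<in>Basis. (b \<bullet> c) * (D b x \<bullet> D c x)) +
         4 / R\<^sup>2 * vg1 ?s * (\<Sum>b\<in>Basis. \<Sum>c\<in>Basis. ((x \<bullet> b) *\<^sub>R D b x) \<bullet> ((x \<bullet> c) *\<^sub>R D c x))"
        unfolding hess_def sum_distrib_left sum.distrib[symmetric]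
        by (intro sum.cong refl) (simp add: algebra_simps)
      also have "(\<Sum>b\<in>Basis. \<Sum>c\<in>Basis. (b \<bullet> c) * (D b x \<bullet> D c x)) = ?K"
        by (intro sum.cong refl) (simp add: inner_Basis if_distrib[of "\<lambda>z. z * _"] cong: if_cong)
      also have "(\<Sum>b\<in>Basis. \<Sum>c\<in>Basis. ((x \<bullet> b) *\<^sub>R D b x) \<bullet> ((x \<bullet> c) *\<^sub>R D c x)) = (norm x)\<^sup>2 * ?q"
        unfolding inner_sum_left[symmetric] inner_sum_right[symmetric] sum_inner_deriv by (simp add: power2_eq_square)
      also have "4 / R\<^sup>2 * vg1 ?s * ((norm x)\<^sup>2 * ?q) = 4 * ?s * vg1 ?s * ?q" by (simp add: rad_def)
      finally have h: "(\<Sum>b\<in>Basis. \<Sum>c\<in>Basis. (hess R b c x *\<^sub>R D b x) \<bullet> D c x) = 2 * vg ?s * ?K + 4 * ?s * vg1 ?s * ?q" .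
      have qK: "?q \<le> ?K" using radial_deriv_le[of D x] by (simp add: power2_norm_eq_inner)
      have "(1 - vg ?s) * ?q \<le> (1 - vg ?s) * ?K" using vg_range[of ?s] by (intro mult_left_mono qK) auto
      moreover have "(?e x)\<^sup>2 * ?q \<le> (2 * (1 - vg ?s) - 4 * ?s * vg1 ?s) * ?q"
        by (rule mult_right_mono[OF v_deficit(1)]) auto
      moreover have ee: "(?e x *\<^sub>R ?U x) \<bullet> (?e x *\<^sub>R ?U x) = (?e x)\<^sup>2 * ?q" by (simp add: power2_eq_square)
      ultimately show "2 * (\<Sum>b\<in>Basis. \<Sum>c\<in>Basis. (hess R b c x *\<^sub>R D b x) \<bullet> D c x) + 2 * ((?e x *\<^sub>R ?U x) \<bullet> (?e x *\<^sub>R ?U x)) \<le> 4 * ?K"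
        unfolding h ee by (simp add: algebra_simps)
    qed
    also have "\<dots> = 4 * (\<Sum>b\<in>Basis. ip (D b) (D b))" unfolding ip_def by (simp add: integrable_ip DL)
    finally show ?thesis by simp
  qed
  have div_part: "(\<Sum>b\<in>Basis. ip (\<lambda>x. ?d1 b x *\<^sub>R D b x) u) \<le> 2 / R * vconst ?n * (L2_norm u * d)"
  proof -
    have pt: "(\<Sum>b\<in>Basis. (?d1 b x *\<^sub>R D b x) \<bullet> u x) = (2 / R\<^sup>2 * vdiv1 ?n (rad R x)) * norm x * (?U x \<bullet> u x)" for x
    proof -
      have "(\<Sum>b\<in>Basis. (?d1 b x *\<^sub>R D b x) \<bullet> u x) = (2 / R\<^sup>2 * vdiv1 ?n (rad R x)) * ((\<Sum>b\<in>Basis. (x \<bullet> b) *\<^sub>R D b x) \<bullet> u x)"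
        by (simp add: inner_sum_left sum_distrib_left mult.assoc)
      then show ?thesis unfolding sum_inner_deriv by simp
    qed
    have i: "integrable lborel (\<lambda>x. \<Sum>b\<in>Basis. (?d1 b x *\<^sub>R D b x) \<bullet> u x)"
      by (intro Bochner_Integration.integrable_sum integrable_ip d1L uL)
    have "(\<Sum>b\<in>Basis. ip (\<lambda>x. ?d1 b x *\<^sub>R D b x) u) = (LINT x|lborel. (\<Sum>b\<in>Basis. (?d1 b x *\<^sub>R D b x) \<bullet> u x))"
      unfolding ip_def by (rule Bochner_Integration.integral_sum[symmetric]) (intro integrable_ip d1L uL)
    also have "\<dots> \<le> (LINT x|lborel. 2 / R * vconst ?n * (cmod (u x) * cmod (?e x *\<^sub>R ?U x)))"
    proof (rule integral_mono[OF i])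
      show "integrable lborel (\<lambda>x. 2 / R * vconst ?n * (cmod (u x) * cmod (?e x *\<^sub>R ?U x)))"
        using integrable_ip(2)[OF uL eUL] by simp
      fix x
      have "(\<Sum>b\<in>Basis. (?d1 b x *\<^sub>R D b x) \<bullet> u x) \<le> \<bar>(2 / R\<^sup>2 * vdiv1 ?n (rad R x)) * norm x * (?U x \<bullet> u x)\<bar>"
        unfolding pt by (rule abs_ge_self)
      also have "\<dots> \<le> (\<bar>2 / R\<^sup>2 * vdiv1 ?n (rad R x)\<bar> * norm x) * (cmod (?U x) * cmod (u x))"
        unfolding abs_mult[of _ "?U x \<bullet> u x"] abs_mult[of _ "norm x"] abs_norm_cancel
        by (intro mult_left_mono Cauchy_Schwarz_ineq2) auto
      also have "\<dots> \<le> (2 / R * (vconst ?n * ?e x)) * (cmod (?U x) * cmod (u x))"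
        by (intro mult_right_mono weight_div_bound R) auto
      finally show "(\<Sum>b\<in>Basis. (?d1 b x *\<^sub>R D b x) \<bullet> u x) \<le> 2 / R * vconst ?n * (cmod (u x) * cmod (?e x *\<^sub>R ?U x))"
        by (simp add: veta_range mult_ac)
    qed
    also have "\<dots> = 2 / R * vconst ?n * (LINT x|lborel. cmod (u x) * cmod (?e x *\<^sub>R ?U x))"
      by (rule integral_mult_right_zero)
    also have "\<dots> \<le> 2 / R * vconst ?n * (L2_norm u * d)"
      unfolding d_def using R by (intro mult_left_mono integral_norm_mult_le[OF uL eUL]) auto
    finally show ?thesis .
  qed
  define Q where "Q = (\<kappa> * (L2_norm u * d)) powr (\<alpha> / 2)"
  have pot_part: "2 * ?n * (LINT x|lborel. ?P x) - 176 * ?n * Q * (L2_norm u)\<^sup>2 \<le> (LINT x|lborel. vdiv ?n (rad R x) * ?P x)"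
  proof -
    have vi: "integrable lborel (\<lambda>x. vdiv ?n (rad R x) * ?P x)"
    proof (rule Bochner_Integration.integrable_bound)
      show "integrable lborel (\<lambda>x. (2 * ?n + 40) * ?P x)" using Pint by simp
      show "AE x in lborel. norm (vdiv ?n (rad R x) * ?P x) \<le> norm ((2 * ?n + 40) * ?P x)"
        by (intro AE_I2) (auto simp: abs_mult intro!: mult_right_mono vdiv_bound)
    qed (use L2_measurable[OF uL] in measurable)
    have "2 * ?n * (LINT x|lborel. ?P x) - 176 * ?n * Q * (L2_norm u)\<^sup>2 = (LINT x|lborel. 2 * ?n * ?P x - 176 * ?n * Q * (u x \<bullet> u x))"
      using Pint integrable_ip(1)[OF uL uL] by (simp add: L2_norm_sq ip_def)
    also have "\<dots> \<le> (LINT x|lborel. vdiv ?n (rad R x) * ?P x)"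
    proof (rule integral_mono[OF _ vi])
      show "integrable lborel (\<lambda>x. 2 * ?n * ?P x - 176 * ?n * Q * (u x \<bullet> u x))"
        using Pint integrable_ip(1)[OF uL uL] by simp
      fix x :: 'a
      let ?s = "rad R x"
      have st: "?e x * (cmod (u x))\<^sup>2 \<le> \<kappa> * (L2_norm u * d)"
        using strauss[OF Dw dim R cont radial, of x] by (simp add: \<kappa>_def d_def mult.assoc)
      have e2: "(?e x)\<^sup>2 * cmod (u x) powr \<alpha> \<le> Q"
      proof (cases "?e x = 0 \<or> u x = 0")
        case True then show ?thesis by (auto simp: Q_def)
      next
        case False
        then have pos: "0 < ?e x" "0 < cmod (u x)" using veta_range(1)[of ?s] by auto
        have "(?e x)\<^sup>2 = ?e x powr 2" using pos by simp
        \<comment> \<open>The upper bound on \<alpha> enters: \<open>veta\<close> is at most 1 and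
          \<alpha>/2 <= 2, so the square of \<open>veta\<close> supplies the power \<alpha>/2 that
          Strauss' inequality consumes.\<close>
        also have "\<dots> \<le> ?e x powr (\<alpha> / 2)" using pos a veta_range(2)[of ?s] by (intro powr_mono') auto
        finally have "(?e x)\<^sup>2 * cmod (u x) powr \<alpha> \<le> ?e x powr (\<alpha> / 2) * cmod (u x) powr \<alpha>" by (rule mult_right_mono) simp
        also have "?e x powr (\<alpha> / 2) * cmod (u x) powr \<alpha> = (?e x * (cmod (u x))\<^sup>2) powr (\<alpha> / 2)"
          using pos by (simp add: powr_mult powr_powr flip: powr_numeral)
        also have "\<dots> \<le> Q" unfolding Q_def using st pos a by (intro powr_mono2) auto
        finally show ?thesis .
      qed
      have "2 * ?n - vdiv ?n ?s \<le> ?n * (2 * (1 - vg ?s) - 4 * ?s * vg1 ?s)"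
      proof -
        \<comment> \<open>The radial deficit is nonnegative and occurs once in \<Delta>\<psi>;
          counting it n times reduces the bound to \<open>v_deficit\<close>.\<close>
        have "1 * (- (4 * ?s * vg1 ?s)) \<le> ?n * (- (4 * ?s * vg1 ?s))"
          using dim vg1_nonpos[of ?s] by (intro mult_right_mono) (auto simp: mult_nonneg_nonpos)
        then show ?thesis by (simp add: vdiv_def algebra_simps)
      qed
      also have "\<dots> \<le> ?n * (176 * (?e x)\<^sup>2)" by (intro mult_left_mono v_deficit(2)) auto
      finally have "(2 * ?n - vdiv ?n ?s) * ?P x \<le> ?n * (176 * (?e x)\<^sup>2) * ?P x" by (rule mult_right_mono) simp
      also have "?P x = cmod (u x) powr \<alpha> * (u x \<bullet> u x)"
        by (cases "u x = 0") (auto simp: powr_add power2_norm_eq_inner)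
      then have "?n * (176 * (?e x)\<^sup>2) * ?P x = 176 * ?n * ((?e x)\<^sup>2 * cmod (u x) powr \<alpha>) * (u x \<bullet> u x)" by simp
      also have "\<dots> \<le> 176 * ?n * Q * (u x \<bullet> u x)"
        by (intro mult_right_mono mult_left_mono e2) auto
      finally show "2 * ?n * ?P x - 176 * ?n * Q * (u x \<bullet> u x) \<le> vdiv ?n ?s * ?P x" by (simp add: algebra_simps)
    qed
    finally show ?thesis .
  qed
  have V: "ip (\<lambda>x. laplacian u x + nl \<alpha> (u x)) (dirW R D u) =
    - 2 * (\<Sum>b\<in>Basis. \<Sum>c\<in>Basis. ip (\<lambda>x. hess R b c x *\<^sub>R D b x) (D c))
    - (\<Sum>b\<in>Basis. ip (\<lambda>x. ?d1 b x *\<^sub>R D b x) u)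
    + \<alpha> / (\<alpha> + 2) * (LINT x|lborel. vdiv ?n (rad R x) * ?P x)"
    unfolding D_def by (rule virial_identity[OF u B a(1) R])
  have "\<alpha> / (\<alpha> + 2) * (2 * ?n * (LINT x|lborel. ?P x) - 176 * ?n * Q * (L2_norm u)\<^sup>2)
     \<le> \<alpha> / (\<alpha> + 2) * (LINT x|lborel. vdiv ?n (rad R x) * ?P x)"
    using a by (intro mult_left_mono pot_part) auto
  then show ?thesis
    using hess_part div_part V unfolding Q_def by linarith
qed

text \<open>Each of the two errors is at most a small constant plus d^2, and the gain 2 d^2 pays for
  both. The radius is fixed before \<open>u\<close>, so it depends on \<open>M\<close>,
  \<open>e0\<close>, \<alpha> and the dimension alone.\<close>

lemma virial_radius:
  assumes M: "0 < M" and e0: "0 < e0" and a: "0 < \<alpha>" "\<alpha> \<le> 4" and dim: "2 \<le> DIM('a::euclidean_space)"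
  obtains R where "0 < R" "\<And>(u :: 'a \<Rightarrow> complex) B. u \<in> H2 \<Longrightarrow> (\<And>x. cmod (u x) \<le> B) \<Longrightarrow> continuous_on UNIV u \<Longrightarrow>
    (\<And>x y. norm x = norm y \<Longrightarrow> u x = u y) \<Longrightarrow> ip u u \<le> M \<Longrightarrow>
    - 4 * (\<Sum>b\<in>Basis. ip (weak_deriv b u) (weak_deriv b u))
      + \<alpha> / (\<alpha> + 2) * (2 * real DIM('a) * (LINT x|lborel. cmod (u x) powr (\<alpha> + 2))) - e0
    \<le> ip (\<lambda>x. laplacian u x + nl \<alpha> (u x)) (dirW R (\<lambda>b. weak_deriv b u) u)"
proof -
  let ?n = "real DIM('a)"
  let ?\<kappa> = "\<lambda>R. strauss_const DIM('a) * inverse R ^ (DIM('a) - 1)"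
  let ?\<epsilon> = "\<lambda>R. 176 * ?n * M * (?\<kappa> R) powr (\<alpha> / 2)"
  let ?C = "vconst ?n"
  have i0: "((inverse :: real \<Rightarrow> real) \<longlongrightarrow> 0) at_top" by (rule tendsto_inverse_0_at_top[OF filterlim_ident])
  have "(?\<kappa> \<longlongrightarrow> strauss_const DIM('a) * 0 ^ (DIM('a) - 1)) at_top" by (intro tendsto_intros i0)
  then have k0: "(?\<kappa> \<longlongrightarrow> 0) at_top" using dim by (simp add: power_0_left)
  have "((\<lambda>R. (?\<kappa> R) powr (\<alpha> / 2)) \<longlongrightarrow> 0) at_top"
    by (rule tendsto_zero_powrI[OF k0 tendsto_const]) (use a in \<open>auto intro!: eventually_mono[OF eventually_ge_at_top[of 0]]\<close>)
  then have e: "(?\<epsilon> \<longlongrightarrow> 176 * ?n * M * 0) at_top" by (intro tendsto_intros)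
  have "((\<lambda>R. ?\<epsilon> R + ?C\<^sup>2 * M * (inverse R)\<^sup>2) \<longlongrightarrow> 176 * ?n * M * 0 + ?C\<^sup>2 * M * 0\<^sup>2) at_top"
    by (intro tendsto_add e tendsto_mult tendsto_power tendsto_const i0)
  then have "\<forall>\<^sub>F R in at_top. ?\<epsilon> R + ?C\<^sup>2 * M * (inverse R)\<^sup>2 < e0" by (rule order_tendstoD(2)) (use e0 in simp)
  moreover have "\<forall>\<^sub>F R in at_top. ?\<epsilon> R < 1 / M" by (rule order_tendstoD(2)[OF e]) (use M in simp)
  moreover have "\<forall>\<^sub>F R in at_top. 0 < (R :: real)" by (rule eventually_gt_at_top)
  ultimately have "\<forall>\<^sub>F R in at_top. ?\<epsilon> R + ?C\<^sup>2 * M * (inverse R)\<^sup>2 < e0 \<and> ?\<epsilon> R < 1 / M \<and> 0 < R"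
    by eventually_elim blast
  then obtain R where R: "?\<epsilon> R + ?C\<^sup>2 * M * (inverse R)\<^sup>2 < e0" "?\<epsilon> R < 1 / M" "0 < R"
    using eventually_happens'[OF trivial_limit_at_top_linorder] by blast
  show ?thesis
  proof (rule that[OF R(3)])
    fix u :: "'a \<Rightarrow> complex" and B
    assume u: "u \<in> H2" "\<And>x. cmod (u x) \<le> B" "continuous_on UNIV u" "\<And>x y. norm x = norm y \<Longrightarrow> u x = u y" "ip u u \<le> M"
    define N where "N = L2_norm u"
    define d where "d = L2_norm (\<lambda>x. veta (rad R x) *\<^sub>R radial_deriv (\<lambda>b. weak_deriv b u) x)"
    have N: "0 \<le> N" "N\<^sup>2 \<le> M" using u(5) by (simp_all add: N_def L2_norm_sq)
    have d: "0 \<le> d" by (simp add: d_def)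
    let ?K = "\<Sum>b\<in>Basis. ip (weak_deriv b u) (weak_deriv b u)" and ?I = "LINT x|lborel. cmod (u x) powr (\<alpha> + 2)"
    have low: "- 4 * ?K + 2 * d\<^sup>2 - 2 / R * ?C * (N * d) + \<alpha> / (\<alpha> + 2) * (2 * ?n * ?I - 176 * ?n * (?\<kappa> R * (N * d)) powr (\<alpha> / 2) * N\<^sup>2)
      \<le> ip (\<lambda>x. laplacian u x + nl \<alpha> (u x)) (dirW R (\<lambda>b. weak_deriv b u) u)"
      unfolding N_def d_def by (rule virial_lower[OF u(1,2) a R(3) dim u(3,4)])
    have cross: "2 / R * ?C * (N * d) \<le> d\<^sup>2 + ?C\<^sup>2 * M * (inverse R)\<^sup>2"
    proof -
      have "2 / R * ?C * (N * d) \<le> (?C * inverse R * N)\<^sup>2 + d\<^sup>2"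
        using sum_squares_bound[of "?C * inverse R * N" d] by (simp add: divide_inverse mult_ac)
      also have "(?C * inverse R * N)\<^sup>2 \<le> ?C\<^sup>2 * M * (inverse R)\<^sup>2"
        using mult_left_mono[OF N(2), of "?C\<^sup>2 * (inverse R)\<^sup>2"] by (simp add: power_mult_distrib mult_ac)
      finally show ?thesis by simp
    qed
    \<comment> \<open>\<alpha>/2 <= 2 once more: a base above 1 raised to this power is at most its
      square, and a smaller base gives at most 1.\<close>
    have pw: "(N * d) powr (\<alpha> / 2) \<le> 1 + M * d\<^sup>2"
    proof (cases "N * d \<le> 1")
      case True
      then have "(N * d) powr (\<alpha> / 2) \<le> 1 powr (\<alpha> / 2)" using N d a by (intro powr_mono2) auto
      then show ?thesis using M by (simp add: add_increasing2)
    next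
      case False
      then have "(N * d) powr (\<alpha> / 2) \<le> (N * d) powr 2" using a by (intro powr_mono) auto
      also have "\<dots> = N\<^sup>2 * d\<^sup>2" using False by (simp add: power_mult_distrib)
      also have "\<dots> \<le> M * d\<^sup>2" by (intro mult_right_mono N) auto
      finally show ?thesis by simp
    qed
    have "\<alpha> / (\<alpha> + 2) * (176 * ?n * (?\<kappa> R * (N * d)) powr (\<alpha> / 2) * N\<^sup>2) \<le> 1 * (176 * ?n * (?\<kappa> R * (N * d)) powr (\<alpha> / 2) * N\<^sup>2)"
      using a by (intro mult_right_mono) auto
    also have "\<dots> = 176 * ?n * (?\<kappa> R) powr (\<alpha> / 2) * ((N * d) powr (\<alpha> / 2) * N\<^sup>2)"
    proof -
      have "1 * (p * (q * r) * z) = p * q * (r * z)" for p q r z :: real by simp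
      then show ?thesis unfolding powr_mult[of "?\<kappa> R" "N * d"] .
    qed
    also have "\<dots> \<le> 176 * ?n * (?\<kappa> R) powr (\<alpha> / 2) * ((1 + M * d\<^sup>2) * M)"
      by (intro mult_left_mono mult_mono pw N) (use M in auto)
    also have "\<dots> = ?\<epsilon> R + ?\<epsilon> R * M * d\<^sup>2" by (simp add: algebra_simps)
    also have "?\<epsilon> R * M * d\<^sup>2 \<le> 1 * d\<^sup>2"
      using R(2) M by (intro mult_right_mono) (auto simp: pos_less_divide_eq)
    finally have "\<alpha> / (\<alpha> + 2) * (176 * ?n * (?\<kappa> R * (N * d)) powr (\<alpha> / 2) * N\<^sup>2) \<le> ?\<epsilon> R + d\<^sup>2" by simp
    then show "- 4 * ?K + \<alpha> / (\<alpha> + 2) * (2 * ?n * ?I) - e0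
      \<le> ip (\<lambda>x. laplacian u x + nl \<alpha> (u x)) (dirW R (\<lambda>b. weak_deriv b u) u)"
      using low cross R(1) unfolding right_diff_distrib by linarith
  qed
qed

section \<open>Bounds on the existence time\<close>

text \<open>Integration by parts shows that the pairing of i f with grad \<psi> . grad g is
  symmetric in \<open>f\<close> and \<open>g\<close> up to a term with \<Delta>\<psi>. This takes
  the gradient off a difference of solutions.\<close>

lemma ip_dirY_swap:
  fixes f g :: "'a::euclidean_space \<Rightarrow> complex"
  assumes R: "0 < R" and f: "\<And>b. b \<in> Basis \<Longrightarrow> has_weak_deriv f b (Df b)" and g: "\<And>b. b \<in> Basis \<Longrightarrow> has_weak_deriv g b (Dg b)"
  shows "ip (\<lambda>x. \<i> * f x) (dirY R Dg) = ip (\<lambda>x. \<i> * g x) (dirY R Df)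
    - ip (\<lambda>x. \<i> * (vdiv (real DIM('a)) (rad R x) *\<^sub>R f x)) g"
proof -
  obtain b0 :: 'a where b0: "b0 \<in> Basis" using nonempty_Basis by blast
  have fL: "f \<in> L2" "g \<in> L2" using has_weak_deriv_L2[OF f[OF b0]] has_weak_deriv_L2[OF g[OF b0]] by auto
  have DL: "Df b \<in> L2" "Dg b \<in> L2" if "b \<in> Basis" for b using has_weak_deriv_L2[OF f[OF that]] has_weak_deriv_L2[OF g[OF that]] by auto
  let ?a = "\<lambda>c x. 2 * vg (rad R x) * (x \<bullet> c)"
  note wL = weight_L2[OF weight_hess[OF R]]
  have "ip (\<lambda>x. ?a b x *\<^sub>R (\<i> * Df b x)) g + ip (\<lambda>x. \<i> * f x) (\<lambda>x. ?a b x *\<^sub>R Dg b x) + ip (\<lambda>x. hess R b b x *\<^sub>R (\<i> * f x)) g = 0"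
    if b: "b \<in> Basis" for b
  proof -
    have "ip (\<lambda>x. ?a b x *\<^sub>R (\<i> * f x)) (Dg b) = ip (\<lambda>x. \<i> * f x) (\<lambda>x. ?a b x *\<^sub>R Dg b x)" by (simp add: ip_def)
    then show ?thesis using weak_Leibniz[OF weight_hess[OF R b b] has_weak_deriv_cmult[OF f[OF b] b, of \<i>] g[OF b] b] by simp
  qed
  then have "0 = (\<Sum>b\<in>Basis. ip (\<lambda>x. ?a b x *\<^sub>R (\<i> * Df b x)) g + ip (\<lambda>x. \<i> * f x) (\<lambda>x. ?a b x *\<^sub>R Dg b x) + ip (\<lambda>x. hess R b b x *\<^sub>R (\<i> * f x)) g)"
    by simp
  also have "\<dots> = ip (\<lambda>x. \<Sum>b\<in>Basis. ?a b x *\<^sub>R (\<i> * Df b x)) g + ip (\<lambda>x. \<i> * f x) (\<lambda>x. \<Sum>b\<in>Basis. ?a b x *\<^sub>R Dg b x)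
     + ip (\<lambda>x. \<Sum>b\<in>Basis. hess R b b x *\<^sub>R (\<i> * f x)) g"
  proof -
    have "ip (\<lambda>x. \<Sum>b\<in>Basis. ?a b x *\<^sub>R (\<i> * Df b x)) g = (\<Sum>b\<in>Basis. ip (\<lambda>x. ?a b x *\<^sub>R (\<i> * Df b x)) g)"
      by (rule ip_sum_left) (auto intro!: wL L2_cmult DL fL)
    moreover have "ip (\<lambda>x. \<i> * f x) (\<lambda>x. \<Sum>b\<in>Basis. ?a b x *\<^sub>R Dg b x) = (\<Sum>b\<in>Basis. ip (\<lambda>x. \<i> * f x) (\<lambda>x. ?a b x *\<^sub>R Dg b x))"
      by (rule ip_sum_right) (auto intro!: wL L2_cmult DL fL)
    moreover have "ip (\<lambda>x. \<Sum>b\<in>Basis. hess R b b x *\<^sub>R (\<i> * f x)) g = (\<Sum>b\<in>Basis. ip (\<lambda>x. hess R b b x *\<^sub>R (\<i> * f x)) g)"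
      by (rule ip_sum_left) (auto intro!: wL L2_cmult DL fL)
    ultimately show ?thesis by (simp only: sum.distrib)
  qed
  also have "(\<lambda>x. \<Sum>b\<in>Basis. ?a b x *\<^sub>R (\<i> * Df b x)) = (\<lambda>x. \<i> * dirY R Df x)" by (simp add: dirY_def sum_distrib_left)
  also have "(\<lambda>x. \<Sum>b\<in>Basis. ?a b x *\<^sub>R Dg b x) = dirY R Dg" by (simp add: dirY_def fun_eq_iff)
  also have "(\<lambda>x. \<Sum>b\<in>Basis. hess R b b x *\<^sub>R (\<i> * f x)) = (\<lambda>x. \<i> * (vdiv (real DIM('a)) (rad R x) *\<^sub>R f x))"
    by (simp add: sum_hess[OF R] flip: scaleR_sum_left)
  also have "ip (\<lambda>x. \<i> * dirY R Df x) g = - ip (\<lambda>x. \<i> * g x) (dirY R Df)"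
    using ip_ii[of "dirY R Df" g] by (simp add: ip_commute)
  finally show ?thesis by simp
qed

lemma dirY_conv:
  assumes "0 < R" "\<And>b. b \<in> Basis \<Longrightarrow> L2_conv (F b) (f b) net"
  shows "L2_conv (\<lambda>s. dirY R (\<lambda>b. F b s)) (dirY R f) net"
  unfolding dirY_def[abs_def]
proof (rule L2_conv_sum)
  fix b :: 'a assume b: "b \<in> Basis"
  obtain C where "\<And>x. \<bar>2 * vg (rad R x) * (x \<bullet> b)\<bar> \<le> C" "(\<lambda>x. 2 * vg (rad R x) * (x \<bullet> b)) \<in> borel_measurable borel"
    using weightE[OF weight_hess[OF assms(1) b b]] by metis
  then show "L2_conv (\<lambda>i x. (2 * vg (rad R x) * (x \<bullet> b)) *\<^sub>R F b i x) (\<lambda>x. (2 * vg (rad R x) * (x \<bullet> b)) *\<^sub>R f b x) net"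
    by (intro L2_conv_scaleR_bounded assms(2) b)
qed

section \<open>Time derivatives of the virial quantities\<close>

context gl_solution begin

text \<open>The momentum along grad \<psi>. The derivative of \<open>virial_mass\<close>, the
  integral of \<psi> |u|^2, is 2 sin \<theta> times this momentum plus a term with the factor cos
  \<theta>.\<close>

definition virial_momentum :: "real \<Rightarrow> real \<Rightarrow> real" where "virial_momentum R t = ip (\<lambda>x. \<i> * u t x) (dirY R (\<lambda>b. D b t))"
definition virial_mass :: "real \<Rightarrow> real \<Rightarrow> real" where "virial_mass R t = ip (\<lambda>x. (R\<^sup>2 * vG (rad R x)) *\<^sub>R u t x) (u t)"

text \<open>\<open>ip_dirY_swap\<close> removes the gradient from u(s) - u(t), after which L2
  differentiability in time suffices. The two copies of grad \<psi> . grad u and the term with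
  \<Delta>\<psi> combine to \<open>dirW\<close>.\<close>

lemma virial_momentum_derivative:
  assumes R: "0 < R" and t: "t \<in> Iop"
  shows "(virial_momentum R has_real_derivative ip (\<lambda>x. \<i> * v t x) (dirW R (\<lambda>b. D b t) (u t))) (at t)"
proof -
  note tc = Iop_Icl[OF t]
  let ?Y = "\<lambda>s. dirY R (\<lambda>b. D b s)"
  let ?du = "\<lambda>x. vdiv (real DIM('a)) (rad R x) *\<^sub>R u t x"
  have YL: "?Y s \<in> L2" if "s \<in> Icl" for s by (rule dirY_L2[OF R]) (rule D_L2[OF that])
  have duL: "?du \<in> L2" by (rule vdiv_rad_L2[OF u_L2[OF tc]])
  have "(virial_momentum R has_real_derivative ip (v t) (\<lambda>x. (- \<i>) * (?Y t x + ?Y t x + ?du x))) (at t)"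
  proof (rule functional_derivative[OF t, where C=0])
    show "L2_conv (\<lambda>s x. (- \<i>) * (?Y s x + ?Y t x + ?du x)) (\<lambda>x. (- \<i>) * (?Y t x + ?Y t x + ?du x)) (at t)"
      by (intro L2_conv_cmult L2_conv_add L2_conv_const YL duL tc dirY_conv R D_conv_at t)
    fix s assume s: "s \<in> Iop"
    note sc = Iop_Icl[OF s]
    let ?w = "\<lambda>x. u s x - u t x"
    let ?Yw = "dirY R (\<lambda>b x. D b s x - D b t x)"
    have wL: "?w \<in> L2" by (intro L2_diff u_L2 sc tc)
    have dw: "has_weak_deriv ?w b (\<lambda>x. D b s x - D b t x)" if "b \<in> Basis" for b
      by (intro has_weak_deriv_diff D_weak sc tc that)
    have Yw: "?Yw = (\<lambda>x. ?Y s x - ?Y t x)"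
      by (simp add: dirY_def fun_eq_iff scaleR_right_diff_distrib sum_subtractf)
    have "virial_momentum R s - virial_momentum R t = ip (\<lambda>x. \<i> * ?w x) (?Y s) + ip (\<lambda>x. \<i> * u t x) ?Yw"
      unfolding virial_momentum_def Yw right_diff_distrib
      by (simp only: ip_diff_left ip_diff_right L2_cmult u_L2 sc tc YL)
    also have "ip (\<lambda>x. \<i> * u t x) ?Yw = ip (\<lambda>x. \<i> * ?w x) (?Y t) - ip (\<lambda>x. \<i> * ?du x) ?w"
      by (rule ip_dirY_swap[OF R D_weak[OF tc] dw])
    also have "ip (\<lambda>x. \<i> * ?du x) ?w = ip ?w (\<lambda>x. \<i> * ?du x)" by (rule ip_commute)
    finally have "virial_momentum R s - virial_momentum R t = - (ip ?w (\<lambda>x. \<i> * ?Y s x) + ip ?w (\<lambda>x. \<i> * ?Y t x) + ip ?w (\<lambda>x. \<i> * ?du x))"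
      by (simp only: ip_ii)
    also have "\<dots> = ip ?w (\<lambda>x. (- \<i>) * (?Y s x + ?Y t x + ?du x))"
    proof -
      have "(\<lambda>x. (- \<i>) * (?Y s x + ?Y t x + ?du x)) = (\<lambda>x. - (\<i> * ?Y s x + \<i> * ?Y t x + \<i> * ?du x))"
        by (simp add: algebra_simps)
      then show ?thesis
        by (simp only: ip_uminus_right ip_add_right L2_add L2_cmult wL YL sc tc duL)
    qed
    finally show "\<bar>virial_momentum R s - virial_momentum R t - ip ?w (\<lambda>x. (- \<i>) * (?Y s x + ?Y t x + ?du x))\<bar> \<le> 0 * (L2_norm ?w)\<^sup>2" by simp
  qed
  also have "ip (v t) (\<lambda>x. (- \<i>) * (?Y t x + ?Y t x + ?du x)) = ip (\<lambda>x. \<i> * v t x) (dirW R (\<lambda>b. D b t) (u t))"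
  proof -
    have "(\<lambda>x. (- \<i>) * (?Y t x + ?Y t x + ?du x)) = (\<lambda>x. - (\<i> * dirW R (\<lambda>b. D b t) (u t) x))"
      by (simp add: dirW_def fun_eq_iff scaleR_conv_of_real algebra_simps)
    then show ?thesis by (simp only: ip_uminus_right ip_ii)
  qed
  finally show ?thesis .
qed

text \<open>The equation reads cos \<theta> v - i sin \<theta> v = G, and this is its pairing with
  \<open>w\<close>. Keeping sin \<theta> on the left avoids a division that is singular at \<theta>
  = 0.\<close>

lemma sin_virial_momentum:
  assumes t: "t \<in> Iop" and w: "w \<in> L2"
  shows "sin \<theta> * ip (\<lambda>x. \<i> * v t x) w = cos \<theta> * ip (v t) w - ip (G t) w"
proof -
  have GL: "G t \<in> L2" by (rule G_L2[OF t])
  let ?a = "ip w (G t)" and ?b = "ip w (\<lambda>x. \<i> * G t x)"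
  have 1: "ip (v t) w = cos \<theta> * ?a + sin \<theta> * ?b" using ip_v[OF t w] by (simp add: ip_commute)
  have iw: "ip (\<lambda>x. \<i> * w x) (G t) = - ?b" by (simp add: ip_ii)
  have "ip (\<lambda>x. \<i> * w x) (\<lambda>x. \<i> * G t x) = ?a" by (simp add: ip_def inner_complex_def add.commute)
  then have "ip (\<lambda>x. \<i> * w x) (v t) = cos \<theta> * - ?b + sin \<theta> * ?a"
    using ip_v[OF t L2_cmult[OF w, of \<i>]] iw by simp
  moreover have "ip (\<lambda>x. \<i> * v t x) w = - ip (\<lambda>x. \<i> * w x) (v t)"
    using ip_ii[of "v t" w] by (simp add: ip_commute)
  ultimately have ivw: "ip (\<lambda>x. \<i> * v t x) w = cos \<theta> * ?b - sin \<theta> * ?a" by linarith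
  have "sin \<theta> * ip (\<lambda>x. \<i> * v t x) w = cos \<theta> * (cos \<theta> * ?a + sin \<theta> * ?b) - ((cos \<theta>)\<^sup>2 + (sin \<theta>)\<^sup>2) * ?a"
    unfolding ivw by (simp add: algebra_simps power2_eq_square del: sin_cos_squared_add sin_cos_squared_add2 sin_cos_squared_add3)
  then show ?thesis using 1 by (simp add: ip_commute[of "G t"])
qed

lemma ip_laplacian_psi:
  assumes R: "0 < R" and t: "t \<in> Iop" and g: "\<And>b. b \<in> Basis \<Longrightarrow> has_weak_deriv g b (Dg b)"
  shows "ip (laplacian (u t)) (\<lambda>x. (R\<^sup>2 * vG (rad R x)) *\<^sub>R g x) =
    - (\<Sum>b\<in>Basis. ip (\<lambda>x. (R\<^sup>2 * vG (rad R x)) *\<^sub>R D b t x) (Dg b)) - ip (dirY R (\<lambda>b. D b t)) g"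
proof -
  let ?p = "\<lambda>x. R\<^sup>2 * vG (rad R x)"
  obtain b0 :: 'a where b0: "b0 \<in> Basis" using nonempty_Basis by blast
  have gL: "g \<in> L2" using has_weak_deriv_L2[OF g[OF b0]] by simp
  note psi = weight_psi[OF R]
  have pL: "(\<lambda>x. ?p x *\<^sub>R g x) \<in> L2" by (rule weight_L2(1)[OF psi[OF b0] gL])
  have "ip (laplacian (u t)) (\<lambda>x. ?p x *\<^sub>R g x) = (\<Sum>b\<in>Basis. ip (DD b b t) (\<lambda>x. ?p x *\<^sub>R g x))"
    unfolding laplacian_def[abs_def]
    by (rule ip_sum_left) (auto intro: has_weak_deriv_L2(2)[OF DD_weak[OF t]] pL)
  also have "\<dots> = (\<Sum>b\<in>Basis. - ip (\<lambda>x. ?p x *\<^sub>R D b t x) (Dg b) - ip (\<lambda>x. (2 * vg (rad R x) * (x \<bullet> b)) *\<^sub>R D b t x) g)"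
  proof (rule sum.cong[OF refl])
    fix b :: 'a assume b: "b \<in> Basis"
    have "ip (DD b b t) (\<lambda>x. ?p x *\<^sub>R g x) = ip (\<lambda>x. ?p x *\<^sub>R DD b b t x) g" by (simp add: ip_def)
    then show "ip (DD b b t) (\<lambda>x. ?p x *\<^sub>R g x) = - ip (\<lambda>x. ?p x *\<^sub>R D b t x) (Dg b) - ip (\<lambda>x. (2 * vg (rad R x) * (x \<bullet> b)) *\<^sub>R D b t x) g"
      using weak_Leibniz[OF psi[OF b] DD_weak[OF t b b] g[OF b] b] by linarith
  qed
  also have "\<dots> = - (\<Sum>b\<in>Basis. ip (\<lambda>x. ?p x *\<^sub>R D b t x) (Dg b)) - (\<Sum>b\<in>Basis. ip (\<lambda>x. (2 * vg (rad R x) * (x \<bullet> b)) *\<^sub>R D b t x) g)"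
    by (simp only: sum_subtractf sum_negf)
  also have "(\<Sum>b\<in>Basis. ip (\<lambda>x. (2 * vg (rad R x) * (x \<bullet> b)) *\<^sub>R D b t x) g) = ip (dirY R (\<lambda>b. D b t)) g"
    unfolding dirY_def[abs_def]
    by (rule ip_sum_left[symmetric]) (auto intro: gL weight_L2(1)[OF weight_hess[OF R] D_L2[OF Iop_Icl[OF t]]])
  finally show ?thesis .
qed

lemma psi_bounds: "0 \<le> R\<^sup>2 * vG (rad R x)" "R\<^sup>2 * vG (rad R x) \<le> 20 * R\<^sup>2"
proof -
  have "-1 < rad R x" using rad_nonneg[of R x] by linarith
  then show "0 \<le> R\<^sup>2 * vG (rad R x)" "R\<^sup>2 * vG (rad R x) \<le> 20 * R\<^sup>2"
    using vG_bounds(2,3)[of "rad R x"] by (auto simp: mult.commute[of 20] mult_left_mono)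
qed

lemma psi_measurable: assumes "0 < R" shows "(\<lambda>x::'a. R\<^sup>2 * vG (rad R x)) \<in> borel_measurable borel"
proof -
  obtain b0 :: 'a where b0: "b0 \<in> Basis" using nonempty_Basis by blast
  show ?thesis using weightE[OF weight_psi[OF assms b0]] by metis
qed

lemma psi_abs: "\<bar>R\<^sup>2 * vG (rad R x)\<bar> \<le> 20 * R\<^sup>2"
  using psi_bounds[of R x] by simp

text \<open>\<open>v\<close> splits into cos \<theta> G and sin \<theta> i G. Paired with \<psi> u,
  the second part gives the momentum, the nonlinearity dropping out; in the first, the integral of
  \<psi> |grad u|^2 has the favourable sign and is discarded.\<close>

lemma virial_mass_derivative:
  assumes R: "0 < R" and t: "t \<in> Iop"
  obtains X where "(virial_mass R has_real_derivative 2 * (sin \<theta> * virial_momentum R t) + 2 * (cos \<theta> * X)) (at t)"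
    "X \<le> 20 * R\<^sup>2 * (pot t + grad t) + 4 * R * (grad t + mass t)"
proof
  let ?p = "\<lambda>x::'a. R\<^sup>2 * vG (rad R x)"
  let ?Y = "dirY R (\<lambda>b. D b t)"
  note tc = Iop_Icl[OF t]
  have uL: "u t \<in> L2" by (rule u_L2[OF tc])
  have pL: "(\<lambda>x. ?p x *\<^sub>R f x) \<in> L2" if "f \<in> L2" for f
    by (rule L2_scaleR_bounded[OF that psi_measurable[OF R] psi_abs])
  have NL: "(\<lambda>x. nl \<alpha> (u t x)) \<in> L2" by (rule nl_u_L2[OF tc])
  have LL: "laplacian (u t) \<in> L2" by (rule laplacian_L2[OF u_H2[OF t]])
  have YL: "?Y \<in> L2" by (rule dirY_L2[OF R]) (rule D_L2[OF tc])
  have iu: "has_weak_deriv (\<lambda>x. \<i> * u t x) b (\<lambda>x. \<i> * D b t x)" if "b \<in> Basis" for b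
    by (intro has_weak_deriv_cmult D_weak tc that)
  have "ip (\<lambda>x. ?p x *\<^sub>R u t x) (\<lambda>x. \<i> * G t x) = - ip (G t) (\<lambda>x. ?p x *\<^sub>R (\<i> * u t x))"
    unfolding ip_def by (simp add: inner_complex_def algebra_simps flip: Bochner_Integration.integral_minus)
  also have "ip (G t) (\<lambda>x. ?p x *\<^sub>R (\<i> * u t x)) = ip (laplacian (u t)) (\<lambda>x. ?p x *\<^sub>R (\<i> * u t x)) + ip (\<lambda>x. nl \<alpha> (u t x)) (\<lambda>x. ?p x *\<^sub>R (\<i> * u t x))"
    unfolding G_def[abs_def] by (intro ip_add_left LL NL pL L2_cmult uL)
  also have "ip (\<lambda>x. nl \<alpha> (u t x)) (\<lambda>x. ?p x *\<^sub>R (\<i> * u t x)) = 0"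
    by (simp add: ip_def nl_def flip: scaleR_conv_of_real)
  also have "ip (laplacian (u t)) (\<lambda>x. ?p x *\<^sub>R (\<i> * u t x)) = - ip ?Y (\<lambda>x. \<i> * u t x)"
    by (subst ip_laplacian_psi[OF R t iu]) (simp_all add: ip_def)
  finally have im: "ip (\<lambda>x. ?p x *\<^sub>R u t x) (\<lambda>x. \<i> * G t x) = virial_momentum R t" by (simp add: virial_momentum_def ip_commute)
  show "(virial_mass R has_real_derivative 2 * (sin \<theta> * virial_momentum R t) + 2 * (cos \<theta> * ip (\<lambda>x. ?p x *\<^sub>R u t x) (G t))) (at t)"
    using weighted_mass_derivative[OF t psi_measurable[OF R] psi_abs] ip_v[OF t pL[OF uL]] im
    by (simp add: virial_mass_def[abs_def] algebra_simps)
  have "ip (\<lambda>x. ?p x *\<^sub>R u t x) (G t) = ip (laplacian (u t)) (\<lambda>x. ?p x *\<^sub>R u t x) + ip (\<lambda>x. nl \<alpha> (u t x)) (\<lambda>x. ?p x *\<^sub>R u t x)"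
    unfolding G_def[abs_def] by (subst ip_commute) (intro ip_add_left LL NL pL uL)
  also have "ip (laplacian (u t)) (\<lambda>x. ?p x *\<^sub>R u t x) = - (\<Sum>b\<in>Basis. ip (\<lambda>x. ?p x *\<^sub>R D b t x) (D b t)) - ip ?Y (u t)"
    by (rule ip_laplacian_psi[OF R t D_weak[OF tc]])
  also have "- (\<Sum>b\<in>Basis. ip (\<lambda>x. ?p x *\<^sub>R D b t x) (D b t)) \<le> 0"
    by (simp add: sum_nonneg ip_def psi_bounds(1))
  also have "ip (\<lambda>x. nl \<alpha> (u t x)) (\<lambda>x. ?p x *\<^sub>R u t x) \<le> 20 * R\<^sup>2 * pot t"
  proof -
    obtain B where B: "\<And>x. cmod (u t x) \<le> B" using u_bounded[OF tc] by blast
    have "ip (\<lambda>x. nl \<alpha> (u t x)) (\<lambda>x. ?p x *\<^sub>R u t x) \<le> (LINT x|lborel. 20 * R\<^sup>2 * cmod (u t x) powr (\<alpha> + 2))"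
      unfolding ip_def
      using integrable_powr_norm[OF alpha uL B]
      by (intro integral_mono integrable_ip NL pL uL) (auto simp: nl_inner[OF alpha] psi_bounds(2) mult_right_mono)
    then show ?thesis by (simp add: pot_def)
  qed
  finally have X: "ip (\<lambda>x. ?p x *\<^sub>R u t x) (G t) \<le> - ip ?Y (u t) + 20 * R\<^sup>2 * pot t" by simp
  have "- ip ?Y (u t) \<le> L2_norm ?Y * L2_norm (u t)" using ip_Cauchy_Schwarz[OF YL uL] by linarith
  also have "\<dots> \<le> (4 * R * sqrt (grad t)) * L2_norm (u t)"
    unfolding grad_def by (rule mult_right_mono[OF dirY_norm[where D="\<lambda>b. D b t", OF R D_L2[OF tc]]]) auto
  also have "\<dots> \<le> 4 * R * (grad t + mass t)"
  proof -
    have g0: "0 \<le> grad t" unfolding grad_def by (intro sum_nonneg) auto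
    have "2 * (sqrt (grad t) * L2_norm (u t)) \<le> grad t + mass t"
      using sum_squares_bound[of "sqrt (grad t)" "L2_norm (u t)"] g0 by (simp add: L2_norm_sq mass_def mult.assoc)
    moreover have "0 \<le> grad t + mass t" using g0 by (simp add: mass_def)
    ultimately have "sqrt (grad t) * L2_norm (u t) \<le> grad t + mass t" by linarith
    then show ?thesis using R by (simp add: mult.assoc)
  qed
  finally show "ip (\<lambda>x. ?p x *\<^sub>R u t x) (G t) \<le> 20 * R\<^sup>2 * (pot t + grad t) + 4 * R * (grad t + mass t)"
    using X mult_nonneg_nonneg[of "20 * R\<^sup>2" "grad t"] unfolding grad_def distrib_left
    by (smt (verit) sum_nonneg ip_nonneg zero_le_power2)
qed

lemma virial_momentum_continuous: "0 < R \<Longrightarrow> continuous_on Icl (virial_momentum R)"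
  unfolding continuous_on_def virial_momentum_def[abs_def] by (intro ballI L2_conv_ip L2_conv_cmult u_conv dirY_conv D_conv)

lemma virial_mass_continuous: "0 < R \<Longrightarrow> continuous_on Icl (virial_mass R)"
  unfolding virial_mass_def[abs_def] by (rule weighted_mass_continuous[OF psi_measurable psi_abs])

lemma virial_mass_nonneg: "0 \<le> virial_mass R t"
  unfolding virial_mass_def ip_def by (intro Bochner_Integration.integral_nonneg) (simp add: psi_bounds(1))

lemma grad_nonneg: "0 \<le> grad t"
  unfolding grad_def by (intro sum_nonneg) auto

lemma mass_nonneg: "0 \<le> mass t"
  by (simp add: mass_def)

lemma sin_virial_momentum_derivative:
  assumes R: "0 < R" and t: "t \<in> Iop"
  obtains z where "((\<lambda>t. sin \<theta> * virial_momentum R t) has_real_derivative z) (at t)"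
    "z \<le> - ip (G t) (dirW R (\<lambda>b. D b t) (u t)) +
      cos \<theta> * L2_norm (v t) * (8 * R * sqrt (grad t) + (2 * real DIM('a) + 40) * L2_norm (u t))"
proof
  let ?W = "dirW R (\<lambda>b. D b t) (u t)"
  note tc = Iop_Icl[OF t]
  have WL: "?W \<in> L2" by (rule dirW_L2[OF R D_L2[OF tc] u_L2[OF tc]])
  show "((\<lambda>t. sin \<theta> * virial_momentum R t) has_real_derivative sin \<theta> * ip (\<lambda>x. \<i> * v t x) ?W) (at t)"
    by (intro DERIV_cmult virial_momentum_derivative R t)
  have "ip (v t) ?W \<le> L2_norm (v t) * L2_norm ?W" using ip_Cauchy_Schwarz[OF v_L2[OF t] WL] by linarith
  also have "\<dots> \<le> L2_norm (v t) * (8 * R * sqrt (grad t) + (2 * real DIM('a) + 40) * L2_norm (u t))"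
    unfolding grad_def by (rule mult_left_mono[OF dirW_norm[where D="\<lambda>b. D b t", OF R D_L2[OF tc] u_L2[OF tc]]]) auto
  finally have "cos \<theta> * ip (v t) ?W \<le> cos \<theta> * (L2_norm (v t) * (8 * R * sqrt (grad t) + (2 * real DIM('a) + 40) * L2_norm (u t)))"
    by (rule mult_left_mono) (use cos_pos in simp)
  then show "sin \<theta> * ip (\<lambda>x. \<i> * v t x) ?W \<le> - ip (G t) ?W +
      cos \<theta> * L2_norm (v t) * (8 * R * sqrt (grad t) + (2 * real DIM('a) + 40) * L2_norm (u t))"
    unfolding sin_virial_momentum[OF t WL] by (simp add: mult.assoc)
qed

end

text \<open>With \<open>q = t - s\<close>, the combination \<open>q\<^sup>3 z + 3/2 q\<^sup>2 V - \<kappa>/8 q\<^sup>4 (e + e0) - \<dots>\<close> is nonincreasing: the weight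
  \<open>q\<close> in Young's inequality lets the derivative of \<open>e\<close> absorb the dissipative error after integration by parts.\<close>

lemma virial_time_bound:
  fixes f e z V f' e' z' V' K \<nu> :: "real \<Rightarrow> real"
  assumes t: "0 < t" and cont: "continuous_on {0..t} f" "continuous_on {0..t} e" "continuous_on {0..t} z" "continuous_on {0..t} V"
    and deriv: "\<And>s. 0 < s \<Longrightarrow> s < t \<Longrightarrow> (f has_real_derivative f' s) (at s)"
      "\<And>s. 0 < s \<Longrightarrow> s < t \<Longrightarrow> (e has_real_derivative c * (\<nu> s)\<^sup>2) (at s)"
      "\<And>s. 0 < s \<Longrightarrow> s < t \<Longrightarrow> (z has_real_derivative z' s) (at s)"
      "\<And>s. 0 < s \<Longrightarrow> s < t \<Longrightarrow> (V has_real_derivative V' s) (at s)"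
    and c: "0 \<le> c" "c \<le> 1" and \<alpha>: "0 < \<alpha>" and \<kappa>: "0 < \<kappa>"
    and f': "\<And>s. 0 < s \<Longrightarrow> s < t \<Longrightarrow> c * \<alpha> * K s \<le> f' s" and K: "\<And>s. 0 \<le> K s" and \<nu>: "\<And>s. 0 \<le> \<nu> s"
    and z': "\<And>s. 0 < s \<Longrightarrow> s < t \<Longrightarrow> z' s \<le> - \<kappa> * e s + c * \<nu> s * (A * sqrt (K s) + B)"
    and V': "\<And>s. 0 < s \<Longrightarrow> s < t \<Longrightarrow> V' s \<le> 2 * z s + A1 * f' s + A2"
    and V: "\<And>s. 0 \<le> V s" and e: "\<And>s. 0 \<le> s \<Longrightarrow> s \<le> t \<Longrightarrow> e0 \<le> e s" and e0: "0 < e0" and f: "0 \<le> f 0" "f t \<le> M"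
    and const: "0 \<le> A" "0 \<le> B" "0 \<le> A1" "0 \<le> A2"
  shows "\<kappa> / 8 * e0 * t\<^sup>2 \<le> t * (\<bar>z 0\<bar> + (4 * B\<^sup>2 / \<kappa> + 3 / 2 * A2)) + 3 / 2 * V 0 + (4 * A\<^sup>2 / (\<kappa> * \<alpha>) + 3 / 2 * A1) * M"
proof -
  define C3 where "C3 = 4 * A\<^sup>2 / (\<kappa> * \<alpha>) + 3 / 2 * A1"
  define C4 where "C4 = 4 * B\<^sup>2 / \<kappa> + 3 / 2 * A2"
  have C: "0 \<le> C3" "0 \<le> C4" using \<kappa> \<alpha> const by (auto simp: C3_def C4_def)
  \<comment> \<open>The derivative of the weight q^3 cancels the term 2 z of V', and that of q^4 e
    uses up half of the virial term -\<kappa> q^3 e; the last summand is balanced by the other half.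
    The part linear in \<open>f\<close> and s, with factor t^2 >= q^2, absorbs the remaining
    errors.\<close>
  let ?X = "\<lambda>s. (t - s) ^ 3 * z s + 3 / 2 * (t - s)\<^sup>2 * V s - \<kappa> / 8 * (t - s) ^ 4 * e s - t\<^sup>2 * (C3 * f s + C4 * s) - \<kappa> / 8 * e0 * (t - s) ^ 4"
  have "?X t \<le> ?X 0"
  proof (rule DERIV_nonpos_imp_decreasing_open[of 0 t ?X])
    fix s assume s: "0 < s" "s < t"
    define q where "q = t - s"
    have q: "0 < q" "q \<le> t" using s by (auto simp: q_def)
    let ?D = "q ^ 3 * z' s - 3 * q\<^sup>2 * z s + (3 / 2 * q\<^sup>2 * V' s - 3 * q * V s) - (\<kappa> / 8 * q ^ 4 * (c * (\<nu> s)\<^sup>2) - \<kappa> / 2 * q ^ 3 * e s)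
      - t\<^sup>2 * (C3 * f' s + C4) + \<kappa> / 2 * e0 * q ^ 3"
    have "(?X has_real_derivative ?D) (at s)"
      unfolding q_def by (rule derivative_eq_intros deriv s refl | simp)+ (simp add: field_simps)
    moreover have "?D \<le> 0"
    proof -
      define w where "w = A * sqrt (K s) + B"
      have w2: "w\<^sup>2 \<le> 2 * A\<^sup>2 * K s + 2 * B\<^sup>2"
        using sum_squares_bound[of "A * sqrt (K s)" B] K[of s] by (simp add: w_def power2_sum power_mult_distrib mult.commute[of "A\<^sup>2"])
      have cK: "c * K s \<le> f' s / \<alpha>" using f'[OF s] \<alpha> by (simp add: field_simps)
      have f0: "0 \<le> f' s" using f'[OF s] c K[of s] \<alpha> by (meson mult_nonneg_nonneg less_imp_le order_trans)
      have "c * w\<^sup>2 \<le> c * (2 * A\<^sup>2 * K s + 2 * B\<^sup>2)" using c by (intro mult_left_mono w2)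
      also have "\<dots> = 2 * A\<^sup>2 * (c * K s) + c * (2 * B\<^sup>2)" by (simp add: algebra_simps)
      also have "\<dots> \<le> 2 * A\<^sup>2 * (f' s / \<alpha>) + 1 * (2 * B\<^sup>2)"
        using c by (intro add_mono mult_left_mono cK mult_right_mono) auto
      finally have cw: "c * w\<^sup>2 \<le> 2 * A\<^sup>2 * (f' s / \<alpha>) + 2 * B\<^sup>2" by simp
      \<comment> \<open>The factor q in front of \<nu> makes the quadratic term equal to \<kappa>/8
        q^4 times the derivative of \<open>e\<close>, exactly what \<open>?X\<close> provides;
        4/\<kappa> normalises the cross term.\<close>
      have "0 \<le> c * (q\<^sup>2 * (\<kappa> / 8 * (q * \<nu> s - 4 / \<kappa> * w)\<^sup>2))" using c \<kappa> by (intro mult_nonneg_nonneg) auto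
      also have "\<dots> = \<kappa> / 8 * q ^ 4 * (c * (\<nu> s)\<^sup>2) - q ^ 3 * (c * \<nu> s * w) + 2 / \<kappa> * q\<^sup>2 * (c * w\<^sup>2)"
        using \<kappa> by (simp add: field_simps power2_eq_square eval_nat_numeral)
      finally have young: "q ^ 3 * (c * \<nu> s * w) \<le> \<kappa> / 8 * q ^ 4 * (c * (\<nu> s)\<^sup>2) + 2 / \<kappa> * q\<^sup>2 * (c * w\<^sup>2)" by simp
      have "2 / \<kappa> * q\<^sup>2 * (c * w\<^sup>2) \<le> 2 / \<kappa> * q\<^sup>2 * (2 * A\<^sup>2 * (f' s / \<alpha>) + 2 * B\<^sup>2)"
        using \<kappa> by (intro mult_left_mono cw) auto
      also have "\<dots> = q\<^sup>2 * (4 * A\<^sup>2 / (\<kappa> * \<alpha>) * f' s + 4 * B\<^sup>2 / \<kappa>)" using \<kappa> \<alpha> by (simp add: field_simps)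
      finally have y2: "2 / \<kappa> * q\<^sup>2 * (c * w\<^sup>2) \<le> q\<^sup>2 * (4 * A\<^sup>2 / (\<kappa> * \<alpha>) * f' s + 4 * B\<^sup>2 / \<kappa>)" .
      have "q ^ 3 * z' s \<le> q ^ 3 * (- \<kappa> * e s + c * \<nu> s * w)"
        using q z'[OF s] by (intro mult_left_mono) (auto simp: w_def)
      then have p1: "q ^ 3 * z' s \<le> - \<kappa> * (q ^ 3 * e s) + q ^ 3 * (c * \<nu> s * w)" by (simp add: algebra_simps)
      have "q\<^sup>2 * V' s \<le> q\<^sup>2 * (2 * z s + A1 * f' s + A2)" by (intro mult_left_mono V'[OF s]) auto
      then have p2: "3 / 2 * q\<^sup>2 * V' s \<le> 3 * q\<^sup>2 * z s + q\<^sup>2 * (3 / 2 * A1 * f' s + 3 / 2 * A2)" by (simp add: algebra_simps)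
      have p3: "q ^ 3 * e0 \<le> q ^ 3 * e s" using q e[of s] s by (intro mult_left_mono) auto
      have p4: "0 \<le> 3 * q * V s" using q V by simp
      have "q\<^sup>2 * (C3 * f' s + C4) \<le> t\<^sup>2 * (C3 * f' s + C4)"
        using q C f0 by (intro mult_right_mono power_mono) auto
      moreover have "q\<^sup>2 * (C3 * f' s + C4) = q\<^sup>2 * (4 * A\<^sup>2 / (\<kappa> * \<alpha>) * f' s + 4 * B\<^sup>2 / \<kappa>) + q\<^sup>2 * (3 / 2 * A1 * f' s + 3 / 2 * A2)"
        by (simp add: C3_def C4_def algebra_simps)
      moreover have "\<kappa> * (q ^ 3 * e0) \<le> \<kappa> * (q ^ 3 * e s)" using p3 \<kappa> by simp
      moreover have "\<kappa> / 2 * q ^ 3 * e s = 1 / 2 * (\<kappa> * (q ^ 3 * e s))" "\<kappa> / 2 * e0 * q ^ 3 = 1 / 2 * (\<kappa> * (q ^ 3 * e0))" by simp_all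
      ultimately show ?thesis using p1 p2 p4 young y2 by linarith
    qed
    ultimately show "\<exists>y. (?X has_real_derivative y) (at s) \<and> y \<le> 0" by blast
  next
    show "continuous_on {0..t} ?X" by (intro continuous_intros cont)
  qed (use t in simp)
  \<comment> \<open>At s = t every power of t - s vanishes, so no bound on \<open>z t\<close>,
    \<open>V t\<close> or \<open>e t\<close> is required.\<close>
  then have "\<kappa> / 8 * t ^ 4 * e 0 + t\<^sup>2 * (C3 * f 0) + \<kappa> / 8 * e0 * t ^ 4 \<le> t ^ 3 * z 0 + 3 / 2 * t\<^sup>2 * V 0 + t\<^sup>2 * (C3 * f t + C4 * t)"
    by simp
  moreover have "0 \<le> \<kappa> / 8 * t ^ 4 * e 0" using e[of 0] e0 \<kappa> t by (intro mult_nonneg_nonneg) auto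
  moreover have "0 \<le> t\<^sup>2 * (C3 * f 0)" using C f by simp
  moreover have "t ^ 3 * z 0 \<le> t ^ 3 * \<bar>z 0\<bar>" using t by (intro mult_left_mono) auto
  moreover have "t\<^sup>2 * (C3 * f t + C4 * t) \<le> t\<^sup>2 * (C3 * M + C4 * t)" using C f by (intro mult_left_mono add_right_mono) auto
  ultimately have "\<kappa> / 8 * e0 * t ^ 4 \<le> t ^ 3 * \<bar>z 0\<bar> + 3 / 2 * t\<^sup>2 * V 0 + t\<^sup>2 * (C3 * M + C4 * t)" by linarith
  then have "t\<^sup>2 * (\<kappa> / 8 * e0 * t\<^sup>2) \<le> t\<^sup>2 * (t * (\<bar>z 0\<bar> + C4) + 3 / 2 * V 0 + C3 * M)"
    by (simp add: algebra_simps eval_nat_numeral)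
  then have "\<kappa> / 8 * e0 * t\<^sup>2 \<le> t * (\<bar>z 0\<bar> + C4) + 3 / 2 * V 0 + C3 * M"
    using t by (simp add: mult_le_cancel_left_pos)
  then show ?thesis by (simp add: C3_def C4_def)
qed

lemma increasing_of_deriv_nonneg:
  fixes g :: "real \<Rightarrow> real"
  assumes cont: "continuous_on {0..T} g" and deriv: "\<And>s. 0 < s \<Longrightarrow> s < T \<Longrightarrow> (g has_real_derivative g' s) (at s)"
    and nonneg: "\<And>s. 0 < s \<Longrightarrow> s < T \<Longrightarrow> 0 \<le> g' s" and ab: "0 \<le> a" "a \<le> b" "b \<le> T"
  shows "g a \<le> g b"
proof (rule DERIV_nonneg_imp_increasing_open[OF ab(2)])
  fix x assume "a < x" "x < b"
  then have "0 < x" "x < T" using ab by auto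
  then show "\<exists>y. (g has_real_derivative y) (at x) \<and> 0 \<le> y" using deriv nonneg by blast
next
  show "continuous_on {a..b} g" using ab by (intro continuous_on_subset[OF cont]) auto
qed

text \<open>Levine's concavity argument for \<open>F(s) = \<integral>\<^sub>0\<^sup>s f\<close>, which does not involve \<open>c\<close> in the conclusion.\<close>

lemma concavity_time_bound:
  fixes f e J \<nu> :: "real \<Rightarrow> real"
  assumes \<tau>: "0 < \<tau>" "\<tau> < T" and cont: "continuous_on {0..T} f" "continuous_on {0..T} e"
    and deriv: "\<And>s. 0 < s \<Longrightarrow> s < T \<Longrightarrow> (f has_real_derivative 2 * c * J s) (at s)"
      "\<And>s. 0 < s \<Longrightarrow> s < T \<Longrightarrow> (e has_real_derivative c * (\<nu> s)\<^sup>2) (at s)"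
    and c: "0 < c" and \<alpha>: "0 < \<alpha>" and J: "\<And>s. 0 < s \<Longrightarrow> s < T \<Longrightarrow> J s \<le> sqrt (f s) * \<nu> s"
    and Je: "\<And>s. 0 < s \<Longrightarrow> s < T \<Longrightarrow> (\<alpha> + 2) * e s \<le> J s" and e0: "0 \<le> e 0"
    and f: "\<And>s. 0 \<le> f s" and r: "0 < r" "r\<^sup>2 * (\<alpha> + 2) = 2 * (1 + \<alpha> / 4)" and big: "f 0 < (1 - r) * f \<tau>"
  shows "T \<le> (1 + 4 / \<alpha>) * \<tau>"
proof -
  define F where "F s = integral {0..s} f" for s
  define p where "p = 1 + \<alpha> / 4"
  have p: "1 < p" using \<alpha> by (simp add: p_def)
  have F0: "F 0 = 0" by (simp add: F_def)
  have Fd: "(F has_real_derivative f s) (at s within {0..T})" if "s \<in> {0..T}" for s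
    unfolding F_def[abs_def] by (rule integral_has_real_derivative[OF cont(1) that])
  have FD: "(F has_real_derivative f s) (at s)" if "0 < s" "s < T" for s
    using Fd[of s] that at_within_interior[of s "{0..T}"] by (simp add: interior_atLeastAtMost_real)
  have Fc: "continuous_on {0..T} F" by (rule DERIV_continuous_on[OF Fd])
  have eincr: "e a \<le> e b" if "0 \<le> a" "a \<le> b" "b \<le> T" for a b
    by (rule increasing_of_deriv_nonneg[OF cont(2) deriv(2) _ that]) (use c in simp_all)
  have J0: "0 \<le> J s" if "0 < s" "s < T" for s
    using Je[OF that] eincr[of 0 s] e0 that \<alpha> by (smt (verit) mult_nonneg_nonneg)
  have fincr: "f a \<le> f b" if "0 \<le> a" "a \<le> b" "b \<le> T" for a b
    by (rule increasing_of_deriv_nonneg[OF cont(1) deriv(1) _ that]) (use c J0 in simp_all)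
  \<comment> \<open>Cauchy-Schwarz with a free parameter: pointwise f' = 2 c J is at most l f + (c
    \<nu>)^2 / l. Integrals of \<nu> are avoided in favour of increments of
    \<open>e\<close>.\<close>
  have lam: "f s - f 0 \<le> l * F s + c * (e s - e 0) / l" if s: "0 \<le> s" "s \<le> T" and l: "0 < l" for s l
  proof -
    let ?H = "\<lambda>s. f s - f 0 - l * F s - c * (e s - e 0) / l"
    have "?H s \<le> ?H 0"
    proof (rule DERIV_nonpos_imp_decreasing_open[of 0 s ?H])
      fix x assume x: "0 < x" "x < s"
      then have x': "0 < x" "x < T" using s by auto
      have "(?H has_real_derivative 2 * c * J x - l * f x - c * (c * (\<nu> x)\<^sup>2) / l) (at x)"
        using l by (auto intro!: derivative_eq_intros deriv x' FD)
      moreover have "2 * c * J x - l * f x - c * (c * (\<nu> x)\<^sup>2) / l \<le> 0"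
      proof -
        have "2 * c * J x \<le> 2 * c * (sqrt (f x) * \<nu> x)" using J[OF x'] c by simp
        moreover have "0 \<le> (l * sqrt (f x) - c * \<nu> x)\<^sup>2 / l" using l by simp
        moreover have "(l * sqrt (f x) - c * \<nu> x)\<^sup>2 / l = l * f x + c * (c * (\<nu> x)\<^sup>2) / l - 2 * c * (sqrt (f x) * \<nu> x)"
        proof -
          have "(l * a - c * b)\<^sup>2 / l = l * a\<^sup>2 + c * (c * b\<^sup>2) / l - 2 * c * (a * b)" for a b
            using l by (simp add: power2_eq_square field_simps)
          then show ?thesis using f[of x] by simp
        qed
        ultimately show ?thesis by linarith
      qed
      ultimately show "\<exists>y. (?H has_real_derivative y) (at x) \<and> y \<le> 0" by blast
    next
      show "continuous_on {0..s} ?H"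
        using l s by (intro continuous_intros continuous_on_subset[OF cont(1)] continuous_on_subset[OF cont(2)] continuous_on_subset[OF Fc]) auto
    qed (use s in simp)
    then show ?thesis by (simp add: F0)
  qed
  have r1: "0 < 1 - r" using big f[of 0] f[of \<tau>] by (smt (verit) mult_nonpos_nonneg)
  have f\<tau>: "0 < f \<tau>" using big f[of 0] r1 by (smt (verit) mult_nonneg_nonpos)
  have F_nonneg: "0 \<le> F s" if "0 \<le> s" "s \<le> T" for s
    unfolding F_def using f that
    by (intro Henstock_Kurzweil_Integration.integral_nonneg integrable_continuous_real continuous_on_subset[OF cont(1)]) auto
  \<comment> \<open>The second claim is p (F')^2 <= F F'' with F'' replaced by its lower bound. The
    relation imposed on \<open>r\<close> is what turns f - f 0 >= r f into this inequality with p =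
    1 + \<alpha>/4.\<close>
  have sq: "0 < F s" "p * (f s)\<^sup>2 \<le> F s * (2 * c * ((\<alpha> + 2) * e s))" if s: "\<tau> \<le> s" "s \<le> T" for s
  proof -
    have fs: "f \<tau> \<le> f s" using fincr[of \<tau> s] s \<tau> by simp
    define y where "y = f s - f 0"
    have "(1 - r) * f \<tau> \<le> (1 - r) * f s" using fs r1 by simp
    then have y: "r * f s \<le> y" using big by (simp add: y_def algebra_simps)
    have y0: "0 < y" using y mult_pos_pos[OF r(1), of "f s"] fs f\<tau> by linarith
    let ?g = "c * (e s - e 0)"
    have g0: "0 \<le> ?g" using eincr[of 0 s] s \<tau> c by simp
    have Fpos: "0 < F s"
    proof (rule ccontr)
      assume "\<not> 0 < F s"
      then have "F s = 0" using F_nonneg[of s] s \<tau> by simp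
      \<comment> \<open>If \<open>F s\<close> were 0, the parameter l could be taken so large that
        the bound falls below y.\<close>
      then have "y \<le> ?g / ((?g + 1) / y)" using lam[of s "(?g + 1) / y"] s \<tau> y0 g0 by (simp add: y_def)
      also have "\<dots> = ?g / (?g + 1) * y" by simp
      also have "\<dots> < 1 * y" using g0 y0 by (intro mult_strict_right_mono) (simp_all add: divide_less_eq)
      finally show False by simp
    qed
    then show "0 < F s" .
    \<comment> \<open>This l gives half of y to the first term, leaving y/2 for the second.\<close>
    have "y \<le> y / (2 * F s) * F s + ?g / (y / (2 * F s))"
      unfolding y_def by (rule lam) (use s \<tau> y0 Fpos in \<open>auto simp: y_def\<close>)
    then have "y / 2 \<le> ?g * (2 * F s) / y" using Fpos by simp
    then have y4: "y\<^sup>2 \<le> 4 * F s * ?g" using y0 by (simp add: field_simps power2_eq_square)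
    have "(r * f s)\<^sup>2 \<le> y\<^sup>2" using y r f by (intro power_mono) auto
    then have "r\<^sup>2 * (f s)\<^sup>2 \<le> 4 * F s * ?g" using y4 by (simp add: power_mult_distrib)
    also have "\<dots> \<le> 4 * F s * (c * e s)" using Fpos e0 c by (intro mult_left_mono) auto
    finally have "(\<alpha> + 2) / 2 * (r\<^sup>2 * (f s)\<^sup>2) \<le> (\<alpha> + 2) / 2 * (4 * F s * (c * e s))"
      using \<alpha> by (intro mult_left_mono) auto
    moreover have "(\<alpha> + 2) / 2 * (r\<^sup>2 * (f s)\<^sup>2) = p * (f s)\<^sup>2"
      using arg_cong[OF r(2), of "\<lambda>x. x / 2 * (f s)\<^sup>2"] by (simp add: p_def algebra_simps)
    ultimately show "p * (f s)\<^sup>2 \<le> F s * (2 * c * ((\<alpha> + 2) * e s))" by (simp add: algebra_simps)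
  qed
  \<comment> \<open>F' F^(-p) is nondecreasing by the differential inequality, so F^(-\<alpha>/4)
    decreases at least linearly after \<tau>. As it stays nonnegative, T - \<tau> is at most
    (4/\<alpha>) F / F' taken at \<tau>.\<close>
  let ?g = "\<lambda>s. f s * F s powr (- p)"
  have cF: "continuous_on {\<tau>..b} F" "continuous_on {\<tau>..b} f" if "b \<le> T" for b
    using that \<tau> by (auto intro: continuous_on_subset[OF Fc] continuous_on_subset[OF cont(1)])
  have g: "?g \<tau> \<le> ?g s" if s: "\<tau> \<le> s" "s \<le> T" for s
  proof (rule DERIV_nonneg_imp_increasing_open[OF s(1)])
    fix x assume x: "\<tau> < x" "x < s"
    then have x': "0 < x" "x < T" "\<tau> \<le> x" "x \<le> T" using s \<tau> by auto
    note Fx = sq[OF x'(3,4)]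
    have "(?g has_real_derivative 2 * c * J x * F x powr (- p) + (- p * F x powr (- p - 1) * f x) * f x) (at x)"
      by (rule DERIV_mult[OF deriv(1)[OF x'(1,2)] DERIV_chain2[of "\<lambda>y. y powr (- p)", OF has_real_derivative_powr FD]]) (use x' Fx in auto)
    moreover have "0 \<le> 2 * c * J x * F x powr (- p) + (- p * F x powr (- p - 1) * f x) * f x"
    proof -
      have pw: "F x powr (- p) = F x powr (- p - 1) * F x" using Fx(1) by (simp add: powr_diff)
      have "F x * (2 * c * ((\<alpha> + 2) * e x)) \<le> F x * (2 * c * J x)"
        using Je[OF x'(1,2)] c Fx(1) by (intro mult_left_mono) auto
      then have "p * (f x)\<^sup>2 \<le> F x * (2 * c * J x)" using Fx(2) by (rule order_trans[rotated])
      then have "0 \<le> F x powr (- p - 1) * (F x * (2 * c * J x) - p * (f x)\<^sup>2)" by (intro mult_nonneg_nonneg) auto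
      then show ?thesis unfolding pw by (simp add: algebra_simps power2_eq_square)
    qed
    ultimately show "\<exists>y. (?g has_real_derivative y) (at x) \<and> 0 \<le> y" by blast
  next
    show "continuous_on {\<tau>..s} ?g"
      using sq(1) s by (intro continuous_intros cF) force+
  qed
  let ?h = "\<lambda>s. F s powr (- (\<alpha> / 4)) + \<alpha> / 4 * ?g \<tau> * s"
  have "?h T \<le> ?h \<tau>"
  proof (rule DERIV_nonpos_imp_decreasing_open[of \<tau> T ?h])
    fix x assume x: "\<tau> < x" "x < T"
    then have x': "0 < x" "x < T" "\<tau> \<le> x" "x \<le> T" using \<tau> by auto
    have "(?h has_real_derivative - (\<alpha> / 4) * F x powr (- (\<alpha> / 4) - 1) * f x + \<alpha> / 4 * ?g \<tau>) (at x)"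
      by (rule DERIV_add[OF DERIV_chain2[of "\<lambda>y. y powr (- (\<alpha> / 4))", OF has_real_derivative_powr FD] DERIV_cmult_Id]) (use x' sq(1)[of x] in auto)
    moreover have "- (\<alpha> / 4) * F x powr (- (\<alpha> / 4) - 1) * f x + \<alpha> / 4 * ?g \<tau> \<le> 0"
    proof -
      have "- (\<alpha> / 4) - 1 = - p" by (simp add: p_def)
      then show ?thesis using g[OF x'(3,4)] \<alpha> by (simp add: mult.commute)
    qed
    ultimately show "\<exists>y. (?h has_real_derivative y) (at x) \<and> y \<le> 0" by blast
  next
    show "continuous_on {\<tau>..T} ?h" using sq(1) by (intro continuous_intros cF) force+
  qed (use \<tau> in simp)
  moreover have "0 \<le> F T powr (- (\<alpha> / 4))" by simp
  ultimately have "\<alpha> / 4 * ?g \<tau> * (T - \<tau>) \<le> F \<tau> powr (- (\<alpha> / 4))" unfolding right_diff_distrib by linarith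
  moreover have "F \<tau> powr (- p) = F \<tau> powr (- (\<alpha> / 4)) / F \<tau>"
  proof -
    have "- p = - (\<alpha> / 4) - 1" by (simp add: p_def)
    then show ?thesis using sq(1)[of \<tau>] \<tau> by (simp only: powr_diff) simp
  qed
  ultimately have "F \<tau> powr (- (\<alpha> / 4)) * (\<alpha> / 4 * f \<tau> / F \<tau> * (T - \<tau>)) \<le> F \<tau> powr (- (\<alpha> / 4)) * 1" by (simp add: mult_ac)
  moreover have "0 < F \<tau> powr (- (\<alpha> / 4))" using sq(1)[of \<tau>] \<tau> by simp
  ultimately have "\<alpha> / 4 * f \<tau> / F \<tau> * (T - \<tau>) \<le> 1" by (simp only: mult_le_cancel_left_pos)
  then have "\<alpha> / 4 * f \<tau> * (T - \<tau>) \<le> F \<tau>" using sq(1)[of \<tau>] \<tau> by (simp add: field_simps)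
  \<comment> \<open>Monotonicity of \<open>f\<close> removes the last dependence on the solution: F
    / F' at \<tau> is at most \<tau>.\<close>
  also have "F \<tau> \<le> \<tau> * f \<tau>"
  proof -
    have "F \<tau> - f \<tau> * \<tau> \<le> F 0 - f \<tau> * 0"
    proof (rule DERIV_nonpos_imp_decreasing_open[of 0 \<tau> "\<lambda>s. F s - f \<tau> * s"])
      fix x assume x: "0 < x" "x < \<tau>"
      have "((\<lambda>s. F s - f \<tau> * s) has_real_derivative f x - f \<tau>) (at x)"
        by (rule DERIV_diff[OF FD DERIV_cmult_Id]) (use x \<tau> in auto)
      moreover have "f x - f \<tau> \<le> 0" using fincr[of x \<tau>] x \<tau> by simp
      ultimately show "\<exists>y. ((\<lambda>s. F s - f \<tau> * s) has_real_derivative y) (at x) \<and> y \<le> 0" by blast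
    next
      show "continuous_on {0..\<tau>} (\<lambda>s. F s - f \<tau> * s)"
        using \<tau> by (intro continuous_intros continuous_on_subset[OF Fc]) auto
    qed (use \<tau> in simp)
    then show ?thesis by (simp add: F0 mult.commute)
  qed
  finally have "f \<tau> * (\<alpha> / 4 * (T - \<tau>)) \<le> f \<tau> * \<tau>" by (simp add: mult_ac)
  then have "\<alpha> / 4 * (T - \<tau>) \<le> \<tau>" using f\<tau> by (simp only: mult_le_cancel_left_pos)
  then show ?thesis using \<alpha> by (simp add: field_simps)
qed

section \<open>The two regimes of the mass\<close>

context gl_solution begin

lemma neg_energy_ge: "t \<in> Icl \<Longrightarrow> neg_energy 0 \<le> neg_energy t"
  by (rule increasing_of_deriv_nonneg[OF neg_energy_continuous neg_energy_derivative]) (use cos_pos in simp_all)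

lemma pot_sub_grad: "pot t - grad t = (\<alpha> + 2) * neg_energy t + \<alpha> / 2 * grad t"
  using alpha by (simp add: neg_energy_def field_simps)

lemma mass_derivative_eq: "t \<in> Iop \<Longrightarrow> (mass has_real_derivative 2 * cos \<theta> * (pot t - grad t)) (at t)"
  using mass_derivative[of t] ip_u_v[of t] by (simp add: mult.assoc)

text \<open>The first claim bounds cos \<theta> times the gradient term by the rate of the mass. Its
  time integral is thus controlled by the mass however small cos \<theta> is.\<close>

lemma mass_rate:
  assumes "0 \<le> neg_energy 0" "t \<in> Icl"
  shows "cos \<theta> * \<alpha> * grad t \<le> 2 * cos \<theta> * (pot t - grad t)" "0 \<le> pot t - grad t" "(\<alpha> + 2) * neg_energy t \<le> pot t - grad t"
proof -
  have n: "0 \<le> (\<alpha> + 2) * neg_energy t" using neg_energy_ge[OF assms(2)] assms(1) alpha by simp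
  have g: "0 \<le> \<alpha> / 2 * grad t" using alpha grad_nonneg by simp
  show "0 \<le> pot t - grad t" "(\<alpha> + 2) * neg_energy t \<le> pot t - grad t" using n g by (simp_all add: pot_sub_grad)
  have "2 * cos \<theta> * (\<alpha> / 2 * grad t) \<le> 2 * cos \<theta> * (pot t - grad t)"
    using n cos_pos unfolding pot_sub_grad by (intro mult_left_mono) auto
  then show "cos \<theta> * \<alpha> * grad t \<le> 2 * cos \<theta> * (pot t - grad t)" by (simp add: mult_ac)
qed

lemma mass_mono:
  assumes "0 \<le> neg_energy 0" "0 \<le> a" "a \<le> b" "b \<le> T"
  shows "mass a \<le> mass b"
proof (rule increasing_of_deriv_nonneg[OF mass_continuous mass_derivative_eq _ assms(2-4)])
  fix s assume "0 < s" "s < T"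
  then show "0 \<le> 2 * cos \<theta> * (pot s - grad s)" using mass_rate(2)[OF assms(1), of s] cos_pos by simp
qed simp

text \<open>An instance of \<open>virial_time_bound\<close>. On the right, \<theta> survives only in
  the initial momentum, through sin \<theta>; elsewhere cos \<theta> is either contained in the rate
  of the mass or bounded by 1.\<close>

lemma time_le_of_mass_le:
  assumes R: "0 < R" and n0: "0 < neg_energy 0" and \<tau>: "0 < \<tau>" "\<tau> < T" and M: "mass \<tau> \<le> M"
    and flux: "\<And>s. s \<in> Iop \<Longrightarrow> mass s \<le> M \<Longrightarrow> real DIM('a) * \<alpha> * neg_energy s \<le> ip (G s) (dirW R (\<lambda>b. D b s) (u s))"
  defines "\<kappa> \<equiv> real DIM('a) * \<alpha>"
  shows "\<kappa> / 8 * neg_energy 0 * \<tau>\<^sup>2 \<le> \<tau> * (\<bar>sin \<theta> * virial_momentum R 0\<bar> + (4 * ((2 * real DIM('a) + 40) * sqrt M)\<^sup>2 / \<kappa> + 3 / 2 * (8 * R * M)))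
    + 3 / 2 * virial_mass R 0 + (4 * (8 * R)\<^sup>2 / (\<kappa> * \<alpha>) + 3 / 2 * (2 * (20 * R\<^sup>2 * (1 / 2 + 2 / \<alpha>) + 4 * R / \<alpha>))) * M"
proof -
  note n0' = less_imp_le[OF n0]
  have ms: "mass s \<le> M" if "0 \<le> s" "s \<le> \<tau>" for s
    using mass_mono[OF n0' that] \<tau> M by linarith
  have M0: "0 \<le> M" using mass_nonneg[of \<tau>] M by linarith
  have sub: "{0..\<tau>} \<subseteq> Icl" using \<tau> by auto
  have op: "s \<in> Iop" if "0 < s" "s < \<tau>" for s using that \<tau> by auto
  have "\<forall>s. \<exists>z. s \<in> Iop \<longrightarrow> ((\<lambda>t. sin \<theta> * virial_momentum R t) has_real_derivative z) (at s) \<and>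
    z \<le> - ip (G s) (dirW R (\<lambda>b. D b s) (u s)) + cos \<theta> * L2_norm (v s) * (8 * R * sqrt (grad s) + (2 * real DIM('a) + 40) * L2_norm (u s))"
    using sin_virial_momentum_derivative[OF R] by metis
  then obtain z' where z': "\<And>s. s \<in> Iop \<Longrightarrow> ((\<lambda>t. sin \<theta> * virial_momentum R t) has_real_derivative z' s) (at s)"
    "\<And>s. s \<in> Iop \<Longrightarrow> z' s \<le> - ip (G s) (dirW R (\<lambda>b. D b s) (u s)) + cos \<theta> * L2_norm (v s) * (8 * R * sqrt (grad s) + (2 * real DIM('a) + 40) * L2_norm (u s))"
    by metis
  have "\<forall>s. \<exists>X. s \<in> Iop \<longrightarrow> (virial_mass R has_real_derivative 2 * (sin \<theta> * virial_momentum R s) + 2 * (cos \<theta> * X)) (at s) \<and>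
    X \<le> 20 * R\<^sup>2 * (pot s + grad s) + 4 * R * (grad s + mass s)"
    using virial_mass_derivative[OF R] by metis
  then obtain X where X: "\<And>s. s \<in> Iop \<Longrightarrow> (virial_mass R has_real_derivative 2 * (sin \<theta> * virial_momentum R s) + 2 * (cos \<theta> * X s)) (at s)"
    "\<And>s. s \<in> Iop \<Longrightarrow> X s \<le> 20 * R\<^sup>2 * (pot s + grad s) + 4 * R * (grad s + mass s)"
    by metis
  show ?thesis
  proof (rule virial_time_bound[where f=mass and e=neg_energy and z="\<lambda>t. sin \<theta> * virial_momentum R t" and V="virial_mass R" and c="cos \<theta>" and \<nu>="\<lambda>s. L2_norm (v s)"
        and K=grad and f'="\<lambda>s. 2 * cos \<theta> * (pot s - grad s)" and z'=z' and V'="\<lambda>s. 2 * (sin \<theta> * virial_momentum R s) + 2 * (cos \<theta> * X s)"])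
    show "continuous_on {0..\<tau>} mass" "continuous_on {0..\<tau>} neg_energy" "continuous_on {0..\<tau>} (virial_mass R)"
      by (rule continuous_on_subset[OF _ sub], rule mass_continuous neg_energy_continuous virial_mass_continuous[OF R])+
    show "continuous_on {0..\<tau>} (\<lambda>t. sin \<theta> * virial_momentum R t)"
      by (intro continuous_intros continuous_on_subset[OF virial_momentum_continuous[OF R] sub])
    fix s assume s: "0 < s" "s < \<tau>"
    note so = op[OF s] and sc = Iop_Icl[OF op[OF s]]
    have ms': "mass s \<le> M" by (rule ms) (use s in auto)
    show "(mass has_real_derivative 2 * cos \<theta> * (pot s - grad s)) (at s)" by (rule mass_derivative_eq[OF so])
    show "(neg_energy has_real_derivative cos \<theta> * (L2_norm (v s))\<^sup>2) (at s)" using neg_energy_derivative[OF so] by (simp add: L2_norm_sq)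
    show "cos \<theta> * \<alpha> * grad s \<le> 2 * cos \<theta> * (pot s - grad s)" by (rule mass_rate(1)[OF n0' sc])
    show "z' s \<le> - \<kappa> * neg_energy s + cos \<theta> * L2_norm (v s) * (8 * R * sqrt (grad s) + (2 * real DIM('a) + 40) * sqrt M)"
    proof -
      have "L2_norm (u s) \<le> sqrt M" using ms' by (intro real_le_rsqrt) (simp add: L2_norm_sq mass_def)
      then have "cos \<theta> * L2_norm (v s) * (8 * R * sqrt (grad s) + (2 * real DIM('a) + 40) * L2_norm (u s))
        \<le> cos \<theta> * L2_norm (v s) * (8 * R * sqrt (grad s) + (2 * real DIM('a) + 40) * sqrt M)"
        using cos_pos by (intro mult_left_mono add_left_mono mult_nonneg_nonneg) auto
      moreover have "- ip (G s) (dirW R (\<lambda>b. D b s) (u s)) \<le> - \<kappa> * neg_energy s" using flux[OF so ms'] by (simp add: \<kappa>_def)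
      ultimately show ?thesis using z'(2)[OF so] by linarith
    qed
    show "2 * (sin \<theta> * virial_momentum R s) + 2 * (cos \<theta> * X s) \<le> 2 * (sin \<theta> * virial_momentum R s)
      + 2 * (20 * R\<^sup>2 * (1 / 2 + 2 / \<alpha>) + 4 * R / \<alpha>) * (2 * cos \<theta> * (pot s - grad s)) + 8 * R * M"
    proof -
      let ?f = "2 * cos \<theta> * (pot s - grad s)"
      have cg: "cos \<theta> * grad s \<le> ?f / \<alpha>" using mass_rate(1)[OF n0' sc] alpha by (simp add: field_simps)
      have "cos \<theta> * mass s \<le> 1 * M" using ms' mass_nonneg cos_pos by (intro mult_mono) auto
      then have cm: "cos \<theta> * grad s + cos \<theta> * mass s \<le> ?f / \<alpha> + M" using cg by linarith
      \<comment> \<open>The sum is the difference plus twice the gradient term, and both parts are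
        controlled by the rate \<open>?f\<close> of the mass.\<close>
      have "cos \<theta> * pot s + cos \<theta> * grad s = ?f / 2 + 2 * (cos \<theta> * grad s)" by (simp add: field_simps)
      then have cp: "cos \<theta> * pot s + cos \<theta> * grad s \<le> ?f / 2 + 2 * (?f / \<alpha>)" using cg by linarith
      have "cos \<theta> * X s \<le> cos \<theta> * (20 * R\<^sup>2 * (pot s + grad s) + 4 * R * (grad s + mass s))"
        using X(2)[OF so] cos_pos by simp
      also have "\<dots> = 20 * R\<^sup>2 * (cos \<theta> * pot s + cos \<theta> * grad s) + 4 * R * (cos \<theta> * grad s + cos \<theta> * mass s)"
        by (simp add: algebra_simps)
      also have "\<dots> \<le> 20 * R\<^sup>2 * (?f / 2 + 2 * (?f / \<alpha>)) + 4 * R * (?f / \<alpha> + M)"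
        using R by (intro add_mono mult_left_mono cm cp) auto
      also have "\<dots> = (20 * R\<^sup>2 * (1 / 2 + 2 / \<alpha>) + 4 * R / \<alpha>) * ?f + 4 * R * M"
        by (simp add: distrib_left distrib_right)
      finally show ?thesis by linarith
    qed
    show "((\<lambda>t. sin \<theta> * virial_momentum R t) has_real_derivative z' s) (at s)" by (rule z'(1)[OF so])
    show "(virial_mass R has_real_derivative 2 * (sin \<theta> * virial_momentum R s) + 2 * (cos \<theta> * X s)) (at s)" by (rule X(1)[OF so])
  next
    fix s assume "0 \<le> s" "s \<le> \<tau>"
    then show "neg_energy 0 \<le> neg_energy s" using \<tau> by (intro neg_energy_ge) auto
  qed (use \<tau> cos_pos alpha n0 R M M0 in \<open>auto simp: \<kappa>_def virial_mass_nonneg grad_nonneg mass_nonneg\<close>)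
qed

lemma time_le_of_mass_growth:
  assumes n0: "0 \<le> neg_energy 0" and \<tau>: "0 < \<tau>" "\<tau> < T"
    and r: "0 < r" "r\<^sup>2 * (\<alpha> + 2) = 2 * (1 + \<alpha> / 4)" and big: "mass 0 < (1 - r) * mass \<tau>"
  shows "T \<le> (1 + 4 / \<alpha>) * \<tau>"
proof (rule concavity_time_bound[OF \<tau> mass_continuous neg_energy_continuous _ _ cos_pos alpha _ _ n0 mass_nonneg r big])
  fix s assume "0 < s" "s < T"
  then have s: "s \<in> Iop" "s \<in> Icl" by auto
  show "(mass has_real_derivative 2 * cos \<theta> * (pot s - grad s)) (at s)" by (rule mass_derivative_eq[OF s(1)])
  show "(neg_energy has_real_derivative cos \<theta> * (L2_norm (v s))\<^sup>2) (at s)" using neg_energy_derivative[OF s(1)] by (simp add: L2_norm_sq)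
  show "pot s - grad s \<le> sqrt (mass s) * L2_norm (v s)"
    using pot_grad_le[OF s(1)] by (simp add: mass_def flip: L2_norm_sq)
  show "(\<alpha> + 2) * neg_energy s \<le> pot s - grad s" by (rule mass_rate(3)[OF n0 s(2)])
qed

end

theorem theorem1p5:
  fixes u0 :: "'a::euclidean_space \<Rightarrow> complex" and \<alpha> :: real
  assumes "DIM('a) \<ge> 2"
    and "4 / real DIM('a) \<le> \<alpha>" and "\<alpha> \<le> 4"
    and "u0 \<in> H1 \<inter> C0"
    and "radially_symmetric u0"
    and "energy \<alpha> u0 < 0"
  shows "\<exists>Tbar::real. \<forall>\<theta>. - pi / 2 < \<theta> \<and> \<theta> < pi / 2 \<longrightarrow>
           (\<forall>Tmax u. maximal_solution \<alpha> \<theta> u0 Tmax u \<longrightarrow> Tmax \<le> ereal Tbar)"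
proof -
  let ?n = "real DIM('a)"
  define e0 where "e0 = - energy \<alpha> u0"
  \<comment> \<open>The solution of the relation that the concavity argument imposes; r < 1 because
    1 + \<alpha>/4 < 1 + \<alpha>/2.\<close>
  define r where "r = sqrt ((1 + \<alpha> / 4) * 2 / (\<alpha> + 2))"
  \<comment> \<open>A mass above \<open>M\<close> puts the initial mass below (1 - r) times it; the
    added 1 makes the inequality strict and \<open>M\<close> positive.\<close>
  define M where "M = ip u0 u0 / (1 - r) + 1"
  have n: "0 < ?n" by simp
  have alpha: "0 < \<alpha>" using assms(2) n by (smt (verit) divide_pos_pos)
  have n\<alpha>: "4 \<le> ?n * \<alpha>" using assms(2) n by (simp add: field_simps)
  have e0: "0 < e0" using assms(6) by (simp add: e0_def)
  have r2: "r\<^sup>2 * (\<alpha> + 2) = 2 * (1 + \<alpha> / 4)" using alpha by (simp add: r_def)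
  have r: "0 < r" "r < 1" using alpha by (auto simp: r_def field_simps)
  have M: "0 < M" "ip u0 u0 < (1 - r) * M"
  proof -
    have "0 \<le> ip u0 u0 / (1 - r)" using r by simp
    then show "0 < M" unfolding M_def by linarith
    have "(1 - r) * M = ip u0 u0 + (1 - r)" using r by (simp add: M_def distrib_left)
    then show "ip u0 u0 < (1 - r) * M" using r by linarith
  qed
  \<comment> \<open>The tolerance granted to the truncation error: it is at most half of the term 2
    N \<alpha> (-E) in the virial bound, since -E >= e0.\<close>
  have pos: "0 < ?n * \<alpha> * e0" using n alpha e0 by simp
  obtain R where R: "0 < R" and flux: "\<And>(w :: 'a \<Rightarrow> complex) B. w \<in> H2 \<Longrightarrow> (\<And>x. cmod (w x) \<le> B) \<Longrightarrow> continuous_on UNIV w \<Longrightarrow>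
      (\<And>x y. norm x = norm y \<Longrightarrow> w x = w y) \<Longrightarrow> ip w w \<le> M \<Longrightarrow>
      - 4 * (\<Sum>b\<in>Basis. ip (weak_deriv b w) (weak_deriv b w))
        + \<alpha> / (\<alpha> + 2) * (2 * ?n * (LINT x|lborel. cmod (w x) powr (\<alpha> + 2))) - ?n * \<alpha> * e0
      \<le> ip (\<lambda>x. laplacian w x + nl \<alpha> (w x)) (dirW R (\<lambda>b. weak_deriv b w) w)"
  proof (rule virial_radius[OF M(1) pos alpha assms(3,1)], goal_cases)
    case R: (1 R)
    show ?case
    proof (rule R(1)[OF R(2)], goal_cases)
      case (1 w B)
      show ?case by (rule R(3)[of w B]) (use 1 in blast)+
    qed
  qed
  define Z where "Z = \<bar>ip (\<lambda>x. \<i> * u0 x) (dirY R (\<lambda>b. weak_deriv b u0))\<bar>"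
  define V where "V = ip (\<lambda>x. (R\<^sup>2 * vG (rad R x)) *\<^sub>R u0 x) u0"
  define \<kappa> where "\<kappa> = ?n * \<alpha>"
  define b where "b = Z + (4 * ((2 * ?n + 40) * sqrt M)\<^sup>2 / \<kappa> + 3 / 2 * (8 * R * M))"
  define c where "c = 3 / 2 * V + (4 * (8 * R)\<^sup>2 / (\<kappa> * \<alpha>) + 3 / 2 * (2 * (20 * R\<^sup>2 * (1 / 2 + 2 / \<alpha>) + 4 * R / \<alpha>))) * M"
  define a where "a = \<kappa> / 8 * e0"
  \<comment> \<open>At this time the quadratic inequality of the virial bound fails. Its
    coefficients depend on \<open>u0\<close>, \<alpha> and the dimension, \<open>R\<close> and
    \<open>M\<close> being fixed by these.\<close>
  define \<tau> where "\<tau> = (\<bar>b\<bar> + \<bar>c\<bar>) / a + 1"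
  have a: "0 < a" using n alpha e0 by (simp add: a_def \<kappa>_def)
  have \<tau>: "1 \<le> \<tau>" "\<bar>b\<bar> + \<bar>c\<bar> < a * \<tau>" using a by (auto simp: \<tau>_def field_simps)
  have late: "b * \<tau> + c < a * \<tau>\<^sup>2"
  proof -
    have "b * \<tau> + c \<le> \<bar>b\<bar> * \<tau> + \<bar>c\<bar> * \<tau>"
      using \<tau>(1) mult_right_mono[of b "\<bar>b\<bar>" \<tau>] mult_left_mono[of 1 \<tau> "\<bar>c\<bar>"] by linarith
    also have "\<dots> = (\<bar>b\<bar> + \<bar>c\<bar>) * \<tau>" by (simp add: distrib_right)
    also have "\<dots> < a * \<tau> * \<tau>" using \<tau> by (intro mult_strict_right_mono) auto
    finally show ?thesis by (simp add: power2_eq_square mult.assoc)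
  qed
  define Tbar where "Tbar = (1 + 4 / \<alpha>) * \<tau>"
  have Tbar: "\<tau> \<le> Tbar" using \<tau>(1) alpha by (simp add: Tbar_def distrib_right)
  have bound: "T \<le> Tbar" if \<theta>: "- pi / 2 < \<theta>" "\<theta> < pi / 2" and sol: "solution_on \<alpha> \<theta> u0 T u" for \<theta> T u
  proof (rule ccontr)
    assume "\<not> T \<le> Tbar"
    then have T: "0 < \<tau>" "\<tau> < T" "Tbar < T" using \<tau>(1) Tbar by auto
    obtain v where v: "gl_solution \<alpha> \<theta> T u v"
    proof -
      obtain v where "continuous_curve L2 L2_norm {0<..<T} v" and eq: "\<forall>t\<in>{0<..<T}. has_L2_derivative u (v t) t \<and>
          (AE x in lborel. exp (- \<i> * of_real \<theta>) * v t x = laplacian (u t) x + of_real (cmod (u t x) powr \<alpha>) * u t x)"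
        using sol unfolding solution_on_def by blast
      then have "\<forall>t\<in>{0<..<T}. v t \<in> L2" by (auto simp: continuous_curve_def)
      moreover have "0 < cos \<theta>" using \<theta> by (intro cos_gt_zero_pi) auto
      ultimately have "gl_solution \<alpha> \<theta> T u v" using sol alpha eq by unfold_locales (auto simp: solution_on_def)
      then show thesis by (rule that)
    qed
    interpret gl_solution \<alpha> \<theta> T u v by (rule v)
    have u0: "u 0 = u0" using sol by (simp add: solution_on_def)
    have neg_energy0: "neg_energy 0 = e0" using energy_eq[of 0] T_pos by (simp add: u0 e0_def neg_energy_def)
    have flux': "?n * \<alpha> * neg_energy s \<le> ip (G s) (dirW R (\<lambda>b. D b s) (u s))" if s: "s \<in> Iop" and ms: "mass s \<le> M" for s
    proof -
      note sc = Iop_Icl[OF s]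
      obtain B where B: "\<And>x. cmod (u s x) \<le> B" using u_bounded[OF sc] by blast
      have "continuous_on UNIV (u s)" using u_C0[OF sc] by (simp add: C0_def)
      moreover have "u s x = u s y" if "norm x = norm y" for x y
        by (rule radial) (use assms(5) u0 s that in auto)
      ultimately have "- 4 * grad s + \<alpha> / (\<alpha> + 2) * (2 * ?n * pot s) - ?n * \<alpha> * e0 \<le> ip (G s) (dirW R (\<lambda>b. D b s) (u s))"
        using flux[OF u_H2[OF s] B] ms unfolding G_def[abs_def] grad_def pot_def mass_def by blast
      moreover have "\<alpha> / (\<alpha> + 2) * (2 * ?n * pot s) = 2 * (?n * \<alpha> * neg_energy s) + ?n * \<alpha> * grad s"
        using alpha by (simp add: neg_energy_def field_simps)
      \<comment> \<open>The lower bound on \<alpha> enters: rewriting the potential through -E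
        yields N \<alpha> times the gradient term, which covers the loss of 4 times it.\<close>
      moreover have "4 * grad s \<le> ?n * \<alpha> * grad s" using n\<alpha> grad_nonneg by (rule mult_right_mono)
      moreover have "?n * \<alpha> * e0 \<le> ?n * \<alpha> * neg_energy s" using neg_energy_ge[OF sc] neg_energy0 n alpha by simp
      ultimately show ?thesis by linarith
    qed
    \<comment> \<open>The same \<tau> serves both regimes: a mass still below \<open>M\<close>
      contradicts its choice, a larger one triggers the concavity bound started at \<tau>.\<close>
    show False
    proof (cases "mass \<tau> \<le> M")
      case True
      have Z: "\<bar>sin \<theta> * virial_momentum R 0\<bar> \<le> Z"
        using mult_right_mono[OF abs_sin_le_one[of \<theta>], of "\<bar>virial_momentum R 0\<bar>"] by (simp add: abs_mult virial_momentum_def Z_def u0)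
      have "a * \<tau>\<^sup>2 \<le> \<tau> * (\<bar>sin \<theta> * virial_momentum R 0\<bar> + (b - Z)) + c"
        using time_le_of_mass_le[OF R _ T(1,2) True flux'] e0
        unfolding neg_energy0 a_def b_def c_def \<kappa>_def V_def virial_mass_def u0 by simp
      also have "\<dots> \<le> \<tau> * b + c" using Z \<tau>(1) by (intro add_right_mono mult_left_mono) auto
      finally show False using late by (simp add: mult.commute)
    next
      case False
      then have "(1 - r) * M < (1 - r) * mass \<tau>" using r by simp
      then have "mass 0 < (1 - r) * mass \<tau>" using M(2) by (simp add: mass_def u0)
      then have "T \<le> Tbar" unfolding Tbar_def using e0 neg_energy0 by (intro time_le_of_mass_growth[OF _ T(1,2) r(1) r2]) auto
      then show False using T(3) by simp
    qed
  qed
  show ?thesis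
  proof (intro exI[of _ Tbar] allI impI)
    fix \<theta> Tmax and u :: "real \<Rightarrow> 'a \<Rightarrow> complex"
    assume \<theta>: "- pi / 2 < \<theta> \<and> \<theta> < pi / 2" and max: "maximal_solution \<alpha> \<theta> u0 Tmax u"
    show "Tmax \<le> ereal Tbar"
    proof (rule ccontr)
      assume "\<not> Tmax \<le> ereal Tbar"
      \<comment> \<open>A finite time strictly between \<open>Tbar\<close> and \<open>Tmax\<close>
        exists even for infinite \<open>Tmax\<close>; it gives a solution on a closed interval
        longer than \<open>Tbar\<close>.\<close>
      then obtain T where T: "ereal Tbar < ereal T" "ereal T < Tmax" using ereal_dense2[of "ereal Tbar" Tmax] by (auto simp: not_le)
      moreover have "0 < T" using T(1) Tbar \<tau>(1) by simp
      ultimately have "solution_on \<alpha> \<theta> u0 T u" using max by (simp add: maximal_solution_def)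
      then show False using bound[of \<theta> T u] \<theta> T(1) by simp
    qed
  qed
qed

end
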